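(* Assume the coefficient hypotheses stated in the context and let $S^\theta_{s,t}(x;y)$ be the common raw flow and $\mathcal K^\theta_{s,t}(r;x,y)$ its response kernel. Let $a:[0,T]\to[0,\Lambda]$ be deterministic and measurable, and on a Wiener space with Brownian motion $W$ let $X^a_t=\int_0^t\sqrt{a_r}\,dW_r$. For every fixed $(\theta,s,t,y)$ with $\theta\in\Theta$, $0\le s\le t\le T$, $y\in\mathbb R$, and every $1\le p<\infty$, $$S^\theta_{s,t}(X^a;y)\in\mathbb D^{1,p}.$$ Its Malliavin derivative with respect to $W$ is $$D^W_rS^\theta_{s,t}(X^a;y)=\mathbf 1_{[s,t]}(r)\,\sqrt{a_r}\,\mathcal K^\theta_{s,t}(r;X^a,y)$$ for almost every $r$, almost surely. In particular, $$\|D^WS^\theta_{s,t}(X^a;y)\|_{L^2([0,T])}\le\overline\sigma C_*\Bigl(\int_s^ta_r\,dr\Bigr)^{1/2}.$$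
   Context: Fix $T,\Lambda>0$. $\Omega=C_0([0,T];\mathbb R)$ is the space of continuous real paths on $[0,T]$ starting at $0$, with the uniform topology. $\mathbb D^{1,p}$ is the usual Malliavin–Sobolev space over the Wiener space of $W$. Bracket functional. $\mathcal A_\Lambda=\{q\in C([0,T]):q_0=0,\ 0\le q_t-q_s\le\Lambda(t-s)\text{ for }s\le t\}$. With $t_k^n=kT2^{-n}$, put $V^n_t(x)=\sum_{k:\,t^n_{k+1}\le t}(x_{t^n_{k+1}}-x_{t^n_k})^2$; for nonnegative increasing $a$ with $a_0=0$ put $(\mathcal R_\Lambda a)_t=\inf_{0\le u\le t}\{a_u+\Lambda(t-u)\}$; $q^n(x)=\mathcal R_\Lambda V^n(x)$ and $Q_t(x)=\limsup_nq^n_t(x)$. One has $Q(x)\in\mathcal A_\Lambda$ for every $x\in\Omega$. Coefficient hypotheses. $\Theta\subset\mathbb R^d$ is compact; $\theta\mapsto(b_\theta,\sigma_\theta)$ is continuous from $\Theta$ into $C_b^2(\mathbb R)\times C_b^3(\mathbb R)$; and there are $L<\infty$, $0<\underline\sigma\le\overline\sigma<\infty$ with $\sup_{\theta}(\|b_\theta\|_{C_b^2}+\|\sigma_\theta\|_{C_b^3})\le L$ and $\underline\sigma\le\sigma_\theta(y)\le\overline\sigma$. Flow. $F_\theta(y)=\int_0^y dr/\sigma_\theta(r)$, $G_\theta=F_\theta^{-1}$, $\widehat b_\theta(z)=b_\theta(G_\theta(z))/\sigma_\theta(G_\theta(z))$, $\widehat c_\theta(z)=-\tfrac12\sigma_\theta'(G_\theta(z))$.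 For $x\in\Omega$, $q\in\mathcal A_\Lambda$, $0\le s\le T$, $y\in\mathbb R$, $Z=Z^{\theta,s,y}(x,q)$ is the unique continuous solution of $Z_t=F_\theta(y)+x_t-x_s+\int_s^t\widehat b_\theta(Z_r)\,dr+\int_s^t\widehat c_\theta(Z_r)\,dq_r$, $s\le t\le T$; $\Phi^\theta_{s,t}(x,q;y)=G_\theta(Z_t^{\theta,s,y}(x,q))$ and $S^\theta_{s,t}(x;y)=\Phi^\theta_{s,t}(x,Q(x);y)$. The map $y\mapsto\Phi^\theta_{s,t}(x,q;y)$ is $C^1$, and $C_*<\infty$ denotes a constant, depending only on $L,\underline\sigma,\overline\sigma,\Lambda,T$, such that $0<\partial_y\Phi^\theta_{s,t}(x,q;y)\le C_*$ for all admissible arguments (such a constant exists). Response kernel. With $Y_r=S^\theta_{s,r}(x;y)$, $\mathcal K^\theta_{s,t}(r;x,y)=\sigma_\theta(Y_r)\,\partial_\xi S^\theta_{r,t}(x;\xi)|_{\xi=Y_r}$ for $s\le r\le t$. *)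

theory Defs
  imports "HOL-Probability.Probability"
begin

section \<open>Paths and the bracket functional\<close>

text \<open>Paths on $[0,T]$ are functions on the reals of which only the values on
  $[0,T]$ matter.\<close>

definition path_space :: "real \<Rightarrow> (real \<Rightarrow> real) set" where
  "path_space T = {x. continuous_on {0..T} x \<and> x 0 = 0}"

definition bracket_paths :: "real \<Rightarrow> real \<Rightarrow> (real \<Rightarrow> real) set" where
  "bracket_paths T \<Lambda> = {q. continuous_on {0..T} q \<and> q 0 = 0 \<and>
     (\<forall>s t. 0 \<le> s \<and> s \<le> t \<and> t \<le> T \<longrightarrow> 0 \<le> q t - q s \<and> q t - q s \<le> \<Lambda> * (t - s))}"

definition dyadic :: "real \<Rightarrow> nat \<Rightarrow> nat \<Rightarrow> real" where
  "dyadic T n k = real k * T / 2 ^ n"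

definition dyadic_variation :: "real \<Rightarrow> nat \<Rightarrow> (real \<Rightarrow> real) \<Rightarrow> real \<Rightarrow> real" where
  "dyadic_variation T n x t =
     (\<Sum>k | dyadic T n (Suc k) \<le> t. (x (dyadic T n (Suc k)) - x (dyadic T n k))\<^sup>2)"

definition lip_regularize :: "real \<Rightarrow> (real \<Rightarrow> real) \<Rightarrow> real \<Rightarrow> real" where
  "lip_regularize \<Lambda> a t = (INF u\<in>{0..t}. a u + \<Lambda> * (t - u))"

text \<open>The library's limsup lives in complete lattices, hence the detour through
  \<open>ereal\<close>; the sequence takes values in $[0,\Lambda t]$, so the limsup is finite.\<close>

definition bracket :: "real \<Rightarrow> real \<Rightarrow> (real \<Rightarrow> real) \<Rightarrow> real \<Rightarrow> real" where
  "bracket T \<Lambda> x t =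
     real_of_ereal (limsup (\<lambda>n. ereal (lip_regularize \<Lambda> (dyadic_variation T n x) t)))"


section \<open>Coefficients\<close>

definition Cb :: "nat \<Rightarrow> (real \<Rightarrow> real) set" where
  "Cb k = {f. (\<forall>j<k. \<forall>y. (deriv ^^ j) f field_differentiable at y) \<and>
              (\<forall>j\<le>k. continuous_on UNIV ((deriv ^^ j) f) \<and> bounded (range ((deriv ^^ j) f)))}"

definition Cb_norm :: "nat \<Rightarrow> (real \<Rightarrow> real) \<Rightarrow> real" where
  "Cb_norm k f = (\<Sum>j\<le>k. SUP y. \<bar>(deriv ^^ j) f y\<bar>)"

definition coefficient_hyps ::
  "(real ^ 'd) set \<Rightarrow> (real ^ 'd \<Rightarrow> real \<Rightarrow> real) \<Rightarrow> (real ^ 'd \<Rightarrow> real \<Rightarrow> real)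
     \<Rightarrow> real \<Rightarrow> real \<Rightarrow> real \<Rightarrow> bool" where
  "coefficient_hyps \<Theta> b \<sigma> L \<sigma>lo \<sigma>hi \<longleftrightarrow>
     compact \<Theta> \<and>
     (\<forall>\<theta>\<in>\<Theta>. b \<theta> \<in> Cb 2 \<and> \<sigma> \<theta> \<in> Cb 3) \<and>
     (\<forall>\<theta>\<in>\<Theta>. ((\<lambda>\<eta>. Cb_norm 2 (\<lambda>y. b \<eta> y - b \<theta> y)) \<longlongrightarrow> 0) (at \<theta> within \<Theta>) \<and>
            ((\<lambda>\<eta>. Cb_norm 3 (\<lambda>y. \<sigma> \<eta> y - \<sigma> \<theta> y)) \<longlongrightarrow> 0) (at \<theta> within \<Theta>)) \<and>
     (\<forall>\<theta>\<in>\<Theta>. Cb_norm 2 (b \<theta>) + Cb_norm 3 (\<sigma> \<theta>) \<le> L) \<and>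
     0 < \<sigma>lo \<and> \<sigma>lo \<le> \<sigma>hi \<and>
     (\<forall>\<theta>\<in>\<Theta>. \<forall>y. \<sigma>lo \<le> \<sigma> \<theta> y \<and> \<sigma> \<theta> y \<le> \<sigma>hi)"


section \<open>The flow and its response kernel\<close>

text \<open>In this section \<open>b\<close> and \<open>\<sigma>\<close> are the coefficients at a fixed parameter.\<close>

definition lamperti :: "(real \<Rightarrow> real) \<Rightarrow> real \<Rightarrow> real" where
  "lamperti \<sigma> y = (LBINT r=ereal 0..ereal y. 1 / \<sigma> r)"

definition lamperti_inv :: "(real \<Rightarrow> real) \<Rightarrow> real \<Rightarrow> real" where
  "lamperti_inv \<sigma> = inv (lamperti \<sigma>)"

definition b_hat :: "(real \<Rightarrow> real) \<Rightarrow> (real \<Rightarrow> real) \<Rightarrow> real \<Rightarrow> real" where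
  "b_hat b \<sigma> z = b (lamperti_inv \<sigma> z) / \<sigma> (lamperti_inv \<sigma> z)"

definition c_hat :: "(real \<Rightarrow> real) \<Rightarrow> real \<Rightarrow> real" where
  "c_hat \<sigma> z = - (1 / 2) * deriv \<sigma> (lamperti_inv \<sigma> z)"

text \<open>\<open>interval_measure\<close> needs a monotone function on the whole line, so \<open>q\<close> is
  extended by constants outside $[0,T]$. For continuous \<open>q\<close> the measure has no atoms.\<close>

definition stieltjes :: "real \<Rightarrow> (real \<Rightarrow> real) \<Rightarrow> real measure" where
  "stieltjes T q = interval_measure (\<lambda>r. q (max 0 (min T r)))"

definition solves_Z :: "real \<Rightarrow> (real \<Rightarrow> real) \<Rightarrow> (real \<Rightarrow> real) \<Rightarrow> real
    \<Rightarrow> (real \<Rightarrow> real) \<Rightarrow> (real \<Rightarrow> real) \<Rightarrow> real \<Rightarrow> (real \<Rightarrow> real) \<Rightarrow> bool" where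
  "solves_Z T b \<sigma> s x q y Z \<longleftrightarrow> continuous_on {s..T} Z \<and>
     (\<forall>t\<in>{s..T}. Z t = lamperti \<sigma> y + x t - x s
        + (LINT r:{s..t}|lborel. b_hat b \<sigma> (Z r))
        + (LINT r:{s..t}|stieltjes T q. c_hat \<sigma> (Z r)))"

definition Z_sol :: "real \<Rightarrow> (real \<Rightarrow> real) \<Rightarrow> (real \<Rightarrow> real) \<Rightarrow> real
    \<Rightarrow> (real \<Rightarrow> real) \<Rightarrow> (real \<Rightarrow> real) \<Rightarrow> real \<Rightarrow> real \<Rightarrow> real" where
  "Z_sol T b \<sigma> s x q y = (THE Z. solves_Z T b \<sigma> s x q y Z \<and> Z \<in> extensional {s..T})"

definition flow :: "real \<Rightarrow> (real \<Rightarrow> real) \<Rightarrow> (real \<Rightarrow> real) \<Rightarrow> real \<Rightarrow> real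
    \<Rightarrow> (real \<Rightarrow> real) \<Rightarrow> (real \<Rightarrow> real) \<Rightarrow> real \<Rightarrow> real" where
  "flow T b \<sigma> s t x q y = lamperti_inv \<sigma> (Z_sol T b \<sigma> s x q y t)"

definition raw_flow :: "real \<Rightarrow> real \<Rightarrow> (real \<Rightarrow> real) \<Rightarrow> (real \<Rightarrow> real) \<Rightarrow> real \<Rightarrow> real
    \<Rightarrow> (real \<Rightarrow> real) \<Rightarrow> real \<Rightarrow> real" where
  "raw_flow T \<Lambda> b \<sigma> s t x y = flow T b \<sigma> s t x (bracket T \<Lambda> x) y"

definition response_kernel :: "real \<Rightarrow> real \<Rightarrow> (real \<Rightarrow> real) \<Rightarrow> (real \<Rightarrow> real) \<Rightarrow> real \<Rightarrow> real
    \<Rightarrow> real \<Rightarrow> (real \<Rightarrow> real) \<Rightarrow> real \<Rightarrow> real" where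
  "response_kernel T \<Lambda> b \<sigma> s t r x y =
     (let Y = raw_flow T \<Lambda> b \<sigma> s r x y
      in \<sigma> Y * deriv (\<lambda>\<xi>. raw_flow T \<Lambda> b \<sigma> r t x \<xi>) Y)"

definition flow_deriv_bound ::
  "real \<Rightarrow> real \<Rightarrow> (real ^ 'd) set \<Rightarrow> (real ^ 'd \<Rightarrow> real \<Rightarrow> real) \<Rightarrow> (real ^ 'd \<Rightarrow> real \<Rightarrow> real)
     \<Rightarrow> real \<Rightarrow> bool" where
  "flow_deriv_bound T \<Lambda> \<Theta> b \<sigma> C \<longleftrightarrow>
     (\<forall>\<theta>\<in>\<Theta>. \<forall>s t y. \<forall>x\<in>path_space T. \<forall>q\<in>bracket_paths T \<Lambda>. 0 \<le> s \<and> s \<le> t \<and> t \<le> T \<longrightarrow>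
        0 < deriv (\<lambda>\<xi>. flow T (b \<theta>) (\<sigma> \<theta>) s t x q \<xi>) y \<and>
        deriv (\<lambda>\<xi>. flow T (b \<theta>) (\<sigma> \<theta>) s t x q \<xi>) y \<le> C)"


section \<open>Brownian motion and the Wiener integral\<close>

definition brownian_motion :: "'w measure \<Rightarrow> real \<Rightarrow> (real \<Rightarrow> 'w \<Rightarrow> real) \<Rightarrow> bool" where
  "brownian_motion M T W \<longleftrightarrow>
     prob_space M \<and>
     (\<forall>t\<in>{0..T}. W t \<in> borel_measurable M) \<and>
     (AE \<omega> in M. W 0 \<omega> = 0) \<and>
     (AE \<omega> in M. continuous_on {0..T} (\<lambda>t. W t \<omega>)) \<and>
     (\<forall>s t. 0 \<le> s \<and> s < t \<and> t \<le> T \<longrightarrow>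
        distributed M lborel (\<lambda>\<omega>. W t \<omega> - W s \<omega>) (normal_density 0 (sqrt (t - s)))) \<and>
     (\<forall>(n::nat) u. (\<forall>i\<le>n. u i \<in> {0..T}) \<and> (\<forall>i<n. u i \<le> u (Suc i)) \<longrightarrow>
        prob_space.indep_vars M (\<lambda>_. borel) (\<lambda>i \<omega>. W (u (Suc i)) \<omega> - W (u i) \<omega>) {..<n})"

definition tendsto_Lp :: "'w measure \<Rightarrow> real \<Rightarrow> (nat \<Rightarrow> 'w \<Rightarrow> real) \<Rightarrow> ('w \<Rightarrow> real) \<Rightarrow> bool" where
  "tendsto_Lp M p Fn F \<longleftrightarrow>
     (\<forall>n. integrable M (\<lambda>\<omega>. \<bar>Fn n \<omega> - F \<omega>\<bar> powr p)) \<and>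
     (\<lambda>n. LINT \<omega>|M. \<bar>Fn n \<omega> - F \<omega>\<bar> powr p) \<longlonglongrightarrow> 0"

definition L2_time :: "real \<Rightarrow> (real \<Rightarrow> real) set" where
  "L2_time T = {h \<in> borel_measurable (lebesgue_on {0..T}).
                 integrable (lebesgue_on {0..T}) (\<lambda>r. (h r)\<^sup>2)}"

definition L2_norm_time :: "real \<Rightarrow> (real \<Rightarrow> real) \<Rightarrow> real" where
  "L2_norm_time T h = sqrt (LINT r|lebesgue_on {0..T}. (h r)\<^sup>2)"

text \<open>\<open>I\<close> is a version of the Wiener integral of the deterministic integrand \<open>h\<close>
  over $[0,T]$: an $L^2$ limit of elementary integrals of step functions
  $\sum_i c_i 1_{(u_i,u_{i+1}]}$ converging to \<open>h\<close> in $L^2([0,T])$. By the It\^o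
  isometry the limit does not depend on the approximating sequence, up to null sets.\<close>

definition is_wiener_integral ::
  "'w measure \<Rightarrow> real \<Rightarrow> (real \<Rightarrow> 'w \<Rightarrow> real) \<Rightarrow> (real \<Rightarrow> real) \<Rightarrow> ('w \<Rightarrow> real) \<Rightarrow> bool" where
  "is_wiener_integral M T W h I \<longleftrightarrow>
     h \<in> L2_time T \<and> I \<in> borel_measurable M \<and>
     (\<exists>(N :: nat \<Rightarrow> nat) (c :: nat \<Rightarrow> nat \<Rightarrow> real) (u :: nat \<Rightarrow> nat \<Rightarrow> real).
        (\<forall>k. (\<forall>i\<le>N k. u k i \<in> {0..T}) \<and> (\<forall>i<N k. u k i \<le> u k (Suc i))) \<and>
        (\<lambda>k. L2_norm_time T
               (\<lambda>r. (\<Sum>i<N k. c k i * indicator {u k i<..u k (Suc i)} r) - h r)) \<longlonglongrightarrow> 0 \<and>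
        tendsto_Lp M 2 (\<lambda>k \<omega>. \<Sum>i<N k. c k i * (W (u k (Suc i)) \<omega> - W (u k i) \<omega>)) I)"


section \<open>Malliavin-Sobolev spaces\<close>

text \<open>Functions of $n$ real variables, with $n$ varying, are represented as functions on
  \<open>nat \<Rightarrow> real\<close> that depend on the coordinates below $n$ only; continuity in the product
  topology is then continuity on $R^n$.\<close>

definition partial_deriv :: "nat \<Rightarrow> ((nat \<Rightarrow> real) \<Rightarrow> real) \<Rightarrow> (nat \<Rightarrow> real) \<Rightarrow> real" where
  "partial_deriv i f z = deriv (\<lambda>v. f (z(i := v))) (z i)"

definition smooth_poly_growth :: "nat \<Rightarrow> ((nat \<Rightarrow> real) \<Rightarrow> real) \<Rightarrow> bool" where
  "smooth_poly_growth n f \<longleftrightarrow>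
     (\<forall>z z'. (\<forall>i<n. z i = z' i) \<longrightarrow> f z = f z') \<and>
     (\<forall>js. set js \<subseteq> {..<n} \<longrightarrow>
        (let g = foldr partial_deriv js f in
           continuous_on UNIV g \<and>
           (\<forall>i<n. \<forall>z. (\<lambda>v. g (z(i := v))) field_differentiable at (z i)) \<and>
           (\<exists>C (m::nat). \<forall>z. \<bar>g z\<bar> \<le> C * (1 + (\<Sum>i<n. \<bar>z i\<bar>)) ^ m)))"

text \<open>\<open>F = f(W(h\<^sub>0),...,W(h\<^sub>n\<^sub>-\<^sub>1))\<close> with derivative \<open>DF = \<Sum>\<^sub>i \<partial>\<^sub>if(W(h\<^sub>0),...) h\<^sub>i\<close>.\<close>

definition smooth_cylindrical ::
  "'w measure \<Rightarrow> real \<Rightarrow> (real \<Rightarrow> 'w \<Rightarrow> real) \<Rightarrow> ('w \<Rightarrow> real) \<Rightarrow> ('w \<Rightarrow> real \<Rightarrow> real) \<Rightarrow> bool" where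
  "smooth_cylindrical M T W F DF \<longleftrightarrow>
     (\<exists>n f h I. smooth_poly_growth n f \<and>
        (\<forall>i<n. is_wiener_integral M T W (h i) (I i)) \<and>
        F = (\<lambda>\<omega>. f (\<lambda>i. I i \<omega>)) \<and>
        DF = (\<lambda>\<omega> r. \<Sum>i<n. partial_deriv i f (\<lambda>i. I i \<omega>) * h i r))"

text \<open>The closure of the derivative on smooth cylindrical functionals, as an operator from
  $L^p(M)$ to $L^p(M;L^2([0,T]))$. It is closable for $p \ge 1$, so \<open>D\<close> is determined by \<open>F\<close>
  up to null sets.\<close>

definition has_malliavin_derivative ::
  "'w measure \<Rightarrow> real \<Rightarrow> (real \<Rightarrow> 'w \<Rightarrow> real) \<Rightarrow> real \<Rightarrow> ('w \<Rightarrow> real)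
     \<Rightarrow> ('w \<Rightarrow> real \<Rightarrow> real) \<Rightarrow> bool" where
  "has_malliavin_derivative M T W p F D \<longleftrightarrow>
     F \<in> borel_measurable M \<and> integrable M (\<lambda>\<omega>. \<bar>F \<omega>\<bar> powr p) \<and>
     case_prod D \<in> borel_measurable (M \<Otimes>\<^sub>M lebesgue_on {0..T}) \<and>
     (AE \<omega> in M. D \<omega> \<in> L2_time T) \<and>
     integrable M (\<lambda>\<omega>. L2_norm_time T (D \<omega>) powr p) \<and>
     (\<exists>Fn Dn. (\<forall>n. smooth_cylindrical M T W (Fn n) (Dn n)) \<and>
        tendsto_Lp M p Fn F \<and>
        tendsto_Lp M p (\<lambda>n \<omega>. L2_norm_time T (\<lambda>r. Dn n \<omega> r - D \<omega> r)) (\<lambda>_. 0))"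

definition malliavin_sobolev ::
  "'w measure \<Rightarrow> real \<Rightarrow> (real \<Rightarrow> 'w \<Rightarrow> real) \<Rightarrow> real \<Rightarrow> ('w \<Rightarrow> real) set" where
  "malliavin_sobolev M T W p = {F. \<exists>D. has_malliavin_derivative M T W p F D}"

end

theory Submission
  imports Defs "HOL-Real_Asymp.Real_Asymp"
begin

text \<open>
  The Lamperti transform turns the flow into \<open>S = G (Z t)\<close>, where \<open>Z\<close> solves an integral equation with
  additive noise \<open>X\<close>, and the only irregular ingredient left is the clock \<open>Q (X)\<close>. For a Gaussian
  martingale \<open>X\<close> with deterministic variance density \<open>a\<close> the dyadic squared variations have expectation
  \<open>\<integral>\<^sub>0\<^sup>t a\<close> and summable variances, so \<open>Q (X)\<close> is almost surely this deterministic function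
  (\<open>AE_bracket_eq_clock\<close>): the clock contributes nothing to the Malliavin derivative. What remains is
  an equation with deterministic clock and additive Gaussian noise, solvable path by path.

  Differentiating it in a direction of the Wiener space gives a linear equation, whose solution is an
  exponential, so formally \<open>D\<^sub>r S = 1\<^bsub>(s,t]\<^esub>(r) \<surd>(a r) \<sigma> (S) exp (\<integral>\<^sub>r\<^sup>t bh' (Z) du + ch' (Z) dq)\<close>. The same
  exponential is the derivative of \<open>z \<mapsto> Z\<close> restarted at time \<open>r\<close>, which identifies the right-hand side
  with the response kernel (\<open>kernel_formula\<close>).

  The formal computation is justified by the Euler scheme. Replacing the coefficients by polynomials in
  \<open>sin (z / c)\<close> and the equation by its Euler scheme yields smooth cylindrical functionals of the values
  of \<open>X\<close> on a grid, whose Malliavin derivative is a discrete tangent process. For each path the values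
  and the tangent processes converge (\<open>euler_converges\<close>, \<open>tangent_converges\<close>); the derivatives are
  bounded uniformly and the values by an affine function of \<open>\<bar>X t - X s\<bar>\<close>, so dominated convergence gives
  convergence in every \<open>L\<^sup>p\<close> (\<open>F0_malliavin\<close>).

  The statement speaks about every derivative of \<open>S\<close>, hence the derivative must be unique, that is, the
  operator closable (\<open>malliavin_derivative_unique\<close>). This is deduced from Gaussian integration by
  parts, proved for one increment of the Brownian motion and carried to cylindrical functionals of
  arbitrary Wiener integrals by linear change of variables, approximation and cut-off
  (\<open>gaussian_ibp\<close>, \<open>eint_ibp\<close>, \<open>wiener_ibp\<close>, \<open>cylinder_ibp\<close>). Finally, \<open>0 < \<partial>S \<le> C\<close> and
  \<open>\<sigma> \<le> \<sigma>hi\<close> bound the kernel and with it the norm of the derivative.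
\<close>

abbreviation leb :: "real => real measure" where "leb T \<equiv> lebesgue_on {0..T}"

abbreviation inner2 :: "real => (real => real) => (real => real) => real" where
  "inner2 T h k \<equiv> (LINT r|leb T. h r * k r)"

section \<open>Square-integrable functions\<close>

lemma tendsto_zero_bound:
  fixes f g :: "nat => real"
  assumes "\<And>k. \<bar>f k\<bar> \<le> g k" "g \<longlonglongrightarrow> 0"
  shows "f \<longlonglongrightarrow> 0"
  by (rule Lim_null_comparison[OF _ assms(2)]) (use assms(1) in auto)

lemma integrable_mult_L2:
  fixes f g :: "'a => real"
  assumes [measurable]: "f \<in> borel_measurable N" "g \<in> borel_measurable N"
    and f: "integrable N (\<lambda>x. (f x)\<^sup>2)" and g: "integrable N (\<lambda>x. (g x)\<^sup>2)"
  shows "integrable N (\<lambda>x. f x * g x)"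
proof (rule Bochner_Integration.integrable_bound)
  show "integrable N (\<lambda>x. (f x)\<^sup>2 + (g x)\<^sup>2)" using f g by simp
  show "(\<lambda>x. f x * g x) \<in> borel_measurable N" by measurable
  have "\<bar>u * v\<bar> \<le> u\<^sup>2 + v\<^sup>2" for u v :: real
  proof -
    have "2 * (\<bar>u\<bar> * \<bar>v\<bar>) \<le> \<bar>u\<bar>\<^sup>2 + \<bar>v\<bar>\<^sup>2" using sum_squares_bound[of "\<bar>u\<bar>" "\<bar>v\<bar>"] by simp
    then show ?thesis by (simp add: abs_mult) (smt (verit) mult_nonneg_nonneg abs_ge_zero)
  qed
  then show "AE x in N. norm (f x * g x) \<le> norm ((f x)\<^sup>2 + (g x)\<^sup>2)" by auto
qed

lemma integrable_add_sq:
  fixes f g :: "'a => real"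
  assumes [measurable]: "f \<in> borel_measurable N" "g \<in> borel_measurable N"
    and f: "integrable N (\<lambda>x. (f x)\<^sup>2)" and g: "integrable N (\<lambda>x. (g x)\<^sup>2)"
  shows "integrable N (\<lambda>x. (f x + g x)\<^sup>2)"
  using f g integrable_mult_L2[OF assms] by (simp add: power2_sum mult.assoc)

lemma integrable_diff_sq:
  fixes f g :: "'a => real"
  assumes [measurable]: "f \<in> borel_measurable N" "g \<in> borel_measurable N"
    and f: "integrable N (\<lambda>x. (f x)\<^sup>2)" and g: "integrable N (\<lambda>x. (g x)\<^sup>2)"
  shows "integrable N (\<lambda>x. (f x - g x)\<^sup>2)"
  using f g integrable_mult_L2[OF assms] by (simp add: power2_diff mult.assoc)

lemma Cauchy_Schwarz_integral:
  fixes f g :: "'a => real"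
  assumes [measurable]: "f \<in> borel_measurable N" "g \<in> borel_measurable N"
    and f: "integrable N (\<lambda>x. (f x)\<^sup>2)" and g: "integrable N (\<lambda>x. (g x)\<^sup>2)"
  shows "\<bar>LINT x|N. f x * g x\<bar> \<le> sqrt (LINT x|N. (f x)\<^sup>2) * sqrt (LINT x|N. (g x)\<^sup>2)"
proof -
  define A where "A = (LINT x|N. (f x)\<^sup>2)"
  define B where "B = (LINT x|N. (g x)\<^sup>2)"
  define C where "C = (LINT x|N. f x * g x)"
  note fg = integrable_mult_L2[OF assms]
  \<comment> \<open>A nonnegative quadratic polynomial in \<open>l\<close>; evaluated at its minimum it gives the inequality.\<close>
  have q: "0 \<le> A + 2 * l * C + l\<^sup>2 * B" for l
  proof -
    have "0 \<le> (LINT x|N. (f x + l * g x)\<^sup>2)" by simp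
    also have "(\<lambda>x. (f x + l * g x)\<^sup>2) = (\<lambda>x. (f x)\<^sup>2 + (2 * l) * (f x * g x) + l\<^sup>2 * (g x)\<^sup>2)"
      by (auto simp: power2_sum power_mult_distrib)
    also have "integral\<^sup>L N \<dots> = A + 2 * l * C + l\<^sup>2 * B"
      using f g fg unfolding A_def B_def C_def by (subst Bochner_Integration.integral_add) auto
    finally show ?thesis .
  qed
  have A0: "0 \<le> A" and B0: "0 \<le> B" by (simp_all add: A_def B_def)
  have "C\<^sup>2 \<le> A * B"
  proof (cases "B = 0")
    case True
    have "C = 0"
    proof (rule ccontr)
      assume "C \<noteq> 0"
      with q[of "-(A + 1) / (2 * C)"] True show False by (simp add: field_simps)
    qed
    then show ?thesis using True by simp
  next
    case False
    with B0 have "0 < B" by simp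
    with q[of "- C / B"] show ?thesis by (simp add: field_simps power2_eq_square)
  qed
  then have "\<bar>C\<bar> \<le> sqrt (A * B)" by (metis real_sqrt_abs real_sqrt_le_iff)
  then show ?thesis by (simp add: A_def B_def C_def real_sqrt_mult)
qed

lemma L2_inner_tendsto:
  fixes f g :: "'a => real" and fk gk :: "nat => 'a => real"
  assumes m[measurable]: "\<And>k. fk k \<in> borel_measurable N" "\<And>k. gk k \<in> borel_measurable N"
      "f \<in> borel_measurable N" "g \<in> borel_measurable N"
    and i: "\<And>k. integrable N (\<lambda>x. (fk k x)\<^sup>2)" "\<And>k. integrable N (\<lambda>x. (gk k x)\<^sup>2)"
      "integrable N (\<lambda>x. (f x)\<^sup>2)" "integrable N (\<lambda>x. (g x)\<^sup>2)"
    and c: "(\<lambda>k. LINT x|N. (fk k x - f x)\<^sup>2) \<longlonglongrightarrow> 0" "(\<lambda>k. LINT x|N. (gk k x - g x)\<^sup>2) \<longlonglongrightarrow> 0"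
  shows "(\<lambda>k. LINT x|N. fk k x * gk k x) \<longlonglongrightarrow> (LINT x|N. f x * g x)"
proof -
  note d = integrable_diff_sq[OF m(1,3) i(1,3)] integrable_diff_sq[OF m(2,4) i(2,4)]
  have dm: "(\<lambda>x. fk k x - f x) \<in> borel_measurable N" "(\<lambda>x. gk k x - g x) \<in> borel_measurable N" for k
    by measurable
  define a where "a k = sqrt (LINT x|N. (fk k x - f x)\<^sup>2)" for k
  define b where "b k = sqrt (LINT x|N. (gk k x - g x)\<^sup>2)" for k
  have a0: "a \<longlonglongrightarrow> 0" using tendsto_real_sqrt[OF c(1)] by (simp add: a_def[abs_def])
  have b0: "b \<longlonglongrightarrow> 0" using tendsto_real_sqrt[OF c(2)] by (simp add: b_def[abs_def])
  define F where "F = sqrt (LINT x|N. (f x)\<^sup>2)"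
  define G where "G = sqrt (LINT x|N. (g x)\<^sup>2)"
  have bd: "\<bar>(LINT x|N. fk k x * gk k x) - (LINT x|N. f x * g x)\<bar> \<le> a k * b k + F * b k + a k * G" for k
  proof -
    have e: "fk k x * gk k x = f x * g x + ((fk k x - f x) * (gk k x - g x) + f x * (gk k x - g x)
       + (fk k x - f x) * g x)" for x
      by (simp add: algebra_simps)
    have "(LINT x|N. fk k x * gk k x) = (LINT x|N. f x * g x) + ((LINT x|N. (fk k x - f x) * (gk k x - g x)) +
       (LINT x|N. f x * (gk k x - g x)) + (LINT x|N. (fk k x - f x) * g x))"
      unfolding e
      apply (subst Bochner_Integration.integral_add)
        apply (intro integrable_mult_L2 m i)
       apply (intro Bochner_Integration.integrable_add integrable_mult_L2 m i d dm)
      apply (subst Bochner_Integration.integral_add)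
        apply (intro Bochner_Integration.integrable_add integrable_mult_L2 m i d dm)
       apply (intro Bochner_Integration.integrable_add integrable_mult_L2 m i d dm)
      apply (subst Bochner_Integration.integral_add)
        apply (intro integrable_mult_L2 m i d dm)+
      by simp
    moreover have "\<bar>LINT x|N. (fk k x - f x) * (gk k x - g x)\<bar> \<le> a k * b k"
      unfolding a_def b_def by (intro Cauchy_Schwarz_integral dm d)
    moreover have "\<bar>LINT x|N. f x * (gk k x - g x)\<bar> \<le> F * b k"
      unfolding F_def b_def by (intro Cauchy_Schwarz_integral dm d m i)
    moreover have "\<bar>LINT x|N. (fk k x - f x) * g x\<bar> \<le> a k * G"
      unfolding a_def G_def by (intro Cauchy_Schwarz_integral dm d m i)
    ultimately show ?thesis by linarith
  qed
  have "(\<lambda>k. a k * b k + F * b k + a k * G) \<longlonglongrightarrow> 0 * 0 + F * 0 + 0 * G"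
    by (intro tendsto_intros a0 b0)
  then have "(\<lambda>k. (LINT x|N. fk k x * gk k x) - (LINT x|N. f x * g x)) \<longlonglongrightarrow> 0"
    by (intro tendsto_zero_bound[OF bd]) simp
  then show ?thesis by (simp add: LIM_zero_iff)
qed

lemma L2_lincomb_tendsto:
  fixes f g :: "'a => real" and fk gk :: "nat => 'a => real"
  assumes m[measurable]: "\<And>k. fk k \<in> borel_measurable N" "\<And>k. gk k \<in> borel_measurable N"
    and i: "\<And>k. integrable N (\<lambda>x. (fk k x)\<^sup>2)" "\<And>k. integrable N (\<lambda>x. (gk k x)\<^sup>2)"
    and c: "(\<lambda>k. LINT x|N. (fk k x)\<^sup>2) \<longlonglongrightarrow> 0" "(\<lambda>k. LINT x|N. (gk k x)\<^sup>2) \<longlonglongrightarrow> 0"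
  shows "(\<lambda>k. LINT x|N. (\<alpha> * fk k x + \<beta> * gk k x)\<^sup>2) \<longlonglongrightarrow> 0"
proof -
  have bd: "(LINT x|N. (\<alpha> * fk k x + \<beta> * gk k x)\<^sup>2) \<le> 2 * \<alpha>\<^sup>2 * (LINT x|N. (fk k x)\<^sup>2) + 2 * \<beta>\<^sup>2 * (LINT x|N. (gk k x)\<^sup>2)" for k
  proof -
    have "(LINT x|N. (\<alpha> * fk k x + \<beta> * gk k x)\<^sup>2) \<le> (LINT x|N. (2 * \<alpha>\<^sup>2) * (fk k x)\<^sup>2 + (2 * \<beta>\<^sup>2) * (gk k x)\<^sup>2)"
    proof (rule integral_mono)
      show "integrable N (\<lambda>x. (\<alpha> * fk k x + \<beta> * gk k x)\<^sup>2)"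
        by (rule integrable_add_sq) (use i in \<open>auto simp: power_mult_distrib\<close>)
      show "integrable N (\<lambda>x. (2 * \<alpha>\<^sup>2) * (fk k x)\<^sup>2 + (2 * \<beta>\<^sup>2) * (gk k x)\<^sup>2)" using i by auto
      fix x
      have "(u + v)\<^sup>2 \<le> 2 * u\<^sup>2 + 2 * v\<^sup>2" for u v :: real
        using sum_squares_bound[of u v] by (simp add: power2_sum)
      from this[of "\<alpha> * fk k x" "\<beta> * gk k x"]
      show "(\<alpha> * fk k x + \<beta> * gk k x)\<^sup>2 \<le> (2 * \<alpha>\<^sup>2) * (fk k x)\<^sup>2 + (2 * \<beta>\<^sup>2) * (gk k x)\<^sup>2"
        by (simp add: power_mult_distrib)
    qed
    also have "\<dots> = 2 * \<alpha>\<^sup>2 * (LINT x|N. (fk k x)\<^sup>2) + 2 * \<beta>\<^sup>2 * (LINT x|N. (gk k x)\<^sup>2)"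
      using i by (subst Bochner_Integration.integral_add) auto
    finally show ?thesis .
  qed
  have "(\<lambda>k. 2 * \<alpha>\<^sup>2 * (LINT x|N. (fk k x)\<^sup>2) + 2 * \<beta>\<^sup>2 * (LINT x|N. (gk k x)\<^sup>2)) \<longlonglongrightarrow> 2 * \<alpha>\<^sup>2 * 0 + 2 * \<beta>\<^sup>2 * 0"
    by (intro tendsto_intros c)
  then have l: "(\<lambda>k. 2 * \<alpha>\<^sup>2 * (LINT x|N. (fk k x)\<^sup>2) + 2 * \<beta>\<^sup>2 * (LINT x|N. (gk k x)\<^sup>2)) \<longlonglongrightarrow> 0"
    by simp
  show ?thesis
    by (rule tendsto_zero_bound[OF _ l]) (subst abs_of_nonneg, simp, rule bd)
qed

text \<open>The form of Fatou's lemma by which moment bounds pass from elementary to general Wiener integrals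
  along an almost surely convergent subsequence.\<close>

lemma Fatou_bounded_integrals:
  fixes f :: "'a => real" and fk :: "nat => 'a => real"
  assumes [measurable]: "f \<in> borel_measurable N"
    and i: "\<And>k. integrable N (fk k)" and nn: "\<And>k x. 0 \<le> fk k x"
    and ae: "AE x in N. (\<lambda>k. fk k x) \<longlonglongrightarrow> f x"
    and c: "(\<lambda>k. LINT x|N. fk k x) \<longlonglongrightarrow> c"
  shows "integrable N f \<and> (LINT x|N. f x) \<le> c"
proof -
  have f0: "AE x in N. 0 \<le> f x"
    using ae by eventually_elim (rule LIMSEQ_le_const, use nn in auto)
  have [measurable]: "fk k \<in> borel_measurable N" for k using i by auto
  have c0: "0 \<le> c" by (rule LIMSEQ_le_const[OF c]) (use nn in auto)
  have "(\<integral>\<^sup>+x. ennreal (f x) \<partial>N) = (\<integral>\<^sup>+x. liminf (\<lambda>k. ennreal (fk k x)) \<partial>N)"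
    by (rule nn_integral_cong_AE, use ae in eventually_elim)
       (metis lim_imp_Liminf tendsto_ennrealI trivial_limit_sequentially)
  also have "\<dots> \<le> liminf (\<lambda>k. \<integral>\<^sup>+x. ennreal (fk k x) \<partial>N)"
    by (rule nn_integral_liminf) auto
  also have "(\<lambda>k. \<integral>\<^sup>+x. ennreal (fk k x) \<partial>N) = (\<lambda>k. ennreal (LINT x|N. fk k x))"
    using i nn by (intro ext nn_integral_eq_integral) auto
  also have "liminf \<dots> = ennreal c"
    by (intro lim_imp_Liminf tendsto_ennrealI c) simp
  finally have *: "(\<integral>\<^sup>+x. ennreal (f x) \<partial>N) \<le> ennreal c" .
  then have I: "integrable N f"
    using f0 by (intro integrableI_nonneg) (auto intro: le_less_trans)
  moreover have "ennreal (LINT x|N. f x) \<le> ennreal c"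
    using * nn_integral_eq_integral[OF I f0] by simp
  ultimately show ?thesis using c0 by simp
qed


section \<open>Elementary integrals and common refinements\<close>

text \<open>One formula covers the elementary stochastic integral (\<open>g\<close> a Brownian path) and the step function it
  integrates (\<open>g v = of_bool (r \<le> v)\<close>), so that refining a grid is done once for both.\<close>

definition isum :: "nat => (nat => real) => (nat => real) => (real => real) => real" where
  "isum N c u g = (\<Sum>i<N. c i * (g (u (Suc i)) - g (u i)))"

definition strict_grid :: "real => nat => (nat => real) => bool" where
  "strict_grid T m p \<longleftrightarrow> (\<forall>j\<le>m. p j \<in> {0..T}) \<and> (\<forall>j<m. p j < p (Suc j))"

lemma step_eq_isum:
  assumes "\<And>i. i < N ==> u i \<le> u (Suc i)"
  shows "(\<Sum>i<N. c i * indicator {u i<..u (Suc i)} r) = isum N c u (\<lambda>v. of_bool (r \<le> v))"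
  unfolding isum_def
proof (rule sum.cong)
  fix i assume "i \<in> {..<N}"
  then have "u i \<le> u (Suc i)" using assms by simp
  then show "c i * indicator {u i<..u (Suc i)} r = c i * (of_bool (r \<le> u (Suc i)) - of_bool (r \<le> u i))"
    by (cases "r \<le> u i"; cases "r \<le> u (Suc i)") (simp_all add: indicator_def)
qed simp

lemma telescope_of_bool:
  fixes G :: "nat => real"
  assumes "a \<le> b" "b \<le> m"
  shows "(\<Sum>j<m. of_bool (a \<le> j \<and> j < b) * (G (Suc j) - G j)) = G b - G a"
proof -
  have "(\<Sum>j<m. of_bool (a \<le> j \<and> j < b) * (G (Suc j) - G j)) = (\<Sum>j\<in>{a..<b}. G (Suc j) - G j)"
    using assms by (intro sum.mono_neutral_cong_right) auto
  also have "\<dots> = G b - G a" using assms(1) by (rule sum_Suc_diff')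
  finally show ?thesis .
qed

text \<open>Sort all grid points; each old cell is then a union of new cells and the old sum telescopes. The
  strictness of the new grid makes its increments nondegenerate Gaussian variables.\<close>

lemma common_refinement:
  fixes u :: "'i => nat => real"
  assumes "finite A" and "0 \<le> T"
    and u: "\<And>a i. a \<in> A ==> i \<le> N a ==> u a i \<in> {0..T}" "\<And>a i. a \<in> A ==> i < N a ==> u a i \<le> u a (Suc i)"
  shows "\<exists>m p e. strict_grid T m p \<and> (\<forall>a\<in>A. \<forall>g. isum (N a) (c a) (u a) g = isum m (e a) p g)"
proof -
  define P where "P = insert 0 (\<Union>a\<in>A. u a ` {..N a})"
  have fP: "finite P" using assms(1) by (simp add: P_def)
  have PT: "P \<subseteq> {0..T}" using u(1) assms(2) by (auto simp: P_def)
  define xs where "xs = sorted_list_of_set P"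
  define m where "m = length xs - 1"
  define p where "p j = xs ! j" for j
  have xs: "set xs = P" "sorted_wrt (<) xs" using fP by (auto simp: xs_def)
  have len: "length xs = Suc m"
    using xs(1) by (cases xs) (auto simp: m_def P_def)
  have pm: "p i < p j" if "i < j" "j \<le> m" for i j
    using xs(2) that len by (auto simp: sorted_wrt_iff_nth_less p_def)
  have grid: "strict_grid T m p"
    unfolding strict_grid_def using pm PT xs(1) len by (auto simp: p_def) (metis in_mono atLeastAtMost_iff less_Suc_eq_le nth_mem)+
  have "\<exists>k\<le>m. p k = v" if "v \<in> P" for v
    using that xs(1) len by (metis in_set_conv_nth less_Suc_eq_le p_def)
  then have "\<forall>a i. \<exists>k. a \<in> A \<and> i \<le> N a \<longrightarrow> k \<le> m \<and> p k = u a i"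
    by (auto simp: P_def)
  then obtain k where k: "\<And>a i. a \<in> A ==> i \<le> N a ==> k a i \<le> m \<and> p (k a i) = u a i"
    by metis
  have kmono: "k a i \<le> k a (Suc i)" if "a \<in> A" "i < N a" for a i
  proof (rule ccontr)
    assume "\<not> k a i \<le> k a (Suc i)"
    then have "p (k a (Suc i)) < p (k a i)" using k[of a i] that by (intro pm) auto
    then show False using k[of a i] k[of a "Suc i"] u(2)[OF that] that by simp
  qed
  define e where "e a j = (\<Sum>i<N a. c a i * of_bool (k a i \<le> j \<and> j < k a (Suc i)))" for a j
  have "isum (N a) (c a) (u a) g = isum m (e a) p g" if a: "a \<in> A" for a g
  proof -
    have "isum m (e a) p g = (\<Sum>j<m. \<Sum>i<N a. c a i * (of_bool (k a i \<le> j \<and> j < k a (Suc i)) * (g (p (Suc j)) - g (p j))))"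
      by (simp only: isum_def e_def sum_distrib_right mult.assoc)
    also have "\<dots> = (\<Sum>i<N a. \<Sum>j<m. c a i * (of_bool (k a i \<le> j \<and> j < k a (Suc i)) * (g (p (Suc j)) - g (p j))))"
      by (rule sum.swap)
    also have "\<dots> = (\<Sum>i<N a. c a i * (g (u a (Suc i)) - g (u a i)))"
    proof (rule sum.cong)
      fix i assume i: "i \<in> {..<N a}"
      have "(\<Sum>j<m. of_bool (k a i \<le> j \<and> j < k a (Suc i)) * (g (p (Suc j)) - g (p j))) = g (p (k a (Suc i))) - g (p (k a i))"
        using k[of a "Suc i"] kmono[of a i] a i by (intro telescope_of_bool) auto
      then show "(\<Sum>j<m. c a i * (of_bool (k a i \<le> j \<and> j < k a (Suc i)) * (g (p (Suc j)) - g (p j)))) = c a i * (g (u a (Suc i)) - g (u a i))"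
        using k[of a "Suc i"] k[of a i] a i by (simp add: sum_distrib_left[symmetric])
    qed simp
    finally show ?thesis by (simp add: isum_def)
  qed
  with grid show ?thesis by blast
qed

lemma isum_lincomb: "\<alpha> * isum m e p g + \<beta> * isum m e' p g = isum m (\<lambda>j. \<alpha> * e j + \<beta> * e' j) p g"
  unfolding isum_def by (simp add: sum_distrib_left sum.distrib[symmetric] algebra_simps)

lemma strict_grid_mono:
  assumes "strict_grid T m p" "i \<le> j" "j \<le> m"
  shows "p i \<le> p j"
proof -
  have "j \<le> m \<longrightarrow> p i \<le> p j" using assms(2)
  proof (induction j rule: dec_induct)
    case (step n)
    show ?case
    proof
      assume n: "Suc n \<le> m"
      then have "p n < p (Suc n)" using assms(1) by (simp add: strict_grid_def)
      with step n show "p i \<le> p (Suc n)" by simp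
    qed
  qed simp
  then show ?thesis using assms(3) by simp
qed

lemma isum_step_mult:
  assumes "strict_grid T m p"
  shows "isum m e p (\<lambda>v. of_bool (r \<le> v)) * isum m e' p (\<lambda>v. of_bool (r \<le> v))
    = (\<Sum>j<m. e j * e' j * indicator {p j<..p (Suc j)} r)"
proof -
  have s: "isum m e p (\<lambda>v. of_bool (r \<le> v)) = (\<Sum>j<m. e j * indicator {p j<..p (Suc j)} r)" for e
    using assms by (subst step_eq_isum) (auto simp: strict_grid_def intro: less_imp_le)
  have d: "indicator {p i<..p (Suc i)} r * indicator {p j<..p (Suc j)} r = (0::real)" if "i \<noteq> j" "i < m" "j < m" for i j
  proof -
    have "\<not> (r \<in> {p i<..p (Suc i)} \<and> r \<in> {p j<..p (Suc j)})"
    proof (cases "i < j")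
      case True then show ?thesis using strict_grid_mono[OF assms, of "Suc i" j] that by auto
    next
      case False then show ?thesis using strict_grid_mono[OF assms, of "Suc j" i] that by auto
    qed
    then show ?thesis by (auto simp: indicator_def)
  qed
  have "isum m e p (\<lambda>v. of_bool (r \<le> v)) * isum m e' p (\<lambda>v. of_bool (r \<le> v))
     = (\<Sum>i<m. \<Sum>j<m. (e i * e' j) * (indicator {p i<..p (Suc i)} r * indicator {p j<..p (Suc j)} r))"
    unfolding s sum_product by (simp add: mult_ac)
  also have "\<dots> = (\<Sum>i<m. \<Sum>j<m. if i = j then e j * e' j * indicator {p j<..p (Suc j)} r else 0)"
    by (intro sum.cong refl) (auto simp: d, auto simp: indicator_def)
  also have "\<dots> = (\<Sum>j<m. e j * e' j * indicator {p j<..p (Suc j)} r)" by simp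
  finally show ?thesis .
qed

lemma step_measurable [measurable]: "(\<lambda>r. isum m e p (\<lambda>v. of_bool (r \<le> v))) \<in> borel_measurable borel"
  unfolding isum_def by measurable

lemma borel_measurable_leb_on:
  "f \<in> borel_measurable borel ==> f \<in> borel_measurable (lebesgue_on S)"
  by (intro measurable_restrict_space1 measurable_completion) simp

lemma step_measurable_leb [measurable]: "(\<lambda>r. isum m e p (\<lambda>v. of_bool (r \<le> v))) \<in> borel_measurable (lebesgue_on S)"
  by (intro measurable_restrict_space1 measurable_completion) simp

lemma isum_bound: "\<bar>isum m e p (\<lambda>v. of_bool (r \<le> v))\<bar> \<le> (\<Sum>j<m. \<bar>e j\<bar>)"
  unfolding isum_def
  by (rule order_trans[OF sum_abs], rule sum_mono) (auto simp: abs_mult of_bool_def)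

lemma finite_leb_on: "finite_measure (leb T)"
  by (metis cbox_interval finite_measure_lebesgue_on lmeasurable_cbox)

lemma bounded_integrable_leb_on:
  fixes f :: "real => real"
  assumes "f \<in> borel_measurable (leb T)" "\<And>r. r \<in> {0..T} ==> \<bar>f r\<bar> \<le> B"
  shows "integrable (leb T) f"
  by (rule finite_measure.integrable_const_bound[OF finite_leb_on, where B = B])
     (use assms in \<open>auto simp: space_restrict_space\<close>)

lemma step_L2: "integrable (leb T) (\<lambda>r. (isum m e p (\<lambda>v. of_bool (r \<le> v)))\<^sup>2)"
proof (rule bounded_integrable_leb_on)
  show "\<bar>(isum m e p (\<lambda>v. of_bool (r \<le> v)))\<^sup>2\<bar> \<le> (\<Sum>j<m. \<bar>e j\<bar>)\<^sup>2" for r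
    using power_mono[OF isum_bound[of m e p r] abs_ge_zero, of 2] by simp
qed measurable

lemma LINT_indicator_cell:
  fixes a b T :: real
  assumes "0 \<le> a" "a \<le> b" "b \<le> T"
  shows "(LINT r|leb T. indicator {a<..b} r) = b - a"
proof -
  have sub: "{a<..b} \<subseteq> {0..T}" 
  proof
    fix x assume "x \<in> {a<..b}"
    with assms show "x \<in> {0..T}" unfolding atLeastAtMost_iff greaterThanAtMost_iff by linarith
  qed
  have "(LINT r|leb T. indicator {a<..b} r) = measure (leb T) {a<..b}"
    using sub by (simp add: space_restrict_space Int_absorb2 Int_absorb1)
  also have "\<dots> = measure lebesgue {a<..b}"
    using sub by (intro measure_restrict_space) auto
  also have "\<dots> = b - a" using assms by simp
  finally show ?thesis .
qed

lemma step_inner: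
  assumes "strict_grid T m p"
  shows "(LINT r|leb T. isum m e p (\<lambda>v. of_bool (r \<le> v)) * isum m e' p (\<lambda>v. of_bool (r \<le> v)))
    = (\<Sum>j<m. e j * e' j * (p (Suc j) - p j))"
proof -
  have i: "integrable (leb T) (\<lambda>r. e j * e' j * indicator {p j<..p (Suc j)} r)" for j
    by (rule bounded_integrable_leb_on[where B = "\<bar>e j * e' j\<bar>"], rule borel_measurable_leb_on)
       (auto simp: indicator_def)
  have "(LINT r|leb T. isum m e p (\<lambda>v. of_bool (r \<le> v)) * isum m e' p (\<lambda>v. of_bool (r \<le> v)))
     = (LINT r|leb T. (\<Sum>j<m. e j * e' j * indicator {p j<..p (Suc j)} r))"
    unfolding isum_step_mult[OF assms] ..
  also have "\<dots> = (\<Sum>j<m. LINT r|leb T. e j * e' j * indicator {p j<..p (Suc j)} r)"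
    by (rule Bochner_Integration.integral_sum) (rule i)
  also have "\<dots> = (\<Sum>j<m. e j * e' j * (p (Suc j) - p j))"
  proof (rule sum.cong)
    fix j assume "j \<in> {..<m}"
    then have "(LINT r|leb T. indicator {p j<..p (Suc j)} r) = p (Suc j) - p j"
      using assms by (intro LINT_indicator_cell) (auto simp: strict_grid_def less_imp_le)
    then show "(LINT r|leb T. e j * e' j * indicator {p j<..p (Suc j)} r) = e j * e' j * (p (Suc j) - p j)"
      by simp
  qed simp
  finally show ?thesis .
qed


section \<open>Gaussian moments of elementary integrals\<close>

locale brownian = prob_space M for M :: "'w measure" +
  fixes T :: real and W :: "real => 'w => real"
  assumes T_pos: "0 < T" and bm: "brownian_motion M T W"
begin

lemma W_measurable [measurable]: "v \<in> {0..T} ==> W v \<in> borel_measurable M"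
  using bm by (simp add: brownian_motion_def)

definition eint :: "nat => (nat => real) => (nat => real) => 'w => real" where
  "eint m e p w = isum m e p (\<lambda>v. W v w)"

lemma eint_measurable:
  assumes "\<And>i. i \<le> m ==> p i \<in> {0..T}"
  shows "eint m e p \<in> borel_measurable M"
  unfolding eint_def[abs_def] isum_def using assms by (intro borel_measurable_sum borel_measurable_times borel_measurable_diff W_measurable) auto

lemma increments_indep:
  assumes "strict_grid T m p"
  shows "indep_vars (\<lambda>_. borel) (\<lambda>i w. W (p (Suc i)) w - W (p i) w) {..<m}"
  using bm assms unfolding brownian_motion_def strict_grid_def by (meson less_imp_le)

lemma increments_normal:
  assumes "strict_grid T m p" "i < m"
  shows "distributed M lborel (\<lambda>w. W (p (Suc i)) w - W (p i) w) (normal_density 0 (sqrt (p (Suc i) - p i)))"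
  using bm assms unfolding brownian_motion_def strict_grid_def by auto

text \<open>An elementary integral is a sum of independent centred Gaussian variables, hence Gaussian, with the
  even moments of the normal distribution. Vanishing coefficients are discarded because a normal
  density needs a positive deviation.\<close>

lemma eint_moment:
  assumes g: "strict_grid T m p"
  shows "has_bochner_integral M (\<lambda>w. (eint m e p w) ^ (2 * k))
    (fact (2 * k) / (2 ^ k * fact k) * (\<Sum>j<m. (e j)\<^sup>2 * (p (Suc j) - p j)) ^ k)"
proof (cases "\<forall>j<m. e j = 0")
  case True
  then have "eint m e p w = 0" for w by (simp add: eint_def isum_def)
  moreover have "(\<Sum>j<m. (e j)\<^sup>2 * (p (Suc j) - p j)) = 0" using True by simp
  ultimately show ?thesis
    by (cases "k = 0") (simp_all add: has_bochner_integral_iff zero_power prob_space)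
next
  case False
  define J where "J = {j. j < m \<and> e j \<noteq> 0}"
  have J: "finite J" "J \<noteq> {}" "J \<subseteq> {..<m}" using False by (auto simp: J_def)
  define X where "X i w = e i * (W (p (Suc i)) w - W (p i) w)" for i w
  define s where "s i = \<bar>e i\<bar> * sqrt (p (Suc i) - p i)" for i
  have s_pos: "0 < s i" if "i \<in> J" for i
    using that g by (auto simp: s_def J_def strict_grid_def)
  have "indep_vars (\<lambda>_. borel) (\<lambda>i w. W (p (Suc i)) w - W (p i) w) J"
    using increments_indep[OF g] J(3) by (rule indep_vars_subset)
  then have ind: "indep_vars (\<lambda>_. borel) X J"
    unfolding X_def by (rule indep_vars_compose2) simp
  have nrm: "distributed M lborel (X i) (normal_density 0 (s i))" if "i \<in> J" for i
    using normal_density_affine[OF increments_normal[OF g, of i], of "e i" 0] that g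
    unfolding X_def s_def by (auto simp: J_def strict_grid_def)
  define V where "V = (\<Sum>j<m. (e j)\<^sup>2 * (p (Suc j) - p j))"
  have V: "(\<Sum>i\<in>J. (s i)\<^sup>2) = V"
  proof -
    have "(\<Sum>i\<in>J. (s i)\<^sup>2) = (\<Sum>j\<in>J. (e j)\<^sup>2 * (p (Suc j) - p j))"
    proof (rule sum.cong)
      fix i assume "i \<in> J"
      then have "p i < p (Suc i)" using g by (auto simp: J_def strict_grid_def)
      then show "(s i)\<^sup>2 = (e i)\<^sup>2 * (p (Suc i) - p i)" by (simp add: s_def power_mult_distrib)
    qed simp
    also have "\<dots> = V" unfolding V_def by (rule sum.mono_neutral_left) (auto simp: J_def)
    finally show ?thesis .
  qed
  have Vpos: "0 < V" unfolding V[symmetric] using J s_pos by (intro sum_pos) (auto simp: less_imp_neq[OF s_pos, symmetric] simp del: zero_less_power2 intro!: zero_less_power)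
  have eq: "(\<lambda>w. \<Sum>i\<in>J. X i w) = eint m e p"
  proof
    fix w
    show "(\<Sum>i\<in>J. X i w) = eint m e p w" unfolding eint_def isum_def X_def by (rule sum.mono_neutral_left) (auto simp: J_def)
  qed
  have "distributed M lborel (\<lambda>w. \<Sum>i\<in>J. X i w) (normal_density (\<Sum>i\<in>J. 0) (sqrt (\<Sum>i\<in>J. (s i)\<^sup>2)))"
    by (rule sum_indep_normal[OF J(1,2) ind s_pos nrm])
  then have D: "distributed M lborel (eint m e p) (normal_density 0 (sqrt V))" by (simp add: eq V)
  have nm: "has_bochner_integral lborel (\<lambda>x. normal_density 0 (sqrt V) x * (x - 0) ^ (2 * k))
     (fact (2 * k) / ((2 / (sqrt V)\<^sup>2) ^ k * fact k))"
    by (rule normal_moment_even) (use Vpos in simp)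
  have "integrable M (\<lambda>w. (eint m e p w) ^ (2 * k))"
    using nm by (subst distributed_integrable[OF D, symmetric]) (auto simp: has_bochner_integral_iff)
  moreover have "(LINT w|M. (eint m e p w) ^ (2 * k)) = fact (2 * k) / ((2 / (sqrt V)\<^sup>2) ^ k * fact k)"
    using nm by (subst distributed_integral[OF D, symmetric]) (auto simp: has_bochner_integral_iff)
  moreover have "fact (2 * k) / ((2 / (sqrt V)\<^sup>2) ^ k * fact k) = fact (2 * k) / (2 ^ k * fact k) * V ^ k"
    using Vpos by (simp add: power_divide field_simps)
  ultimately show ?thesis by (simp add: has_bochner_integral_iff V_def)
qed

lemma eint_sq:
  assumes g: "strict_grid T m p"
  shows "integrable M (\<lambda>w. (eint m e p w)\<^sup>2)"
    "(LINT w|M. (eint m e p w)\<^sup>2) = (\<Sum>j<m. (e j)\<^sup>2 * (p (Suc j) - p j))"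
  using eint_moment[OF g, of e 1] by (simp_all add: has_bochner_integral_iff)

text \<open>The fourth moment of a centred Gaussian determines the mixed moment of two jointly
  Gaussian variables by polarisation.\<close>

lemma eint_mixed_moment:
  assumes g: "strict_grid T m p"
  defines "ip \<equiv> \<lambda>e e'. \<Sum>j<m. e j * e' j * (p (Suc j) - p j)"
  shows "has_bochner_integral M (\<lambda>w. (eint m e p w)\<^sup>2 * (eint m e' p w)\<^sup>2)
     (ip e e * ip e' e' + 2 * (ip e e')\<^sup>2)"
proof -
  let ?a = "eint m e p" and ?b = "eint m e' p"
  define s where "s = (\<lambda>j. 1 * e j + 1 * e' j)"
  define d where "d = (\<lambda>j. 1 * e j + (-1) * e' j)"
  have S: "eint m s p w = ?a w + ?b w" for w
    unfolding eint_def s_def isum_lincomb[symmetric] by simp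
  have D: "eint m d p w = ?a w - ?b w" for w
    unfolding eint_def d_def isum_lincomb[symmetric] by simp
  have m4: "has_bochner_integral M (\<lambda>w. (eint m f p w) ^ 4) (3 * (ip f f)\<^sup>2)" for f
    using eint_moment[OF g, of f 2] by (simp add: ip_def power2_eq_square fact_numeral)
  have "has_bochner_integral M (\<lambda>w. 1 / 12 * ((eint m s p w) ^ 4 + (eint m d p w) ^ 4 - 2 * (?a w) ^ 4 - 2 * (?b w) ^ 4))
     (1 / 12 * (3 * (ip s s)\<^sup>2 + 3 * (ip d d)\<^sup>2 - 2 * (3 * (ip e e)\<^sup>2) - 2 * (3 * (ip e' e')\<^sup>2)))"
    by (intro has_bochner_integral_mult_right has_bochner_integral_diff has_bochner_integral_add m4)
  moreover have "1 / 12 * ((eint m s p w) ^ 4 + (eint m d p w) ^ 4 - 2 * (?a w) ^ 4 - 2 * (?b w) ^ 4)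
     = (?a w)\<^sup>2 * (?b w)\<^sup>2" for w
    unfolding S D by (simp add: power2_eq_square power4_eq_xxxx algebra_simps)
  moreover have ss: "ip s s = ip e e + 2 * ip e e' + ip e' e'"
    unfolding ip_def s_def sum_distrib_left sum.distrib[symmetric] by (intro sum.cong) (auto simp: algebra_simps)
  moreover have dd: "ip d d = ip e e - 2 * ip e e' + ip e' e'"
    unfolding ip_def d_def sum_distrib_left sum.distrib[symmetric] sum_subtractf[symmetric] by (intro sum.cong) (auto simp: algebra_simps)
  moreover have "1 / 12 * (3 * (A + 2 * C + B)\<^sup>2 + 3 * (A - 2 * C + B)\<^sup>2 - 2 * (3 * A\<^sup>2) - 2 * (3 * B\<^sup>2)) = A * B + 2 * C\<^sup>2"
    for A B C :: real by (simp add: power2_eq_square algebra_simps)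
  ultimately show ?thesis by (simp add: add_divide_distrib)
qed

end


section \<open>Wiener integrals as limits of elementary integrals\<close>

abbreviation stepf :: "nat => (nat => real) => (nat => real) => real => real" where
  "stepf m e p r \<equiv> isum m e p (\<lambda>v. of_bool (r \<le> v))"

lemma abs_powr_two: "\<bar>x::real\<bar> powr 2 = x\<^sup>2"
  by (cases "x = 0") simp_all

lemma tendsto_sqrt_zero_cancel:
  assumes "(\<lambda>k. sqrt (f k)) \<longlonglongrightarrow> 0" "\<And>k. 0 \<le> f k"
  shows "f \<longlonglongrightarrow> 0"
  using tendsto_power[OF assms(1), of 2] assms(2) by simp

context brownian
begin

text \<open>Finitely many Wiener integrals are approximated along one common grid, in \<open>L\<^sup>2\<close> and, after passing to
  a subsequence, almost surely. All later properties of Wiener integrals are limits of elementary ones.\<close>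

lemma joint_approx:
  assumes A: "finite A" and wi: "\<And>i. i \<in> A ==> is_wiener_integral M T W (h i) (I i)"
  obtains m p e where "\<And>k. strict_grid T (m k) (p k)"
    and "\<And>i. i \<in> A ==> (\<lambda>k. LINT r|leb T. (stepf (m k) (e k i) (p k) r - h i r)\<^sup>2) \<longlonglongrightarrow> 0"
    and "\<And>i k. i \<in> A ==> integrable M (\<lambda>w. (eint (m k) (e k i) (p k) w - I i w)\<^sup>2)"
    and "\<And>i. i \<in> A ==> (\<lambda>k. LINT w|M. (eint (m k) (e k i) (p k) w - I i w)\<^sup>2) \<longlonglongrightarrow> 0"
    and "AE w in M. \<forall>i\<in>A. (\<lambda>k. eint (m k) (e k i) (p k) w) \<longlonglongrightarrow> I i w"
proof -
  define Q where "Q i N c u \<longleftrightarrow> (\<forall>k. (\<forall>j\<le>N k. u k j \<in> {0..T}) \<and> (\<forall>j<N k. u k j \<le> u k (Suc j))) \<and>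
        (\<lambda>k. L2_norm_time T
               (\<lambda>r. (\<Sum>j<N k. c k j * indicator {u k j<..u k (Suc j)} r) - h i r)) \<longlonglongrightarrow> 0 \<and>
        tendsto_Lp M 2 (\<lambda>k w. \<Sum>j<N k. c k j * (W (u k (Suc j)) w - W (u k j) w)) (I i)"
    for i and N :: "nat => nat" and c u :: "nat => nat => real"
  have "\<exists>N c u. Q i N c u" if "i \<in> A" for i
    using wi[OF that] unfolding is_wiener_integral_def Q_def by (elim conjE)
  then obtain N c u where NQ: "\<And>i. i \<in> A ==> Q i (N i) (c i) (u i)" by metis
  have G: "j \<le> N i k ==> u i k j \<in> {0..T}" "j < N i k ==> u i k j \<le> u i k (Suc j)"
    and L: "(\<lambda>k. L2_norm_time T
               (\<lambda>r. (\<Sum>j<N i k. c i k j * indicator {u i k j<..u i k (Suc j)} r) - h i r)) \<longlonglongrightarrow> 0"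
    and P: "tendsto_Lp M 2 (\<lambda>k w. \<Sum>j<N i k. c i k j * (W (u i k (Suc j)) w - W (u i k j) w)) (I i)"
    if "i \<in> A" for i k j
    using NQ[OF that] unfolding Q_def by (elim conjE, simp)+
  have "\<forall>k. \<exists>m p e. strict_grid T m p \<and> (\<forall>i\<in>A. \<forall>g. isum (N i k) (c i k) (u i k) g = isum m (e i) p g)"
  proof
    fix k
    show "\<exists>m p e. strict_grid T m p \<and> (\<forall>i\<in>A. \<forall>g. isum (N i k) (c i k) (u i k) g = isum m (e i) p g)"
      using common_refinement[OF A, of T "\<lambda>i. N i k" "\<lambda>i. u i k" "\<lambda>i. c i k"] G T_pos by auto
  qed
  then obtain m p e where grid: "\<And>k. strict_grid T (m k) (p k)"
    and eq: "\<And>i k g. i \<in> A ==> isum (N i k) (c i k) (u i k) g = isum (m k) (e k i) (p k) g"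
    by metis
  have st: "(\<Sum>j<N i k. c i k j * indicator {u i k j<..u i k (Suc j)} r) = stepf (m k) (e k i) (p k) r" if "i \<in> A" for i k r
    using that G by (subst step_eq_isum) (auto simp: eq)
  have ei: "(\<Sum>j<N i k. c i k j * (W (u i k (Suc j)) w - W (u i k j) w)) = eint (m k) (e k i) (p k) w" if "i \<in> A" for i k w
    using eq[OF that, of k "\<lambda>v. W v w"] by (simp add: isum_def eint_def)
  have L': "(\<lambda>k. LINT r|leb T. (stepf (m k) (e k i) (p k) r - h i r)\<^sup>2) \<longlonglongrightarrow> 0" if "i \<in> A" for i
    by (rule tendsto_sqrt_zero_cancel) (use L[OF that] in \<open>simp_all add: st[OF that] L2_norm_time_def\<close>)
  have I': "integrable M (\<lambda>w. (eint (m k) (e k i) (p k) w - I i w)\<^sup>2)" if "i \<in> A" for i k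
    using P[OF that] by (simp add: ei[OF that] tendsto_Lp_def abs_powr_two)
  have P': "(\<lambda>k. LINT w|M. (eint (m k) (e k i) (p k) w - I i w)\<^sup>2) \<longlonglongrightarrow> 0" if "i \<in> A" for i
    using P[OF that] by (simp add: ei[OF that] tendsto_Lp_def abs_powr_two)
  define S where "S k w = (\<Sum>i\<in>A. (eint (m k) (e k i) (p k) w - I i w)\<^sup>2)" for k w
  have Si: "integrable M (S k)" for k unfolding S_def by (intro Bochner_Integration.integrable_sum I')
  have "(LINT w|M. norm (S k w)) = (\<Sum>i\<in>A. LINT w|M. (eint (m k) (e k i) (p k) w - I i w)\<^sup>2)" for k
    unfolding S_def by (simp add: sum_nonneg Bochner_Integration.integral_sum[OF I'])
  moreover have "(\<lambda>k. \<Sum>i\<in>A. LINT w|M. (eint (m k) (e k i) (p k) w - I i w)\<^sup>2) \<longlonglongrightarrow> (\<Sum>i\<in>A. 0)"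
    by (intro tendsto_sum P')
  ultimately have "(\<lambda>k. LINT w|M. norm (S k w)) \<longlonglongrightarrow> 0" by simp
  then obtain s where s: "strict_mono s" "AE w in M. (\<lambda>k. S (s k) w) \<longlonglongrightarrow> 0"
    using tendsto_L1_AE_subseq[of M S] Si by blast
  have ae: "AE w in M. \<forall>i\<in>A. (\<lambda>k. eint (m (s k)) (e (s k) i) (p (s k)) w) \<longlonglongrightarrow> I i w"
    using s(2)
  proof eventually_elim
    fix w assume l: "(\<lambda>k. S (s k) w) \<longlonglongrightarrow> 0"
    show "\<forall>i\<in>A. (\<lambda>k. eint (m (s k)) (e (s k) i) (p (s k)) w) \<longlonglongrightarrow> I i w"
    proof
      fix i assume i: "i \<in> A"
      have "(\<lambda>k. (eint (m (s k)) (e (s k) i) (p (s k)) w - I i w)\<^sup>2) \<longlonglongrightarrow> 0"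
      proof (rule tendsto_zero_bound[OF _ l])
        show "\<bar>(eint (m (s k)) (e (s k) i) (p (s k)) w - I i w)\<^sup>2\<bar> \<le> S (s k) w" for k
          unfolding S_def using A i by (simp add: member_le_sum[where f="\<lambda>i. (eint (m (s k)) (e (s k) i) (p (s k)) w - I i w)\<^sup>2"])
      qed
      then have "(\<lambda>k. sqrt ((eint (m (s k)) (e (s k) i) (p (s k)) w - I i w)\<^sup>2)) \<longlonglongrightarrow> sqrt 0"
        by (rule tendsto_real_sqrt)
      then have "(\<lambda>k. eint (m (s k)) (e (s k) i) (p (s k)) w - I i w) \<longlonglongrightarrow> 0"
        by (simp add: tendsto_rabs_zero_iff)
      then show "(\<lambda>k. eint (m (s k)) (e (s k) i) (p (s k)) w) \<longlonglongrightarrow> I i w"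
        by (simp add: LIM_zero_iff)
    qed
  qed
  show ?thesis
    by (rule that[of "m \<circ> s" "p \<circ> s" "e \<circ> s"])
       (use grid L' I' P' ae s(1) in \<open>auto simp: o_def intro: LIMSEQ_subseq_LIMSEQ[unfolded o_def]\<close>)
qed

lemma single_approx:
  assumes w: "is_wiener_integral M T W h I"
  obtains m p e where "\<And>k. strict_grid T (m k) (p k)"
    and "(\<lambda>k. LINT r|leb T. (stepf (m k) (e k) (p k) r - h r)\<^sup>2) \<longlonglongrightarrow> 0"
    and "\<And>k. integrable M (\<lambda>w. (eint (m k) (e k) (p k) w - I w)\<^sup>2)"
    and "(\<lambda>k. LINT w|M. (eint (m k) (e k) (p k) w - I w)\<^sup>2) \<longlonglongrightarrow> 0"
    and "AE w in M. (\<lambda>k. eint (m k) (e k) (p k) w) \<longlonglongrightarrow> I w"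
proof (rule joint_approx[of "{()}" "\<lambda>_. h" "\<lambda>_. I"])
  fix m p and e :: "nat => unit => nat => real"
  assume J: "\<And>k. strict_grid T (m k) (p k)"
    "\<And>i. i \<in> {()} ==> (\<lambda>k. LINT r|leb T. (stepf (m k) (e k i) (p k) r - h r)\<^sup>2) \<longlonglongrightarrow> 0"
    "\<And>i k. i \<in> {()} ==> integrable M (\<lambda>w. (eint (m k) (e k i) (p k) w - I w)\<^sup>2)"
    "\<And>i. i \<in> {()} ==> (\<lambda>k. LINT w|M. (eint (m k) (e k i) (p k) w - I w)\<^sup>2) \<longlonglongrightarrow> 0"
    "AE w in M. \<forall>i\<in>{()}. (\<lambda>k. eint (m k) (e k i) (p k) w) \<longlonglongrightarrow> I w"
  show thesis by (rule that[of m p "\<lambda>k. e k ()"]) (use J in simp_all)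
qed (use w in simp_all)

lemma pair_approx:
  assumes w: "is_wiener_integral M T W h1 I1" "is_wiener_integral M T W h2 I2"
  obtains m p e where "\<And>k. strict_grid T (m k) (p k)"
    and "\<And>i. (\<lambda>k. LINT r|leb T. (stepf (m k) (e k i) (p k) r - (if i then h1 else h2) r)\<^sup>2) \<longlonglongrightarrow> 0"
    and "\<And>i k. integrable M (\<lambda>w. (eint (m k) (e k i) (p k) w - (if i then I1 else I2) w)\<^sup>2)"
    and "\<And>i. (\<lambda>k. LINT w|M. (eint (m k) (e k i) (p k) w - (if i then I1 else I2) w)\<^sup>2) \<longlonglongrightarrow> 0"
    and "AE w in M. \<forall>i. (\<lambda>k. eint (m k) (e k i) (p k) w) \<longlonglongrightarrow> (if i then I1 else I2) w"
proof (rule joint_approx[of UNIV "\<lambda>i. if i then h1 else h2" "\<lambda>i. if i then I1 else I2"])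
  fix m p and e :: "nat => bool => nat => real"
  assume J: "\<And>k. strict_grid T (m k) (p k)"
    "\<And>i. i \<in> UNIV ==> (\<lambda>k. LINT r|leb T. (stepf (m k) (e k i) (p k) r - (if i then h1 else h2) r)\<^sup>2) \<longlonglongrightarrow> 0"
    "\<And>i k. i \<in> UNIV ==> integrable M (\<lambda>w. (eint (m k) (e k i) (p k) w - (if i then I1 else I2) w)\<^sup>2)"
    "\<And>i. i \<in> UNIV ==> (\<lambda>k. LINT w|M. (eint (m k) (e k i) (p k) w - (if i then I1 else I2) w)\<^sup>2) \<longlonglongrightarrow> 0"
    "AE w in M. \<forall>i\<in>UNIV. (\<lambda>k. eint (m k) (e k i) (p k) w) \<longlonglongrightarrow> (if i then I1 else I2) w"
  show thesis by (rule that[OF J(1) J(2) J(3) J(4)]) (use J(5) in simp_all)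
qed (use w in simp_all)

lemma wiener_measurable:
  assumes "is_wiener_integral M T W h I"
  shows "I \<in> borel_measurable M" "h \<in> borel_measurable (leb T)" "integrable (leb T) (\<lambda>r. (h r)\<^sup>2)"
  using assms by (auto simp: is_wiener_integral_def L2_time_def)

lemma eint_measurable_grid: "strict_grid T m p ==> eint m e p \<in> borel_measurable M"
  by (rule eint_measurable) (auto simp: strict_grid_def)

text \<open>The Ito isometry, inherited from independence of the increments by passing to the limit.\<close>

lemma wiener_L2:
  assumes w: "is_wiener_integral M T W h I"
  shows "integrable M (\<lambda>w. (I w)\<^sup>2)" "(LINT w|M. (I w)\<^sup>2) = (LINT r|leb T. (h r)\<^sup>2)"
proof -
  obtain m p e where J: "\<And>k. strict_grid T (m k) (p k)"
    "(\<lambda>k. LINT r|leb T. (stepf (m k) (e k) (p k) r - h r)\<^sup>2) \<longlonglongrightarrow> 0"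
    "\<And>k. integrable M (\<lambda>w. (eint (m k) (e k) (p k) w - I w)\<^sup>2)"
    "(\<lambda>k. LINT w|M. (eint (m k) (e k) (p k) w - I w)\<^sup>2) \<longlonglongrightarrow> 0"
    by (rule single_approx[OF w]) (rule that)
  note mI = wiener_measurable[OF w] and mE = eint_measurable_grid[OF J(1)] and iE = eint_sq[OF J(1)]
  have "integrable M (\<lambda>w. (eint (m 0) (e 0) (p 0) w - (eint (m 0) (e 0) (p 0) w - I w))\<^sup>2)"
    using mI mE by (intro integrable_diff_sq iE(1) J(3)) auto
  then show i: "integrable M (\<lambda>w. (I w)\<^sup>2)" by simp
  have "(\<lambda>k. LINT w|M. eint (m k) (e k) (p k) w * eint (m k) (e k) (p k) w) \<longlonglongrightarrow> (LINT w|M. I w * I w)"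
    by (intro L2_inner_tendsto mE mI iE i J(4))
  moreover have "(\<lambda>k. LINT r|leb T. stepf (m k) (e k) (p k) r * stepf (m k) (e k) (p k) r)
     \<longlonglongrightarrow> (inner2 T h h)"
    by (intro L2_inner_tendsto mI step_L2 step_measurable_leb J(2))
  moreover have "(LINT w|M. eint (m k) (e k) (p k) w * eint (m k) (e k) (p k) w)
     = (LINT r|leb T. stepf (m k) (e k) (p k) r * stepf (m k) (e k) (p k) r)" for k
    using iE(2)[of k "e k"] by (simp add: step_inner[OF J(1)] power2_eq_square)
  ultimately show "(LINT w|M. (I w)\<^sup>2) = (LINT r|leb T. (h r)\<^sup>2)"
    using LIMSEQ_unique by (simp add: power2_eq_square)
qed

lemma wiener_lincomb:
  assumes w: "is_wiener_integral M T W h1 I1" "is_wiener_integral M T W h2 I2"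
  shows "is_wiener_integral M T W (\<lambda>r. \<alpha> * h1 r + \<beta> * h2 r) (\<lambda>w. \<alpha> * I1 w + \<beta> * I2 w)"
proof -
  let ?h = "\<lambda>b. if b then h1 else h2" and ?I = "\<lambda>b. if b then I1 else I2"
  obtain m p e where J: "\<And>k. strict_grid T (m k) (p k)"
    "\<And>i. (\<lambda>k. LINT r|leb T. (stepf (m k) (e k i) (p k) r - ?h i r)\<^sup>2) \<longlonglongrightarrow> 0"
    "\<And>i k. integrable M (\<lambda>w. (eint (m k) (e k i) (p k) w - ?I i w)\<^sup>2)"
    "\<And>i. (\<lambda>k. LINT w|M. (eint (m k) (e k i) (p k) w - ?I i w)\<^sup>2) \<longlonglongrightarrow> 0"
    by (rule pair_approx[OF w]) (rule that)
  have wi: "is_wiener_integral M T W (?h i) (?I i)" for i using w by simp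
  note mI = wiener_measurable[OF wi] and mE = eint_measurable_grid[OF J(1)] and iE = eint_sq[OF J(1)]
  define f where "f k = (\<lambda>j. \<alpha> * e k True j + \<beta> * e k False j)" for k
  have st: "stepf (m k) (f k) (p k) r = \<alpha> * stepf (m k) (e k True) (p k) r + \<beta> * stepf (m k) (e k False) (p k) r" for k r
    unfolding f_def isum_lincomb[symmetric] ..
  have ei: "eint (m k) (f k) (p k) w = \<alpha> * eint (m k) (e k True) (p k) w + \<beta> * eint (m k) (e k False) (p k) w" for k w
    unfolding eint_def f_def isum_lincomb[symmetric] ..
  have mS: "(\<lambda>r. stepf (m k) (e k i) (p k) r - ?h i r) \<in> borel_measurable (leb T)" for k i
    by (intro borel_measurable_diff step_measurable_leb mI)
  have iS: "integrable (leb T) (\<lambda>r. (stepf (m k) (e k i) (p k) r - ?h i r)\<^sup>2)" for k i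
    by (intro integrable_diff_sq step_measurable_leb mI step_L2)
  have mD: "(\<lambda>w. eint (m k) (e k i) (p k) w - ?I i w) \<in> borel_measurable M" for k i
    by (intro borel_measurable_diff mE mI)
  have S0: "(\<lambda>k. LINT r|leb T. (stepf (m k) (f k) (p k) r - (\<alpha> * h1 r + \<beta> * h2 r))\<^sup>2) \<longlonglongrightarrow> 0"
    using L2_lincomb_tendsto[OF mS[of _ True] mS[of _ False] iS iS J(2) J(2), of \<alpha> \<beta>]
    by (simp add: st algebra_simps)
  have E0: "(\<lambda>k. LINT w|M. (eint (m k) (f k) (p k) w - (\<alpha> * I1 w + \<beta> * I2 w))\<^sup>2) \<longlonglongrightarrow> 0"
    using L2_lincomb_tendsto[OF mD[of _ True] mD[of _ False] J(3) J(3) J(4) J(4), of \<alpha> \<beta>]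
    by (simp add: ei  algebra_simps)
  have Ei: "integrable M (\<lambda>w. (eint (m k) (f k) (p k) w - (\<alpha> * I1 w + \<beta> * I2 w))\<^sup>2)" for k
  proof -
    have "integrable M (\<lambda>w. (\<alpha> * (eint (m k) (e k True) (p k) w - ?I True w) + \<beta> * (eint (m k) (e k False) (p k) w - ?I False w))\<^sup>2)"
      by (rule integrable_add_sq) (use mD[of k True] mD[of k False] J(3)[of k True] J(3)[of k False] in \<open>auto simp: power_mult_distrib\<close>)
    then show ?thesis by (simp add: ei  algebra_simps)
  qed
  have [measurable]: "I1 \<in> borel_measurable M" "I2 \<in> borel_measurable M"
    "h1 \<in> borel_measurable (leb T)" "h2 \<in> borel_measurable (leb T)"
    using mI[of True] mI[of False] by auto
  have "integrable (leb T) (\<lambda>r. (\<alpha> * h1 r + \<beta> * h2 r)\<^sup>2)"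
    by (rule integrable_add_sq) (use mI(3)[of True] mI(3)[of False] in \<open>auto simp: power_mult_distrib\<close>)
  then have "(\<lambda>r. \<alpha> * h1 r + \<beta> * h2 r) \<in> L2_time T" by (simp add: L2_time_def)
  moreover have "(\<lambda>k. L2_norm_time T (\<lambda>r. (\<Sum>j<m k. f k j * indicator {p k j<..p k (Suc j)} r) - (\<alpha> * h1 r + \<beta> * h2 r))) \<longlonglongrightarrow> 0"
  proof -
    have "(\<Sum>j<m k. f k j * indicator {p k j<..p k (Suc j)} r) = stepf (m k) (f k) (p k) r" for k r
      using J(1)[of k] by (intro step_eq_isum) (auto simp: strict_grid_def less_imp_le)
    then show ?thesis unfolding L2_norm_time_def using tendsto_real_sqrt[OF S0] by simp
  qed
  moreover have "tendsto_Lp M 2 (\<lambda>k w. \<Sum>j<m k. f k j * (W (p k (Suc j)) w - W (p k j) w)) (\<lambda>w. \<alpha> * I1 w + \<beta> * I2 w)"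
    using E0 Ei unfolding tendsto_Lp_def abs_powr_two by (simp add: eint_def isum_def)
  moreover have "\<forall>k. (\<forall>i\<le>m k. p k i \<in> {0..T}) \<and> (\<forall>i<m k. p k i \<le> p k (Suc i))"
    using J(1) by (auto simp: strict_grid_def less_imp_le)
  ultimately show ?thesis unfolding is_wiener_integral_def by (intro conjI exI) auto
qed

lemma wiener_increment:
  assumes "u \<in> {0..T}" "v \<in> {0..T}" "u \<le> v"
  shows "is_wiener_integral M T W (indicator {u<..v}) (\<lambda>w. W v w - W u w)"
proof -
  have "indicator {u<..v} \<in> L2_time T"
    unfolding L2_time_def
    by (auto intro!: borel_measurable_leb_on bounded_integrable_leb_on[where B=1] simp: indicator_def)
  moreover have "(\<lambda>w. W v w - W u w) \<in> borel_measurable M" using assms by measurable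
  ultimately show ?thesis
    unfolding is_wiener_integral_def
    using assms
    by (intro conjI exI[of _ "\<lambda>_. 1"] exI[of _ "\<lambda>_ _. 1"] exI[of _ "\<lambda>_ i. if i = 0 then u else v"])
       (auto simp: L2_norm_time_def tendsto_Lp_def)
qed

lemma wiener_even_moment:
  assumes w: "is_wiener_integral M T W h I"
  shows "integrable M (\<lambda>w. (I w) ^ (2 * k))"
proof -
  obtain m p e where J: "\<And>k. strict_grid T (m k) (p k)"
    "(\<lambda>k. LINT r|leb T. (stepf (m k) (e k) (p k) r - h r)\<^sup>2) \<longlonglongrightarrow> 0"
    "AE w in M. (\<lambda>k. eint (m k) (e k) (p k) w) \<longlonglongrightarrow> I w"
    by (rule single_approx[OF w]) (rule that)
  note mI = wiener_measurable[OF w]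
  have l: "(\<lambda>n. \<Sum>j<m n. e n j * e n j * (p n (Suc j) - p n j)) \<longlonglongrightarrow> (inner2 T h h)"
    unfolding step_inner[OF J(1), symmetric] by (intro L2_inner_tendsto mI step_L2 step_measurable_leb J(2))
  have "integrable M (\<lambda>w. (I w) ^ (2 * k)) \<and> (LINT w|M. (I w) ^ (2 * k)) \<le> fact (2 * k) / (2 ^ k * fact k) * (inner2 T h h) ^ k"
  proof (rule Fatou_bounded_integrals)
    show "(\<lambda>w. I w ^ (2 * k)) \<in> borel_measurable M" using mI by measurable
    show "integrable M (\<lambda>w. (eint (m n) (e n) (p n) w) ^ (2 * k))" for n
      using eint_moment[OF J(1)] by (auto simp: has_bochner_integral_iff)
    show "0 \<le> (eint (m n) (e n) (p n) w) ^ (2 * k)" for n w by simp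
    show "AE w in M. (\<lambda>n. (eint (m n) (e n) (p n) w) ^ (2 * k)) \<longlonglongrightarrow> I w ^ (2 * k)"
      using J(3) by eventually_elim (rule tendsto_power)
    have "(LINT w|M. (eint (m n) (e n) (p n) w) ^ (2 * k)) = fact (2 * k) / (2 ^ k * fact k) * (\<Sum>j<m n. e n j * e n j * (p n (Suc j) - p n j)) ^ k" for n
      using eint_moment[OF J(1), of n "e n" k] by (simp add: has_bochner_integral_iff power2_eq_square)
    then show "(\<lambda>n. LINT w|M. (eint (m n) (e n) (p n) w) ^ (2 * k)) \<longlonglongrightarrow> fact (2 * k) / (2 ^ k * fact k) * (inner2 T h h) ^ k"
      by (simp only:) (intro tendsto_intros l)
  qed
  then show ?thesis ..
qed

lemma wiener_powr:
  assumes w: "is_wiener_integral M T W h I" and p: "0 \<le> p"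
  shows "integrable M (\<lambda>w. \<bar>I w\<bar> powr p)"
proof (rule Bochner_Integration.integrable_bound)
  \<comment> \<open>\<open>2 k\<close> is an even exponent not below \<open>p\<close>, and even moments are known to be finite.\<close>
  define k where "k = nat \<lceil>p\<rceil>"
  show "integrable M (\<lambda>w. 1 + (I w) ^ (2 * k))" using wiener_even_moment[OF w] by simp
  show "(\<lambda>w. \<bar>I w\<bar> powr p) \<in> borel_measurable M" using wiener_measurable(1)[OF w] by measurable
  have "\<bar>v\<bar> powr p \<le> 1 + v ^ (2 * k)" for v :: real
  proof (cases "\<bar>v\<bar> \<le> 1")
    case True
    then have "\<bar>v\<bar> powr p \<le> 1" using p by (simp add: powr_le1)
    then show ?thesis by (simp add: add_increasing2)
  next
    case False
    have "p \<le> real k" unfolding k_def by (rule real_nat_ceiling_ge)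
    then have "p \<le> real (2 * k)" by simp
    then have "\<bar>v\<bar> powr p \<le> \<bar>v\<bar> powr real (2 * k)" using False by (intro powr_mono) auto
    also have "\<dots> = \<bar>v\<bar> ^ (2 * k)" using False by (subst powr_realpow) auto
    also have "\<dots> = v ^ (2 * k)" by (simp add: power_even_abs)
    finally show ?thesis by simp
  qed
  then show "AE w in M. norm (\<bar>I w\<bar> powr p) \<le> norm (1 + I w ^ (2 * k))"
    by (intro AE_I2) (simp add: zero_le_even_power add_nonneg_nonneg abs_of_nonneg)
qed

text \<open>For jointly Gaussian variables equality holds; the inequality is what Fatou's lemma delivers, and it
  suffices to bound the variance of a squared increment sum.\<close>

lemma wiener_mixed_moment:
  assumes w: "is_wiener_integral M T W h1 I1" "is_wiener_integral M T W h2 I2"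
  shows "integrable M (\<lambda>w. (I1 w)\<^sup>2 * (I2 w)\<^sup>2)"
    "(LINT w|M. (I1 w)\<^sup>2 * (I2 w)\<^sup>2) \<le> (LINT r|leb T. (h1 r)\<^sup>2) * (LINT r|leb T. (h2 r)\<^sup>2)
       + 2 * (inner2 T h1 h2)\<^sup>2"
proof -
  let ?h = "\<lambda>b. if b then h1 else h2" and ?I = "\<lambda>b. if b then I1 else I2"
  obtain m p e where J: "\<And>k. strict_grid T (m k) (p k)"
    "\<And>i. (\<lambda>k. LINT r|leb T. (stepf (m k) (e k i) (p k) r - ?h i r)\<^sup>2) \<longlonglongrightarrow> 0"
    "AE w in M. \<forall>i. (\<lambda>k. eint (m k) (e k i) (p k) w) \<longlonglongrightarrow> ?I i w"
    by (rule pair_approx[OF w]) (rule that)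
  have wi: "is_wiener_integral M T W (?h i) (?I i)" for i using w by simp
  note mI = wiener_measurable[OF wi]
  have l: "(\<lambda>n. \<Sum>j<m n. e n i j * e n i' j * (p n (Suc j) - p n j)) \<longlonglongrightarrow> (LINT r|leb T. ?h i r * ?h i' r)" for i i'
    unfolding step_inner[OF J(1), symmetric] by (intro L2_inner_tendsto mI step_L2 step_measurable_leb J(2))
  have "integrable M (\<lambda>w. (?I True w)\<^sup>2 * (?I False w)\<^sup>2) \<and> (LINT w|M. (?I True w)\<^sup>2 * (?I False w)\<^sup>2) \<le>
     (LINT r|leb T. ?h True r * ?h True r) * (LINT r|leb T. ?h False r * ?h False r)
       + 2 * (LINT r|leb T. ?h True r * ?h False r)\<^sup>2"
  proof (rule Fatou_bounded_integrals)
    show "(\<lambda>w. (?I True w)\<^sup>2 * (?I False w)\<^sup>2) \<in> borel_measurable M" using mI by measurable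
    show "integrable M (\<lambda>w. (eint (m n) (e n True) (p n) w)\<^sup>2 * (eint (m n) (e n False) (p n) w)\<^sup>2)" for n
      using eint_mixed_moment[OF J(1)] by (auto simp: has_bochner_integral_iff)
    show "0 \<le> (eint (m n) (e n True) (p n) w)\<^sup>2 * (eint (m n) (e n False) (p n) w)\<^sup>2" for n w by simp
    show "AE w in M. (\<lambda>n. (eint (m n) (e n True) (p n) w)\<^sup>2 * (eint (m n) (e n False) (p n) w)\<^sup>2) \<longlonglongrightarrow> (?I True w)\<^sup>2 * (?I False w)\<^sup>2"
      using J(3)
    proof eventually_elim
      fix w assume a: "\<forall>i. (\<lambda>k. eint (m k) (e k i) (p k) w) \<longlonglongrightarrow> ?I i w"
      show "(\<lambda>n. (eint (m n) (e n True) (p n) w)\<^sup>2 * (eint (m n) (e n False) (p n) w)\<^sup>2) \<longlonglongrightarrow> (?I True w)\<^sup>2 * (?I False w)\<^sup>2"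
        by (intro tendsto_mult tendsto_power a[rule_format])
    qed
    show "(\<lambda>n. LINT w|M. (eint (m n) (e n True) (p n) w)\<^sup>2 * (eint (m n) (e n False) (p n) w)\<^sup>2) \<longlonglongrightarrow>
      (LINT r|leb T. ?h True r * ?h True r) * (LINT r|leb T. ?h False r * ?h False r)
       + 2 * (LINT r|leb T. ?h True r * ?h False r)\<^sup>2"
      unfolding has_bochner_integral_integral_eq[OF eint_mixed_moment[OF J(1)]]
      by (intro tendsto_intros l)
  qed
  then show "integrable M (\<lambda>w. (I1 w)\<^sup>2 * (I2 w)\<^sup>2)"
    "(LINT w|M. (I1 w)\<^sup>2 * (I2 w)\<^sup>2) \<le> (LINT r|leb T. (h1 r)\<^sup>2) * (LINT r|leb T. (h2 r)\<^sup>2)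
       + 2 * (inner2 T h1 h2)\<^sup>2"
    by (simp_all add:   power2_eq_square)
qed

end


section \<open>The bracket functional\<close>

lemma dyadic_mono: "0 < T ==> i \<le> j ==> dyadic T n i \<le> dyadic T n j"
  by (simp add: dyadic_def divide_right_mono mult_right_mono)

lemma dyadic_less_iff: "0 < T ==> dyadic T n i < dyadic T n j \<longleftrightarrow> i < j"
  by (simp add: dyadic_def divide_less_cancel)

lemma dyadic_le_iff: "0 < T ==> dyadic T n i \<le> dyadic T n j \<longleftrightarrow> i \<le> j"
  by (simp add: dyadic_def divide_le_cancel)

lemma dyadic_nonneg: "0 < T ==> 0 \<le> dyadic T n i"
  by (simp add: dyadic_def)

lemma dyadic_zero [simp]: "dyadic T n 0 = 0" by (simp add: dyadic_def)

lemma dyadic_end [simp]: "dyadic T n (2 ^ n) = T" by (simp add: dyadic_def)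

lemma dyadic_Suc: "dyadic T n (Suc i) = dyadic T n i + T / 2 ^ n"
  by (simp add: dyadic_def field_simps)

lemma dyadic_refine: "m \<le> n ==> dyadic T m j = dyadic T n (j * 2 ^ (n - m))"
  by (simp add: dyadic_def field_simps power_add[symmetric])

lemma dyadic_cell:
  assumes "0 < T" "0 \<le> u"
  obtains j where "dyadic T n j \<le> u" "u < dyadic T n (Suc j)"
proof -
  define j where "j = nat \<lfloor>u * 2 ^ n / T\<rfloor>"
  have "real j \<le> u * 2 ^ n / T" "u * 2 ^ n / T < real (Suc j)"
    using assms by (auto simp: j_def) linarith+
  then show ?thesis using assms by (intro that[of j]) (auto simp: dyadic_def field_simps)
qed

lemma finite_dyadic: "0 < T ==> finite {k. dyadic T n (Suc k) \<le> t}"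
proof -
  assume T: "0 < T"
  show ?thesis
  proof (cases "0 \<le> t")
    case True
    obtain j where j: "t < dyadic T n (Suc j)" using dyadic_cell[OF T True] by metis
    have "{k. dyadic T n (Suc k) \<le> t} \<subseteq> {..<Suc j}"
    proof
      fix k assume "k \<in> {k. dyadic T n (Suc k) \<le> t}"
      then have "dyadic T n (Suc k) < dyadic T n (Suc j)" using j by simp
      then show "k \<in> {..<Suc j}" using T by (simp add: dyadic_less_iff)
    qed
    then show ?thesis by (rule finite_subset) simp
  next
    case False
    then have "{k. dyadic T n (Suc k) \<le> t} = {}"
      using dyadic_nonneg[OF T, of n] by (auto simp: not_le) (meson dual_order.strict_trans1 not_le)
    then show ?thesis by simp
  qed
qed

lemma dyadic_variation_mono:
  "0 < T ==> t \<le> t' ==> dyadic_variation T n x t \<le> dyadic_variation T n x t'"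
  unfolding dyadic_variation_def by (rule sum_mono2) (auto simp: finite_dyadic)

lemma dyadic_variation_nonneg: "0 \<le> dyadic_variation T n x t"
  unfolding dyadic_variation_def by (rule sum_nonneg) simp

lemma dyadic_variation_zero: "0 < T ==> dyadic_variation T n x 0 = 0"
proof -
  assume T: "0 < T"
  have "\<not> dyadic T n (Suc k) \<le> 0" for k using T by (simp add: dyadic_def not_le)
  then show ?thesis by (simp add: dyadic_variation_def)
qed

lemma dyadic_variation_dyadic:
  assumes T: "0 < T"
  shows "dyadic_variation T n x (dyadic T n N) = (\<Sum>k<N. (x (dyadic T n (Suc k)) - x (dyadic T n k))\<^sup>2)"
  unfolding dyadic_variation_def using T by (intro sum.cong) (auto simp: dyadic_le_iff)

text \<open>The bracket is the upper limit of these functions.\<close>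

definition regvar :: "real => real => nat => (real => real) => real => real" where
  "regvar T \<Lambda> n x t = lip_regularize \<Lambda> (dyadic_variation T n x) t"

context
  fixes T \<Lambda> :: real and n :: nat and x :: "real => real"
  assumes T: "0 < T" and L: "0 < \<Lambda>"
begin

lemma regvar_le: "0 \<le> u ==> u \<le> t ==> regvar T \<Lambda> n x t \<le> dyadic_variation T n x u + \<Lambda> * (t - u)"
  unfolding regvar_def lip_regularize_def using L dyadic_variation_nonneg by (intro cINF_lower bdd_belowI2[where m=0]) auto

lemma regvar_ge:
  "0 \<le> t ==> (\<And>u. 0 \<le> u ==> u \<le> t ==> c \<le> dyadic_variation T n x u + \<Lambda> * (t - u)) ==> c \<le> regvar T \<Lambda> n x t"
  unfolding regvar_def lip_regularize_def by (intro cINF_greatest) auto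

lemma regvar_bounds:
  assumes "0 \<le> t" shows "0 \<le> regvar T \<Lambda> n x t" "regvar T \<Lambda> n x t \<le> \<Lambda> * t"
  using regvar_le[of 0 t] assms dyadic_variation_zero[OF T] L dyadic_variation_nonneg by (auto intro!: regvar_ge)

lemma regvar_mono:
  assumes st: "0 \<le> s" "s \<le> t"
  shows "regvar T \<Lambda> n x s \<le> regvar T \<Lambda> n x t"
proof (rule regvar_ge)
  fix u assume u: "0 \<le> u" "u \<le> t"
  show "regvar T \<Lambda> n x s \<le> dyadic_variation T n x u + \<Lambda> * (t - u)"
  proof (cases "u \<le> s")
    case True
    have "\<Lambda> * (s - u) \<le> \<Lambda> * (t - u)" using L st by simp
    with regvar_le[OF u(1) True] show ?thesis by linarith
  next
    case False
    have "regvar T \<Lambda> n x s \<le> dyadic_variation T n x s" using regvar_le[of s s] st by simp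
    also have "dyadic_variation T n x s \<le> dyadic_variation T n x u" using False by (intro dyadic_variation_mono[OF T]) simp
    finally show ?thesis using L u by (simp add: add_increasing2)
  qed
qed (use st in simp)

lemma regvar_lip:
  assumes st: "0 \<le> s" "s \<le> t"
  shows "regvar T \<Lambda> n x t \<le> regvar T \<Lambda> n x s + \<Lambda> * (t - s)"
proof -
  have "regvar T \<Lambda> n x t - \<Lambda> * (t - s) \<le> regvar T \<Lambda> n x s"
  proof (rule regvar_ge)
    fix u assume u: "0 \<le> u" "u \<le> s"
    then have "regvar T \<Lambda> n x t \<le> dyadic_variation T n x u + \<Lambda> * (t - u)" using st by (intro regvar_le) auto
    then show "regvar T \<Lambda> n x t - \<Lambda> * (t - s) \<le> dyadic_variation T n x u + \<Lambda> * (s - u)" by (simp add: algebra_simps)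
  qed (use st in simp)
  then show ?thesis by simp
qed

end

lemma bracket_limsup:
  assumes T: "0 < T" and L: "0 < \<Lambda>" and t: "0 \<le> t"
  shows "ereal (bracket T \<Lambda> x t) = limsup (\<lambda>n. ereal (regvar T \<Lambda> n x t))"
proof -
  note b = regvar_bounds[OF T L t]
  have "limsup (\<lambda>n. ereal (regvar T \<Lambda> n x t)) \<le> ereal (\<Lambda> * t)"
    by (rule Limsup_bounded) (use b in auto)
  moreover have "ereal 0 \<le> limsup (\<lambda>n. ereal (regvar T \<Lambda> n x t))"
    by (rule le_Limsup) (use b in auto)
  ultimately show ?thesis
    unfolding bracket_def regvar_def[symmetric] by (intro ereal_real') auto
qed

text \<open>For every path the bracket is increasing and \<open>\<Lambda>\<close>-Lipschitz, because both properties hold for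
  the regularised dyadic variations and survive the upper limit.\<close>

lemma bracket_in_bracket_paths:
  assumes T: "0 < T" and L: "0 < \<Lambda>"
  shows "bracket T \<Lambda> x \<in> bracket_paths T \<Lambda>"
proof -
  have mono: "bracket T \<Lambda> x s \<le> bracket T \<Lambda> x t" if "0 \<le> s" "s \<le> t" for s t
  proof -
    have "limsup (\<lambda>n. ereal (regvar T \<Lambda> n x s)) \<le> limsup (\<lambda>n. ereal (regvar T \<Lambda> n x t))"
      by (rule Limsup_mono) (simp add: regvar_mono[OF T L that])
    then have "ereal (bracket T \<Lambda> x s) \<le> ereal (bracket T \<Lambda> x t)"
      using that by (simp add: bracket_limsup[OF T L])
    then show ?thesis by simp
  qed
  have lip: "bracket T \<Lambda> x t \<le> bracket T \<Lambda> x s + \<Lambda> * (t - s)" if "0 \<le> s" "s \<le> t" for s t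
  proof -
    have "limsup (\<lambda>n. ereal (regvar T \<Lambda> n x t)) \<le> limsup (\<lambda>n. ereal (regvar T \<Lambda> n x s) + ereal (\<Lambda> * (t - s)))"
      by (rule Limsup_mono) (simp add: regvar_lip[OF T L that])
    also have "\<dots> = limsup (\<lambda>n. ereal (regvar T \<Lambda> n x s)) + ereal (\<Lambda> * (t - s))"
      by (rule Limsup_add_ereal_right) auto
    finally have "ereal (bracket T \<Lambda> x t) \<le> ereal (bracket T \<Lambda> x s) + ereal (\<Lambda> * (t - s))"
      using that by (simp add: bracket_limsup[OF T L])
    then show ?thesis by simp
  qed
  have z: "bracket T \<Lambda> x 0 = 0"
  proof -
    have "regvar T \<Lambda> n x 0 = 0" for n
      using regvar_bounds[OF T L order_refl, of n x] by simp
    then have "ereal (bracket T \<Lambda> x 0) = ereal 0" unfolding bracket_limsup[OF T L order_refl] by (simp add: Limsup_const)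
    then show ?thesis by simp
  qed
  have "\<Lambda>-lipschitz_on {0..T} (bracket T \<Lambda> x)"
  proof (rule lipschitz_onI)
    fix s t assume "s \<in> {0..T}" "t \<in> {0..T}"
    then show "dist (bracket T \<Lambda> x s) (bracket T \<Lambda> x t) \<le> \<Lambda> * dist s t"
      using mono[of s t] mono[of t s] lip[of s t] lip[of t s] by (cases "s \<le> t") (auto simp: dist_real_def)
  qed (use L in simp)
  then have "continuous_on {0..T} (bracket T \<Lambda> x)" by (rule lipschitz_on_continuous_on)
  with z show ?thesis
    using mono lip by (auto simp: bracket_paths_def) (smt (verit) mono lip)
qed

text \<open>The infimum in the regularisation may be taken over rational times, the dyadic variation
  being a right-continuous step function; this gives measurability in the path.\<close>

lemma regvar_rational:
  assumes T: "0 < T" and L: "0 < \<Lambda>" and t: "0 \<le> t"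
  shows "regvar T \<Lambda> n x t = (INF u\<in>({0..t} \<inter> \<rat>) \<union> {t}. dyadic_variation T n x u + \<Lambda> * (t - u))"
proof -
  let ?D = "({0..t} \<inter> \<rat>) \<union> {t}" and ?f = "\<lambda>u. dyadic_variation T n x u + \<Lambda> * (t - u)"
  have bd: "bdd_below (?f ` ?D)" using L t by (intro bdd_belowI2[where m=0]) (auto simp: dyadic_variation_nonneg)
  have "Inf (?f ` ?D) \<le> ?f u" if u: "0 \<le> u" "u \<le> t" for u
  proof (cases "u = t")
    case True then show ?thesis using bd by (intro cINF_lower) auto
  next
    case False
    obtain j where j: "dyadic T n j \<le> u" "u < dyadic T n (Suc j)" using dyadic_cell[OF T u(1)] by metis
    have "u < min t (dyadic T n (Suc j))" using j u False by simp
    then obtain r where r: "r \<in> \<rat>" "u < r" "r < min t (dyadic T n (Suc j))" using Rats_dense_in_real by blast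
    have "dyadic T n (Suc k) \<le> r \<longleftrightarrow> dyadic T n (Suc k) \<le> u" for k
    proof
      assume "dyadic T n (Suc k) \<le> r"
      then have "dyadic T n (Suc k) < dyadic T n (Suc j)" using r by simp
      then have "Suc k \<le> j" using T by (simp add: dyadic_less_iff)
      then show "dyadic T n (Suc k) \<le> u" using j(1) dyadic_mono[OF T, of "Suc k" j n] by simp
    qed (use r in simp)
    then have "dyadic_variation T n x r = dyadic_variation T n x u" by (simp add: dyadic_variation_def)
    moreover have "Inf (?f ` ?D) \<le> ?f r" using r u bd by (intro cINF_lower) auto
    moreover have "\<Lambda> * (t - r) \<le> \<Lambda> * (t - u)" using r L by simp
    ultimately show ?thesis by linarith
  qed
  then have "Inf (?f ` ?D) \<le> regvar T \<Lambda> n x t"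
    unfolding regvar_def lip_regularize_def using t by (intro cINF_greatest) auto
  moreover have "regvar T \<Lambda> n x t \<le> Inf (?f ` ?D)"
    by (intro cINF_greatest regvar_le[OF T L]) (use t in auto)
  ultimately show ?thesis by simp
qed

lemma bracket_measurable:
  assumes T: "0 < T" and L: "0 < \<Lambda>" and t: "t \<in> {0..T}"
    and X: "\<And>u. u \<in> {0..T} ==> (\<lambda>w. X w u) \<in> borel_measurable M"
  shows "(\<lambda>w. bracket T \<Lambda> (X w) t) \<in> borel_measurable M"
proof -
  have dv: "(\<lambda>w. dyadic_variation T n (X w) u) \<in> borel_measurable M" if "u \<in> {0..T}" for n u
    unfolding dyadic_variation_def
  proof (intro borel_measurable_sum borel_measurable_power borel_measurable_diff X)
    fix k assume "k \<in> {k. dyadic T n (Suc k) \<le> u}"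
    then show "dyadic T n (Suc k) \<in> {0..T}" "dyadic T n k \<in> {0..T}"
      using that dyadic_nonneg[OF T] dyadic_mono[OF T, of k "Suc k" n] by auto
  qed
  have t0: "0 \<le> t" using t by simp
  have "(\<lambda>w. regvar T \<Lambda> n (X w) t) \<in> borel_measurable M" for n
    unfolding regvar_rational[OF T L t0]
    by (intro borel_measurable_cINF_real borel_measurable_add dv) (use t in \<open>auto intro: countable_rat\<close>)
  then show ?thesis unfolding bracket_def regvar_def[symmetric] by measurable
qed

text \<open>Convergence at dyadic times is already uniform, since the dyadic variations increase and the
  limit is continuous; and regularising a \<open>\<Lambda>\<close>-Lipschitz limit does nothing.\<close>

lemma bracket_eq_limit:
  assumes T: "0 < T" and L: "0 < \<Lambda>" and A: "A \<in> bracket_paths T \<Lambda>"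
    and conv: "\<And>m j. j \<le> 2 ^ m ==> (\<lambda>n. dyadic_variation T n x (dyadic T m j)) \<longlonglongrightarrow> A (dyadic T m j)"
    and t: "t \<in> {0..T}"
  shows "bracket T \<Lambda> x t = A t"
proof -
  have AL: "A s \<le> A u" "A u \<le> A s + \<Lambda> * (u - s)" if "0 \<le> s" "s \<le> u" "u \<le> T" for s u
    using A that by (auto simp: bracket_paths_def) (smt (verit))+
  have key: "eventually (\<lambda>n. \<forall>u\<in>{0..T}. \<bar>dyadic_variation T n x u - A u\<bar> \<le> \<epsilon>) sequentially" if e: "0 < \<epsilon>" for \<epsilon>
  proof -
    have "(\<lambda>m. \<Lambda> * T * (1 / 2) ^ m) \<longlonglongrightarrow> \<Lambda> * T * 0" by (intro tendsto_intros LIMSEQ_power_zero) simp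
    then have "eventually (\<lambda>m. \<Lambda> * T * (1 / 2) ^ m < \<epsilon> / 2) sequentially"
      using e by (intro order_tendstoD(2)) auto
    then obtain m where m: "\<Lambda> * T * (1 / 2) ^ m < \<epsilon> / 2" by (auto simp: eventually_sequentially)
    then have m: "\<Lambda> * (T / 2 ^ m) < \<epsilon> / 2" by (simp add: power_divide)
    have "eventually (\<lambda>n. \<forall>j\<in>{..2 ^ m}. \<bar>dyadic_variation T n x (dyadic T m j) - A (dyadic T m j)\<bar> < \<epsilon> / 2) sequentially"
    proof (intro eventually_ball_finite ballI)
      fix j :: nat assume "j \<in> {..2 ^ m}"
      then have "(\<lambda>n. \<bar>dyadic_variation T n x (dyadic T m j) - A (dyadic T m j)\<bar>) \<longlonglongrightarrow> 0"
        using conv[of j m] by (simp add: LIM_zero tendsto_rabs_zero)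
      then show "eventually (\<lambda>n. \<bar>dyadic_variation T n x (dyadic T m j) - A (dyadic T m j)\<bar> < \<epsilon> / 2) sequentially"
        using e by (intro order_tendstoD(2)) auto
    qed simp
    then show ?thesis
    proof eventually_elim
      fix n assume n: "\<forall>j\<in>{..2 ^ m}. \<bar>dyadic_variation T n x (dyadic T m j) - A (dyadic T m j)\<bar> < \<epsilon> / 2"
      show "\<forall>u\<in>{0..T}. \<bar>dyadic_variation T n x u - A u\<bar> \<le> \<epsilon>"
      proof
        fix u assume u: "u \<in> {0..T}"
        show "\<bar>dyadic_variation T n x u - A u\<bar> \<le> \<epsilon>"
        proof (cases "u = T")
          case True
          then show ?thesis using n[rule_format, of "2 ^ m"] e by simp
        next
          case False
          obtain j where j: "dyadic T m j \<le> u" "u < dyadic T m (Suc j)" using dyadic_cell[OF T, of u] u by auto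
          have "dyadic T m j < dyadic T m (2 ^ m)" using j u False by simp
          then have j2: "j < 2 ^ m" using T by (simp only: dyadic_less_iff)
          have dT: "dyadic T m (Suc j) \<le> T" using dyadic_mono[OF T, of "Suc j" "2 ^ m" m] j2 by simp
          have d0: "0 \<le> dyadic T m j" by (rule dyadic_nonneg[OF T])
          have "dyadic_variation T n x (dyadic T m j) \<le> dyadic_variation T n x u"
            "dyadic_variation T n x u \<le> dyadic_variation T n x (dyadic T m (Suc j))"
            using j by (auto intro!: dyadic_variation_mono T)
          moreover have "A u \<le> A (dyadic T m j) + \<Lambda> * (u - dyadic T m j)"
            "A (dyadic T m (Suc j)) \<le> A u + \<Lambda> * (dyadic T m (Suc j) - u)"
            using j u d0 dT by (auto intro!: AL)
          moreover have "\<Lambda> * (u - dyadic T m j) \<le> \<Lambda> * (T / 2 ^ m)" "\<Lambda> * (dyadic T m (Suc j) - u) \<le> \<Lambda> * (T / 2 ^ m)"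
            using j L by (auto simp: dyadic_Suc intro!: mult_left_mono simp del: times_divide_eq_right)
          moreover have "\<bar>dyadic_variation T n x (dyadic T m j) - A (dyadic T m j)\<bar> < \<epsilon> / 2"
            "\<bar>dyadic_variation T n x (dyadic T m (Suc j)) - A (dyadic T m (Suc j))\<bar> < \<epsilon> / 2"
            using n j2 by auto
          ultimately show ?thesis using m by linarith
        qed
      qed
    qed
  qed
  have "(\<lambda>n. regvar T \<Lambda> n x t) \<longlonglongrightarrow> A t"
  proof (rule tendstoI)
    fix \<epsilon> :: real assume e: "0 < \<epsilon>"
    from key[of "\<epsilon> / 2"] e have "eventually (\<lambda>n. \<forall>u\<in>{0..T}. \<bar>dyadic_variation T n x u - A u\<bar> \<le> \<epsilon> / 2) sequentially" by simp
    then show "eventually (\<lambda>n. dist (regvar T \<Lambda> n x t) (A t) < \<epsilon>) sequentially"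
    proof eventually_elim
      fix n assume n: "\<forall>u\<in>{0..T}. \<bar>dyadic_variation T n x u - A u\<bar> \<le> \<epsilon> / 2"
      have up: "regvar T \<Lambda> n x t \<le> dyadic_variation T n x t"
        using regvar_le[OF T L, of t t n x] t by simp
      have lo: "A t - \<epsilon> / 2 \<le> regvar T \<Lambda> n x t"
      proof (rule regvar_ge[OF T L])
        fix u assume u: "0 \<le> u" "u \<le> t"
        then have "A t \<le> A u + \<Lambda> * (t - u)" using t by (intro AL) auto
        moreover have "\<bar>dyadic_variation T n x u - A u\<bar> \<le> \<epsilon> / 2" using n u t by auto
        ultimately show "A t - \<epsilon> / 2 \<le> dyadic_variation T n x u + \<Lambda> * (t - u)" by linarith
      qed (use t in simp)
      show "dist (regvar T \<Lambda> n x t) (A t) < \<epsilon>"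
      proof -
        have "\<bar>dyadic_variation T n x t - A t\<bar> \<le> \<epsilon> / 2" using n t by auto
        with up lo e show ?thesis unfolding dist_real_def by linarith
      qed
    qed
  qed
  then have "(\<lambda>n. ereal (regvar T \<Lambda> n x t)) \<longlonglongrightarrow> ereal (A t)" by simp
  then have "limsup (\<lambda>n. ereal (regvar T \<Lambda> n x t)) = ereal (A t)" by (intro lim_imp_Limsup) simp
  then show ?thesis using bracket_limsup[OF T L, of t x] t by simp
qed


section \<open>The bracket of a Wiener integral process\<close>

lemma AE_tendsto_zero_of_summable:
  fixes g :: "nat => 'a => real"
  assumes i: "\<And>n. integrable N (g n)" and nn: "\<And>n x. 0 \<le> g n x" and s: "summable (\<lambda>n. LINT x|N. g n x)"
  shows "AE x in N. (\<lambda>n. g n x) \<longlonglongrightarrow> 0"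
proof -
  have [measurable]: "g n \<in> borel_measurable N" for n using i by auto
  have "(\<integral>\<^sup>+x. (\<Sum>n. ennreal (g n x)) \<partial>N) = (\<Sum>n. \<integral>\<^sup>+x. ennreal (g n x) \<partial>N)"
    by (rule nn_integral_suminf) auto
  also have "\<dots> = (\<Sum>n. ennreal (LINT x|N. g n x))"
    using i nn by (intro suminf_cong nn_integral_eq_integral) auto
  also have "\<dots> = ennreal (\<Sum>n. LINT x|N. g n x)"
    using s nn by (intro suminf_ennreal2) auto
  finally have "(\<integral>\<^sup>+x. (\<Sum>n. ennreal (g n x)) \<partial>N) \<noteq> \<infinity>" by simp
  then have "AE x in N. (\<Sum>n. ennreal (g n x)) \<noteq> \<infinity>" by (intro nn_integral_PInf_AE) auto
  then show ?thesis
  proof eventually_elim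
    fix x assume "(\<Sum>n. ennreal (g n x)) \<noteq> \<infinity>"
    then have "summable (\<lambda>n. g n x)" using nn by (intro summable_suminf_not_top) auto
    then show "(\<lambda>n. g n x) \<longlonglongrightarrow> 0" by (rule summable_LIMSEQ_zero)
  qed
qed

locale wiener_process = brownian M T W for M :: "'w measure" and T W +
  fixes \<Lambda> :: real and a :: "real => real" and X :: "'w => real => real"
  assumes Lam_pos: "0 < \<Lambda>"
    and a_meas: "a \<in> borel_measurable (leb T)"
    and a_bounds: "\<And>r. r \<in> {0..T} ==> a r \<in> {0..\<Lambda>}"
    and X_path: "\<And>w. w \<in> space M ==> X w \<in> path_space T"
    and X_wiener: "\<And>u. u \<in> {0..T} ==>
           is_wiener_integral M T W (\<lambda>r. indicator {0..u} r * sqrt (a r)) (\<lambda>w. X w u)"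
begin

definition clock :: "real => real" where
  "clock t = (LINT r|leb T. indicator {0..t} r * a r)"

lemma indicator_a_integrable: "integrable (leb T) (\<lambda>r. indicator {u..t} r * a r)"
proof (rule bounded_integrable_leb_on)
  show "(\<lambda>r. indicator {u..t} r * a r) \<in> borel_measurable (leb T)"
    by (intro borel_measurable_times a_meas borel_measurable_leb_on) simp
  show "\<bar>indicator {u..t} r * a r\<bar> \<le> \<Lambda>" if "r \<in> {0..T}" for r
    using a_bounds[OF that] Lam_pos by (auto simp: indicator_def)
qed

lemma clock_diff:
  assumes "0 \<le> s" "s \<le> t" "t \<le> T"
  shows "clock t - clock s = (LINT r|leb T. (indicator {0..t} r - indicator {0..s} r) * a r)"
  unfolding clock_def by (subst Bochner_Integration.integral_diff[symmetric, OF indicator_a_integrable indicator_a_integrable])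
    (simp add: left_diff_distrib)

lemma clock_bounds:
  assumes st: "0 \<le> s" "s \<le> t" "t \<le> T"
  shows "0 \<le> clock t - clock s" "clock t - clock s \<le> \<Lambda> * (t - s)"
proof -
  have ind: "indicator {0..t} r - indicator {0..s} r = (indicator {s<..t} r :: real)" if "r \<in> {0..T}" for r :: real
    using that st by (auto simp: indicator_def)
  have e: "clock t - clock s = (LINT r|leb T. indicator {s<..t} r * a r)"
    unfolding clock_diff[OF st] by (rule Bochner_Integration.integral_cong) (auto simp: ind space_restrict_space)
  have i: "integrable (leb T) (\<lambda>r. indicator {s<..t} r * a r)"
  proof (rule bounded_integrable_leb_on)
    show "(\<lambda>r. indicator {s<..t} r * a r) \<in> borel_measurable (leb T)"
      by (intro borel_measurable_times a_meas borel_measurable_leb_on) simp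
    show "\<bar>indicator {s<..t} r * a r\<bar> \<le> \<Lambda>" if "r \<in> {0..T}" for r
      using a_bounds[OF that] Lam_pos by (auto simp: indicator_def)
  qed
  show "0 \<le> clock t - clock s"
    unfolding e by (rule Bochner_Integration.integral_nonneg_AE) (use a_bounds in \<open>auto simp: space_restrict_space\<close>)
  have i2: "integrable (leb T) (\<lambda>r. indicator {s<..t} r * \<Lambda>)"
    by (rule bounded_integrable_leb_on[where B = \<Lambda>], intro borel_measurable_leb_on) (use Lam_pos in \<open>auto simp: indicator_def\<close>)
  have "clock t - clock s \<le> (LINT r|leb T. indicator {s<..t} r * \<Lambda>)"
    unfolding e by (rule integral_mono[OF i i2]) (use a_bounds in \<open>auto simp: space_restrict_space indicator_def\<close>)
  also have "\<dots> = (LINT r|leb T. indicator {s<..t} r) * \<Lambda>"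
    by (rule Bochner_Integration.integral_mult_left_zero)
  also have "\<dots> = \<Lambda> * (t - s)" using st by (subst LINT_indicator_cell) auto
  finally show "clock t - clock s \<le> \<Lambda> * (t - s)" .
qed

lemma clock_zero: "clock 0 = 0"
proof -
  have "clock 0 = (LINT r|leb T. 0)"
    unfolding clock_def
  proof (rule integral_cong_AE)
    have "AE r in leb T. r \<noteq> 0"
    proof (rule AE_I')
      have "{0::real} \<in> null_sets lebesgue" by simp
      then show "{0} \<in> null_sets (leb T)"
        using T_pos by (subst null_sets_restrict_space) auto
    qed (auto simp: space_restrict_space)
    then show "AE r in leb T. indicator {0..0} r * a r = 0"
      by eventually_elim (simp add: indicator_def)
  qed (use indicator_a_integrable[of 0 0, THEN borel_measurable_integrable] in simp_all)
  then show ?thesis by simp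
qed

lemma clock_in_bracket_paths: "clock \<in> bracket_paths T \<Lambda>"
proof -
  have "\<Lambda>-lipschitz_on {0..T} clock"
  proof (rule lipschitz_onI)
    fix s t assume "s \<in> {0..T}" "t \<in> {0..T}"
    then show "dist (clock s) (clock t) \<le> \<Lambda> * dist s t"
      using clock_bounds[of s t] clock_bounds[of t s] by (cases "s \<le> t") (auto simp: dist_real_def)
  qed (use Lam_pos in simp)
  then have "continuous_on {0..T} clock" by (rule lipschitz_on_continuous_on)
  then show ?thesis using clock_bounds clock_zero by (auto simp: bracket_paths_def)
qed

lemma X_measurable: "u \<in> {0..T} ==> (\<lambda>w. X w u) \<in> borel_measurable M"
  using wiener_measurable(1)[OF X_wiener] .

lemma X_increment:
  assumes "0 \<le> u" "u \<le> v" "v \<le> T"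
  shows "is_wiener_integral M T W (\<lambda>r. 1 * (indicator {0..v} r * sqrt (a r)) + (-1) * (indicator {0..u} r * sqrt (a r))) (\<lambda>w. 1 * X w v + (-1) * X w u)"
  using assms by (intro wiener_lincomb X_wiener) auto

text \<open>The squared increments over disjoint cells are uncorrelated and each has variance at most
  twice its squared mean, so the dyadic variation concentrates at its mean.\<close>

lemma dyadic_variation_L2:
  assumes N: "N \<le> 2 ^ n"
  defines "V \<equiv> \<lambda>w. dyadic_variation T n (X w) (dyadic T n N) - clock (dyadic T n N)"
  shows "integrable M (\<lambda>w. (V w)\<^sup>2)" "(LINT w|M. (V w)\<^sup>2) \<le> 2 * (\<Lambda> * T)\<^sup>2 * (1 / 2) ^ n"
proof -
  define d where "d k = dyadic T n k" for k
  have d: "0 \<le> d k" "d k \<le> d (Suc k)" for k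
    using dyadic_nonneg[OF T_pos] dyadic_mono[OF T_pos, of k "Suc k" n] by (auto simp: d_def)
  have dT: "d (Suc k) \<le> T" if "k < N" for k
    using dyadic_mono[OF T_pos, of "Suc k" "2 ^ n" n] that N by (simp add: d_def)
  define J where "J k w = 1 * X w (d (Suc k)) + (-1) * X w (d k)" for k w
  define h where "h k r = 1 * (indicator {0..d (Suc k)} r * sqrt (a r)) + (-1) * (indicator {0..d k} r * sqrt (a r))" for k r
  define al where "al k = clock (d (Suc k)) - clock (d k)" for k
  have w: "is_wiener_integral M T W (h k) (J k)" if "k < N" for k
    unfolding h_def[abs_def] J_def[abs_def] using d dT[OF that] by (intro X_increment) auto
  have hh: "(LINT r|leb T. (h k r)\<^sup>2) = al k" if "k < N" for k
    unfolding al_def clock_diff[OF d dT[OF that]]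
    by (rule Bochner_Integration.integral_cong)
       (use a_bounds d(2)[of k] in \<open>auto simp: h_def indicator_def space_restrict_space\<close>)
  have hl: "(inner2 T (h k) (h l)) = 0" if "k < l" for k l
  proof -
    have "d (Suc k) \<le> d l" using that dyadic_mono[OF T_pos, of "Suc k" l n] by (simp add: d_def)
    then have "h k r * h l r = 0" for r
      using d(2)[of k] d(2)[of l] by (auto simp: h_def indicator_def)
    then show ?thesis by (simp only: Bochner_Integration.integral_zero)
  qed
  have hl': "(inner2 T (h k) (h l)) = 0" if "k \<noteq> l" for k l
    using hl[of k l] hl[of l k] that by (cases "k < l") (auto simp: mult.commute)
  define Y where "Y k w = (J k w)\<^sup>2 - al k" for k w
  have J2: "integrable M (\<lambda>w. (J k w)\<^sup>2)" "(LINT w|M. (J k w)\<^sup>2) = al k" if "k < N" for k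
    using wiener_L2[OF w[OF that]] hh[OF that] by auto
  have Yeq: "Y k w * Y l w = (J k w)\<^sup>2 * (J l w)\<^sup>2 - al l * (J k w)\<^sup>2 - al k * (J l w)\<^sup>2 + al k * al l" for k l w
    by (simp add: Y_def algebra_simps)
  have Yi: "integrable M (\<lambda>w. Y k w * Y l w)" if "k < N" "l < N" for k l
    unfolding Yeq using J2(1)[OF that(1)] J2(1)[OF that(2)] wiener_mixed_moment(1)[OF w[OF that(1)] w[OF that(2)]] by auto
  have YE: "(LINT w|M. Y k w * Y l w) \<le> (if k = l then 2 * (al k)\<^sup>2 else 0)" if kl: "k < N" "l < N" for k l
  proof -
    note m = wiener_mixed_moment[OF w[OF kl(1)] w[OF kl(2)]]
    have "(LINT w|M. Y k w * Y l w) = (LINT w|M. (J k w)\<^sup>2 * (J l w)\<^sup>2) - al k * al l"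
      unfolding Yeq using J2[OF kl(1)] J2[OF kl(2)] m(1) by (simp add: prob_space)
    also have "\<dots> \<le> 2 * (inner2 T (h k) (h l))\<^sup>2"
      using m(2) hh[OF kl(1)] hh[OF kl(2)] by simp
    also have "\<dots> = (if k = l then 2 * (al k)\<^sup>2 else 0)"
      using hl'[of k l] hh[OF kl(1)] by (auto simp: power2_eq_square)
    finally show ?thesis .
  qed
  have clock_sum: "clock (d N) = (\<Sum>k<N. al k)"
    unfolding al_def by (subst sum_lessThan_telescope) (simp add: d_def clock_zero)
  have V: "V w = (\<Sum>k<N. Y k w)" for w
    using clock_sum unfolding V_def dyadic_variation_dyadic[OF T_pos] Y_def J_def d_def
    by (simp add: sum_subtractf)
  have V2: "(V w)\<^sup>2 = (\<Sum>k<N. \<Sum>l<N. Y k w * Y l w)" for w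
    by (simp add: V power2_eq_square sum_product)
  show "integrable M (\<lambda>w. (V w)\<^sup>2)" unfolding V2 by (intro Bochner_Integration.integrable_sum Yi) auto
  have "(LINT w|M. (V w)\<^sup>2) = (\<Sum>k<N. \<Sum>l<N. LINT w|M. Y k w * Y l w)"
    unfolding V2 by (subst Bochner_Integration.integral_sum, intro Bochner_Integration.integrable_sum Yi, simp, simp,
      intro sum.cong refl Bochner_Integration.integral_sum Yi) auto
  also have "\<dots> \<le> (\<Sum>k<N. \<Sum>l<N. if k = l then 2 * (al k)\<^sup>2 else 0)"
    by (intro sum_mono YE) auto
  also have "\<dots> = (\<Sum>k<N. 2 * (al k)\<^sup>2)" by simp
  also have "\<dots> \<le> (\<Sum>k<N. 2 * (\<Lambda> * T / 2 ^ n)\<^sup>2)"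
  proof (intro sum_mono)
    fix k assume "k \<in> {..<N}"
    then have "0 \<le> al k" "al k \<le> \<Lambda> * T / 2 ^ n"
      using clock_bounds[OF d, of k] dT[of k] by (auto simp: al_def d_def dyadic_Suc)
    then show "2 * (al k)\<^sup>2 \<le> 2 * (\<Lambda> * T / 2 ^ n)\<^sup>2" by (simp add: power_mono)
  qed
  also have "\<dots> = real N * (2 * (\<Lambda> * T / 2 ^ n)\<^sup>2)" by simp
  also have "\<dots> \<le> 2 ^ n * (2 * (\<Lambda> * T / 2 ^ n)\<^sup>2)"
    using N by (intro mult_right_mono) (simp_all add: of_nat_le_numeral_power_cancel_iff)
  also have "\<dots> = 2 * (\<Lambda> * T)\<^sup>2 * (1 / 2) ^ n" by (simp add: power_divide power2_eq_square)
  finally show "(LINT w|M. (V w)\<^sup>2) \<le> 2 * (\<Lambda> * T)\<^sup>2 * (1 / 2) ^ n" .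
qed

text \<open>The variances decay geometrically in \<open>n\<close>, hence are summable, which upgrades convergence in mean
  square to almost sure convergence along the whole sequence.\<close>

lemma AE_dyadic_variation:
  assumes j: "j \<le> 2 ^ m"
  shows "AE w in M. (\<lambda>n. dyadic_variation T n (X w) (dyadic T m j)) \<longlonglongrightarrow> clock (dyadic T m j)"
proof -
  \<comment> \<open>The time is a grid point from level \<open>m\<close> on, hence the shift of the index.\<close>
  define V where "V n w = dyadic_variation T (n + m) (X w) (dyadic T m j) - clock (dyadic T m j)" for n w
  have B: "integrable M (\<lambda>w. (V n w)\<^sup>2)" "(LINT w|M. (V n w)\<^sup>2) \<le> 2 * (\<Lambda> * T)\<^sup>2 * (1 / 2) ^ (n + m)" for n
  proof -
    have "j * 2 ^ n \<le> 2 ^ (n + m)" using j by (simp add: power_add)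
    from dyadic_variation_L2[OF this] dyadic_refine[of m "n + m" T j]
    show "integrable M (\<lambda>w. (V n w)\<^sup>2)" "(LINT w|M. (V n w)\<^sup>2) \<le> 2 * (\<Lambda> * T)\<^sup>2 * (1 / 2) ^ (n + m)"
      by (simp_all add: V_def)
  qed
  have "summable (\<lambda>n. LINT w|M. (V n w)\<^sup>2)"
  proof (rule summable_comparison_test')
    show "summable (\<lambda>n. 2 * (\<Lambda> * T)\<^sup>2 * (1 / 2) ^ m * (1 / 2 :: real) ^ n)"
      by (intro summable_mult summable_geometric) simp
    show "norm (LINT w|M. (V n w)\<^sup>2) \<le> 2 * (\<Lambda> * T)\<^sup>2 * (1 / 2) ^ m * (1 / 2) ^ n" for n
      using B(2)[of n] by (simp add: power_add mult_ac)
  qed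
  then have "AE w in M. (\<lambda>n. (V n w)\<^sup>2) \<longlonglongrightarrow> 0"
    by (intro AE_tendsto_zero_of_summable B) auto
  then show ?thesis
  proof eventually_elim
    fix w assume "(\<lambda>n. (V n w)\<^sup>2) \<longlonglongrightarrow> 0"
    then have "(\<lambda>n. sqrt ((V n w)\<^sup>2)) \<longlonglongrightarrow> sqrt 0" by (rule tendsto_real_sqrt)
    then have "(\<lambda>n. V n w) \<longlonglongrightarrow> 0" by (simp add: tendsto_rabs_zero_iff)
    then have "(\<lambda>n. dyadic_variation T (n + m) (X w) (dyadic T m j)) \<longlonglongrightarrow> clock (dyadic T m j)"
      unfolding V_def by (simp add: LIM_zero_iff)
    then show "(\<lambda>n. dyadic_variation T n (X w) (dyadic T m j)) \<longlonglongrightarrow> clock (dyadic T m j)"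
      by (rule LIMSEQ_offset)
  qed
qed

text \<open>Only countably many dyadic times have to be controlled, so one null set serves all times.\<close>

lemma AE_bracket_eq_clock: "AE w in M. \<forall>t\<in>{0..T}. bracket T \<Lambda> (X w) t = clock t"
proof -
  have "AE w in M. j \<le> 2 ^ m \<longrightarrow> (\<lambda>n. dyadic_variation T n (X w) (dyadic T m j)) \<longlonglongrightarrow> clock (dyadic T m j)" for m j :: nat
    by (cases "j \<le> 2 ^ m") (simp_all add: AE_dyadic_variation)
  then have "AE w in M. \<forall>m j. j \<le> 2 ^ m \<longrightarrow> (\<lambda>n. dyadic_variation T n (X w) (dyadic T m j)) \<longlonglongrightarrow> clock (dyadic T m j)"
    by (simp add: AE_all_countable)
  then show ?thesis
    by eventually_elim (intro ballI bracket_eq_limit T_pos Lam_pos clock_in_bracket_paths, auto)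
qed

end


section \<open>Differentiable functions of finitely many coordinates\<close>

lemma tendsto_coordinatewise:
  fixes f :: "'a => nat => real"
  assumes "\<And>i. ((\<lambda>x. f x i) \<longlongrightarrow> l i) F"
  shows "(f \<longlongrightarrow> l) F"
proof -
  have "limitin (product_topology (\<lambda>_. euclidean) UNIV) f l F"
    unfolding limitin_componentwise using assms by simp
  then show ?thesis by (simp only: euclidean_product_topology limitin_canonical_iff)
qed

text \<open>The partial derivatives are carried along as data \<open>g\<close>, so that sums, products and compositions
  produce them without recourse to an operator of differentiation.\<close>

definition C1_fun :: "nat => ((nat => real) => real) => (nat => (nat => real) => real) => bool" where
  "C1_fun n f g \<longleftrightarrow>
     (\<forall>z z'. (\<forall>i<n. z i = z' i) \<longrightarrow> f z = f z' \<and> (\<forall>i<n. g i z = g i z')) \<and>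
     continuous_on UNIV f \<and> (\<forall>i<n. continuous_on UNIV (g i)) \<and>
     (\<forall>i<n. \<forall>z. ((\<lambda>v. f (z(i := v))) has_real_derivative g i z) (at (z i)))"

lemma C1_funD:
  assumes "C1_fun n f g"
  shows "(\<And>i. i < n ==> z i = z' i) ==> f z = f z'"
    "i < n ==> (\<And>i. i < n ==> z i = z' i) ==> g i z = g i z'"
    "continuous_on UNIV f" "i < n ==> continuous_on UNIV (g i)"
    "i < n ==> ((\<lambda>v. f (z(i := v))) has_real_derivative g i z) (at (z i))"
  using assms unfolding C1_fun_def by blast+

lemma C1_fun_deriv_at:
  assumes "C1_fun n f g" "i < n"
  shows "((\<lambda>v. f (z(i := v))) has_real_derivative g i (z(i := u))) (at u)"
  using C1_funD(5)[OF assms, of "z(i := u)"] by simp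

lemma MVT_real_between:
  fixes f :: "real => real"
  assumes "\<And>x. (f has_real_derivative f' x) (at x)"
  shows "\<exists>\<zeta>. \<bar>\<zeta> - a\<bar> \<le> \<bar>b - a\<bar> \<and> f b - f a = (b - a) * f' \<zeta>"
proof (cases a b rule: linorder_cases)
  case less
  obtain \<zeta> where "a < \<zeta>" "\<zeta> < b" "f b - f a = (b - a) * f' \<zeta>" using MVT2[OF less, of f f'] assms by auto
  then show ?thesis by (intro exI[of _ \<zeta>]) auto
next
  case greater
  obtain \<zeta> where "b < \<zeta>" "\<zeta> < a" "f a - f b = (a - b) * f' \<zeta>" using MVT2[OF greater, of f f'] assms by auto
  then show ?thesis by (intro exI[of _ \<zeta>]) (auto simp: algebra_simps)
qed auto

text \<open>The chain rule along a line: the increment is telescoped over the coordinates, and the mean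
  value theorem together with continuity of the partial derivatives treats each summand.\<close>

lemma C1_fun_line:
  assumes f: "C1_fun n f g"
  shows "((\<lambda>v. f (\<lambda>i. z i + v * e i)) has_real_derivative (\<Sum>i<n. e i * g i (\<lambda>i. z i + u * e i))) (at u)"
proof -
  define y where "y = (\<lambda>i. z i + u * e i)"
  define Y where "Y v k = (\<lambda>i. if i < k then y i + v * e i else y i)" for v k
  have "\<exists>\<zeta>. \<bar>\<zeta> - y i\<bar> \<le> \<bar>v * e i\<bar> \<and> f (Y v (Suc i)) - f (Y v i) = v * e i * g i ((Y v i)(i := \<zeta>))" if "i < n" for i v
  proof -
    have "(Y v i)(i := y i + v * e i) = Y v (Suc i)" "(Y v i)(i := y i) = Y v i"
      by (auto simp: Y_def fun_eq_iff less_Suc_eq)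
    then show ?thesis using MVT_real_between[OF C1_fun_deriv_at[OF f that], of "y i" "y i + v * e i" "Y v i"] by auto
  qed
  then obtain \<zeta> where \<zeta>: "\<And>i v. i < n ==> \<bar>\<zeta> i v - y i\<bar> \<le> \<bar>v * e i\<bar>"
    "\<And>i v. i < n ==> f (Y v (Suc i)) - f (Y v i) = v * e i * g i ((Y v i)(i := \<zeta> i v))" by metis
  have tel: "f (\<lambda>i. y i + v * e i) - f y = v * (\<Sum>i<n. e i * g i ((Y v i)(i := \<zeta> i v)))" for v
  proof -
    have "f (\<lambda>i. y i + v * e i) = f (Y v n)" by (rule C1_funD(1)[OF f]) (simp add: Y_def)
    moreover have "f y = f (Y v 0)" by (simp add: Y_def)
    moreover have "f (Y v n) - f (Y v 0) = (\<Sum>i<n. v * e i * g i ((Y v i)(i := \<zeta> i v)))"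
      by (subst sum_lessThan_telescope[symmetric], rule sum.cong) (simp_all add: \<zeta>)
    ultimately show ?thesis by (simp add: sum_distrib_left mult.assoc)
  qed
  have lim: "((\<lambda>v. g i ((Y v i)(i := \<zeta> i v))) \<longlongrightarrow> g i y) (at 0)" if i: "i < n" for i
  proof -
    have "((\<lambda>v. (Y v i)(i := \<zeta> i v)) \<longlongrightarrow> y) (at 0)"
    proof (rule tendsto_coordinatewise)
      fix j
      have 1: "((\<lambda>v. y j + v * e j) \<longlongrightarrow> y j) (at 0)" by (auto intro!: tendsto_eq_intros)
      have 2: "((\<lambda>v. \<zeta> i v) \<longlongrightarrow> y i) (at 0)"
      proof (rule LIM_zero_cancel, rule Lim_null_comparison)
        show "eventually (\<lambda>v. norm (\<zeta> i v - y i) \<le> \<bar>v * e i\<bar>) (at 0)" using \<zeta>(1)[OF i] by simp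
        show "((\<lambda>v. \<bar>v * e i\<bar>) \<longlongrightarrow> 0) (at 0)" by (auto intro!: tendsto_eq_intros)
      qed
      show "((\<lambda>v. ((Y v i)(i := \<zeta> i v)) j) \<longlongrightarrow> y j) (at 0)"
        using 1 2 by (cases "j = i"; cases "j < i") (simp_all add: Y_def)
    qed
    moreover have "isCont (g i) y" using C1_funD(4)[OF f i] by (simp add: continuous_on_eq_continuous_at)
    ultimately show ?thesis by (rule isCont_tendsto_compose[rotated])
  qed
  have "((\<lambda>v. f (\<lambda>i. y i + v * e i)) has_real_derivative (\<Sum>i<n. e i * g i y)) (at 0)"
    unfolding DERIV_def
  proof (rule Lim_transform_eventually)
    show "((\<lambda>v. \<Sum>i<n. e i * g i ((Y v i)(i := \<zeta> i v))) \<longlongrightarrow> (\<Sum>i<n. e i * g i y)) (at 0)"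
      by (intro tendsto_sum tendsto_mult tendsto_const lim) auto
    show "\<forall>\<^sub>F v in at 0. (\<Sum>i<n. e i * g i ((Y v i)(i := \<zeta> i v))) =
        (f (\<lambda>i. y i + (0 + v) * e i) - f (\<lambda>i. y i + 0 * e i)) / v"
      by (auto simp: eventually_at_filter tel)
  qed
  then have "((\<lambda>v. f (\<lambda>i. y i + (v - u) * e i)) has_real_derivative (\<Sum>i<n. e i * g i y)) (at u)"
    using DERIV_shift[of "\<lambda>v. f (\<lambda>i. y i + (v - u) * e i)" "\<Sum>i<n. e i * g i y" 0 u] by simp
  moreover have "(\<lambda>i. y i + (v - u) * e i) = (\<lambda>i. z i + v * e i)" for v
    by (auto simp: y_def algebra_simps)
  ultimately show ?thesis by (simp add: y_def)
qed

lemma measurable_coords: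
  assumes "continuous_on UNIV (f :: (nat => real) => real)" "\<And>i. (\<lambda>w. J w i) \<in> borel_measurable N"
  shows "(\<lambda>w. f (J w)) \<in> borel_measurable N"
proof -
  have "f \<in> borel_measurable borel" using assms(1) by (rule borel_measurable_continuous_onI)
  moreover have "J \<in> borel_measurable N" using assms(2) by (rule measurable_coordinatewise_then_product)
  ultimately show ?thesis by (rule measurable_compose[rotated])
qed


lemma abs_mult_bound: "\<bar>x\<bar> \<le> B ==> \<bar>x * y\<bar> \<le> \<bar>B * y\<bar>" for x y B :: real
  unfolding abs_mult by (intro mult_right_mono) auto


section \<open>Gaussian integration by parts\<close>

lemma tendsto_normal_density:
  assumes "0 < \<sigma>"
  shows "(normal_density 0 \<sigma> \<longlongrightarrow> 0) at_top" "(normal_density 0 \<sigma> \<longlongrightarrow> 0) at_bot"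
  using assms unfolding normal_density_def[abs_def] by real_asymp+

text \<open>Stein's identity \<open>E[N f (N)] = \<sigma>\<^sup>2 E[f' (N)]\<close>: the normal density satisfies \<open>\<phi>' = - (x / \<sigma>\<^sup>2) \<phi>\<close> and the
  boundary terms vanish because \<open>f\<close> is bounded.\<close>

lemma gaussian_ibp:
  fixes G G' :: "real => real"
  assumes s: "0 < \<sigma>" and d: "\<And>x. (G has_real_derivative G' x) (at x)" and c: "continuous_on UNIV G'"
    and B: "\<And>x. \<bar>G x\<bar> \<le> B" "\<And>x. \<bar>G' x\<bar> \<le> B"
  shows "(LINT x|density lborel (normal_density 0 \<sigma>). G x * x) = \<sigma>\<^sup>2 * (LINT x|density lborel (normal_density 0 \<sigma>). G' x)"
proof -
  let ?n = "normal_density 0 \<sigma>"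
  have cG: "continuous_on UNIV G" using d by (meson DERIV_isCont continuous_at_imp_continuous_on)
  have [measurable]: "G \<in> borel_measurable borel" "G' \<in> borel_measurable borel"
    using c cG by (auto intro: borel_measurable_continuous_onI)
  have n0: "0 \<le> ?n x" for x by simp
  have i1: "integrable lborel (\<lambda>x. ?n x * G' x)"
  proof (rule Bochner_Integration.integrable_bound)
    show "integrable lborel (\<lambda>x. B * ?n x)" using integrable_normal_moment[of \<sigma> 0 0] s by simp
    show "AE x in lborel. norm (?n x * G' x) \<le> norm (B * ?n x)"
    proof (rule AE_I2)
      fix x have "\<bar>G' x\<bar> * ?n x \<le> \<bar>B\<bar> * ?n x" using B(2)[of x] by (intro mult_right_mono) auto
      then show "norm (?n x * G' x) \<le> norm (B * ?n x)" by (simp add: abs_mult mult.commute)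
    qed
  qed measurable
  have i2: "integrable lborel (\<lambda>x. ?n x * (G x * x))"
  proof (rule Bochner_Integration.integrable_bound)
    show "integrable lborel (\<lambda>x. B * (?n x * x))" using integrable_normal_moment[of \<sigma> 0 1] s by simp
    show "AE x in lborel. norm (?n x * (G x * x)) \<le> norm (B * (?n x * x))"
    proof (rule AE_I2)
      fix x have "\<bar>G x\<bar> * (?n x * \<bar>x\<bar>) \<le> \<bar>B\<bar> * (?n x * \<bar>x\<bar>)" using B(1)[of x] by (intro mult_right_mono) auto
      then show "norm (?n x * (G x * x)) \<le> norm (B * (?n x * x))" by (simp add: abs_mult mult_ac)
    qed
  qed measurable
  define f where "f x = ?n x * G' x - (1 / \<sigma>\<^sup>2) * (?n x * (G x * x))" for x
  have dn: "(?n has_real_derivative - (x / \<sigma>\<^sup>2) * ?n x) (at x)" for x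
    unfolding normal_density_def using s by (auto intro!: derivative_eq_intros simp: field_simps power2_eq_square)
  have dF: "((\<lambda>x. G x * ?n x) has_vector_derivative f x) (at x)" for x
    unfolding has_real_derivative_iff_has_vector_derivative[symmetric] f_def
    by (rule DERIV_cong[OF DERIV_mult[OF d dn]]) (simp add: field_simps)
  have cn: "continuous_on UNIV ?n" using dn by (meson DERIV_isCont continuous_at_imp_continuous_on)
  have cf: "continuous_on UNIV f" unfolding f_def by (intro continuous_intros cn c cG)
  have Flim: "((\<lambda>x. G x * ?n x) \<longlongrightarrow> 0) F" if "(?n \<longlongrightarrow> 0) F" for F
  proof (rule Lim_null_comparison)
    show "\<forall>\<^sub>F x in F. norm (G x * ?n x) \<le> B * ?n x"
      using B(1) n0 by (intro always_eventually allI) (auto simp: abs_mult intro!: mult_right_mono)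
    show "((\<lambda>x. B * ?n x) \<longlongrightarrow> 0) F" using tendsto_mult[OF tendsto_const that, of B] by simp
  qed
  have "(LBINT x=-\<infinity>..\<infinity>. f x) = 0 - 0"
  proof (rule interval_integral_FTC_integrable)
    show "(((\<lambda>x. G x * ?n x) \<circ> real_of_ereal) \<longlongrightarrow> 0) (at_right (-\<infinity>))"
      unfolding ereal_tendsto_simps by (rule Flim[OF tendsto_normal_density(2)[OF s]])
    show "(((\<lambda>x. G x * ?n x) \<circ> real_of_ereal) \<longlongrightarrow> 0) (at_left \<infinity>)"
      unfolding ereal_tendsto_simps by (rule Flim[OF tendsto_normal_density(1)[OF s]])
    show "set_integrable lborel (einterval (- \<infinity>) \<infinity>) f"
      using i1 i2 by (simp add: einterval_eq_UNIV set_integrable_def f_def)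
    show "isCont f x" for x using cf by (simp add: continuous_on_eq_continuous_at)
  qed (use dF in auto)
  then have "(LINT x|lborel. f x) = 0"
    by (simp add: interval_lebesgue_integral_def einterval_eq_UNIV set_lebesgue_integral_def)
  then have "(LINT x|lborel. ?n x * G' x) = (1 / \<sigma>\<^sup>2) * (LINT x|lborel. ?n x * (G x * x))"
    using i1 i2 by (simp add: f_def)
  then have "\<sigma>\<^sup>2 * (LINT x|lborel. ?n x * G' x) = (LINT x|lborel. ?n x * (G x * x))"
    using s by simp
  then show ?thesis by (simp add: integral_density)
qed

context brownian
begin

text \<open>One Brownian increment is integrated out by Stein's identity while the others, being independent of
  it, are frozen by Fubini's theorem.\<close>

lemma increments_ibp:
  assumes gr: "strict_grid T m p" and f: "C1_fun m f g" and j: "j < m"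
    and B: "\<And>z. \<bar>f z\<bar> \<le> B" "\<And>z. \<bar>g j z\<bar> \<le> B"
  defines "\<xi> \<equiv> \<lambda>w i. if i < m then W (p (Suc i)) w - W (p i) w else 0"
  shows "(LINT w|M. f (\<xi> w) * \<xi> w j) = (p (Suc j) - p j) * (LINT w|M. g j (\<xi> w))"
proof -
  define K where "K = {..<m} - {j}"
  define D where "D i w = W (p (Suc i)) w - W (p i) w" for i w
  define Y where "Y w = restrict (\<lambda>i. D i w) K" for w
  let ?N = "Pi\<^sub>M K (\<lambda>_. borel :: real measure)"
  have v: "0 < p (Suc j) - p j" using gr j by (simp add: strict_grid_def)
  have ind: "indep_vars (\<lambda>_. borel) D {..<m}" using increments_indep[OF gr] by (simp add: D_def[abs_def])
  define X where "X w = restrict (\<lambda>i. D i w) {j}" for w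
  let ?L = "Pi\<^sub>M {j} (\<lambda>_. borel :: real measure)"
  have "indep_var ?L X ?N Y"
    unfolding X_def Y_def using j by (intro indep_var_restrict[OF ind]) (auto simp: K_def)
  note iv = this[unfolded indep_var_distribution_eq]
  have rvX: "X \<in> measurable M ?L" by (rule iv[THEN conjunct1])
  have rvY: "Y \<in> measurable M ?N" by (rule iv[THEN conjunct2, THEN conjunct1])
  have jd: "distr M (?L \<Otimes>\<^sub>M ?N) (\<lambda>w. (X w, Y w)) = distr M ?L X \<Otimes>\<^sub>M distr M ?N Y"
    by (rule iv[THEN conjunct2, THEN conjunct2, symmetric])
  have rvD: "D j \<in> borel_measurable M"
    using ind j by (auto simp: indep_vars_def)
  note rv = rvD rvY
  have dd: "distr M borel (D j) = density lborel (normal_density 0 (sqrt (p (Suc j) - p j)))"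
    using distributed_distr_eq_density[OF increments_normal[OF gr j]] by (simp add: D_def[abs_def] cong: distr_cong)
  define C where "C x y = (\<lambda>i. if i = j then x else if i \<in> K then y i else 0)" for x and y :: "nat => real"
  have Cxi: "C (D j w) (Y w) = \<xi> w" for w
    using j by (auto simp: C_def Y_def \<xi>_def K_def D_def fun_eq_iff)
  have Cup: "C x y = (C 0 y)(j := x)" for x y by (auto simp: C_def)
  have Cm: "(\<lambda>q. C (fst q) (snd q) i) \<in> borel_measurable (borel \<Otimes>\<^sub>M ?N)" for i
    unfolding C_def
    by (cases "i = j"; cases "i \<in> K") (auto intro: measurable_compose[OF measurable_snd measurable_component_singleton])
  have fm: "(\<lambda>q. f (C (fst q) (snd q))) \<in> borel_measurable (borel \<Otimes>\<^sub>M ?N)"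
    "(\<lambda>q. g j (C (fst q) (snd q))) \<in> borel_measurable (borel \<Otimes>\<^sub>M ?N)"
    by (rule measurable_coords[OF C1_funD(3)[OF f] Cm], rule measurable_coords[OF C1_funD(4)[OF f j] Cm])
  have fxm: "(\<lambda>q. f (C (fst q) (snd q)) * fst q) \<in> borel_measurable (borel \<Otimes>\<^sub>M ?N)"
    by (intro borel_measurable_times fm) measurable
  interpret P1: prob_space "distr M ?L X" by (rule prob_space_distr[OF rvX])
  interpret P2: prob_space "distr M ?N Y" by (rule prob_space_distr[OF rvY])
  interpret PP: pair_prob_space "distr M ?L X" "distr M ?N Y" ..
  have cj: "(\<lambda>x. x j) \<in> measurable ?L borel" by (rule measurable_component_singleton) simp
  have fub: "(LINT w|M. H (D j w) (Y w)) = (LINT y|distr M ?N Y. LINT x|distr M borel (D j). H x y)"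
    if m: "(\<lambda>q. H (fst q) (snd q)) \<in> borel_measurable (borel \<Otimes>\<^sub>M ?N)" and i: "integrable M (\<lambda>w. H (D j w) (Y w))"
    for H :: "real => (nat => real) => real"
  proof -
    have mp: "(\<lambda>w. (X w, Y w)) \<in> measurable M (?L \<Otimes>\<^sub>M ?N)" using rvX rvY by measurable
    have m': "(\<lambda>q. H (fst q j) (snd q)) \<in> borel_measurable (?L \<Otimes>\<^sub>M ?N)"
    proof -
      have "(\<lambda>q. (fst q j, snd q)) \<in> measurable (?L \<Otimes>\<^sub>M ?N) (borel \<Otimes>\<^sub>M ?N)"
        by (intro measurable_Pair measurable_compose[OF measurable_fst cj] measurable_snd)
      from measurable_compose[OF this m] show ?thesis by simp
    qed
    have XD: "X w j = D j w" for w by (simp add: X_def)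
    have "integrable (distr M (?L \<Otimes>\<^sub>M ?N) (\<lambda>w. (X w, Y w))) (\<lambda>q. H (fst q j) (snd q))"
      using i by (subst integrable_distr_eq[OF mp m']) (simp add: XD)
    then have ii: "integrable (distr M ?L X \<Otimes>\<^sub>M distr M ?N Y) (\<lambda>(x, y). H (x j) y)"
      by (simp add: jd split_beta')
    have "(LINT w|M. H (D j w) (Y w)) = (LINT q|distr M (?L \<Otimes>\<^sub>M ?N) (\<lambda>w. (X w, Y w)). H (fst q j) (snd q))"
      by (subst integral_distr[OF mp m']) (simp add: XD)
    also have "\<dots> = (LINT y|distr M ?N Y. LINT x|distr M ?L X. H (x j) y)"
      unfolding jd PP.integral_snd[OF ii] by (simp add: split_beta')
    also have "\<dots> = (LINT y|distr M ?N Y. LINT x|distr M borel (D j). H x y)"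
    proof (rule Bochner_Integration.integral_cong[OF refl])
      fix y assume "y \<in> space (distr M ?N Y)"
      then have y: "y \<in> space ?N" by simp
      have my: "(\<lambda>x. H x y) \<in> borel_measurable borel"
        using measurable_compose[OF measurable_Pair[OF measurable_ident_sets[OF refl] measurable_const[OF y]] m] by simp
      show "(LINT x|distr M ?L X. H (x j) y) = (LINT x|distr M borel (D j). H x y)"
        by (subst integral_distr[OF rvX measurable_compose[OF cj my]], subst integral_distr[OF rvD my]) (simp add: XD)
    qed
    finally show ?thesis .
  qed
  have xi_m: "(\<lambda>w. f (\<xi> w)) \<in> borel_measurable M" "(\<lambda>w. g j (\<xi> w)) \<in> borel_measurable M"
    using measurable_compose[OF measurable_Pair[OF rv] fm(1)] measurable_compose[OF measurable_Pair[OF rv] fm(2)]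
    by (simp_all add: Cxi)
  have Di: "integrable M (D j)"
  proof -
    have "integrable M (\<lambda>w. (D j w)\<^sup>2)"
      using eint_sq(1)[OF gr, of "\<lambda>i. of_bool (i = j)"] j
      by (simp add: eint_def isum_def D_def of_bool_def if_distrib[of "\<lambda>c. c * _"] sum.delta cong: if_cong)
    then show ?thesis using rv(1) by (rule square_integrable_imp_integrable[rotated])
  qed
  have "(LINT w|M. f (\<xi> w) * \<xi> w j) = (LINT w|M. f (C (D j w) (Y w)) * D j w)"
    using j by (simp add: Cxi) (simp add: \<xi>_def D_def)
  also have "\<dots> = (LINT y|distr M ?N Y. LINT x|distr M borel (D j). f (C x y) * x)"
  proof (rule fub[of "\<lambda>x y. f (C x y) * x", OF fxm])
    show "integrable M (\<lambda>w. f (C (D j w) (Y w)) * D j w)"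
    proof (rule Bochner_Integration.integrable_bound)
      show "integrable M (\<lambda>w. B * D j w)" using Di by simp
      show "(\<lambda>w. f (C (D j w) (Y w)) * D j w) \<in> borel_measurable M"
        unfolding Cxi by (intro borel_measurable_times xi_m rv)
      show "AE w in M. norm (f (C (D j w) (Y w)) * D j w) \<le> norm (B * D j w)"
        using abs_mult_bound[OF B(1)] by (intro AE_I2) simp
    qed
  qed
  also have "\<dots> = (LINT y|distr M ?N Y. (p (Suc j) - p j) * (LINT x|distr M borel (D j). g j (C x y)))"
  proof (rule Bochner_Integration.integral_cong[OF refl])
    fix y
    have d: "((\<lambda>x. f (C x y)) has_real_derivative g j (C x y)) (at x)" for x
      using C1_fun_deriv_at[OF f j, of "C 0 y" x] by (simp only: Cup[symmetric])
    have c: "continuous_on UNIV (\<lambda>x. g j (C x y))"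
    proof (rule continuous_on_compose2[OF C1_funD(4)[OF f j]])
      show "continuous_on UNIV (\<lambda>x. C x y)"
      proof (rule continuous_on_coordinatewise_then_product)
        show "continuous_on UNIV (\<lambda>x. C x y i)" for i
          by (cases "i = j"; cases "i \<in> K") (auto simp: C_def intro: continuous_intros)
      qed
    qed auto
    show "(LINT x|distr M borel (D j). f (C x y) * x) = (p (Suc j) - p j) * (LINT x|distr M borel (D j). g j (C x y))"
      unfolding dd using gaussian_ibp[OF _ d c, of "sqrt (p (Suc j) - p j)" B] B v by simp
  qed
  also have "\<dots> = (p (Suc j) - p j) * (LINT y|distr M ?N Y. LINT x|distr M borel (D j). g j (C x y))" by simp
  also have "(LINT y|distr M ?N Y. LINT x|distr M borel (D j). g j (C x y)) = (LINT w|M. g j (C (D j w) (Y w)))"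
  proof (rule fub[of "\<lambda>x y. g j (C x y)", OF fm(2), symmetric])
    show "integrable M (\<lambda>w. g j (C (D j w) (Y w)))"
      by (rule integrable_const_bound[of _ B]) (use B(2) xi_m in \<open>auto simp: Cxi\<close>)
  qed
  finally show ?thesis by (simp add: Cxi)
qed

text \<open>Elementary integrals on a common grid are linear functions of the increments; the chain rule turns
  integration by parts in the increments into integration by parts in the integrals.\<close>

lemma eint_ibp:
  fixes e :: "nat => nat => real"
  assumes gr: "strict_grid T m p" and f: "C1_fun n f g"
    and B: "\<And>z. \<bar>f z\<bar> \<le> B" "\<And>i z. i < n ==> \<bar>g i z\<bar> \<le> B"
  defines "I \<equiv> \<lambda>w i. if i < n then eint m (e i) p w else 0"
  shows "(LINT w|M. f (I w) * eint m d p w)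
     = (\<Sum>i<n. (LINT w|M. g i (I w)) * (\<Sum>j<m. e i j * d j * (p (Suc j) - p j)))"
proof -
  define \<xi> where "\<xi> w i = (if i < m then W (p (Suc i)) w - W (p i) w else 0)" for w i
  define A where "A x = (\<lambda>i. if i < n then \<Sum>j<m. e i j * x j else 0)" for x :: "nat => real"
  have A\<xi>: "A (\<xi> w) = I w" for w
    by (auto simp: A_def I_def \<xi>_def eint_def isum_def fun_eq_iff)
  define g' where "g' j x = (\<Sum>i<n. e i j * g i (A x))" for j x
  have cA: "continuous_on UNIV A"
  proof (rule continuous_on_coordinatewise_then_product)
    show "continuous_on UNIV (\<lambda>x. A x i)" for i
      unfolding A_def
      by (cases "i < n") (auto intro!: continuous_on_sum continuous_on_mult continuous_on_const continuous_on_product_coordinates)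
  qed
  have C1: "C1_fun m (\<lambda>x. f (A x)) g'"
    unfolding C1_fun_def
  proof (intro conjI allI impI)
    fix x x' :: "nat => real" assume "\<forall>i<m. x i = x' i"
    then have "A x = A x'" by (auto simp: A_def fun_eq_iff)
    then show "f (A x) = f (A x')" "\<And>j. g' j x = g' j x'" by (simp_all add: g'_def)
  next
    show "continuous_on UNIV (\<lambda>x. f (A x))"
      by (rule continuous_on_compose2[OF C1_funD(3)[OF f] cA]) simp
    show "continuous_on UNIV (g' j)" for j
      unfolding g'_def
      by (intro continuous_on_sum continuous_on_mult continuous_on_const continuous_on_compose2[OF C1_funD(4)[OF f] cA]) auto
  next
    fix j and x :: "nat => real" assume j: "j < m"
    have Aup: "A (x(j := v)) = (\<lambda>i. A (x(j := 0)) i + v * (if i < n then e i j else 0))" for v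
    proof
      fix i
      have "(\<Sum>k<m. e i k * (x(j := v)) k) = (\<Sum>k<m. e i k * (x(j := 0)) k + (if k = j then v * e i j else 0))"
        by (intro sum.cong) auto
      also have "\<dots> = (\<Sum>k<m. e i k * (x(j := 0)) k) + v * e i j" using j by (simp add: sum.distrib)
      finally show "A (x(j := v)) i = A (x(j := 0)) i + v * (if i < n then e i j else 0)" by (simp add: A_def)
    qed
    have "((\<lambda>v. f (\<lambda>i. A (x(j := 0)) i + v * (if i < n then e i j else 0))) has_real_derivative
        (\<Sum>i<n. (if i < n then e i j else 0) * g i (\<lambda>i. A (x(j := 0)) i + x j * (if i < n then e i j else 0)))) (at (x j))"
      by (rule C1_fun_line[OF f])
    then have "((\<lambda>v. f (A (x(j := v)))) has_real_derivative
        (\<Sum>i<n. (if i < n then e i j else 0) * g i (A (x(j := x j))))) (at (x j))"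
      by (simp only: Aup[symmetric])
    then show "((\<lambda>v. f (A (x(j := v)))) has_real_derivative g' j x) (at (x j))" by (simp add: g'_def)
  qed
  define B' where "B' = \<bar>B\<bar> + (\<Sum>j<m. \<Sum>i<n. \<bar>e i j\<bar> * \<bar>B\<bar>)"
  have b: "\<bar>f (A z)\<bar> \<le> B'" for z
  proof -
    have "\<bar>f (A z)\<bar> \<le> \<bar>B\<bar>" using B(1)[of "A z"] by linarith
    moreover have "0 \<le> (\<Sum>j<m. \<Sum>i<n. \<bar>e i j\<bar> * \<bar>B\<bar>)" by (intro sum_nonneg) auto
    ultimately show ?thesis by (simp add: B'_def)
  qed
  have b': "\<bar>g' j z\<bar> \<le> B'" if "j < m" for j z
  proof -
    have "\<bar>g' j z\<bar> \<le> (\<Sum>i<n. \<bar>e i j\<bar> * \<bar>B\<bar>)"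
      unfolding g'_def
    proof (intro order_trans[OF sum_abs] sum_mono)
      fix i assume "i \<in> {..<n}"
      then show "\<bar>e i j * g i (A z)\<bar> \<le> \<bar>e i j\<bar> * \<bar>B\<bar>"
        using abs_mult_bound[OF B(2)[of i "A z"], of "e i j"] by (simp add: abs_mult mult.commute)
    qed
    also have "\<dots> \<le> (\<Sum>j<m. \<Sum>i<n. \<bar>e i j\<bar> * \<bar>B\<bar>)"
      using that by (intro member_le_sum[where f="\<lambda>j. \<Sum>i<n. \<bar>e i j\<bar> * \<bar>B\<bar>"]) (auto intro!: sum_nonneg)
    finally show ?thesis by (simp add: B'_def)
  qed
  have Dm: "W (p (Suc j)) \<in> borel_measurable M" "W (p j) \<in> borel_measurable M" if "j < m" for j
    using gr that by (auto intro!: W_measurable simp: strict_grid_def)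
  have \<xi>m: "(\<lambda>w. \<xi> w i) \<in> borel_measurable M" for i
    unfolding \<xi>_def using Dm by (cases "i < m") auto
  have Im: "(\<lambda>w. I w i) \<in> borel_measurable M" for i
    unfolding I_def using eint_measurable_grid[OF gr] by (cases "i < n") auto
  have fm: "(\<lambda>w. f (I w)) \<in> borel_measurable M" "i < n ==> (\<lambda>w. g i (I w)) \<in> borel_measurable M" for i
    by (rule measurable_coords[OF C1_funD(3)[OF f] Im], rule measurable_coords[OF C1_funD(4)[OF f] Im])
  have gi: "integrable M (\<lambda>w. g i (I w))" if "i < n" for i
    by (rule integrable_const_bound[of _ B]) (use that fm B in auto)
  have \<xi>i: "integrable M (\<lambda>w. \<xi> w j)" if "j < m" for j
  proof -
    have "integrable M (\<lambda>w. (\<xi> w j)\<^sup>2)"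
      using eint_sq(1)[OF gr, of "\<lambda>i. of_bool (i = j)"] that
      by (simp add: eint_def isum_def \<xi>_def of_bool_def if_distrib[of "\<lambda>c. c * _"] sum.delta cong: if_cong)
    then show ?thesis using \<xi>m by (rule square_integrable_imp_integrable[rotated])
  qed
  have f\<xi>: "integrable M (\<lambda>w. f (I w) * \<xi> w j)" if "j < m" for j
  proof (rule Bochner_Integration.integrable_bound)
    show "integrable M (\<lambda>w. B * \<xi> w j)" using \<xi>i[OF that] by simp
    show "AE w in M. norm (f (I w) * \<xi> w j) \<le> norm (B * \<xi> w j)"
      using abs_mult_bound[OF B(1)] by (intro AE_I2) simp
  qed (intro borel_measurable_times fm \<xi>m)
  have E: "(LINT w|M. f (I w) * \<xi> w j) = (p (Suc j) - p j) * (\<Sum>i<n. e i j * (LINT w|M. g i (I w)))" if j: "j < m" for j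
  proof -
    have "(LINT w|M. f (A (\<xi> w)) * \<xi> w j) = (p (Suc j) - p j) * (LINT w|M. g' j (\<xi> w))"
      using increments_ibp[of m p "\<lambda>x. f (A x)" g' j B', OF gr C1 j b b'[OF j]] by (simp only: \<xi>_def[abs_def])
    also have "(LINT w|M. g' j (\<xi> w)) = (\<Sum>i<n. e i j * (LINT w|M. g i (I w)))"
      unfolding g'_def A\<xi> using gi by (subst Bochner_Integration.integral_sum) auto
    finally show ?thesis by (simp add: A\<xi>)
  qed
  have "(LINT w|M. f (I w) * eint m d p w) = (LINT w|M. (\<Sum>j<m. d j * (f (I w) * \<xi> w j)))"
    by (simp add: eint_def isum_def \<xi>_def sum_distrib_left mult_ac)
  also have "\<dots> = (\<Sum>j<m. d j * ((p (Suc j) - p j) * (\<Sum>i<n. e i j * (LINT w|M. g i (I w)))))"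
    using f\<xi> by (subst Bochner_Integration.integral_sum) (auto simp: E)
  also have "\<dots> = (\<Sum>j<m. \<Sum>i<n. (LINT w|M. g i (I w)) * (e i j * d j * (p (Suc j) - p j)))"
    by (simp add: sum_distrib_left mult_ac)
  also have "\<dots> = (\<Sum>i<n. \<Sum>j<m. (LINT w|M. g i (I w)) * (e i j * d j * (p (Suc j) - p j)))"
    by (rule sum.swap)
  finally show ?thesis by (simp add: sum_distrib_left)
qed

end


context brownian
begin

text \<open>Integration by parts for arbitrary Wiener integrals: pass to the limit along a common
  approximation by elementary integrals.\<close>

lemma wiener_ibp:
  assumes wi: "\<And>i. i < n ==> is_wiener_integral M T W (h i) (I i)"
    and wk: "is_wiener_integral M T W k J"
    and f: "C1_fun n f g"
    and B: "\<And>z. \<bar>f z\<bar> \<le> B" "\<And>i z. i < n ==> \<bar>g i z\<bar> \<le> B"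
  defines "Z \<equiv> \<lambda>w i. if i < n then I i w else 0"
  shows "(LINT w|M. f (Z w) * J w) = (\<Sum>i<n. (LINT w|M. g i (Z w)) * (inner2 T (h i) k))"
proof -
  define h' where "h' i = (if i < n then h i else k)" for i
  define I' where "I' i = (if i < n then I i else J)" for i
  have w': "is_wiener_integral M T W (h' i) (I' i)" for i using wi wk by (simp add: h'_def I'_def)
  obtain m p e where gr: "\<And>q. strict_grid T (m q) (p q)"
    and hL: "\<And>i. i \<in> {..n} ==> (\<lambda>q. LINT r|leb T. (stepf (m q) (e q i) (p q) r - h' i r)\<^sup>2) \<longlonglongrightarrow> 0"
    and Ii: "\<And>i q. i \<in> {..n} ==> integrable M (\<lambda>w. (eint (m q) (e q i) (p q) w - I' i w)\<^sup>2)"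
    and IL: "\<And>i. i \<in> {..n} ==> (\<lambda>q. LINT w|M. (eint (m q) (e q i) (p q) w - I' i w)\<^sup>2) \<longlonglongrightarrow> 0"
    and ae: "AE w in M. \<forall>i\<in>{..n}. (\<lambda>q. eint (m q) (e q i) (p q) w) \<longlonglongrightarrow> I' i w"
    by (rule joint_approx[of "{..n}" h' I']) (simp, rule w', rule that)
  define Zq where "Zq q w = (\<lambda>i. if i < n then eint (m q) (e q i) (p q) w else 0)" for q w
  note mI = wiener_measurable[OF w']
  have mZ: "(\<lambda>w. Z w i) \<in> borel_measurable M" for i
    unfolding Z_def using wiener_measurable(1)[OF wi] by (cases "i < n") auto
  have mZq: "(\<lambda>w. Zq q w i) \<in> borel_measurable M" for q i
    unfolding Zq_def using eint_measurable_grid[OF gr] by (cases "i < n") auto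
  note mf = measurable_coords[OF C1_funD(3)[OF f] mZ] measurable_coords[OF C1_funD(3)[OF f] mZq]
  note mg = measurable_coords[OF C1_funD(4)[OF f] mZ] measurable_coords[OF C1_funD(4)[OF f] mZq]
  have lZ: "AE w in M. (\<lambda>q. Zq q w) \<longlonglongrightarrow> Z w"
    using ae
  proof eventually_elim
    fix w assume a: "\<forall>i\<in>{..n}. (\<lambda>q. eint (m q) (e q i) (p q) w) \<longlonglongrightarrow> I' i w"
    show "(\<lambda>q. Zq q w) \<longlonglongrightarrow> Z w"
    proof (rule tendsto_coordinatewise)
      show "(\<lambda>q. Zq q w i) \<longlonglongrightarrow> Z w i" for i
        using a[rule_format, of i] by (cases "i < n") (simp_all add: Zq_def Z_def I'_def)
    qed
  qed
  have lf: "AE w in M. (\<lambda>q. f (Zq q w)) \<longlonglongrightarrow> f (Z w)"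
    using lZ by eventually_elim (rule isCont_tendsto_compose[OF C1_funD(3)[OF f, THEN continuous_on_interior]], simp_all)
  have lg: "AE w in M. (\<lambda>q. g i (Zq q w)) \<longlonglongrightarrow> g i (Z w)" if "i < n" for i
    using lZ by eventually_elim (rule isCont_tendsto_compose[OF C1_funD(4)[OF f that, THEN continuous_on_interior]], simp_all)
  have B2: "(f z)\<^sup>2 \<le> B\<^sup>2" for z using power_mono[OF B(1)[of z] abs_ge_zero, of 2] by simp
  have if2: "integrable M (\<lambda>w. (f (Z w))\<^sup>2)" "integrable M (\<lambda>w. (f (Zq q w))\<^sup>2)" for q
    using B2 mf by (auto intro!: integrable_const_bound[of _ "B\<^sup>2"] AE_I2)
  have "(\<lambda>q. LINT w|M. (f (Zq q w) - f (Z w))\<^sup>2) \<longlonglongrightarrow> (LINT w|M. 0)"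
  proof (rule integral_dominated_convergence[where w = "\<lambda>_. (2 * B)\<^sup>2"])
    show "AE w in M. (\<lambda>q. (f (Zq q w) - f (Z w))\<^sup>2) \<longlonglongrightarrow> 0"
      using lf by eventually_elim (auto intro!: tendsto_eq_intros)
    show "AE w in M. norm ((f (Zq q w) - f (Z w))\<^sup>2) \<le> (2 * B)\<^sup>2" for q
    proof (rule AE_I2)
      fix w
      have "\<bar>f (Zq q w) - f (Z w)\<bar> \<le> 2 * B" using B(1)[of "Zq q w"] B(1)[of "Z w"] by linarith
      from power_mono[OF this abs_ge_zero, of 2] show "norm ((f (Zq q w) - f (Z w))\<^sup>2) \<le> (2 * B)\<^sup>2" by simp
    qed
  qed (use mf in auto)
  then have lf2: "(\<lambda>q. LINT w|M. (f (Zq q w) - f (Z w))\<^sup>2) \<longlonglongrightarrow> 0" by simp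
  have "(\<lambda>q. LINT w|M. f (Zq q w) * eint (m q) (e q n) (p q) w) \<longlonglongrightarrow> (LINT w|M. f (Z w) * I' n w)"
    by (intro L2_inner_tendsto mf mI(1) eint_measurable_grid gr if2 eint_sq(1) wiener_L2(1)[OF w'] lf2 IL) simp
  moreover have "(\<lambda>q. \<Sum>i<n. (LINT w|M. g i (Zq q w)) * (\<Sum>j<m q. e q i j * e q n j * (p q (Suc j) - p q j)))
    \<longlonglongrightarrow> (\<Sum>i<n. (LINT w|M. g i (Z w)) * (inner2 T (h' i) (h' n)))"
  proof (intro tendsto_sum tendsto_mult)
    fix i assume i: "i \<in> {..<n}"
    show "(\<lambda>q. LINT w|M. g i (Zq q w)) \<longlonglongrightarrow> (LINT w|M. g i (Z w))"
      by (rule integral_dominated_convergence[where w = "\<lambda>_. B"]) (use mg lg B(2) i in auto)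
    show "(\<lambda>q. \<Sum>j<m q. e q i j * e q n j * (p q (Suc j) - p q j)) \<longlonglongrightarrow> (inner2 T (h' i) (h' n))"
      unfolding step_inner[OF gr, symmetric]
      using i by (intro L2_inner_tendsto mI step_L2 step_measurable_leb hL) auto
  qed
  moreover have "(LINT w|M. f (Zq q w) * eint (m q) (e q n) (p q) w)
      = (\<Sum>i<n. (LINT w|M. g i (Zq q w)) * (\<Sum>j<m q. e q i j * e q n j * (p q (Suc j) - p q j)))" for q
    unfolding Zq_def by (rule eint_ibp[OF gr f B])
  ultimately have "(LINT w|M. f (Z w) * I' n w) = (\<Sum>i<n. (LINT w|M. g i (Z w)) * (inner2 T (h' i) (h' n)))"
    using LIMSEQ_unique by simp
  then show ?thesis by (simp add: I'_def h'_def)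
qed

end


section \<open>Cylindrical functionals and cut-off\<close>

text \<open>Polynomial growth enters through its consequence that functions and partial derivatives are bounded
  on balls, a property which survives sums, products and relabelling of coordinates.\<close>

definition C1_loc :: "nat => ((nat => real) => real) => (nat => (nat => real) => real) => bool" where
  "C1_loc n f g \<longleftrightarrow> C1_fun n f g \<and>
     (\<forall>R. \<exists>B. \<forall>z. (\<Sum>i<n. (z i)\<^sup>2) \<le> R \<longrightarrow> \<bar>f z\<bar> \<le> B \<and> (\<forall>i<n. \<bar>g i z\<bar> \<le> B))"

lemma C1_locD: "C1_loc n f g ==> C1_fun n f g" by (simp add: C1_loc_def)

lemma C1_loc_bound:
  assumes "C1_loc n f g"
  obtains B where "0 \<le> B" "\<And>z. (\<Sum>i<n. (z i)\<^sup>2) \<le> R ==> \<bar>f z\<bar> \<le> B"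
    "\<And>i z. (\<Sum>i<n. (z i)\<^sup>2) \<le> R ==> i < n ==> \<bar>g i z\<bar> \<le> B"
proof -
  obtain B where B: "\<And>z. (\<Sum>i<n. (z i)\<^sup>2) \<le> R ==> \<bar>f z\<bar> \<le> B \<and> (\<forall>i<n. \<bar>g i z\<bar> \<le> B)"
    using assms unfolding C1_loc_def by metis
  show ?thesis
    by (rule that[of "\<bar>B\<bar>"]) (use B in \<open>force intro: order_trans[OF _ abs_ge_self]\<close>)+
qed

lemma C1_fun_mult:
  assumes f: "C1_fun n f g" and f': "C1_fun n f' g'"
  shows "C1_fun n (\<lambda>z. f z * f' z) (\<lambda>i z. g i z * f' z + f z * g' i z)"
  unfolding C1_fun_def
proof (intro conjI allI impI)
  fix z z' :: "nat => real" assume e: "\<forall>i<n. z i = z' i"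
  show "f z * f' z = f z' * f' z'" using C1_funD(1)[OF f, of z z'] C1_funD(1)[OF f', of z z'] e by auto
  fix i assume i: "i < n"
  show "g i z * f' z + f z * g' i z = g i z' * f' z' + f z' * g' i z'"
    using C1_funD(1)[OF f, of z z'] C1_funD(1)[OF f', of z z'] C1_funD(2)[OF f i, of z z'] C1_funD(2)[OF f' i, of z z'] e by auto
next
  show "continuous_on UNIV (\<lambda>z. f z * f' z)" by (intro continuous_on_mult C1_funD[OF f] C1_funD[OF f'])
  fix i assume i: "i < n"
  show "continuous_on UNIV (\<lambda>z. g i z * f' z + f z * g' i z)"
    by (intro continuous_on_mult continuous_on_add C1_funD[OF f] C1_funD[OF f'] i)
  fix z
  show "((\<lambda>v. f (z(i := v)) * f' (z(i := v))) has_real_derivative g i z * f' z + f z * g' i z) (at (z i))"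
    by (rule DERIV_cong[OF DERIV_mult[OF C1_funD(5)[OF f i] C1_funD(5)[OF f' i]]]) (simp add: algebra_simps)
qed

lemma C1_fun_add:
  assumes f: "C1_fun n f g" and f': "C1_fun n f' g'"
  shows "C1_fun n (\<lambda>z. f z + c * f' z) (\<lambda>i z. g i z + c * g' i z)"
  unfolding C1_fun_def
proof (intro conjI allI impI)
  fix z z' :: "nat => real" assume e: "\<forall>i<n. z i = z' i"
  show "f z + c * f' z = f z' + c * f' z'" using C1_funD(1)[OF f, of z z'] C1_funD(1)[OF f', of z z'] e by auto
  fix i assume i: "i < n"
  show "g i z + c * g' i z = g i z' + c * g' i z'"
    using C1_funD(2)[OF f i, of z z'] C1_funD(2)[OF f' i, of z z'] e by auto
next
  show "continuous_on UNIV (\<lambda>z. f z + c * f' z)" by (intro continuous_on_mult continuous_on_const continuous_on_add C1_funD[OF f] C1_funD[OF f'])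
  fix i assume i: "i < n"
  show "continuous_on UNIV (\<lambda>z. g i z + c * g' i z)"
    by (intro continuous_on_mult continuous_on_const continuous_on_add C1_funD[OF f] C1_funD[OF f'] i)
  fix z
  show "((\<lambda>v. f (z(i := v)) + c * f' (z(i := v))) has_real_derivative g i z + c * g' i z) (at (z i))"
    by (intro DERIV_add DERIV_cmult C1_funD(5)[OF f i] C1_funD(5)[OF f' i])
qed

lemma C1_fun_comp:
  assumes f: "C1_fun n f g" and d: "\<And>x. (\<phi> has_real_derivative \<phi>' x) (at x)" and c: "continuous_on UNIV \<phi>'"
  shows "C1_fun n (\<lambda>z. \<phi> (f z)) (\<lambda>i z. \<phi>' (f z) * g i z)"
  unfolding C1_fun_def
proof (intro conjI allI impI)
  have c\<phi>: "continuous_on UNIV \<phi>" using d by (meson DERIV_isCont continuous_at_imp_continuous_on)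
  fix z z' :: "nat => real" assume e: "\<forall>i<n. z i = z' i"
  show "\<phi> (f z) = \<phi> (f z')" using C1_funD(1)[OF f, of z z'] e by auto
  fix i assume i: "i < n"
  show "\<phi>' (f z) * g i z = \<phi>' (f z') * g i z'"
    using C1_funD(1)[OF f, of z z'] C1_funD(2)[OF f i, of z z'] e by auto
next
  have c\<phi>: "continuous_on UNIV \<phi>" using d by (meson DERIV_isCont continuous_at_imp_continuous_on)
  show "continuous_on UNIV (\<lambda>z. \<phi> (f z))" by (rule continuous_on_compose2[OF c\<phi> C1_funD(3)[OF f]]) simp
  fix i assume i: "i < n"
  show "continuous_on UNIV (\<lambda>z. \<phi>' (f z) * g i z)"
    by (intro continuous_on_mult continuous_on_compose2[OF c C1_funD(3)[OF f]] C1_funD[OF f] i) simp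
  fix z
  have "((\<lambda>v. \<phi> (f (z(i := v)))) has_real_derivative \<phi>' (f (z(i := z i))) * g i z) (at (z i))"
    by (rule DERIV_chain2[OF d C1_funD(5)[OF f i]])
  then show "((\<lambda>v. \<phi> (f (z(i := v)))) has_real_derivative \<phi>' (f z) * g i z) (at (z i))" by simp
qed

lemma C1_fun_coord:
  assumes "k < n" shows "C1_fun n (\<lambda>z. z k) (\<lambda>i z. of_bool (i = k))"
  unfolding C1_fun_def
proof (intro conjI allI impI)
  fix i and z :: "nat => real"
  show "((\<lambda>v. (z(i := v)) k) has_real_derivative of_bool (i = k)) (at (z i))"
    by (cases "i = k") simp_all
qed (use assms in \<open>auto intro: continuous_on_product_coordinates\<close>)

lemma C1_fun_const: "C1_fun n (\<lambda>z. c) (\<lambda>i z. 0)"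
  unfolding C1_fun_def by auto

text \<open>Two families of coordinates are joined by placing the second one after the first.\<close>

lemma C1_fun_left:
  assumes f: "C1_fun n f g"
  shows "C1_fun (n + m) f (\<lambda>i. if i < n then g i else (\<lambda>_. 0))"
  unfolding C1_fun_def
proof (intro conjI allI impI)
  fix z z' :: "nat => real" assume e: "\<forall>i<n+m. z i = z' i"
  show "f z = f z'" using C1_funD(1)[OF f, of z z'] e by auto
  fix i assume i: "i < n + m"
  show "(if i < n then g i else (\<lambda>_. 0)) z = (if i < n then g i else (\<lambda>_. 0)) z'"
    using C1_funD(2)[OF f, of i z z'] e by auto
next
  show "continuous_on UNIV f" by (rule C1_funD(3)[OF f])
  fix i assume i: "i < n + m"
  show "continuous_on UNIV (if i < n then g i else (\<lambda>_. 0))" using C1_funD(4)[OF f, of i] by auto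
  fix z
  show "((\<lambda>v. f (z(i := v))) has_real_derivative (if i < n then g i else (\<lambda>_. 0)) z) (at (z i))"
  proof (cases "i < n")
    case True then show ?thesis using C1_funD(5)[OF f True, of z] by simp
  next
    case False
    then have "f (z(i := v)) = f z" for v by (intro C1_funD(1)[OF f]) auto
    then show ?thesis using False by simp
  qed
qed

lemma C1_fun_right:
  assumes f: "C1_fun m f g"
  shows "C1_fun (n + m) (\<lambda>z. f (\<lambda>i. z (n + i))) (\<lambda>i z. if i < n then 0 else g (i - n) (\<lambda>i. z (n + i)))"
  unfolding C1_fun_def
proof (intro conjI allI impI)
  fix z z' :: "nat => real" assume e: "\<forall>i<n+m. z i = z' i"
  show "f (\<lambda>i. z (n + i)) = f (\<lambda>i. z' (n + i))" using e by (intro C1_funD(1)[OF f]) auto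
  fix i assume i: "i < n + m"
  show "(if i < n then 0 else g (i - n) (\<lambda>i. z (n + i))) = (if i < n then 0 else g (i - n) (\<lambda>i. z' (n + i)))"
    using C1_funD(2)[OF f, of "i - n" "\<lambda>i. z (n + i)" "\<lambda>i. z' (n + i)"] e i by auto
next
  have c: "continuous_on UNIV (\<lambda>z i. z (n + i))" for n
    by (rule continuous_on_coordinatewise_then_product) (rule continuous_on_product_coordinates)
  show "continuous_on UNIV (\<lambda>z. f (\<lambda>i. z (n + i)))" by (rule continuous_on_compose2[OF C1_funD(3)[OF f] c]) simp
  fix i assume i: "i < n + m"
  show "continuous_on UNIV (\<lambda>z. if i < n then 0 else g (i - n) (\<lambda>i. z (n + i)))"
    using i by (cases "i < n") (auto intro!: continuous_on_compose2[OF C1_funD(4)[OF f] c])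
  fix z :: "nat => real"
  show "((\<lambda>v. f (\<lambda>j. (z(i := v)) (n + j))) has_real_derivative (if i < n then 0 else g (i - n) (\<lambda>i. z (n + i)))) (at (z i))"
  proof (cases "i < n")
    case True
    then have "(\<lambda>j. (z(i := v)) (n + j)) = (\<lambda>j. z (n + j))" for v by (auto simp: fun_eq_iff)
    then show ?thesis using True by simp
  next
    case False
    then have "(\<lambda>j. (z(i := v)) (n + j)) = (\<lambda>j. z (n + j))(i - n := v)" for v by (auto simp: fun_eq_iff)
    then show ?thesis using False C1_funD(5)[OF f, of "i - n" "\<lambda>j. z (n + j)"] i by simp
  qed
qed

text \<open>The square makes the cut-off continuously differentiable at the edge of its support.\<close>

definition cut :: "real => real" where "cut v = (max 0 (1 - v))\<^sup>2"

lemma cut_deriv: "(cut has_real_derivative - 2 * max 0 (1 - v)) (at v)"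
proof -
  have pos: "((\<lambda>v. (1 - v)\<^sup>2) has_real_derivative - 2 * (1 - v)) (at v within S)" for v :: real and S
    by (auto intro!: derivative_eq_intros)
  consider "v < 1" | "1 < v" | "v = 1" by linarith
  then show ?thesis
  proof cases
    case 1
    have "(cut has_real_derivative - 2 * (1 - v)) (at v)"
      by (rule has_field_derivative_transform_within_open[OF pos, where S="{..<1}"]) (use 1 in \<open>auto simp: cut_def\<close>)
    then show ?thesis using 1 by simp
  next
    case 2
    have "(cut has_real_derivative 0) (at v)"
      by (rule has_field_derivative_transform_within_open[OF DERIV_const[of 0], where S="{1<..}"]) (use 2 in \<open>auto simp: cut_def\<close>)
    then show ?thesis using 2 by simp
  next
    case 3
    have "(cut has_real_derivative 0) (at v)"
      unfolding DERIV_def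
    proof (rule Lim_null_comparison)
      show "\<forall>\<^sub>F h in at 0. norm ((cut (v + h) - cut v) / h) \<le> \<bar>h\<bar>"
      proof (rule always_eventually, rule allI)
        fix h :: real
        have "cut (v + h) \<le> h\<^sup>2" "0 \<le> cut (v + h)" "cut v = 0" using 3 by (auto simp: cut_def max_def)
        then have "\<bar>cut (v + h) - cut v\<bar> \<le> \<bar>h\<bar> * \<bar>h\<bar>" by (simp add: power2_eq_square abs_mult[symmetric])
        then show "norm ((cut (v + h) - cut v) / h) \<le> \<bar>h\<bar>"
          by (cases "h = 0") (auto simp: divide_simps mult.commute)
      qed
      show "((\<lambda>h. \<bar>h\<bar>) \<longlongrightarrow> 0) (at (0::real))" by (auto intro!: tendsto_eq_intros)
    qed
    then show ?thesis using 3 by simp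
  qed
qed

definition cutn :: "nat => real => (nat => real) => real" where
  "cutn n R z = cut ((\<Sum>i<n. (z i)\<^sup>2) / R)"

definition cutn_deriv :: "nat => real => nat => (nat => real) => real" where
  "cutn_deriv n R i z = - 2 * max 0 (1 - (\<Sum>i<n. (z i)\<^sup>2) / R) * (2 * z i / R)"

lemma cutn_C1: "C1_fun n (cutn n R) (cutn_deriv n R)"
proof -
  have sq: "C1_fun n (\<lambda>z. \<Sum>k<j. (z k)\<^sup>2) (\<lambda>i z. of_bool (i < j) * (2 * z i))" if "j \<le> n" for j
    using that
  proof (induction j)
    case 0 then show ?case by (simp add: C1_fun_const)
  next
    case (Suc j)
    then have c: "C1_fun n (\<lambda>z. z j) (\<lambda>i z. of_bool (i = j))" by (intro C1_fun_coord) simp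
    have e: "(\<lambda>i z. of_bool (i < j) * (2 * z i) + 1 * (of_bool (i = j) * z j + z j * of_bool (i = j))) =
      (\<lambda>i (z::nat => real). of_bool (i < Suc j) * (2 * z i))"
      by (intro ext) (auto simp: less_Suc_eq of_bool_def)
    from C1_fun_add[OF Suc.IH C1_fun_mult[OF c c], of 1] Suc.prems
    show ?case unfolding e by (simp add: power2_eq_square add.commute)
  qed
  have d: "((\<lambda>v. cut (v / R)) has_real_derivative - 2 * max 0 (1 - v / R) * (1 / R)) (at v)" for v
    by (rule DERIV_chain2[OF cut_deriv DERIV_cdivide[OF DERIV_ident]])
  have "C1_fun n (\<lambda>z. cut ((\<Sum>k<n. (z k)\<^sup>2) / R)) (\<lambda>i z. - 2 * max 0 (1 - (\<Sum>k<n. (z k)\<^sup>2) / R) * (1 / R) * (of_bool (i < n) * (2 * z i)))"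
    by (rule C1_fun_comp[OF sq[OF order_refl] d]) (unfold divide_inverse, intro continuous_intros)
  then show ?thesis unfolding C1_fun_def cutn_def cutn_deriv_def by simp
qed

lemma cutn_bounds: "0 < R ==> 0 \<le> cutn n R z" "0 < R ==> cutn n R z \<le> 1"
proof -
  assume "0 < R"
  then have "0 \<le> (\<Sum>i<n. (z i)\<^sup>2) / R" by (simp add: sum_nonneg)
  then show "0 \<le> cutn n R z" "cutn n R z \<le> 1" by (auto simp: cutn_def cut_def max_def power_le_one)
qed

lemma cutn_support: "0 < R ==> R \<le> (\<Sum>i<n. (z i)\<^sup>2) ==> cutn n R z = 0 \<and> cutn_deriv n R i z = 0"
proof -
  assume "0 < R" "R \<le> (\<Sum>i<n. (z i)\<^sup>2)"
  then have "1 \<le> (\<Sum>i<n. (z i)\<^sup>2) / R" by (simp add: le_divide_eq)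
  then show ?thesis by (simp add: cutn_def cutn_deriv_def cut_def max_def)
qed

text \<open>On the support \<open>\<bar>z i\<bar> \<le> sqrt R\<close>, so the derivative of the cut-off decays like \<open>1 / sqrt R\<close> and disappears
  together with the cut-off as \<open>R\<close> grows.\<close>

lemma cutn_deriv_bound:
  assumes R: "0 < R" and i: "i < n"
  shows "\<bar>cutn_deriv n R i z\<bar> \<le> 4 / sqrt R"
proof (cases "R \<le> (\<Sum>i<n. (z i)\<^sup>2)")
  case True then show ?thesis using cutn_support[OF R True, of i] R by simp
next
  case False
  let ?S = "\<Sum>i<n. (z i)\<^sup>2"
  have "(z i)\<^sup>2 \<le> ?S" using i by (intro member_le_sum[where f="\<lambda>i. (z i)\<^sup>2"]) auto
  then have "(z i)\<^sup>2 \<le> R" using False by simp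
  then have zi: "\<bar>z i\<bar> \<le> sqrt R" by (metis real_sqrt_abs real_sqrt_le_iff)
  have m: "0 \<le> max 0 (1 - ?S / R)" "max 0 (1 - ?S / R) \<le> 1" using R by (auto simp: sum_nonneg)
  have "\<bar>cutn_deriv n R i z\<bar> = 4 * (max 0 (1 - ?S / R) * \<bar>z i\<bar>) / R"
    using R m by (simp add: cutn_deriv_def abs_mult)
  also have "\<dots> \<le> 4 * (1 * sqrt R) / R"
    using R m zi by (intro divide_right_mono mult_left_mono mult_mono) auto
  also have "\<dots> = 4 * sqrt R / (sqrt R * sqrt R)" using R by simp
  also have "\<dots> = 4 / sqrt R" by (rule nonzero_mult_divide_mult_cancel_right) (use R in simp)
  finally show ?thesis .
qed

lemma cutn_tendsto: "(\<lambda>q. cutn n (real (Suc q)) z) \<longlonglongrightarrow> 1"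
proof -
  have "(\<lambda>q. (\<Sum>i<n. (z i)\<^sup>2) / real (Suc q)) \<longlonglongrightarrow> 0"
    by (rule LIMSEQ_Suc[OF lim_const_over_n])
  moreover have "isCont cut 0" using cut_deriv by (rule DERIV_isCont)
  ultimately have "(\<lambda>q. cut ((\<Sum>i<n. (z i)\<^sup>2) / real (Suc q))) \<longlonglongrightarrow> cut 0" by (rule isCont_tendsto_compose[rotated])
  then show ?thesis by (simp add: cutn_def cut_def)
qed

lemma cutn_cut_bounded:
  assumes f: "C1_loc n f g" and R: "0 < R"
  obtains B where "0 \<le> B" "\<And>z. \<bar>f z * cutn n R z\<bar> \<le> B"
    "\<And>i z. i < n ==> \<bar>g i z * cutn n R z + f z * cutn_deriv n R i z\<bar> \<le> B"
proof -
  obtain B where B: "0 \<le> B" "\<And>z. (\<Sum>i<n. (z i)\<^sup>2) \<le> R ==> \<bar>f z\<bar> \<le> B"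
    "\<And>i z. (\<Sum>i<n. (z i)\<^sup>2) \<le> R ==> i < n ==> \<bar>g i z\<bar> \<le> B" using C1_loc_bound[OF f, of R] by blast
  define B' where "B' = B * 1 + B * (4 / sqrt R)"
  have nn: "0 \<le> B * (4 / sqrt R)" using B(1) R by simp
  show ?thesis
  proof (rule that[of B'])
    show "0 \<le> B'" using B(1) nn by (simp add: B'_def)
    fix z
    have c: "\<bar>cutn n R z\<bar> \<le> 1" using cutn_bounds[OF R, of n z] by simp
    show "\<bar>f z * cutn n R z\<bar> \<le> B'"
    proof (cases "R \<le> (\<Sum>i<n. (z i)\<^sup>2)")
      case True then show ?thesis using cutn_support[OF R True] \<open>0 \<le> B'\<close> by simp
    next
      case False
      then have "\<bar>f z\<bar> * \<bar>cutn n R z\<bar> \<le> B * 1" using B(2)[of z] c B(1) by (intro mult_mono) auto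
      then show ?thesis using nn by (simp add: B'_def abs_mult)
    qed
    fix i assume i: "i < n"
    show "\<bar>g i z * cutn n R z + f z * cutn_deriv n R i z\<bar> \<le> B'"
    proof (cases "R \<le> (\<Sum>i<n. (z i)\<^sup>2)")
      case True then show ?thesis using cutn_support[OF R True] \<open>0 \<le> B'\<close> by simp
    next
      case False
      then have "\<bar>g i z\<bar> * \<bar>cutn n R z\<bar> \<le> B * 1" using B(3)[of z i] c B(1) i by (intro mult_mono) auto
      moreover have "\<bar>f z\<bar> * \<bar>cutn_deriv n R i z\<bar> \<le> B * (4 / sqrt R)"
        using B(2)[of z] cutn_deriv_bound[OF R i, of z] B(1) False by (intro mult_mono) auto
      ultimately have "\<bar>g i z * cutn n R z\<bar> + \<bar>f z * cutn_deriv n R i z\<bar> \<le> B'" by (simp add: B'_def abs_mult)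
      then show ?thesis by (rule order_trans[OF abs_triangle_ineq])
    qed
  qed
qed


lemma sum_lessThan_add: "(\<Sum>i<n + m. F i) = (\<Sum>i<n. F i) + (\<Sum>i<m. F (n + i))" for F :: "nat => real"
  by (induction m) (simp_all add: add.assoc)

context brownian
begin

text \<open>Integration by parts against a cylindrical functional \<open>f (Z)\<close> that is merely integrable: cut
  it off in its own coordinates and remove the cut-off by dominated convergence.\<close>

lemma cylinder_ibp:
  assumes wi: "\<And>i. i < n ==> is_wiener_integral M T W (h i) (I i)" and f: "C1_loc n f g"
    and wi': "\<And>i. i < m ==> is_wiener_integral M T W (h' i) (I' i)" and f': "C1_fun m f' g'"
    and B: "\<And>z. \<bar>f' z\<bar> \<le> B" "\<And>i z. i < m ==> \<bar>g' i z\<bar> \<le> B"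
    and wk: "is_wiener_integral M T W k J"
  defines "Z \<equiv> \<lambda>w i. if i < n then I i w else 0" and "Z' \<equiv> \<lambda>w i. if i < m then I' i w else 0"
    and "dF \<equiv> \<lambda>w. \<Sum>i<n. g i (\<lambda>i. if i < n then I i w else 0) * (inner2 T (h i) k)"
    and "dG \<equiv> \<lambda>w. \<Sum>i<m. g' i (\<lambda>i. if i < m then I' i w else 0) * (inner2 T (h' i) k)"
  assumes BJ: "\<And>w. \<bar>f' (Z' w) * J w\<bar> \<le> B"
    and Fi: "integrable M (\<lambda>w. f (Z w))" and dFi: "integrable M dF"
  shows "(LINT w|M. dF w * f' (Z' w)) = (LINT w|M. f (Z w) * (f' (Z' w) * J w - dG w))"
proof -
  define c where "c i = (inner2 T (h i) k)" for i
  define c' where "c' i = (inner2 T (h' i) k)" for i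
  note f1 = C1_locD[OF f]
  have dF: "dF w = (\<Sum>i<n. g i (Z w) * c i)" for w by (simp add: dF_def Z_def c_def)
  have dG: "dG w = (\<Sum>i<m. g' i (Z' w) * c' i)" for w by (simp add: dG_def Z'_def c'_def)
  define R where "R q = real (Suc q)" for q
  have R: "0 < R q" for q by (simp add: R_def)
  define \<kappa> where "\<kappa> q w = cutn n (R q) (Z w)" for q w
  define e where "e q w = (\<Sum>i<n. cutn_deriv n (R q) i (Z w) * c i)" for q w
  define S where "S q w = f (Z w) * \<kappa> q w * f' (Z' w) * J w - (dF w * \<kappa> q w + f (Z w) * e q w) * f' (Z' w) - f (Z w) * \<kappa> q w * dG w" for q w
  have mZ: "(\<lambda>w. Z w i) \<in> borel_measurable M" for i
    unfolding Z_def using wiener_measurable(1)[OF wi] by (cases "i < n") auto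
  have mZ': "(\<lambda>w. Z' w i) \<in> borel_measurable M" for i
    unfolding Z'_def using wiener_measurable(1)[OF wi'] by (cases "i < m") auto
  note mf = measurable_coords[OF C1_funD(3)[OF f1] mZ] and mg = measurable_coords[OF C1_funD(4)[OF f1] mZ]
  note mf' = measurable_coords[OF C1_funD(3)[OF f'] mZ'] and mg' = measurable_coords[OF C1_funD(4)[OF f'] mZ']
  note mJ = wiener_measurable(1)[OF wk]
  have m\<kappa>: "\<kappa> q \<in> borel_measurable M" for q
    unfolding \<kappa>_def[abs_def] by (rule measurable_coords[OF C1_funD(3)[OF cutn_C1] mZ])
  have mcd: "(\<lambda>w. cutn_deriv n (R q) i (Z w)) \<in> borel_measurable M" if "i < n" for q i
    by (rule measurable_coords[OF C1_funD(4)[OF cutn_C1 that] mZ])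
  have me: "e q \<in> borel_measurable M" for q
    unfolding e_def[abs_def] by (intro borel_measurable_sum borel_measurable_times mcd borel_measurable_const) auto
  have mdG: "dG \<in> borel_measurable M"
    unfolding dG[abs_def] by (intro borel_measurable_sum borel_measurable_times mg' borel_measurable_const) auto
  have mdF: "dF \<in> borel_measurable M" using dFi by auto
  have mS: "S q \<in> borel_measurable M" for q
    unfolding S_def[abs_def]
    by (intro borel_measurable_diff borel_measurable_times borel_measurable_add mf mf' m\<kappa> mJ mdF me mdG)
  have S0: "(LINT w|M. S q w) = 0" for q
  proof -
    define fc where "fc z = f z * cutn n (R q) z" for z
    define gc where "gc i z = g i z * cutn n (R q) z + f z * cutn_deriv n (R q) i z" for i z
    have fcC: "C1_fun n fc gc" unfolding fc_def[abs_def] gc_def[abs_def] by (rule C1_fun_mult[OF f1 cutn_C1])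
    obtain K where K: "0 \<le> K" "\<And>z. \<bar>fc z\<bar> \<le> K" "\<And>i z. i < n ==> \<bar>gc i z\<bar> \<le> K"
      by (rule cutn_cut_bounded[OF f R[of q]], rule that) (auto simp: fc_def gc_def)
    define \<Psi> where "\<Psi> z = fc z * f' (\<lambda>i. z (n + i))" for z :: "nat => real"
    define d\<Psi> where "d\<Psi> i z = (if i < n then gc i else (\<lambda>_. 0)) z * f' (\<lambda>i. z (n + i))
        + fc z * (if i < n then 0 else g' (i - n) (\<lambda>i. z (n + i)))" for i and z :: "nat => real"
    have \<Psi>C: "C1_fun (n + m) \<Psi> d\<Psi>"
      unfolding \<Psi>_def[abs_def] d\<Psi>_def[abs_def] by (rule C1_fun_mult[OF C1_fun_left[OF fcC] C1_fun_right[OF f']])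
    have B0: "0 \<le> B" using B(1)[of "\<lambda>_. 0"] by linarith
    have b1: "\<bar>\<Psi> z\<bar> \<le> K * B" for z
      unfolding \<Psi>_def abs_mult by (intro mult_mono K B) auto
    have b2: "\<bar>d\<Psi> i z\<bar> \<le> K * B" if "i < n + m" for i z
    proof (cases "i < n")
      case True
      then have "\<bar>d\<Psi> i z\<bar> = \<bar>gc i z\<bar> * \<bar>f' (\<lambda>i. z (n + i))\<bar>" by (simp add: d\<Psi>_def abs_mult)
      also have "\<dots> \<le> K * B" by (intro mult_mono K B True) auto
      finally show ?thesis .
    next
      case False
      then have "\<bar>d\<Psi> i z\<bar> = \<bar>fc z\<bar> * \<bar>g' (i - n) (\<lambda>i. z (n + i))\<bar>" by (simp add: d\<Psi>_def abs_mult)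
      also have "\<dots> \<le> K * B" using that False by (intro mult_mono K B) auto
      finally show ?thesis .
    qed
    define h2 where "h2 i = (if i < n then h i else h' (i - n))" for i
    define I2 where "I2 i = (if i < n then I i else I' (i - n))" for i
    have w2: "is_wiener_integral M T W (h2 i) (I2 i)" if "i < n + m" for i
      using wi[of i] wi'[of "i - n"] that by (simp add: h2_def I2_def)
    \<comment> \<open>The coordinates of \<open>f\<close>, followed by those of \<open>f'\<close>.\<close>
    define Z2 where "Z2 w = (\<lambda>i. if i < n + m then I2 i w else 0)" for w
    have fcZ: "fc (Z2 w) = fc (Z w)" for w
      by (rule C1_funD(1)[OF fcC]) (simp add: Z2_def Z_def I2_def)
    have gcZ: "gc i (Z2 w) = gc i (Z w)" if "i < n" for w i
      by (rule C1_funD(2)[OF fcC that]) (simp add: Z2_def Z_def I2_def)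
    have Zr: "(\<lambda>i. Z2 w (n + i)) = Z' w" for w by (auto simp: Z2_def Z'_def I2_def)
    have ibp: "(LINT w|M. \<Psi> (Z2 w) * J w) = (\<Sum>i<n + m. (LINT w|M. d\<Psi> i (Z2 w)) * (inner2 T (h2 i) k))"
      unfolding Z2_def by (rule wiener_ibp[OF w2 wk \<Psi>C b1 b2])
    have mfc: "(\<lambda>w. fc (Z w)) \<in> borel_measurable M" "i < n ==> (\<lambda>w. gc i (Z w)) \<in> borel_measurable M" for i
      by (rule measurable_coords[OF C1_funD(3)[OF fcC] mZ], rule measurable_coords[OF C1_funD(4)[OF fcC] mZ])
    have i1: "integrable M (\<lambda>w. gc i (Z w) * f' (Z' w))" if "i < n" for i
      by (rule integrable_const_bound[of _ "K * B"])
         (use that in \<open>auto intro!: AE_I2 mult_mono K B borel_measurable_times mfc mf' simp: abs_mult K(1)\<close>)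
    have i2: "integrable M (\<lambda>w. fc (Z w) * g' i (Z' w))" if "i < m" for i
      by (rule integrable_const_bound[of _ "K * B"])
         (use that in \<open>auto intro!: AE_I2 mult_mono K B borel_measurable_times mfc mg' simp: abs_mult K(1)\<close>)
    have i3: "integrable M (\<lambda>w. fc (Z w) * (f' (Z' w) * J w))"
      by (rule integrable_const_bound[of _ "K * B"])
         (auto intro!: AE_I2 mult_mono K BJ borel_measurable_times mfc mf' mJ simp: abs_mult[of "fc _"] K(1))
    have "(LINT w|M. fc (Z w) * (f' (Z' w) * J w)) = (LINT w|M. \<Psi> (Z2 w) * J w)"
      by (simp add: \<Psi>_def fcZ Zr mult.assoc)
    also have "\<dots> = (\<Sum>i<n. (LINT w|M. gc i (Z w) * f' (Z' w)) * c i) + (\<Sum>i<m. (LINT w|M. fc (Z w) * g' i (Z' w)) * c' i)"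
      unfolding ibp sum_lessThan_add
      by (intro arg_cong2[of _ _ _ _ "(+)"] sum.cong) (auto simp: d\<Psi>_def gcZ fcZ Zr h2_def c_def c'_def)
    also have "\<dots> = (LINT w|M. (\<Sum>i<n. gc i (Z w) * f' (Z' w) * c i)) + (LINT w|M. (\<Sum>i<m. fc (Z w) * g' i (Z' w) * c' i))"
      using i1 i2 by (simp add: Bochner_Integration.integral_sum)
    finally have eq: "(LINT w|M. fc (Z w) * (f' (Z' w) * J w)) = \<dots>" .
    have "S q w = fc (Z w) * (f' (Z' w) * J w) - ((\<Sum>i<n. gc i (Z w) * f' (Z' w) * c i) + (\<Sum>i<m. fc (Z w) * g' i (Z' w) * c' i))" for w
    proof -
      have "(\<Sum>i<n. gc i (Z w) * f' (Z' w) * c i) = (dF w * \<kappa> q w + f (Z w) * e q w) * f' (Z' w)"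
        unfolding dF e_def gc_def \<kappa>_def by (simp add: sum_distrib_left sum_distrib_right sum.distrib[symmetric] algebra_simps)
      moreover have "(\<Sum>i<m. fc (Z w) * g' i (Z' w) * c' i) = f (Z w) * \<kappa> q w * dG w"
        unfolding dG fc_def \<kappa>_def by (simp add: sum_distrib_left mult.assoc)
      ultimately show ?thesis by (simp add: S_def fc_def \<kappa>_def mult.assoc)
    qed
    moreover have "integrable M (\<lambda>w. \<Sum>i<n. gc i (Z w) * f' (Z' w) * c i)"
      using i1 by (intro Bochner_Integration.integrable_sum integrable_mult_left) auto
    moreover have "integrable M (\<lambda>w. \<Sum>i<m. fc (Z w) * g' i (Z' w) * c' i)"
      using i2 by (intro Bochner_Integration.integrable_sum integrable_mult_left) auto
    ultimately show ?thesis
      using i3 eq by (simp only: Bochner_Integration.integral_diff Bochner_Integration.integral_add Bochner_Integration.integrable_add diff_self)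
  qed
  define Cc where "Cc = (\<Sum>i<n. 4 * \<bar>c i\<bar>)"
  define Cd where "Cd = (\<Sum>i<m. B * \<bar>c' i\<bar>)"
  have B0: "0 \<le> B" using B(1)[of "\<lambda>_. 0"] by linarith
  have Cc0: "0 \<le> Cc" and Cd0: "0 \<le> Cd" using B0 by (simp_all add: Cc_def Cd_def sum_nonneg)
  have eb: "\<bar>e q w\<bar> \<le> Cc / sqrt (R q)" for q w
  proof -
    have "\<bar>e q w\<bar> \<le> (\<Sum>i<n. 4 / sqrt (R q) * \<bar>c i\<bar>)"
      unfolding e_def
    proof (intro order_trans[OF sum_abs] sum_mono)
      fix i assume "i \<in> {..<n}"
      then show "\<bar>cutn_deriv n (R q) i (Z w) * c i\<bar> \<le> 4 / sqrt (R q) * \<bar>c i\<bar>"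
        unfolding abs_mult by (intro mult_right_mono cutn_deriv_bound R) auto
    qed
    then show ?thesis by (simp add: Cc_def sum_divide_distrib)
  qed
  have eb1: "\<bar>e q w\<bar> \<le> Cc" for q w
  proof -
    have "Cc / sqrt (R q) \<le> Cc / 1" using Cc0 by (intro divide_left_mono) (auto simp: R_def)
    then show ?thesis using eb[of q w] by simp
  qed
  have dGb: "\<bar>dG w\<bar> \<le> Cd" for w
    unfolding dG Cd_def by (intro order_trans[OF sum_abs] sum_mono) (auto simp: abs_mult intro!: mult_right_mono B)
  have \<kappa>b: "\<bar>\<kappa> q w\<bar> \<le> 1" for q w using cutn_bounds[OF R, of n q "Z w"] by (simp add: \<kappa>_def)
  have "(\<lambda>q. LINT w|M. S q w) \<longlonglongrightarrow> (LINT w|M. f (Z w) * (f' (Z' w) * J w - dG w) - dF w * f' (Z' w))"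
  proof (rule integral_dominated_convergence[where w = "\<lambda>w. \<bar>f (Z w)\<bar> * (B + Cc * B + Cd) + \<bar>dF w\<bar> * B"])
    show "integrable M (\<lambda>w. \<bar>f (Z w)\<bar> * (B + Cc * B + Cd) + \<bar>dF w\<bar> * B)" using Fi dFi by simp
    show "S q \<in> borel_measurable M" for q by (rule mS)
    show "(\<lambda>w. f (Z w) * (f' (Z' w) * J w - dG w) - dF w * f' (Z' w)) \<in> borel_measurable M"
      by (intro borel_measurable_diff borel_measurable_times mf mf' mJ mdF mdG)
    show "AE w in M. (\<lambda>q. S q w) \<longlonglongrightarrow> f (Z w) * (f' (Z' w) * J w - dG w) - dF w * f' (Z' w)"
    proof (rule AE_I2, goal_cases)
      case (1 w)
      have k1: "(\<lambda>q. \<kappa> q w) \<longlonglongrightarrow> 1" unfolding \<kappa>_def R_def by (rule cutn_tendsto)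
      have "filterlim (\<lambda>q. sqrt (R q)) at_top sequentially"
        unfolding R_def by (intro filterlim_compose[OF sqrt_at_top] filterlim_compose[OF filterlim_real_sequentially] filterlim_Suc)
      then have "(\<lambda>q. Cc / sqrt (R q)) \<longlonglongrightarrow> 0" by (rule tendsto_divide_0[OF tendsto_const filterlim_at_top_imp_at_infinity])
      then have e0: "(\<lambda>q. e q w) \<longlonglongrightarrow> 0" by (rule tendsto_zero_bound[OF eb])
      have "(\<lambda>q. S q w) \<longlonglongrightarrow> f (Z w) * 1 * f' (Z' w) * J w - (dF w * 1 + f (Z w) * 0) * f' (Z' w) - f (Z w) * 1 * dG w"
        unfolding S_def by (intro tendsto_diff tendsto_mult tendsto_add tendsto_const k1 e0)
      then show ?case
        by (simp add: algebra_simps)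
    qed
    show "AE w in M. norm (S q w) \<le> \<bar>f (Z w)\<bar> * (B + Cc * B + Cd) + \<bar>dF w\<bar> * B" for q
    proof (rule AE_I2, goal_cases)
      case (1 w)
      have t1: "\<bar>f (Z w) * \<kappa> q w * f' (Z' w) * J w\<bar> \<le> \<bar>f (Z w)\<bar> * 1 * B"
        using BJ[of w] \<kappa>b[of q w] B0 unfolding mult.assoc[of _ "f' (Z' w)"] by (subst abs_mult, subst abs_mult) (intro mult_mono, auto)
      have t2: "\<bar>dF w * \<kappa> q w * f' (Z' w)\<bar> \<le> \<bar>dF w\<bar> * 1 * B"
        using B(1) \<kappa>b[of q w] B0 unfolding abs_mult by (intro mult_mono) auto
      have t3: "\<bar>f (Z w) * e q w * f' (Z' w)\<bar> \<le> \<bar>f (Z w)\<bar> * Cc * B"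
        using B(1) eb1[of q w] B0 Cc0 unfolding abs_mult by (intro mult_mono) auto
      have t4: "\<bar>f (Z w) * \<kappa> q w * dG w\<bar> \<le> \<bar>f (Z w)\<bar> * 1 * Cd"
        using dGb[of w] \<kappa>b[of q w] Cd0 unfolding abs_mult by (intro mult_mono) auto
      show ?case
        using t1 t2 t3 t4 unfolding S_def real_norm_def distrib_left distrib_right mult.assoc[symmetric] by linarith
    qed
  qed
  then have z: "(LINT w|M. f (Z w) * (f' (Z' w) * J w - dG w) - dF w * f' (Z' w)) = 0"
    using S0 LIMSEQ_unique[OF _ tendsto_const] by simp
  have iA: "integrable M (\<lambda>w. f (Z w) * (f' (Z' w) * J w - dG w))"
  proof (rule Bochner_Integration.integrable_bound)
    show "integrable M (\<lambda>w. (B + Cd) * f (Z w))" using Fi by simp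
    show "(\<lambda>w. f (Z w) * (f' (Z' w) * J w - dG w)) \<in> borel_measurable M"
      by (intro borel_measurable_diff borel_measurable_times mf mf' mJ mdG)
    show "AE w in M. norm (f (Z w) * (f' (Z' w) * J w - dG w)) \<le> norm ((B + Cd) * f (Z w))"
    proof (rule AE_I2, goal_cases)
      case (1 w)
      have "\<bar>f' (Z' w) * J w - dG w\<bar> \<le> B + Cd" using BJ[of w] dGb[of w] by linarith
      from abs_mult_bound[OF this, of "f (Z w)"]
      show ?case
        by (simp only: real_norm_def mult.commute[of "f (Z w)"])
    qed
  qed
  have iB: "integrable M (\<lambda>w. dF w * f' (Z' w))"
  proof (rule Bochner_Integration.integrable_bound)
    show "integrable M (\<lambda>w. B * dF w)" using dFi by simp
    show "(\<lambda>w. dF w * f' (Z' w)) \<in> borel_measurable M" by (intro borel_measurable_times mdF mf')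
    show "AE w in M. norm (dF w * f' (Z' w)) \<le> norm (B * dF w)"
    proof (rule AE_I2, goal_cases)
      case (1 w) then show ?case
        using abs_mult_bound[OF B(1)[of "Z' w"], of "dF w"] by (simp add: mult.commute)
    qed
  qed
  show ?thesis using z iA iB by simp
qed

end


section \<open>Closability of the Malliavin derivative\<close>

lemma C1_loc_const: "C1_loc n (\<lambda>z. c) (\<lambda>i z. 0)"
  unfolding C1_loc_def using C1_fun_const by (auto intro!: exI[of _ "\<bar>c\<bar>"])

lemma C1_loc_add:
  assumes f: "C1_loc n f g" and f': "C1_loc n f' g'"
  shows "C1_loc n (\<lambda>z. f z + c * f' z) (\<lambda>i z. g i z + c * g' i z)"
  unfolding C1_loc_def
proof (intro conjI allI)
  show "C1_fun n (\<lambda>z. f z + c * f' z) (\<lambda>i z. g i z + c * g' i z)"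
    by (rule C1_fun_add[OF C1_locD[OF f] C1_locD[OF f']])
  fix R
  obtain B where B: "\<And>z. (\<Sum>i<n. (z i)\<^sup>2) \<le> R ==> \<bar>f z\<bar> \<le> B" "\<And>i z. (\<Sum>i<n. (z i)\<^sup>2) \<le> R ==> i < n ==> \<bar>g i z\<bar> \<le> B"
    using C1_loc_bound[OF f, of R] by metis
  obtain B' where B': "\<And>z. (\<Sum>i<n. (z i)\<^sup>2) \<le> R ==> \<bar>f' z\<bar> \<le> B'" "\<And>i z. (\<Sum>i<n. (z i)\<^sup>2) \<le> R ==> i < n ==> \<bar>g' i z\<bar> \<le> B'"
    using C1_loc_bound[OF f', of R] by metis
  have t: "\<bar>x + c * y\<bar> \<le> B + \<bar>c\<bar> * B'" if "\<bar>x\<bar> \<le> B" "\<bar>y\<bar> \<le> B'" for x y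
  proof -
    have "\<bar>x + c * y\<bar> \<le> \<bar>x\<bar> + \<bar>c\<bar> * \<bar>y\<bar>" by (rule order_trans[OF abs_triangle_ineq]) (simp add: abs_mult)
    also have "\<dots> \<le> B + \<bar>c\<bar> * B'" using that by (intro add_mono mult_left_mono) auto
    finally show ?thesis .
  qed
  show "\<exists>B. \<forall>z. (\<Sum>i<n. (z i)\<^sup>2) \<le> R \<longrightarrow> \<bar>f z + c * f' z\<bar> \<le> B \<and> (\<forall>i<n. \<bar>g i z + c * g' i z\<bar> \<le> B)"
    by (intro exI[of _ "B + \<bar>c\<bar> * B'"]) (auto intro!: t B B')
qed

lemma C1_loc_lincomb:
  fixes k :: nat
  assumes "\<And>i. i < k ==> C1_loc n (f i) (g i)"
  shows "C1_loc n (\<lambda>z. \<Sum>i<k. f i z * c i) (\<lambda>j z. \<Sum>i<k. g i j z * c i)"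
  using assms
proof (induction k)
  case 0 then show ?case by (simp add: C1_loc_const)
next
  case (Suc k)
  then have "C1_loc n (\<lambda>z. (\<Sum>i<k. f i z * c i) + c k * f k z) (\<lambda>j z. (\<Sum>i<k. g i j z * c i) + c k * g k j z)"
    by (intro C1_loc_add) auto
  then show ?case by (simp add: mult.commute)
qed

lemma C1_loc_arctan:
  assumes f: "C1_loc n f g"
  shows "C1_loc n (\<lambda>z. arctan (f z)) (\<lambda>i z. inverse (1 + (f z)\<^sup>2) * g i z)"
  unfolding C1_loc_def
proof (intro conjI allI)
  have "1 + x\<^sup>2 \<noteq> 0" for x :: real by (metis add_pos_nonneg less_irrefl zero_le_power2 zero_less_one)
  then show "C1_fun n (\<lambda>z. arctan (f z)) (\<lambda>i z. inverse (1 + (f z)\<^sup>2) * g i z)"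
    by (intro C1_fun_comp[OF C1_locD[OF f] DERIV_arctan]) (intro continuous_intros, auto)
  fix R
  obtain B where B: "0 \<le> B" "\<And>z. (\<Sum>i<n. (z i)\<^sup>2) \<le> R ==> \<bar>f z\<bar> \<le> B" "\<And>i z. (\<Sum>i<n. (z i)\<^sup>2) \<le> R ==> i < n ==> \<bar>g i z\<bar> \<le> B"
    using C1_loc_bound[OF f, of R] by metis
  have "\<bar>inverse (1 + (f z)\<^sup>2) * g i z\<bar> \<le> 2 + B" if "(\<Sum>i<n. (z i)\<^sup>2) \<le> R" "i < n" for z i
  proof -
    have "\<bar>inverse (1 + (f z)\<^sup>2)\<bar> \<le> 1" using zero_le_power2[of "f z"] by (simp add: inverse_le_1_iff)
    then have "\<bar>inverse (1 + (f z)\<^sup>2)\<bar> * \<bar>g i z\<bar> \<le> 1 * B" using B(3)[OF that] B(1) by (intro mult_mono) auto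
    then show ?thesis by (simp add: abs_mult)
  qed
  moreover have "\<bar>arctan x\<bar> \<le> 2 + B" for x
    using arctan_bounded[of x] pi_less_4 B(1) by auto
  ultimately show "\<exists>B. \<forall>z. (\<Sum>i<n. (z i)\<^sup>2) \<le> R \<longrightarrow> \<bar>arctan (f z)\<bar> \<le> B \<and> (\<forall>i<n. \<bar>inverse (1 + (f z)\<^sup>2) * g i z\<bar> \<le> B)"
    by (intro exI[of _ "2 + B"]) auto
qed

lemma C1_loc_left:
  assumes f: "C1_loc n f g"
  shows "C1_loc (n + m) f (\<lambda>i. if i < n then g i else (\<lambda>_. 0))"
  unfolding C1_loc_def
proof (intro conjI allI)
  show "C1_fun (n + m) f (\<lambda>i. if i < n then g i else (\<lambda>_. 0))" by (rule C1_fun_left[OF C1_locD[OF f]])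
  fix R
  obtain B where B: "0 \<le> B" "\<And>z. (\<Sum>i<n. (z i)\<^sup>2) \<le> R ==> \<bar>f z\<bar> \<le> B" "\<And>i z. (\<Sum>i<n. (z i)\<^sup>2) \<le> R ==> i < n ==> \<bar>g i z\<bar> \<le> B"
    using C1_loc_bound[OF f, of R] by metis
  have "(\<Sum>i<n. (z i)\<^sup>2) \<le> R" if "(\<Sum>i<n + m. (z i)\<^sup>2) \<le> R" for z
  proof -
    have "(\<Sum>i<n. (z i)\<^sup>2) \<le> (\<Sum>i<n + m. (z i)\<^sup>2)" by (rule sum_mono2) auto
    with that show ?thesis by simp
  qed
  then show "\<exists>B. \<forall>z. (\<Sum>i<n + m. (z i)\<^sup>2) \<le> R \<longrightarrow> \<bar>f z\<bar> \<le> B \<and> (\<forall>i<n + m. \<bar>(if i < n then g i else (\<lambda>_. 0)) z\<bar> \<le> B)"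
    using B by (intro exI[of _ B]) auto
qed

lemma C1_loc_right:
  assumes f: "C1_loc m f g"
  shows "C1_loc (n + m) (\<lambda>z. f (\<lambda>i. z (n + i))) (\<lambda>i z. if i < n then 0 else g (i - n) (\<lambda>i. z (n + i)))"
  unfolding C1_loc_def
proof (intro conjI allI)
  show "C1_fun (n + m) (\<lambda>z. f (\<lambda>i. z (n + i))) (\<lambda>i z. if i < n then 0 else g (i - n) (\<lambda>i. z (n + i)))"
    by (rule C1_fun_right[OF C1_locD[OF f]])
  fix R
  obtain B where B: "0 \<le> B" "\<And>z. (\<Sum>i<m. (z i)\<^sup>2) \<le> R ==> \<bar>f z\<bar> \<le> B" "\<And>i z. (\<Sum>i<m. (z i)\<^sup>2) \<le> R ==> i < m ==> \<bar>g i z\<bar> \<le> B"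
    using C1_loc_bound[OF f, of R] by metis
  have "(\<Sum>i<m. (z (n + i))\<^sup>2) \<le> R" if "(\<Sum>i<n + m. (z i)\<^sup>2) \<le> R" for z
    using that sum_nonneg[of "{..<n}" "\<lambda>i. (z i)\<^sup>2"] by (simp add: sum_lessThan_add)
  then show "\<exists>B. \<forall>z. (\<Sum>i<n + m. (z i)\<^sup>2) \<le> R \<longrightarrow> \<bar>f (\<lambda>i. z (n + i))\<bar> \<le> B \<and> (\<forall>i<n + m. \<bar>if i < n then 0 else g (i - n) (\<lambda>i. z (n + i))\<bar> \<le> B)"
    using B by (intro exI[of _ B]) auto
qed

text \<open>The second derivatives occur because the test functional of the closability argument is built from
  the derivative of a cylindrical functional.\<close>

definition C2_loc :: "nat => ((nat => real) => real) => (nat => (nat => real) => real) => bool" where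
  "C2_loc n f g \<longleftrightarrow> C1_loc n f g \<and> (\<exists>gg. \<forall>i<n. C1_loc n (g i) (gg i))"

lemma C2_loc_add:
  assumes f: "C2_loc n f g" and f': "C2_loc n f' g'"
  shows "C2_loc n (\<lambda>z. f z + c * f' z) (\<lambda>i z. g i z + c * g' i z)"
proof -
  obtain gg gg' where "\<And>i. i < n ==> C1_loc n (g i) (gg i)" "\<And>i. i < n ==> C1_loc n (g' i) (gg' i)"
    using f f' unfolding C2_loc_def by auto
  then have "\<forall>i<n. C1_loc n (\<lambda>z. g i z + c * g' i z) (\<lambda>j z. gg i j z + c * gg' i j z)"
    by (auto intro: C1_loc_add)
  then show ?thesis using f f' C1_loc_add unfolding C2_loc_def by (intro conjI exI) auto
qed

lemma C2_loc_left:
  assumes f: "C2_loc n f g"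
  shows "C2_loc (n + m) f (\<lambda>i. if i < n then g i else (\<lambda>_. 0))"
proof -
  obtain gg where gg: "\<And>i. i < n ==> C1_loc n (g i) (gg i)" using f unfolding C2_loc_def by auto
  define h where "h i = (if i < n then (\<lambda>j. if j < n then gg i j else (\<lambda>_. 0)) else (\<lambda>j z. 0))" for i
  have "C1_loc (n + m) (if i < n then g i else (\<lambda>_. 0)) (h i)" for i
    using C1_loc_left[OF gg, of i m] C1_loc_const by (cases "i < n") (auto simp: h_def)
  moreover have "C1_loc (n + m) f (\<lambda>i. if i < n then g i else (\<lambda>_. 0))"
    using f C1_loc_left unfolding C2_loc_def by blast
  ultimately show ?thesis unfolding C2_loc_def by blast
qed

lemma C2_loc_right:
  assumes f: "C2_loc m f g"
  shows "C2_loc (n + m) (\<lambda>z. f (\<lambda>i. z (n + i))) (\<lambda>i z. if i < n then 0 else g (i - n) (\<lambda>i. z (n + i)))"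
proof -
  obtain gg where gg: "\<And>i. i < m ==> C1_loc m (g i) (gg i)" using f unfolding C2_loc_def by auto
  define h where "h i = (if i < n then (\<lambda>j z. 0) else (\<lambda>j z. if j < n then 0 else gg (i - n) (j - n) (\<lambda>i. z (n + i))))" for i
  have "C1_loc (n + m) (\<lambda>z. if i < n then 0 else g (i - n) (\<lambda>i. z (n + i))) (h i)" if "i < n + m" for i
  proof (cases "i < n")
    case True then show ?thesis by (simp add: h_def C1_loc_const)
  next
    case False
    then have "i - n < m" using that by simp
    from C1_loc_right[OF gg[OF this], of n] False show ?thesis by (simp add: h_def)
  qed
  then show ?thesis using f C1_loc_right unfolding C2_loc_def by blast
qed

definition L1_conv :: "'w measure => (nat => 'w => real) => bool" where
  "L1_conv M F \<longleftrightarrow> (\<forall>k. integrable M (F k)) \<and> (\<lambda>k. LINT w|M. \<bar>F k w\<bar>) \<longlonglongrightarrow> 0"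

lemma L1_conv_mult_bounded:
  fixes F :: "nat => 'w => real"
  assumes F: "L1_conv M F" and G: "G \<in> borel_measurable M" "\<And>w. \<bar>G w\<bar> \<le> B"
  shows "(\<lambda>k. LINT w|M. F k w * G w) \<longlonglongrightarrow> 0"
proof (rule tendsto_zero_bound)
  show "(\<lambda>k. B * (LINT w|M. \<bar>F k w\<bar>)) \<longlonglongrightarrow> 0"
    using tendsto_mult[OF tendsto_const, of "\<lambda>k. LINT w|M. \<bar>F k w\<bar>" 0 sequentially B] F by (simp add: L1_conv_def)
  fix k
  have Fk: "integrable M (F k)" using F by (simp add: L1_conv_def)
  have b: "\<bar>F k w * G w\<bar> \<le> B * \<bar>F k w\<bar>" for w
    unfolding abs_mult using G(2)[of w] by (subst mult.commute) (intro mult_right_mono, auto)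
  have i: "integrable M (\<lambda>w. F k w * G w)"
  proof (rule Bochner_Integration.integrable_bound)
    show "integrable M (\<lambda>w. B * \<bar>F k w\<bar>)" using Fk by simp
    show "AE w in M. norm (F k w * G w) \<le> norm (B * \<bar>F k w\<bar>)" using b by (intro AE_I2) (simp, metis abs_ge_self order_trans)
  qed (use Fk G in auto)
  have "\<bar>LINT w|M. F k w * G w\<bar> \<le> (LINT w|M. \<bar>F k w * G w\<bar>)" by (rule integral_abs_bound)
  also have "\<dots> \<le> (LINT w|M. B * \<bar>F k w\<bar>)" by (rule integral_mono) (use i Fk b in auto)
  finally show "\<bar>LINT w|M. F k w * G w\<bar> \<le> B * (LINT w|M. \<bar>F k w\<bar>)" by simp
qed

lemma sigma_finite_leb_on: "sigma_finite_measure (leb T)"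
  using finite_leb_on finite_measure.axioms(1) by blast

context brownian
begin

text \<open>A smooth cylindrical functional with the number of derivatives that closability uses. Coordinates
  beyond \<open>n\<close> are set to \<open>0\<close>, since integrals with those indices carry no information.\<close>

definition cyl :: "nat => ((nat => real) => real) => (nat => (nat => real) => real) => (nat => real => real) => (nat => 'w => real)
    => ('w => real) => ('w => real => real) => bool" where
  "cyl n f g h I F DF \<longleftrightarrow> C2_loc n f g \<and> (\<forall>i<n. is_wiener_integral M T W (h i) (I i)) \<and>
     (\<forall>w. F w = f (\<lambda>i. if i < n then I i w else 0)) \<and>
     (\<forall>w r. DF w r = (\<Sum>i<n. g i (\<lambda>i. if i < n then I i w else 0) * h i r))"

text \<open>The difference of two cylindrical functionals is cylindrical in the joined family of coordinates.\<close>

lemma cyl_diff: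
  assumes c: "cyl n f g h I F DF" and c': "cyl m f' g' h' I' F' DF'"
  shows "\<exists>n f g h I. cyl n f g h I (\<lambda>w. F w - F' w) (\<lambda>w r. DF w r - DF' w r)"
proof -
  define f2 where "f2 z = f z + (-1) * f' (\<lambda>i. z (n + i))" for z :: "nat => real"
  define g2 where "g2 i z = (if i < n then g i else (\<lambda>_. 0)) z + (-1) * (if i < n then 0 else g' (i - n) (\<lambda>i. z (n + i)))" for i and z :: "nat => real"
  define h2 where "h2 i = (if i < n then h i else h' (i - n))" for i
  define I2 where "I2 i = (if i < n then I i else I' (i - n))" for i
  define Z where "Z w = (\<lambda>i. if i < n then I i w else 0)" for w
  define Z' where "Z' w = (\<lambda>i. if i < m then I' i w else 0)" for w
  define Z2 where "Z2 w = (\<lambda>i. if i < n + m then I2 i w else 0)" for w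
  have f: "C2_loc n f g" and f': "C2_loc m f' g'" using c c' by (auto simp: cyl_def)
  have f1: "C1_fun n f g" using f by (simp add: C2_loc_def C1_loc_def)
  have "C2_loc (n + m) f2 g2"
    unfolding f2_def[abs_def] g2_def[abs_def] by (rule C2_loc_add[OF C2_loc_left[OF f] C2_loc_right[OF f']])
  moreover have "is_wiener_integral M T W (h2 i) (I2 i)" if "i < n + m" for i
    using c c' that by (auto simp: cyl_def h2_def I2_def)
  moreover have fZ: "f (Z2 w) = f (Z w)" for w by (rule C1_funD(1)[OF f1]) (simp add: Z2_def Z_def I2_def)
  moreover have gZ: "g i (Z2 w) = g i (Z w)" if "i < n" for i w
    by (rule C1_funD(2)[OF f1 that]) (simp add: Z2_def Z_def I2_def)
  moreover have Zr: "(\<lambda>i. Z2 w (n + i)) = Z' w" for w by (auto simp: Z2_def Z'_def I2_def)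
  moreover have "F w - F' w = f2 (Z2 w)" for w
    using c c' by (simp add: cyl_def f2_def fZ Zr Z_def Z'_def)
  moreover have "DF w r - DF' w r = (\<Sum>i<n + m. g2 i (Z2 w) * h2 i r)" for w r
  proof -
    have "DF w r = (\<Sum>i<n. g i (Z w) * h i r)" "DF' w r = (\<Sum>i<m. g' i (Z' w) * h' i r)"
      using c c' by (simp_all add: cyl_def Z_def Z'_def)
    then show ?thesis unfolding sum_lessThan_add by (simp add: g2_def h2_def gZ Zr sum_negf)
  qed
  ultimately show ?thesis
    unfolding cyl_def Z2_def by (intro exI[of _ "n + m"] exI[of _ f2] exI[of _ g2] exI[of _ h2] exI[of _ I2]) simp
qed

text \<open>If cylindrical functionals tend to \<open>0\<close> while their derivatives converge to \<open>\<eta>\<close>, then each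
  \<open>H = \<langle>\<eta>, k\<rangle>\<close> vanishes. Integration by parts gives \<open>E[H G] = 0\<close> for every bounded cylindrical
  \<open>G\<close> with bounded derivative and bounded \<open>G W(k)\<close>. Since \<open>H\<close> is itself a limit of cylindrical
  functionals, namely of the derivatives in direction \<open>k\<close>, the choice
  \<open>G = arctan H\<^sub>m\<close>, cut off, is available, and in the limit \<open>E[H arctan H] = 0\<close>.\<close>

lemma closable_direction:
  assumes cy: "\<And>q. cyl (n q) (f q) (g q) (h q) (I q) (F q) (D q)"
    and F: "L1_conv M F"
    and k: "is_wiener_integral M T W k J"
    and Hi: "integrable M H"
    and HL: "L1_conv M (\<lambda>q w. (\<Sum>i<n q. g q i (\<lambda>i. if i < n q then I q i w else 0) * (inner2 T (h q i) k)) - H w)"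
  shows "AE w in M. H w = 0"
proof -
  define Z where "Z q w = (\<lambda>i. if i < n q then I q i w else 0)" for q w
  define c where "c q i = (inner2 T (h q i) k)" for q i
  define Hq where "Hq q w = (\<Sum>i<n q. g q i (Z q w) * c q i)" for q w
  have HL': "L1_conv M (\<lambda>q w. Hq q w - H w)" using HL by (simp add: Hq_def[abs_def] Z_def c_def)
  have Hqi: "integrable M (Hq q)" for q
  proof -
    have "integrable M (\<lambda>w. (Hq q w - H w) + H w)" using HL' Hi unfolding L1_conv_def by (intro Bochner_Integration.integrable_add) auto
    then show ?thesis by simp
  qed
  have wi: "i < n q ==> is_wiener_integral M T W (h q i) (I q i)" for q i using cy by (simp add: cyl_def)
  have f1: "C1_loc (n q) (f q) (g q)" for q using cy by (simp add: cyl_def C2_loc_def)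
  have FZ: "F q w = f q (Z q w)" for q w using cy by (simp add: cyl_def Z_def)
  have "\<exists>gg. \<forall>i<n q. C1_loc (n q) (g q i) (gg i)" for q using cy by (simp add: cyl_def C2_loc_def)
  then obtain gg where gg: "\<And>q i. i < n q ==> C1_loc (n q) (g q i) (gg q i)" by metis
  note mJ = wiener_measurable(1)[OF k]
  have test: "(LINT w|M. H w * (arctan (Hq m w) * cutn (Suc (n m)) R (\<lambda>i. if i < n m then I m i w else if i = n m then J w else 0))) = 0"
    if R: "0 < R" for m R
  proof -
    define a where "a z = (\<Sum>i<n m. g m i z * c m i)" for z
    define a' where "a' j z = (\<Sum>i<n m. gg m i j z * c m i)" for j z
    define N where "N = n m + 1"
    have aC: "C1_loc N (\<lambda>z. arctan (a z)) (\<lambda>i. if i < n m then (\<lambda>z. inverse (1 + (a z)\<^sup>2) * a' i z) else (\<lambda>_. 0))"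
      unfolding N_def a_def[abs_def] a'_def[abs_def]
      by (rule C1_loc_left[OF C1_loc_arctan[OF C1_loc_lincomb]]) (rule gg)
    define G where "G z = arctan (a z) * cutn N R z" for z
    define G' where "G' i z = (if i < n m then (\<lambda>z. inverse (1 + (a z)\<^sup>2) * a' i z) else (\<lambda>_. 0)) z * cutn N R z + arctan (a z) * cutn_deriv N R i z" for i z
    have GC: "C1_fun N G G'" unfolding G_def[abs_def] G'_def[abs_def] by (rule C1_fun_mult[OF C1_locD[OF aC] cutn_C1])
    obtain B where B: "0 \<le> B" "\<And>z. \<bar>G z\<bar> \<le> B" "\<And>i z. i < N ==> \<bar>G' i z\<bar> \<le> B"
      by (rule cutn_cut_bounded[OF aC R], rule that, assumption, simp only: G_def, simp only: G'_def)
    define h' where "h' i = (if i < n m then h m i else k)" for i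
    define I' where "I' i = (if i < n m then I m i else J)" for i
    have wi': "is_wiener_integral M T W (h' i) (I' i)" if "i < N" for i
      using wi k that by (auto simp: h'_def I'_def)
    define Z' where "Z' w = (\<lambda>i. if i < N then I' i w else 0)" for w
    \<comment> \<open>\<open>\<bar>arctan\<bar> \<le> 2\<close>, and \<open>\<bar>J\<bar> \<le> sqrt R\<close> on the support of the cut-off, because \<open>J\<close> is its last coordinate.\<close>
    define B2 where "B2 = B + 2 * sqrt R"
    have B2: "B \<le> B2" using R by (simp add: B2_def)
    have GJ: "\<bar>G (Z' w) * J w\<bar> \<le> B2" for w
    proof (cases "R \<le> (\<Sum>i<N. (Z' w i)\<^sup>2)")
      case True then show ?thesis using cutn_support[OF R True] B(1) B2 by (simp add: G_def)
    next
      case False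
      have "(Z' w (n m))\<^sup>2 \<le> (\<Sum>i<N. (Z' w i)\<^sup>2)" by (intro member_le_sum[where f="\<lambda>i. (Z' w i)\<^sup>2"]) (auto simp: N_def)
      then have "(J w)\<^sup>2 \<le> R" using False by (simp add: Z'_def N_def I'_def)
      then have j: "\<bar>J w\<bar> \<le> sqrt R" by (metis real_sqrt_abs real_sqrt_le_iff)
      have "\<bar>G (Z' w)\<bar> \<le> 2 * 1"
        unfolding G_def abs_mult using arctan_bounded[of "a (Z' w)"] pi_less_4 cutn_bounds[OF R, of N "Z' w"]
        by (intro mult_mono) auto
      then have "\<bar>G (Z' w)\<bar> * \<bar>J w\<bar> \<le> 2 * sqrt R" using j by (intro mult_mono) auto
      then show ?thesis using B(1) by (simp add: B2_def abs_mult)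
    qed
    have Gb: "\<bar>G z\<bar> \<le> B2" "i < N ==> \<bar>G' i z\<bar> \<le> B2" for i z using B(2)[of z] B(3)[of i z] B2 by linarith+
    define dG where "dG w = (\<Sum>i<N. G' i (Z' w) * (inner2 T (h' i) k))" for w
    have ibp: "(LINT w|M. Hq q w * G (Z' w)) = (LINT w|M. F q w * (G (Z' w) * J w - dG w))" for q
      unfolding Hq_def Z_def c_def FZ dG_def Z'_def
      by (rule cylinder_ibp[OF wi f1 wi' GC Gb k])
         (use GJ F Hqi[of q] in \<open>simp_all add: Z'_def L1_conv_def FZ[abs_def] Z_def Hq_def[abs_def] c_def\<close>)
    have mZ': "(\<lambda>w. Z' w i) \<in> borel_measurable M" for i
      unfolding Z'_def using wiener_measurable(1)[OF wi'] by (cases "i < N") auto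
    note mG = measurable_coords[OF C1_funD(3)[OF GC] mZ'] and mG' = measurable_coords[OF C1_funD(4)[OF GC] mZ']
    have mdG: "dG \<in> borel_measurable M"
      unfolding dG_def[abs_def] by (intro borel_measurable_sum borel_measurable_times mG' borel_measurable_const) auto
    have dGb: "\<bar>dG w\<bar> \<le> (\<Sum>i<N. B2 * \<bar>LINT r|leb T. h' i r * k r\<bar>)" for w
      unfolding dG_def by (intro order_trans[OF sum_abs] sum_mono) (auto simp: abs_mult intro!: mult_right_mono Gb)
    have "(\<lambda>q. LINT w|M. F q w * (G (Z' w) * J w - dG w)) \<longlonglongrightarrow> 0"
    proof (rule L1_conv_mult_bounded[OF F])
      show "(\<lambda>w. G (Z' w) * J w - dG w) \<in> borel_measurable M" by (intro borel_measurable_diff borel_measurable_times mG mJ mdG)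
      show "\<bar>G (Z' w) * J w - dG w\<bar> \<le> B2 + (\<Sum>i<N. B2 * \<bar>LINT r|leb T. h' i r * k r\<bar>)" for w
        using GJ[of w] dGb[of w] by linarith
    qed
    then have l1: "(\<lambda>q. LINT w|M. Hq q w * G (Z' w)) \<longlonglongrightarrow> 0" by (simp add: ibp)
    have l2: "(\<lambda>q. LINT w|M. (Hq q w - H w) * G (Z' w)) \<longlonglongrightarrow> 0"
      by (rule L1_conv_mult_bounded[OF HL' mG Gb(1)])
    have Gi: "integrable M (\<lambda>w. X w * G (Z' w))" if X: "integrable M X" for X
    proof (rule Bochner_Integration.integrable_bound)
      show "integrable M (\<lambda>w. B2 * X w)" using X by simp
      show "AE w in M. norm (X w * G (Z' w)) \<le> norm (B2 * X w)"
      proof (rule AE_I2, goal_cases)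
        case (1 w) then show ?case
          using abs_mult_bound[OF Gb(1)[of "Z' w"], of "X w"] by (simp add: mult.commute)
      qed
    qed (use X mG in auto)
    have "(LINT w|M. (Hq q w - H w) * G (Z' w)) = (LINT w|M. Hq q w * G (Z' w)) - (LINT w|M. H w * G (Z' w))" for q
      using Gi[OF Hqi] Gi[OF Hi] by (simp add: left_diff_distrib)
    with l2 have "(\<lambda>q. (LINT w|M. Hq q w * G (Z' w)) - (LINT w|M. H w * G (Z' w))) \<longlonglongrightarrow> 0" by simp
    then have "(\<lambda>q. LINT w|M. Hq q w * G (Z' w)) \<longlonglongrightarrow> (LINT w|M. H w * G (Z' w))" by (simp only: LIM_zero_iff)
    with l1 have "(LINT w|M. H w * G (Z' w)) = 0" using LIMSEQ_unique by blast
    moreover have "a (Z' w) = Hq m w" for w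
    proof -
      have "g m i (Z' w) = g m i (Z m w)" if "i < n m" for i
        by (rule C1_funD(2)[OF C1_locD[OF f1] that]) (simp add: Z'_def Z_def N_def I'_def)
      then show ?thesis by (simp add: a_def Hq_def)
    qed
    moreover have "Z' w = (\<lambda>i. if i < n m then I m i w else if i = n m then J w else 0)" for w
      by (auto simp: Z'_def N_def I'_def fun_eq_iff)
    ultimately show ?thesis by (simp add: G_def N_def)
  qed
  have arc: "\<bar>arctan x\<bar> \<le> 2" for x using arctan_bounded[of x] pi_less_4 by auto
  have mHq: "(\<lambda>w. arctan (Hq m w)) \<in> borel_measurable M" for m
    using borel_measurable_integrable[OF Hqi[of m]] by measurable
  have t2: "(LINT w|M. H w * arctan (Hq m w)) = 0" for m
  proof -
    define Y where "Y w = (\<lambda>i. if i < n m then I m i w else if i = n m then J w else 0)" for w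
    have mY: "(\<lambda>w. Y w i) \<in> borel_measurable M" for i
      unfolding Y_def using wiener_measurable(1)[OF wi] mJ by (cases "i < n m"; cases "i = n m") auto
    have mc: "(\<lambda>w. cutn (Suc (n m)) R (Y w)) \<in> borel_measurable M" for R
      by (rule measurable_coords[OF C1_funD(3)[OF cutn_C1] mY])
    have "(\<lambda>q. LINT w|M. H w * (arctan (Hq m w) * cutn (Suc (n m)) (real (Suc q)) (Y w))) \<longlonglongrightarrow> (LINT w|M. H w * arctan (Hq m w))"
    proof (rule integral_dominated_convergence[where w = "\<lambda>w. 2 * \<bar>H w\<bar>"])
      show "AE w in M. (\<lambda>q. H w * (arctan (Hq m w) * cutn (Suc (n m)) (real (Suc q)) (Y w))) \<longlonglongrightarrow> H w * arctan (Hq m w)"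
      proof (rule AE_I2, goal_cases)
        case (1 w)
        have "(\<lambda>q. H w * (arctan (Hq m w) * cutn (Suc (n m)) (real (Suc q)) (Y w))) \<longlonglongrightarrow> H w * (arctan (Hq m w) * 1)"
          by (intro tendsto_mult tendsto_const cutn_tendsto)
        then show ?case by simp
      qed
      show "AE w in M. norm (H w * (arctan (Hq m w) * cutn (Suc (n m)) (real (Suc q)) (Y w))) \<le> 2 * \<bar>H w\<bar>" for q
      proof (rule AE_I2, goal_cases)
        case (1 w)
        have "\<bar>arctan (Hq m w)\<bar> * \<bar>cutn (Suc (n m)) (real (Suc q)) (Y w)\<bar> \<le> 2 * 1"
          using cutn_bounds[of "real (Suc q)" "Suc (n m)" "Y w"] by (intro mult_mono arc) auto
        then have "\<bar>H w\<bar> * (\<bar>arctan (Hq m w)\<bar> * \<bar>cutn (Suc (n m)) (real (Suc q)) (Y w)\<bar>) \<le> \<bar>H w\<bar> * 2"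
          by (intro mult_left_mono) auto
        then show ?case by (simp add: abs_mult)
      qed
    qed (use Hi mHq mc in auto)
    moreover have "(LINT w|M. H w * (arctan (Hq m w) * cutn (Suc (n m)) (real (Suc q)) (Y w))) = 0" for q
      unfolding Y_def by (rule test) simp
    ultimately show ?thesis using LIMSEQ_unique[OF _ tendsto_const] by simp
  qed
  have "\<exists>s. strict_mono s \<and> (AE w in M. (\<lambda>q. Hq (s q) w - H w) \<longlonglongrightarrow> 0)"
    using HL' unfolding L1_conv_def by (intro tendsto_L1_AE_subseq) auto
  then obtain s where s: "AE w in M. (\<lambda>q. Hq (s q) w - H w) \<longlonglongrightarrow> 0" by blast
  have "(\<lambda>q. LINT w|M. H w * arctan (Hq (s q) w)) \<longlonglongrightarrow> (LINT w|M. H w * arctan (H w))"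
  proof (rule integral_dominated_convergence[where w = "\<lambda>w. 2 * \<bar>H w\<bar>"])
    show "AE w in M. (\<lambda>q. H w * arctan (Hq (s q) w)) \<longlonglongrightarrow> H w * arctan (H w)"
      using s by eventually_elim (intro tendsto_mult tendsto_const tendsto_arctan, simp add: LIM_zero_iff)
    show "AE w in M. norm (H w * arctan (Hq (s q) w)) \<le> 2 * \<bar>H w\<bar>" for q
      using arc by (intro AE_I2) (simp add: abs_mult mult.commute[of 2] mult_left_mono)
  qed (use Hi mHq in auto)
  then have z: "(LINT w|M. H w * arctan (H w)) = 0" using t2 LIMSEQ_unique[OF _ tendsto_const] by simp
  have nn: "0 \<le> x * arctan x" for x :: real
    by (cases "0 \<le> x") (simp_all add: mult_nonpos_nonpos)
  have "integrable M (\<lambda>w. H w * arctan (H w))"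
  proof (rule Bochner_Integration.integrable_bound)
    show "integrable M (\<lambda>w. 2 * \<bar>H w\<bar>)" using Hi by simp
    show "AE w in M. norm (H w * arctan (H w)) \<le> norm (2 * \<bar>H w\<bar>)"
      using arc by (intro AE_I2) (simp add: abs_mult mult.commute[of 2] mult_left_mono)
  qed (use Hi in auto)
  then have "AE w in M. H w * arctan (H w) = 0"
    using z nn by (subst (asm) integral_nonneg_eq_0_iff_AE) auto
  then show ?thesis by eventually_elim auto
qed

end


section \<open>Uniqueness of the Malliavin derivative\<close>

lemma foldr_partial_deriv_coords:
  assumes f: "\<And>z z'. (\<And>i. i < n ==> z i = z' i) ==> f z = f z'" and js: "set js \<subseteq> {..<n}"
    and z: "\<And>i. i < n ==> z i = z' i"
  shows "foldr partial_deriv js f z = foldr partial_deriv js f z'"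
  using js z
proof (induction js arbitrary: z z')
  case Nil then show ?case using f[of z z'] by simp
next
  case (Cons j js)
  have "foldr partial_deriv js f (z(j := v)) = foldr partial_deriv js f (z'(j := v))" for v
    using Cons.prems by (intro Cons.IH) auto
  moreover have "z j = z' j" using Cons.prems by auto
  ultimately show ?case by (simp only: foldr.simps o_apply partial_deriv_def[of j "foldr partial_deriv js f"])
qed

text \<open>Polynomial growth bounds every iterated partial derivative on balls, because
  \<open>\<Sum>\<bar>z i\<bar> \<le> n + \<Sum>(z i)\<^sup>2\<close>.\<close>

lemma smooth_poly_growth_C1:
  assumes f: "smooth_poly_growth n f" and js: "set js \<subseteq> {..<n}"
  shows "C1_loc n (foldr partial_deriv js f) (\<lambda>i. foldr partial_deriv (i # js) f)"
proof -
  have dep: "f z = f z'" if "\<And>i. i < n ==> z i = z' i" for z z'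
    using f that unfolding smooth_poly_growth_def by blast
  have A: "continuous_on UNIV (foldr partial_deriv ks f)"
    "i < n ==> (\<lambda>v. foldr partial_deriv ks f (z(i := v))) field_differentiable at (z i)"
    "\<exists>C (m::nat). \<forall>z. \<bar>foldr partial_deriv ks f z\<bar> \<le> C * (1 + (\<Sum>i<n. \<bar>z i\<bar>)) ^ m" if "set ks \<subseteq> {..<n}" for ks i z
    using f that unfolding smooth_poly_growth_def Let_def by blast+
  have bd: "\<exists>B. \<forall>z. (\<Sum>i<n. (z i)\<^sup>2) \<le> R \<longrightarrow> \<bar>foldr partial_deriv ks f z\<bar> \<le> B" if ks: "set ks \<subseteq> {..<n}" for ks R
  proof -
    obtain C and m :: nat where C: "\<And>z. \<bar>foldr partial_deriv ks f z\<bar> \<le> C * (1 + (\<Sum>i<n. \<bar>z i\<bar>)) ^ m"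
      using A(3)[OF ks] by blast
    have "\<bar>foldr partial_deriv ks f z\<bar> \<le> \<bar>C\<bar> * (1 + (real n + R)) ^ m" if z: "(\<Sum>i<n. (z i)\<^sup>2) \<le> R" for z
    proof -
      have "\<bar>x\<bar> \<le> 1 + x\<^sup>2" for x :: real
        using sum_squares_bound[of "\<bar>x\<bar>" 1] by simp
      then have "(\<Sum>i<n. \<bar>z i\<bar>) \<le> (\<Sum>i<n. 1 + (z i)\<^sup>2)" by (intro sum_mono) auto
      also have "\<dots> \<le> real n + R" using z by (simp add: sum.distrib)
      finally have s: "(\<Sum>i<n. \<bar>z i\<bar>) \<le> real n + R" .
      have s0: "0 \<le> (\<Sum>i<n. \<bar>z i\<bar>)" by (simp add: sum_nonneg)
      have "\<bar>foldr partial_deriv ks f z\<bar> \<le> C * (1 + (\<Sum>i<n. \<bar>z i\<bar>)) ^ m" by (rule C)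
      also have "\<dots> \<le> \<bar>C\<bar> * (1 + (\<Sum>i<n. \<bar>z i\<bar>)) ^ m" using s0 by (intro mult_right_mono) auto
      also have "\<dots> \<le> \<bar>C\<bar> * (1 + (real n + R)) ^ m" using s s0 by (intro mult_left_mono power_mono) auto
      finally show ?thesis .
    qed
    then show ?thesis by blast
  qed
  show ?thesis
    unfolding C1_loc_def
  proof (intro conjI allI)
    show "C1_fun n (foldr partial_deriv js f) (\<lambda>i. foldr partial_deriv (i # js) f)"
      unfolding C1_fun_def
    proof (intro conjI allI impI)
      fix z z' :: "nat => real" assume z: "\<forall>i<n. z i = z' i"
      show "foldr partial_deriv js f z = foldr partial_deriv js f z'"
        using z by (intro foldr_partial_deriv_coords[where n=n] dep js) auto
      fix i assume "i < n"
      then show "foldr partial_deriv (i # js) f z = foldr partial_deriv (i # js) f z'"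
        using z js by (intro foldr_partial_deriv_coords[where n=n] dep) auto
    next
      show "continuous_on UNIV (foldr partial_deriv js f)" by (rule A(1)[OF js])
      fix i assume i: "i < n"
      then show "continuous_on UNIV (foldr partial_deriv (i # js) f)" using js by (intro A(1)) auto
      fix z
      show "((\<lambda>v. foldr partial_deriv js f (z(i := v))) has_real_derivative foldr partial_deriv (i # js) f z) (at (z i))"
        using A(2)[OF js i, of z] by (simp add: partial_deriv_def DERIV_deriv_iff_field_differentiable)
    qed
    fix R
    obtain B0 where B0: "\<And>z. (\<Sum>i<n. (z i)\<^sup>2) \<le> R ==> \<bar>foldr partial_deriv js f z\<bar> \<le> B0" using bd[OF js, of R] by blast
    have "\<forall>i. \<exists>B. i < n \<longrightarrow> (\<forall>z. (\<Sum>i<n. (z i)\<^sup>2) \<le> R \<longrightarrow> \<bar>foldr partial_deriv (i # js) f z\<bar> \<le> B)"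
    proof
      fix i
      show "\<exists>B. i < n \<longrightarrow> (\<forall>z. (\<Sum>i<n. (z i)\<^sup>2) \<le> R \<longrightarrow> \<bar>foldr partial_deriv (i # js) f z\<bar> \<le> B)"
      proof (cases "i < n")
        case True
        then have "set (i # js) \<subseteq> {..<n}" using js by auto
        from bd[OF this, of R] show ?thesis by blast
      qed simp
    qed
    then obtain Bi where Bi: "\<And>i z. i < n ==> (\<Sum>i<n. (z i)\<^sup>2) \<le> R ==> \<bar>foldr partial_deriv (i # js) f z\<bar> \<le> Bi i" by metis
    define B where "B = \<bar>B0\<bar> + (\<Sum>i<n. \<bar>Bi i\<bar>)"
    have "0 \<le> (\<Sum>i<n. \<bar>Bi i\<bar>)" by (simp add: sum_nonneg)
    then have "B0 \<le> B" unfolding B_def by linarith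
    moreover have "Bi i \<le> B" if "i < n" for i
      using member_le_sum[of i "{..<n}" "\<lambda>i. \<bar>Bi i\<bar>"] that by (simp add: B_def)
    ultimately show "\<exists>B. \<forall>z. (\<Sum>i<n. (z i)\<^sup>2) \<le> R \<longrightarrow>
         \<bar>foldr partial_deriv js f z\<bar> \<le> B \<and> (\<forall>i<n. \<bar>foldr partial_deriv (i # js) f z\<bar> \<le> B)"
      using B0 Bi by (intro exI[of _ B]) (meson order_trans)
  qed
qed

lemma smooth_poly_growth_C2:
  assumes f: "smooth_poly_growth n f"
  shows "C2_loc n f (\<lambda>i. partial_deriv i f)"
proof -
  have "C1_loc n (partial_deriv i f) (\<lambda>j. foldr partial_deriv [j, i] f)" if "i < n" for i
    using smooth_poly_growth_C1[OF f, of "[i]"] that by simp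
  moreover have "C1_loc n f (\<lambda>i. partial_deriv i f)" using smooth_poly_growth_C1[OF f, of "[]"] by simp
  ultimately show ?thesis
    unfolding C2_loc_def by (intro conjI exI[of _ "\<lambda>i j. foldr partial_deriv [j, i] f"]) auto
qed

lemma L2_norm_nonneg: "0 \<le> L2_norm_time T h"
  by (simp add: L2_norm_time_def)

lemma L2_norm_triangle:
  assumes f: "f \<in> L2_time T" and g: "g \<in> L2_time T"
  shows "L2_norm_time T (\<lambda>r. f r - g r) \<le> L2_norm_time T f + L2_norm_time T g"
proof -
  let ?L = "leb T"
  have m: "f \<in> borel_measurable ?L" "g \<in> borel_measurable ?L" "integrable ?L (\<lambda>r. (f r)\<^sup>2)" "integrable ?L (\<lambda>r. (g r)\<^sup>2)"
    using f g by (auto simp: L2_time_def)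
  note i = integrable_mult_L2[OF m]
  have "(LINT r|?L. (f r - g r)\<^sup>2) = (LINT r|?L. (f r)\<^sup>2) - 2 * (LINT r|?L. f r * g r) + (LINT r|?L. (g r)\<^sup>2)"
    using m i by (simp add: power2_diff mult.assoc)
  also have "\<dots> \<le> (L2_norm_time T f + L2_norm_time T g)\<^sup>2"
  proof -
    have "\<bar>LINT r|?L. f r * g r\<bar> \<le> L2_norm_time T f * L2_norm_time T g"
      unfolding L2_norm_time_def by (rule Cauchy_Schwarz_integral[OF m])
    moreover have "(LINT r|?L. (f r)\<^sup>2) = (L2_norm_time T f)\<^sup>2" "(LINT r|?L. (g r)\<^sup>2) = (L2_norm_time T g)\<^sup>2"
      by (simp_all add: L2_norm_time_def)
    ultimately show ?thesis by (simp add: power2_sum)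
  qed
  finally have "sqrt (LINT r|?L. (f r - g r)\<^sup>2) \<le> L2_norm_time T f + L2_norm_time T g"
    using L2_norm_nonneg by (intro real_le_lsqrt) auto
  then show ?thesis by (simp add: L2_norm_time_def)
qed

lemma L2_time_diff: "f \<in> L2_time T ==> g \<in> L2_time T ==> (\<lambda>r. f r - g r) \<in> L2_time T"
  by (auto simp: L2_time_def intro!: integrable_diff_sq)

lemma L2_time_sum:
  assumes "\<And>i. i < n ==> h i \<in> L2_time T"
  shows "(\<lambda>r. \<Sum>i<(n::nat). c i * h i r) \<in> L2_time T"
  using assms
proof (induction n)
  case 0 then show ?case by (simp add: L2_time_def)
next
  case (Suc n)
  have "(\<lambda>r. \<Sum>i<n. c i * h i r) \<in> L2_time T" "h n \<in> L2_time T" using Suc by auto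
  then have "integrable (leb T) (\<lambda>r. ((\<Sum>i<n. c i * h i r) + c n * h n r)\<^sup>2)"
    by (intro integrable_add_sq) (auto simp: L2_time_def power_mult_distrib)
  with \<open>(\<lambda>r. \<Sum>i<n. c i * h i r) \<in> L2_time T\<close> \<open>h n \<in> L2_time T\<close> show ?case by (auto simp: L2_time_def)
qed

lemma L2_norm_measurable:
  assumes "case_prod D \<in> borel_measurable (M \<Otimes>\<^sub>M leb T)"
  shows "(\<lambda>w. L2_norm_time T (D w)) \<in> borel_measurable M"
proof -
  interpret L: sigma_finite_measure "leb T" by (rule sigma_finite_leb_on)
  have "(\<lambda>(w, r). (D w r)\<^sup>2) \<in> borel_measurable (M \<Otimes>\<^sub>M leb T)"
    using borel_measurable_power[OF assms, of 2] by (simp add: split_beta')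
  then have "(\<lambda>w. LINT r|leb T. (D w r)\<^sup>2) \<in> borel_measurable M"
    by (rule L.borel_measurable_lebesgue_integral)
  then show ?thesis unfolding L2_norm_time_def by measurable
qed

text \<open>On a probability space convergence in \<open>L\<^sup>p\<close> implies convergence in \<open>L\<^sup>1\<close>; instead of Hoelder's
  inequality the pointwise bound \<open>\<bar>x\<bar> \<le> \<epsilon> + \<epsilon>\<^bsup>1-p\<^esup> \<bar>x\<bar>\<^sup>p\<close> is integrated.\<close>

lemma (in prob_space) L1_conv_of_tendsto_Lp:
  assumes t: "tendsto_Lp M p Fn F" and p: "1 \<le> p" and m: "\<And>n. Fn n \<in> borel_measurable M" "F \<in> borel_measurable M"
  shows "L1_conv M (\<lambda>n w. Fn n w - F w)"
proof -
  have ip: "integrable M (\<lambda>w. \<bar>Fn n w - F w\<bar> powr p)" for n using t by (simp add: tendsto_Lp_def)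
  have le: "\<bar>x\<bar> \<le> \<epsilon> + \<epsilon> powr (1 - p) * \<bar>x\<bar> powr p" if e: "0 < \<epsilon>" for \<epsilon> x :: real
  proof (cases "\<bar>x\<bar> \<le> \<epsilon>")
    case True then show ?thesis by (simp add: add_increasing2)
  next
    case False
    then have x: "0 < \<bar>x\<bar>" "\<epsilon> \<le> \<bar>x\<bar>" using e by auto
    have "\<bar>x\<bar> = \<bar>x\<bar> powr (1 - p) * \<bar>x\<bar> powr p" using x by (simp add: powr_add[symmetric])
    also have "\<dots> \<le> \<epsilon> powr (1 - p) * \<bar>x\<bar> powr p" using x e p by (intro mult_right_mono powr_mono2') auto
    finally show ?thesis using e by simp
  qed
  have i: "integrable M (\<lambda>w. Fn n w - F w)" for n
  proof (rule Bochner_Integration.integrable_bound)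
    show "integrable M (\<lambda>w. 1 + \<bar>Fn n w - F w\<bar> powr p)" using ip by simp
    show "AE w in M. norm (Fn n w - F w) \<le> norm (1 + \<bar>Fn n w - F w\<bar> powr p)"
      using le[of 1] by (intro AE_I2) (simp add: add_nonneg_nonneg abs_of_nonneg)
  qed (use m in auto)
  have "(\<lambda>n. LINT w|M. \<bar>Fn n w - F w\<bar>) \<longlonglongrightarrow> 0"
  proof (rule tendstoI)
    fix \<epsilon> :: real assume e: "0 < \<epsilon>"
    define K where "K = (\<epsilon> / 2) powr (1 - p)"
    have "(\<lambda>n. K * (LINT w|M. \<bar>Fn n w - F w\<bar> powr p)) \<longlonglongrightarrow> K * 0"
      using t by (intro tendsto_mult tendsto_const) (simp add: tendsto_Lp_def)
    then have "eventually (\<lambda>n. K * (LINT w|M. \<bar>Fn n w - F w\<bar> powr p) < \<epsilon> / 2) sequentially"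
      using e by (intro order_tendstoD(2)) auto
    then show "eventually (\<lambda>n. dist (LINT w|M. \<bar>Fn n w - F w\<bar>) 0 < \<epsilon>) sequentially"
    proof eventually_elim
      fix n assume n: "K * (LINT w|M. \<bar>Fn n w - F w\<bar> powr p) < \<epsilon> / 2"
      have "(LINT w|M. \<bar>Fn n w - F w\<bar>) \<le> (LINT w|M. \<epsilon> / 2 + K * \<bar>Fn n w - F w\<bar> powr p)"
        unfolding K_def using i ip e by (intro integral_mono le) auto
      also have "\<dots> = \<epsilon> / 2 + K * (LINT w|M. \<bar>Fn n w - F w\<bar> powr p)" using ip by (simp add: prob_space)
      finally show "dist (LINT w|M. \<bar>Fn n w - F w\<bar>) 0 < \<epsilon>" using n by (simp add: dist_real_def)
    qed
  qed
  with i show ?thesis by (simp add: L1_conv_def)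
qed

lemma L1_conv_bound:
  fixes G K :: "nat => 'w => real"
  assumes K: "L1_conv M K" and G: "\<And>q. G q \<in> borel_measurable M" and b: "\<And>q. AE w in M. \<bar>G q w\<bar> \<le> C * \<bar>K q w\<bar>"
  shows "L1_conv M G"
proof -
  have Ki: "integrable M (K q)" for q using K by (simp add: L1_conv_def)
  have i: "integrable M (G q)" for q
  proof (rule Bochner_Integration.integrable_bound)
    show "integrable M (\<lambda>w. C * \<bar>K q w\<bar>)" using Ki by simp
    show "AE w in M. norm (G q w) \<le> norm (C * \<bar>K q w\<bar>)" using b[of q] by eventually_elim simp
  qed (rule G)
  have "(\<lambda>q. LINT w|M. \<bar>G q w\<bar>) \<longlonglongrightarrow> 0"
  proof (rule tendsto_zero_bound)
    show "(\<lambda>q. C * (LINT w|M. \<bar>K q w\<bar>)) \<longlonglongrightarrow> 0"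
      using tendsto_mult[OF tendsto_const, of "\<lambda>k. LINT w|M. \<bar>K k w\<bar>" 0 sequentially C] K by (simp add: L1_conv_def)
    show "\<bar>LINT w|M. \<bar>G q w\<bar>\<bar> \<le> C * (LINT w|M. \<bar>K q w\<bar>)" for q
    proof -
      have "(LINT w|M. \<bar>G q w\<bar>) \<le> (LINT w|M. C * \<bar>K q w\<bar>)"
        by (rule integral_mono_AE) (use i Ki b in auto)
      then show ?thesis by simp
    qed
  qed
  with i show ?thesis by (simp add: L1_conv_def)
qed

lemma L1_conv_add:
  fixes G K :: "nat => 'w => real"
  assumes K: "L1_conv M K" and G: "L1_conv M G"
  shows "L1_conv M (\<lambda>q w. \<bar>K q w\<bar> + \<bar>G q w\<bar>)"
  using tendsto_add[of "\<lambda>q. LINT w|M. \<bar>K q w\<bar>" 0 sequentially "\<lambda>q. LINT w|M. \<bar>G q w\<bar>" 0] K G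
  by (simp add: L1_conv_def)

lemma right_cont_agree:
  fixes f g :: "real => real"
  assumes c: "continuous (at_right x) f" "continuous (at_right x) g" and e: "\<And>q. q \<in> \<rat> ==> f q = g q"
  shows "f x = g x"
proof (rule ccontr)
  assume "f x \<noteq> g x"
  then have "f x - g x \<noteq> 0" by simp
  moreover have "((\<lambda>v. f v - g v) \<longlongrightarrow> f x - g x) (at_right x)"
    using c by (auto simp: continuous_within intro!: tendsto_diff)
  ultimately have "eventually (\<lambda>v. f v - g v \<noteq> 0) (at_right x)" by (intro tendsto_imp_eventually_ne)
  then obtain b where b: "x < b" "\<And>v. x < v ==> v < b ==> f v - g v \<noteq> 0" unfolding eventually_at_right_field by auto
  obtain q where "q \<in> \<rat>" "x < q" "q < b" using Rats_dense_in_real[OF b(1)] by blast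
  then show False using b(2)[of q] e[of q] by simp
qed

text \<open>The positive and the negative part of \<open>f\<close> define finite measures whose distribution functions agree at
  rational points, hence everywhere by right continuity; so the parts coincide. Countably many
  intervals suffice, which matters when each of them comes with its own null set.\<close>

lemma integrals_zero_imp_zero:
  fixes f :: "real => real"
  assumes T: "0 < T" and f: "integrable (leb T) f"
    and z: "\<And>w. w \<in> ({0<..<T} \<inter> \<rat>) \<union> {T} ==> (LINT r|leb T. f r * indicator {0<..w} r) = 0"
  shows "AE r in leb T. f r = 0"
proof -
  have mi: "(indicator A :: real => real) \<in> borel_measurable (leb T)" if "A \<in> sets borel" for A
    using that by (intro borel_measurable_leb_on) simp
  have zero: "AE r in leb T. r \<noteq> 0"
  proof (rule AE_I')
    have "{0::real} \<in> null_sets lebesgue" by simp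
    then show "{0} \<in> null_sets (leb T)" using T by (subst null_sets_restrict_space) auto
  qed (auto simp: space_restrict_space)
  have z2: "(LINT r|leb T. f r * indicator {..x} r) = 0" if x: "x \<in> \<rat>" for x
  proof -
    \<comment> \<open>Clamping sends a rational point to \<open>0\<close>, to \<open>T\<close>, or to a rational point in between.\<close>
    define w where "w = max 0 (min T x)"
    have "(LINT r|leb T. f r * indicator {..x} r) = (LINT r|leb T. f r * indicator {0<..w} r)"
    proof (rule integral_cong_AE)
      have "AE r in leb T. r \<in> {0..T}" by (rule AE_I2) (simp add: space_restrict_space)
      with zero show "AE r in leb T. f r * indicator {..x} r = f r * indicator {0<..w} r"
        by eventually_elim (use T in \<open>auto simp: w_def indicator_def\<close>)
    qed (use f mi in auto)
    also have "\<dots> = 0"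
    proof (cases "x \<le> 0")
      case False
      then show ?thesis using x T by (intro z) (auto simp: w_def min_def)
    qed (use T in \<open>simp add: w_def min_def\<close>)
    finally show ?thesis .
  qed
  define g where "g r = indicator {0..T} r * f r" for r
  have gi: "integrable lebesgue g"
    using f by (simp add: integrable_restrict_space g_def[abs_def])
  then have gm: "g \<in> borel_measurable (completion lborel)" by auto
  obtain g' where g': "g' \<in> borel_measurable lborel" "AE r in lborel. g r = g' r"
    using completion_ex_borel_measurable_real[OF gm] by blast
  have ae: "AE r in lebesgue. g r = g' r" by (rule AE_completion[OF g'(2)])
  have g'l: "g' \<in> borel_measurable lebesgue" using g'(1) by (rule measurable_completion)
  have g'i: "integrable lebesgue g'" using integrable_cong_AE[OF _ g'l ae] gi by auto
  then have g'b: "integrable lborel g'" using integrable_completion[of g' lborel] g'(1) by simp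
  have z3: "(LINT r|lborel. g' r * indicator {..x} r) = 0" if x: "x \<in> \<rat>" for x
  proof -
    have "(LINT r|lborel. g' r * indicator {..x} r) = (LINT r|lebesgue. g' r * indicator {..x} r)"
      by (rule integral_completion[symmetric]) (use g' in measurable)
    also have "\<dots> = (LINT r|lebesgue. g r * indicator {..x} r)"
    proof (rule integral_cong_AE)
      show "AE r in lebesgue. g' r * indicator {..x} r = g r * indicator {..x} r"
        using ae by eventually_elim simp
      have "(indicator {..x} :: real => real) \<in> borel_measurable lebesgue" by (intro measurable_completion) simp
      then show "(\<lambda>r. g' r * indicator {..x} r) \<in> borel_measurable lebesgue"
        "(\<lambda>r. g r * indicator {..x} r) \<in> borel_measurable lebesgue" using g'l gi by auto
    qed
    also have "\<dots> = (LINT r|leb T. f r * indicator {..x} r)"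
      by (subst integral_restrict_space) (simp_all add: g_def mult.assoc)
    finally show ?thesis by (simp add: z2[OF x])
  qed
  define \<mu> where "\<mu> h = density lborel (\<lambda>r. ennreal (max 0 (h r)))" for h :: "real => real"
  have fin: "finite_borel_measure (\<mu> h)" and cdf: "cdf (\<mu> h) x = (LINT r|lborel. max 0 (h r) * indicator {..x} r)"
    if h: "integrable lborel h" for h x
  proof -
    have hm: "integrable lborel (\<lambda>r. max 0 (h r))" using h by (intro integrable_max) auto
    have [measurable]: "h \<in> borel_measurable borel" using h by auto
    have e: "emeasure (\<mu> h) A = ennreal (LINT r|lborel. max 0 (h r) * indicator A r)" if "A \<in> sets borel" for A
    proof -
      have "emeasure (\<mu> h) A = (\<integral>\<^sup>+r. ennreal (max 0 (h r)) * indicator A r \<partial>lborel)"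
        unfolding \<mu>_def using that by (intro emeasure_density) auto
      also have "\<dots> = (\<integral>\<^sup>+r. ennreal (max 0 (h r) * indicator A r) \<partial>lborel)"
        by (intro nn_integral_cong) (simp add: indicator_def)
      also have "\<dots> = ennreal (LINT r|lborel. max 0 (h r) * indicator A r)"
        by (rule nn_integral_eq_integral) (use that hm in \<open>auto intro!: integrable_real_mult_indicator\<close>)
      finally show ?thesis .
    qed
    show "finite_borel_measure (\<mu> h)"
    proof (intro finite_borel_measure.intro finite_measureI finite_borel_measure_axioms.intro)
      show "emeasure (\<mu> h) (space (\<mu> h)) \<noteq> \<infinity>" using e[of UNIV] by (simp add: \<mu>_def)
    qed (simp add: \<mu>_def)
    have "0 \<le> (LINT r|lborel. max 0 (h r) * indicator {..x} r)" by (rule Bochner_Integration.integral_nonneg) simp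
    then show "cdf (\<mu> h) x = (LINT r|lborel. max 0 (h r) * indicator {..x} r)"
      unfolding cdf_def measure_def using e[of "{..x}"] by simp
  qed
  have rat: "cdf (\<mu> g') x = cdf (\<mu> (\<lambda>r. - g' r)) x" if x: "x \<in> \<rat>" for x
  proof -
    have i: "integrable lborel (\<lambda>r. max 0 (g' r) * indicator {..x} r)" "integrable lborel (\<lambda>r. max 0 (- g' r) * indicator {..x} r)"
      using g'b by (auto intro!: integrable_real_mult_indicator integrable_max)
    have "cdf (\<mu> g') x - cdf (\<mu> (\<lambda>r. - g' r)) x = (LINT r|lborel. max 0 (g' r) * indicator {..x} r - max 0 (- g' r) * indicator {..x} r)"
      using g'b i by (simp add: cdf)
    also have "\<dots> = (LINT r|lborel. g' r * indicator {..x} r)"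
      by (rule Bochner_Integration.integral_cong) (auto simp: max_def)
    finally show ?thesis using z3[OF x] by simp
  qed
  have "cdf (\<mu> g') x = cdf (\<mu> (\<lambda>r. - g' r)) x" for x
    using g'b by (intro right_cont_agree[OF _ _ rat] finite_borel_measure.cdf_is_right_cont fin) auto
  then have "\<mu> g' = \<mu> (\<lambda>r. - g' r)"
    using g'b by (intro cdf_unique' fin ext) auto
  then have "AE r in lborel. ennreal (max 0 (g' r)) = ennreal (max 0 (- g' r))"
  proof (unfold \<mu>_def, subst (asm) finite_density_unique)
    have "(\<integral>\<^sup>+r. ennreal (max 0 (g' r)) \<partial>lborel) = ennreal (LINT r|lborel. max 0 (g' r))"
      using g'b by (intro nn_integral_eq_integral integrable_max) auto
    then show "(\<integral>\<^sup>+r. ennreal (max 0 (g' r)) \<partial>lborel) \<noteq> \<infinity>" by simp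
  qed (use g' in auto)
  then have "AE r in lborel. g' r = 0"
    by eventually_elim (auto simp: max_def split: if_splits)
  with g'(2) have "AE r in lborel. g r = 0" by eventually_elim simp
  then have "AE r in lebesgue. g r = 0" by (rule AE_completion)
  then show ?thesis by (simp add: AE_restrict_space_iff g_def indicator_def) (auto elim: eventually_mono split: if_splits)
qed

context brownian
begin

lemma smooth_cylindrical_cyl:
  assumes "smooth_cylindrical M T W F DF"
  shows "\<exists>n f g h I. cyl n f g h I F DF"
proof -
  obtain n f h I where s: "smooth_poly_growth n f" and w: "\<And>i. i < n ==> is_wiener_integral M T W (h i) (I i)"
    and F: "F = (\<lambda>w. f (\<lambda>i. I i w))" and DF: "DF = (\<lambda>w r. \<Sum>i<n. partial_deriv i f (\<lambda>i. I i w) * h i r)"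
    using assms unfolding smooth_cylindrical_def by blast
  note C2 = smooth_poly_growth_C2[OF s]
  then have C1: "C1_fun n f (\<lambda>i. partial_deriv i f)" by (simp add: C2_loc_def C1_loc_def)
  have "f (\<lambda>i. I i w) = f (\<lambda>i. if i < n then I i w else 0)" for w by (rule C1_funD(1)[OF C1]) simp
  moreover have "partial_deriv i f (\<lambda>i. I i w) = partial_deriv i f (\<lambda>i. if i < n then I i w else 0)" if "i < n" for i w
    by (rule C1_funD(2)[OF C1 that]) simp
  ultimately have "cyl n f (\<lambda>i. partial_deriv i f) h I F DF"
    unfolding cyl_def F DF using C2 w by simp
  then show ?thesis by blast
qed

lemma cyl_measurable:
  assumes "cyl n f g h I F DF"
  shows "F \<in> borel_measurable M" "DF w \<in> L2_time T"
    "case_prod DF \<in> borel_measurable (M \<Otimes>\<^sub>M leb T)"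
proof -
  have C1: "C1_fun n f g" and w: "\<And>i. i < n ==> is_wiener_integral M T W (h i) (I i)"
    using assms by (auto simp: cyl_def C2_loc_def C1_loc_def)
  have F: "F = (\<lambda>w. f (\<lambda>i. if i < n then I i w else 0))"
    and DF: "DF = (\<lambda>w r. \<Sum>i<n. g i (\<lambda>i. if i < n then I i w else 0) * h i r)"
    using assms by (simp_all add: cyl_def fun_eq_iff)
  have m: "(\<lambda>w. if i < n then I i w else 0) \<in> borel_measurable M" for i
    using wiener_measurable(1)[OF w] by (cases "i < n") auto
  show "F \<in> borel_measurable M" unfolding F by (rule measurable_coords[OF C1_funD(3)[OF C1] m])
  show "DF w \<in> L2_time T" unfolding DF by (rule L2_time_sum) (use w in \<open>simp add: is_wiener_integral_def\<close>)
  have "(\<lambda>x. g i (\<lambda>i. if i < n then I i (fst x) else 0) * h i (snd x)) \<in> borel_measurable (M \<Otimes>\<^sub>M leb T)" if i: "i < n" for i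
    using measurable_compose[OF measurable_fst measurable_coords[OF C1_funD(4)[OF C1 i] m]]
      measurable_compose[OF measurable_snd wiener_measurable(2)[OF w[OF i]]] by (rule borel_measurable_times)
  then show "case_prod DF \<in> borel_measurable (M \<Otimes>\<^sub>M leb T)"
    unfolding DF split_beta' by (intro borel_measurable_sum) auto
qed

lemma smooth_cylindrical_measurable:
  assumes "smooth_cylindrical M T W F DF"
  shows "F \<in> borel_measurable M" "DF w \<in> L2_time T"
    "case_prod DF \<in> borel_measurable (M \<Otimes>\<^sub>M leb T)"
proof -
  obtain n f g h I where c: "cyl n f g h I F DF" using smooth_cylindrical_cyl[OF assms] by (elim exE)
  show "F \<in> borel_measurable M" "DF w \<in> L2_time T"
    "case_prod DF \<in> borel_measurable (M \<Otimes>\<^sub>M leb T)"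
    by (rule cyl_measurable[OF c])+
qed

text \<open>Two derivatives of the same functional differ by a limit \<open>\<eta>\<close> of derivatives of cylindrical functionals
  that tend to \<open>0\<close>. Closability in the directions \<open>1\<^bsub>(0,v]\<^esub>\<close> with rational \<open>v\<close> makes the integrals of \<open>\<eta>\<close>
  over all these intervals vanish almost surely.\<close>

lemma malliavin_derivative_unique:
  assumes D: "has_malliavin_derivative M T W p F D" and D': "has_malliavin_derivative M T W p F D'" and p: "1 \<le> p"
  shows "AE w in M. AE r in leb T. D w r = D' w r"
proof -
  let ?L = "leb T"
  obtain Fn Dn where a: "\<And>q. smooth_cylindrical M T W (Fn q) (Dn q)" "tendsto_Lp M p Fn F"
      "tendsto_Lp M p (\<lambda>q w. L2_norm_time T (\<lambda>r. Dn q w r - D w r)) (\<lambda>_. 0)"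
    using D unfolding has_malliavin_derivative_def by blast
  obtain Fn' Dn' where a': "\<And>q. smooth_cylindrical M T W (Fn' q) (Dn' q)" "tendsto_Lp M p Fn' F"
      "tendsto_Lp M p (\<lambda>q w. L2_norm_time T (\<lambda>r. Dn' q w r - D' w r)) (\<lambda>_. 0)"
    using D' unfolding has_malliavin_derivative_def by blast
  have mF: "F \<in> borel_measurable M" and mD: "case_prod D \<in> borel_measurable (M \<Otimes>\<^sub>M ?L)" "case_prod D' \<in> borel_measurable (M \<Otimes>\<^sub>M ?L)"
    and L2: "AE w in M. D w \<in> L2_time T" "AE w in M. D' w \<in> L2_time T"
    and iD: "integrable M (\<lambda>w. L2_norm_time T (D w) powr p)" "integrable M (\<lambda>w. L2_norm_time T (D' w) powr p)"
    using D D' by (auto simp: has_malliavin_derivative_def)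
  have ex: "\<exists>n f g h I. cyl n f g h I (\<lambda>w. Fn q w - Fn' q w) (\<lambda>w r. Dn q w r - Dn' q w r)" for q
  proof -
    obtain n1 f1 g1 h1 I1 where c1: "cyl n1 f1 g1 h1 I1 (Fn q) (Dn q)" using smooth_cylindrical_cyl[OF a(1)[of q]] by (elim exE)
    obtain n2 f2 g2 h2 I2 where c2: "cyl n2 f2 g2 h2 I2 (Fn' q) (Dn' q)" using smooth_cylindrical_cyl[OF a'(1)[of q]] by (elim exE)
    show ?thesis by (rule cyl_diff[OF c1 c2])
  qed
  obtain n f g h I where cy: "\<And>q. cyl (n q) (f q) (g q) (h q) (I q) (\<lambda>w. Fn q w - Fn' q w) (\<lambda>w r. Dn q w r - Dn' q w r)"
  proof -
    define P where "P q n f g h I = cyl n f g h I (\<lambda>w. Fn q w - Fn' q w) (\<lambda>w r. Dn q w r - Dn' q w r)" for q n f g h I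
    have "\<exists>n f g h I. P q n f g h I" for q unfolding P_def by (rule ex)
    then obtain n f g h I where "\<And>q. P q (n q) (f q) (g q) (h q) (I q)" by metis
    then show thesis unfolding P_def by (rule that)
  qed
  have mFn: "Fn q \<in> borel_measurable M" "Fn' q \<in> borel_measurable M" "Dn q w \<in> L2_time T" "Dn' q w \<in> L2_time T"
    "case_prod (Dn q) \<in> borel_measurable (M \<Otimes>\<^sub>M ?L)" "case_prod (Dn' q) \<in> borel_measurable (M \<Otimes>\<^sub>M ?L)" for q w
    by (rule smooth_cylindrical_measurable[OF a(1)] smooth_cylindrical_measurable[OF a'(1)])+
  define N where "N q w = L2_norm_time T (\<lambda>r. Dn q w r - D w r)" for q w
  define N' where "N' q w = L2_norm_time T (\<lambda>r. Dn' q w r - D' w r)" for q w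
  have mN: "N q \<in> borel_measurable M" "N' q \<in> borel_measurable M" for q
    unfolding N_def[abs_def] N'_def[abs_def]
    by (rule L2_norm_measurable; use mFn(5,6)[of q] mD in \<open>simp add: split_beta'\<close>)+
  have "L1_conv M (\<lambda>q w. N q w - 0)"
    by (rule L1_conv_of_tendsto_Lp[OF _ p]) (use a(3) mN in \<open>auto simp: N_def[abs_def]\<close>)
  then have cN: "L1_conv M N" by simp
  have "L1_conv M (\<lambda>q w. N' q w - 0)"
    by (rule L1_conv_of_tendsto_Lp[OF _ p]) (use a'(3) mN in \<open>auto simp: N'_def[abs_def]\<close>)
  then have cN': "L1_conv M N'" by simp
  have cF: "L1_conv M (\<lambda>q w. Fn q w - Fn' q w)"
  proof (rule L1_conv_bound)
    show "L1_conv M (\<lambda>q w. \<bar>Fn q w - F w\<bar> + \<bar>Fn' q w - F w\<bar>)"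
      by (rule L1_conv_add[OF L1_conv_of_tendsto_Lp[OF a(2) p mFn(1) mF] L1_conv_of_tendsto_Lp[OF a'(2) p mFn(2) mF]])
    show "AE w in M. \<bar>Fn q w - Fn' q w\<bar> \<le> 1 * \<bar>\<bar>Fn q w - F w\<bar> + \<bar>Fn' q w - F w\<bar>\<bar>" for q
    proof -
      have "\<bar>x - y\<bar> \<le> 1 * \<bar>\<bar>x - z\<bar> + \<bar>y - z\<bar>\<bar>" for x y z :: real by (smt (verit))
      then show ?thesis by (intro AE_I2)
    qed
    show "(\<lambda>w. Fn q w - Fn' q w) \<in> borel_measurable M" for q using mFn by auto
  qed
  define \<eta> where "\<eta> w r = D w r - D' w r" for w r
  have m\<eta>: "case_prod \<eta> \<in> borel_measurable (M \<Otimes>\<^sub>M ?L)" using mD by (simp add: \<eta>_def split_beta')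
  have L1D: "integrable M (\<lambda>w. L2_norm_time T (D w))" "integrable M (\<lambda>w. L2_norm_time T (D' w))"
  proof -
    have *: "integrable M (\<lambda>w. L2_norm_time T (E w))"
      if "integrable M (\<lambda>w. L2_norm_time T (E w) powr p)" "case_prod E \<in> borel_measurable (M \<Otimes>\<^sub>M ?L)" for E
    proof (rule Bochner_Integration.integrable_bound)
      show "integrable M (\<lambda>w. 1 + L2_norm_time T (E w) powr p)" using that(1) by simp
      show "(\<lambda>w. L2_norm_time T (E w)) \<in> borel_measurable M" by (rule L2_norm_measurable[OF that(2)])
      have "x \<le> 1 + x powr p" if "0 \<le> x" for x :: real
      proof (cases "x \<le> 1")
        case True then show ?thesis by (simp add: add_increasing2)
      next
        case False
        then have "x powr 1 \<le> x powr p" using p by (intro powr_mono) auto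
        then show ?thesis using False by simp
      qed
      then show "AE w in M. norm (L2_norm_time T (E w)) \<le> norm (1 + L2_norm_time T (E w) powr p)"
        using L2_norm_nonneg by (intro AE_I2) (simp add: add_nonneg_nonneg abs_of_nonneg)
    qed
    show "integrable M (\<lambda>w. L2_norm_time T (D w))" "integrable M (\<lambda>w. L2_norm_time T (D' w))"
      by (rule *[OF iD(1) mD(1)], rule *[OF iD(2) mD(2)])
  qed
  have dir: "AE w in M. (LINT r|?L. \<eta> w r * indicator {0<..v} r) = 0" if w: "v \<in> {0..T}" for v
  proof -
    define k where "k = (indicator {0<..v} :: real => real)"
    define H where "H w = (LINT r|?L. \<eta> w r * k r)" for w
    have wk: "is_wiener_integral M T W k (\<lambda>w. W v w - W 0 w)"
      unfolding k_def using w T_pos by (intro wiener_increment) auto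
    note mk = wiener_measurable(2,3)[OF wk]
    have kL2: "k \<in> L2_time T" using mk by (simp add: L2_time_def)
    interpret L: sigma_finite_measure ?L by (rule sigma_finite_leb_on)
    have "(\<lambda>(w, r). \<eta> w r * k r) \<in> borel_measurable (M \<Otimes>\<^sub>M ?L)"
      using borel_measurable_times[OF m\<eta> measurable_compose[OF measurable_snd mk(1)]] by (simp add: split_beta')
    then have mH: "H \<in> borel_measurable M" unfolding H_def[abs_def] by (rule L.borel_measurable_lebesgue_integral)
    define K where "K = L2_norm_time T k"
    have K0: "0 \<le> K" by (simp add: K_def L2_norm_nonneg)
    have cs: "\<bar>LINT r|?L. e r * k r\<bar> \<le> L2_norm_time T e * K" if "e \<in> L2_time T" for e
      unfolding K_def L2_norm_time_def using that mk by (intro Cauchy_Schwarz_integral) (auto simp: L2_time_def)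
    have Hi: "integrable M H"
    proof (rule Bochner_Integration.integrable_bound)
      show "integrable M (\<lambda>w. (L2_norm_time T (D w) + L2_norm_time T (D' w)) * K)" using L1D by simp
      show "AE w in M. norm (H w) \<le> norm ((L2_norm_time T (D w) + L2_norm_time T (D' w)) * K)"
        using L2
      proof eventually_elim
        fix w assume l: "D w \<in> L2_time T" "D' w \<in> L2_time T"
        have "\<bar>H w\<bar> \<le> L2_norm_time T (\<lambda>r. D w r - D' w r) * K"
          unfolding H_def \<eta>_def by (rule cs[OF L2_time_diff[OF l]])
        also have "\<dots> \<le> (L2_norm_time T (D w) + L2_norm_time T (D' w)) * K"
          by (intro mult_right_mono L2_norm_triangle l K0)
        finally show "norm (H w) \<le> norm ((L2_norm_time T (D w) + L2_norm_time T (D' w)) * K)" by simp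
      qed
    qed (rule mH)
    define Hq where "Hq q w = (\<Sum>i<n q. g q i (\<lambda>i. if i < n q then I q i w else 0) * (LINT r|?L. h q i r * k r))" for q w
    have Hq: "Hq q w = (LINT r|?L. (Dn q w r - Dn' q w r) * k r)" for q w
    proof -
      have hw: "i < n q ==> is_wiener_integral M T W (h q i) (I q i)" for i using cy[of q] by (simp add: cyl_def)
      have "(Dn q w r - Dn' q w r) * k r = (\<Sum>i<n q. g q i (\<lambda>i. if i < n q then I q i w else 0) * (h q i r * k r))" for r
        using cy[of q] by (simp add: cyl_def sum_distrib_right mult.assoc)
      moreover have "integrable ?L (\<lambda>r. h q i r * k r)" if "i < n q" for i
        using wiener_measurable(2,3)[OF hw[OF that]] mk by (intro integrable_mult_L2) auto
      ultimately show ?thesis unfolding Hq_def by (subst Bochner_Integration.integral_cong[OF refl]) (auto simp: Bochner_Integration.integral_sum)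
    qed
    have mHq: "Hq q \<in> borel_measurable M" for q
    proof -
      have "(\<lambda>(w, r). (Dn q w r - Dn' q w r) * k r) \<in> borel_measurable (M \<Otimes>\<^sub>M ?L)"
        using borel_measurable_times[OF cyl_measurable(3)[OF cy] measurable_compose[OF measurable_snd mk(1)], of q] by (simp add: split_beta')
      then show ?thesis unfolding Hq[abs_def] by (rule L.borel_measurable_lebesgue_integral)
    qed
    have HL: "L1_conv M (\<lambda>q w. Hq q w - H w)"
    proof (rule L1_conv_bound[OF L1_conv_add[OF cN cN'], where C = K])
      show "(\<lambda>w. Hq q w - H w) \<in> borel_measurable M" for q using mHq mH by auto
      fix q
      show "AE w in M. \<bar>Hq q w - H w\<bar> \<le> K * \<bar>\<bar>N q w\<bar> + \<bar>N' q w\<bar>\<bar>"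
        using L2
      proof eventually_elim
        fix w assume l: "D w \<in> L2_time T" "D' w \<in> L2_time T"
        note d1 = L2_time_diff[OF mFn(3)[of q w] l(1)] and d2 = L2_time_diff[OF mFn(4)[of q w] l(2)]
        have i: "integrable ?L (\<lambda>r. e r * k r)" if "e \<in> L2_time T" for e
          using that mk by (intro integrable_mult_L2) (auto simp: L2_time_def)
        have "Hq q w - H w = (LINT r|?L. (Dn q w r - Dn' q w r) * k r - (D w r - D' w r) * k r)"
          unfolding Hq H_def \<eta>_def
          by (rule Bochner_Integration.integral_diff[symmetric]) (intro i L2_time_diff mFn l)+
        also have "\<dots> = (LINT r|?L. ((Dn q w r - D w r) - (Dn' q w r - D' w r)) * k r)"
          by (rule Bochner_Integration.integral_cong) (auto simp: algebra_simps)
        finally have "\<bar>Hq q w - H w\<bar> \<le> L2_norm_time T (\<lambda>r. (Dn q w r - D w r) - (Dn' q w r - D' w r)) * K"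
          using cs[OF L2_time_diff[OF d1 d2]] by simp
        also have "\<dots> \<le> (N q w + N' q w) * K"
          unfolding N_def N'_def by (intro mult_right_mono L2_norm_triangle d1 d2 K0)
        finally show "\<bar>Hq q w - H w\<bar> \<le> K * \<bar>\<bar>N q w\<bar> + \<bar>N' q w\<bar>\<bar>"
          by (simp add: N_def N'_def L2_norm_nonneg mult.commute)
      qed
    qed
    have "AE w in M. H w = 0"
      by (rule closable_direction[OF cy cF wk Hi]) (use HL in \<open>simp add: Hq_def[abs_def]\<close>)
    then show ?thesis by (simp add: H_def k_def)
  qed
  have "countable (({0<..<T} \<inter> \<rat>) \<union> {T})" by (auto intro: countable_rat)
  moreover have "AE w in M. (LINT r|?L. \<eta> w r * indicator {0<..v} r) = 0" if "v \<in> ({0<..<T} \<inter> \<rat>) \<union> {T}" for v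
    using that T_pos by (intro dir) auto
  ultimately have "AE w in M. \<forall>v\<in>({0<..<T} \<inter> \<rat>) \<union> {T}. (LINT r|?L. \<eta> w r * indicator {0<..v} r) = 0"
    by (simp add: AE_ball_countable)
  with L2 show ?thesis
  proof eventually_elim
    fix w assume l: "D w \<in> L2_time T" "D' w \<in> L2_time T"
      and z: "\<forall>v\<in>({0<..<T} \<inter> \<rat>) \<union> {T}. (LINT r|?L. \<eta> w r * indicator {0<..v} r) = 0"
    have e2: "\<eta> w \<in> L2_time T" using L2_time_diff[OF l] by (simp add: \<eta>_def[abs_def])
    note c = this[unfolded L2_time_def mem_Collect_eq]
    have "integrable ?L (\<eta> w)"
      by (rule finite_measure.square_integrable_imp_integrable[OF finite_leb_on c[THEN conjunct1] c[THEN conjunct2]])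
    then have "AE r in ?L. \<eta> w r = 0" by (rule integrals_zero_imp_zero[OF T_pos]) (use z in blast)
    then show "AE r in ?L. D w r = D' w r" by eventually_elim (simp add: \<eta>_def)
  qed
qed

end


section \<open>Integral equations driven by Lipschitz clocks\<close>

text \<open>Lebesgue measure and the measure of a Lipschitz clock are treated alike: \<open>p\<close> is the distribution
  function of \<open>\<mu>\<close> on \<open>[0, T]\<close>, and \<open>K\<close> bounds its slope.\<close>

locale driver =
  fixes T K :: real and \<mu> :: "real measure" and p :: "real => real"
  assumes sets_mu: "sets \<mu> = sets borel" and K_nonneg: "0 \<le> K"
    and emeasure_mu: "\<And>u v. 0 \<le> u ==> u \<le> v ==> v \<le> T ==> emeasure \<mu> {u..v} = ennreal (p v - p u)"
    and clock_inc: "\<And>u v. 0 \<le> u ==> u \<le> v ==> v \<le> T ==> 0 \<le> p v - p u \<and> p v - p u \<le> K * (v - u)"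

definition mb :: "real => real => real => (real => real) => bool" where
  "mb u v B a \<longleftrightarrow> set_borel_measurable borel {u..v} a \<and> (\<forall>r\<in>{u..v}. \<bar>a r\<bar> \<le> B)"

lemma mb_sub: "mb u v B a ==> u \<le> u' ==> v' \<le> v ==> mb u' v' B a"
  unfolding mb_def by (auto intro: set_borel_measurable_subset)

lemma mb_cont: "continuous_on {u..v} a ==> (\<And>r. r \<in> {u..v} ==> \<bar>a r\<bar> \<le> B) ==> mb u v B a"
  using borel_measurable_continuous_on_indicator[of "{u..v}" a]
  unfolding mb_def set_borel_measurable_def by auto

lemma mb_diff: "mb u v B a ==> mb u v C b ==> mb u v (B + C) (\<lambda>r. a r - b r)"
  unfolding mb_def set_borel_measurable_def
  by (auto simp: right_diff_distrib intro!: borel_measurable_diff) (smt (verit) atLeastAtMost_iff)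

lemma mb_mult: "mb u v B a ==> mb u v C b ==> mb u v (B * C) (\<lambda>r. a r * b r)"
proof -
  assume a: "mb u v B a" and b: "mb u v C b"
  have "(\<lambda>r. indicator {u..v} r *\<^sub>R (a r * b r)) = (\<lambda>r. (indicator {u..v} r *\<^sub>R a r) * (indicator {u..v} r *\<^sub>R b r))"
    by (auto simp: indicator_def)
  moreover have "\<bar>a r * b r\<bar> \<le> B * C" if "r \<in> {u..v}" for r
  proof -
    have "\<bar>a r\<bar> \<le> B" "\<bar>b r\<bar> \<le> C" using a b that by (auto simp: mb_def)
    then show ?thesis unfolding abs_mult by (intro mult_mono) auto
  qed
  ultimately show ?thesis using a b unfolding mb_def set_borel_measurable_def by auto
qed


context driver
begin

lemma driver_integrable:
  assumes uv: "0 \<le> u" "u \<le> v" "v \<le> T" and a: "mb u v B a"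
  shows "set_integrable \<mu> {u..v} a"
  unfolding set_integrable_def
proof (rule Bochner_Integration.integrable_bound)
  have "emeasure \<mu> {u..v} < \<infinity>" using emeasure_mu[OF uv] by simp
  then show "integrable \<mu> (\<lambda>r. B * indicator {u..v} r)"
    using sets_mu by (intro integrable_mult_right integrable_real_indicator) auto
  show "(\<lambda>r. indicator {u..v} r *\<^sub>R a r) \<in> borel_measurable \<mu>"
    using a unfolding mb_def set_borel_measurable_def measurable_cong_sets[OF sets_mu refl] by simp
  show "AE r in \<mu>. norm (indicator {u..v} r *\<^sub>R a r) \<le> norm (B * indicator {u..v} r)"
    using a by (intro AE_I2) (force simp: mb_def indicator_def)
qed

lemma driver_bound:
  assumes uv: "0 \<le> u" "u \<le> v" "v \<le> T" and a: "mb u v B a"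
  shows "\<bar>LINT r:{u..v}|\<mu>. a r\<bar> \<le> B * K * (v - u)"
proof -
  have i: "integrable \<mu> (\<lambda>r. B * indicator {u..v} r)"
    using sets_mu emeasure_mu[OF uv] by (intro integrable_mult_right integrable_real_indicator) auto
  have B: "0 \<le> B" using a uv(2) by (force simp: mb_def)
  have "\<bar>LINT r:{u..v}|\<mu>. a r\<bar> \<le> (LINT r|\<mu>. \<bar>indicator {u..v} r *\<^sub>R a r\<bar>)"
    unfolding set_lebesgue_integral_def by (rule integral_abs_bound)
  also have "\<dots> \<le> (LINT r|\<mu>. B * indicator {u..v} r)"
    using driver_integrable[OF uv a] a i unfolding set_integrable_def
    by (intro integral_mono) (auto simp: mb_def indicator_def)
  also have "\<dots> = B * measure \<mu> {u..v}"
    using sets_mu emeasure_mu[OF uv] sets_eq_imp_space_eq[OF sets_mu] by simp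
  also have "measure \<mu> {u..v} = p v - p u"
    using emeasure_mu[OF uv] clock_inc[OF uv] by (simp add: measure_def)
  also have "B * (p v - p u) \<le> B * (K * (v - u))" using clock_inc[OF uv] B by (intro mult_left_mono) auto
  finally show ?thesis by (simp add: mult.assoc)
qed

lemma driver_const:
  assumes uv: "0 \<le> u" "u \<le> v" "v \<le> T"
  shows "(LINT r:{u..v}|\<mu>. c) = c * (p v - p u)"
proof -
  have "measure \<mu> {u..v} = p v - p u"
    using emeasure_mu[OF uv] clock_inc[OF uv] by (simp add: measure_def)
  then show ?thesis
    using sets_mu emeasure_mu[OF uv] by (simp add: sets_eq_imp_space_eq[OF sets_mu] set_lebesgue_integral_def mult.commute)
qed

lemma driver_add:
  assumes uv: "0 \<le> u" "u \<le> v" "v \<le> w" "w \<le> T" and a: "mb u w B a"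
  shows "(LINT r:{u..w}|\<mu>. a r) = (LINT r:{u..v}|\<mu>. a r) + (LINT r:{v..w}|\<mu>. a r)"
proof -
  have "emeasure \<mu> {v} = 0" using emeasure_mu[of v v] uv by simp
  then have n: "{v} \<in> null_sets \<mu>" using sets_mu by (auto simp: null_sets_def)
  have ae: "AE r in \<mu>. \<not> (r \<in> {u..v} \<and> r \<in> {v..w})"
    by (rule AE_I'[OF n]) auto
  have "{u..w} = {u..v} \<union> {v..w}" using uv by auto
  then show ?thesis
    using set_integral_Un_AE[OF ae, of a] sets_mu uv
      driver_integrable[OF _ _ _ mb_sub[OF a], of u v] driver_integrable[OF _ _ _ mb_sub[OF a], of v w] by auto
qed

lemma driver_diff:
  assumes uv: "0 \<le> u" "u \<le> v" "v \<le> T" and a: "mb u v B a" and b: "mb u v C b"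
  shows "(LINT r:{u..v}|\<mu>. a r - b r) = (LINT r:{u..v}|\<mu>. a r) - (LINT r:{u..v}|\<mu>. b r)"
  using driver_integrable[OF uv a] driver_integrable[OF uv b] by simp

text \<open>The substitute for \<open>\<integral> e\<^bsup>lr\<^esup> dr = (e\<^bsup>lv\<^esup> - e\<^bsup>lu\<^esup>) / l\<close>: on a cell of length \<open>1 / l\<close> the integrand varies by a
  factor at most \<open>e \<le> 3\<close>, and cells add up.\<close>

lemma driver_exp_bound:
  assumes l: "0 < l"
  shows "0 \<le> u ==> u \<le> v ==> v \<le> T ==> (LINT r:{u..v}|\<mu>. exp (l * r)) \<le> 3 * K / l * (exp (l * v) - exp (l * u))"
proof -
  have m: "mb u v (exp (l * v)) (\<lambda>r. exp (l * r))" for u v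
    using l by (intro mb_cont continuous_intros) auto
  have small: "(LINT r:{u..v}|\<mu>. exp (l * r)) \<le> 3 * K / l * (exp (l * v) - exp (l * u))"
    if uv: "0 \<le> u" "u \<le> v" "v \<le> T" "v - u \<le> 1 / l" for u v
  proof -
    have "l * (v - u) \<le> 1" using that(4) l by (simp add: field_simps)
    then have "exp (l * (v - u)) \<le> exp 1" by simp
    also have "\<dots> \<le> 3" using exp_le by simp
    finally have e3: "exp (l * v) \<le> 3 * exp (l * u)" by (simp add: right_diff_distrib exp_diff field_simps)
    have "1 + l * (v - u) \<le> exp (l * (v - u))" by (rule exp_ge_add_one_self)
    then have "exp (l * u) * (1 + l * (v - u)) \<le> exp (l * u) * exp (l * (v - u))" by (rule mult_left_mono) simp
    then have e1: "exp (l * u) * (l * (v - u)) \<le> exp (l * v) - exp (l * u)"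
      by (simp add: exp_add[symmetric] algebra_simps)
    have "(LINT r:{u..v}|\<mu>. exp (l * r)) \<le> exp (l * v) * K * (v - u)" using driver_bound[OF uv(1-3) m] by simp
    also have "\<dots> \<le> (3 * exp (l * u)) * K * (v - u)" using e3 K_nonneg uv by (intro mult_right_mono) auto
    also have "\<dots> = 3 * K / l * (exp (l * u) * (l * (v - u)))" using l by simp
    also have "\<dots> \<le> 3 * K / l * (exp (l * v) - exp (l * u))" using e1 l K_nonneg by (intro mult_left_mono) auto
    finally show ?thesis .
  qed
  have "0 \<le> u ==> u \<le> v ==> v \<le> T ==> v - u \<le> real n * (1 / l) ==>
     (LINT r:{u..v}|\<mu>. exp (l * r)) \<le> 3 * K / l * (exp (l * v) - exp (l * u))" for n u v
  proof (induction n arbitrary: v)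
    case 0 then show ?case by (intro small) (use l in auto)
  next
    case (Suc n)
    define w where "w = max u (v - 1 / l)"
    have w: "u \<le> w" "w \<le> v" "v - w \<le> 1 / l" using Suc.prems l by (auto simp: w_def)
    have "w - u \<le> real n * (1 / l)" using Suc.prems(4) l by (auto simp: w_def add_divide_distrib max_def)
    then have "(LINT r:{u..w}|\<mu>. exp (l * r)) \<le> 3 * K / l * (exp (l * w) - exp (l * u))"
      using Suc w by (intro Suc.IH) auto
    moreover have "(LINT r:{w..v}|\<mu>. exp (l * r)) \<le> 3 * K / l * (exp (l * v) - exp (l * w))"
      using Suc w by (intro small) auto
    moreover have "(LINT r:{u..v}|\<mu>. exp (l * r)) = (LINT r:{u..w}|\<mu>. exp (l * r)) + (LINT r:{w..v}|\<mu>. exp (l * r))"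
      by (rule driver_add[OF _ _ _ _ m]) (use Suc w in auto)
    ultimately show ?case by (simp add: algebra_simps)
  qed
  moreover have "\<exists>n. v - u \<le> real n * (1 / l)" for u v
    using real_arch_simple[of "(v - u) * l"] l by (auto simp: field_simps)
  ultimately show "0 \<le> u ==> u \<le> v ==> v \<le> T ==> (LINT r:{u..v}|\<mu>. exp (l * r)) \<le> 3 * K / l * (exp (l * v) - exp (l * u))" by blast
qed

end

locale drivers = d1: driver T K \<mu>1 p1 + d2: driver T K \<mu>2 p2 for T K \<mu>1 p1 \<mu>2 p2
begin

definition dint :: "(real => real) => (real => real) => real => real => real" where
  "dint a b u v = (LINT r:{u..v}|\<mu>1. a r) + (LINT r:{u..v}|\<mu>2. b r)"

lemma dint_bound:
  assumes uv: "0 \<le> u" "u \<le> v" "v \<le> T" and a: "mb u v B a" and b: "mb u v B b"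
  shows "\<bar>dint a b u v\<bar> \<le> 2 * B * K * (v - u)"
  using d1.driver_bound[OF uv a] d2.driver_bound[OF uv b] unfolding dint_def by linarith

lemma dint_add:
  assumes "0 \<le> u" "u \<le> v" "v \<le> w" "w \<le> T" and "mb u w B a" and "mb u w B b"
  shows "dint a b u w = dint a b u v + dint a b v w"
  using d1.driver_add[OF assms(1-5)] d2.driver_add[OF assms(1-4,6)] unfolding dint_def by simp

lemma dint_diff:
  assumes uv: "0 \<le> u" "u \<le> v" "v \<le> T" and "mb u v B a" "mb u v B b" "mb u v C a'" "mb u v C b'"
  shows "dint (\<lambda>r. a r - a' r) (\<lambda>r. b r - b' r) u v = dint a b u v - dint a' b' u v"
  using d1.driver_diff[OF uv assms(4,6)] d2.driver_diff[OF uv assms(5,7)] unfolding dint_def by simp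

lemma dint_const:
  assumes uv: "0 \<le> u" "u \<le> v" "v \<le> T"
  shows "dint (\<lambda>r. c) (\<lambda>r. d) u v = c * (p1 v - p1 u) + d * (p2 v - p2 u)"
  using d1.driver_const[OF uv] d2.driver_const[OF uv] unfolding dint_def by simp

lemma dint_refl: "0 \<le> u ==> u \<le> T ==> mb u u B a ==> mb u u B b ==> dint a b u u = 0"
  using dint_bound[of u u B a b] by simp

lemma dint_cong: "(\<And>r. r \<in> {u..v} ==> a r = a' r) ==> (\<And>r. r \<in> {u..v} ==> b r = b' r) ==> dint a b u v = dint a' b' u v"
  unfolding dint_def by (intro arg_cong2[of _ _ _ _ "(+)"]) (auto simp: set_lebesgue_integral_def indicator_def intro!: Bochner_Integration.integral_cong)

end

text \<open>A clock need not be differentiable, so the product rule for \<open>w e\<^bsup>-E\<^esup>\<close> is not at hand; that its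
  increments are of second order is checked directly and makes the derivative of the product zero.\<close>

lemma quadratic_increments_const:
  fixes f :: "real => real"
  assumes d: "0 < d" and q: "\<And>u v. s \<le> u ==> u \<le> v ==> v \<le> T ==> v - u \<le> d ==> \<bar>f v - f u\<bar> \<le> C * (v - u)\<^sup>2"
    and t: "s \<le> t" "t \<le> T"
  shows "f t = f s"
proof -
  have "(f has_field_derivative 0) (at x within {s..T})" if x: "x \<in> {s..T}" for x
    unfolding has_field_derivative_iff
  proof (rule Lim_null_comparison)
    have "eventually (\<lambda>y. y \<in> {s..T} \<and> dist y x < d) (at x within {s..T})"
      using d by (auto simp: eventually_at intro!: exI[of _ d])
    then show "eventually (\<lambda>y. norm ((f y - f x) / (y - x)) \<le> \<bar>C\<bar> * \<bar>y - x\<bar>) (at x within {s..T})"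
    proof eventually_elim
      fix y assume y: "y \<in> {s..T} \<and> dist y x < d"
      have "\<bar>f y - f x\<bar> \<le> C * (y - x)\<^sup>2"
        using q[of x y] q[of y x] x y by (cases "x \<le> y") (auto simp: dist_real_def abs_minus_commute power2_commute)
      also have "\<dots> \<le> \<bar>C\<bar> * (y - x)\<^sup>2" by (intro mult_right_mono) auto
      also have "\<dots> = \<bar>C\<bar> * \<bar>y - x\<bar> * \<bar>y - x\<bar>" by (simp add: power2_eq_square)
      finally show "norm ((f y - f x) / (y - x)) \<le> \<bar>C\<bar> * \<bar>y - x\<bar>"
        by (cases "y = x") (auto simp: divide_le_eq)
    qed
    show "((\<lambda>y. \<bar>C\<bar> * \<bar>y - x\<bar>) \<longlongrightarrow> 0) (at x within {s..T})"
      by (auto intro!: tendsto_eq_intros)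
  qed
  then obtain c where "\<And>x. x \<in> {s..T} ==> f x = c"
    using has_field_derivative_zero_constant[of "{s..T}" f] by auto
  then show ?thesis using t by auto
qed

lemma one_plus_exp_minus: "\<bar>(1 + e) * exp (- e) - 1\<bar> \<le> e\<^sup>2" if "\<bar>e\<bar> \<le> 1" for e :: real
proof -
  have "(1 + e) * (1 + (- e)) \<le> (1 + e) * exp (- e)"
    using that by (intro mult_left_mono exp_ge_add_one_self) auto
  moreover have "(1 + e) * exp (- e) \<le> exp e * exp (- e)" by (intro mult_right_mono exp_ge_add_one_self) auto
  then have "(1 + e) * exp (- e) \<le> 1" by (simp add: exp_add[symmetric])
  moreover have "(1 + e) * (1 + (- e)) = 1 - e\<^sup>2" by (simp add: algebra_simps power2_eq_square)
  ultimately show ?thesis by simp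
qed

context drivers
begin

text \<open>With \<open>E\<close> the integrated coefficient, the increments of \<open>w e\<^bsup>-E\<^esup>\<close> over short intervals are of second
  order, because both \<open>w\<close> and \<open>E\<close> are Lipschitz.\<close>

lemma linear_solution:
  assumes s: "0 \<le> s" and w: "continuous_on {s..T} w"
    and a: "mb s T L a" and b: "mb s T L b"
    and eq: "\<And>t. t \<in> {s..T} ==> w t = w s + dint (\<lambda>r. a r * w r) (\<lambda>r. b r * w r) s t"
    and t: "t \<in> {s..T}"
  shows "w t = w s * exp (dint a b s t)"
proof -
  have L0: "0 \<le> L" using a t by (force simp: mb_def)
  have "bounded (w ` {s..T})" by (intro compact_imp_bounded compact_continuous_image w) simp
  then obtain Q where "\<forall>x\<in>w ` {s..T}. norm x \<le> Q" unfolding bounded_iff by blast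
  then have Q: "\<bar>w r\<bar> \<le> Q" if "r \<in> {s..T}" for r using that by auto
  have Q0: "0 \<le> Q" using Q[OF t] by linarith
  have mw: "mb s T Q w" using Q by (intro mb_cont w)
  note aw = mb_mult[OF a mw] and bw = mb_mult[OF b mw]
  define E where "E t = dint a b s t" for t
  define c where "c = 2 * L * K"
  have c0: "0 \<le> c" using L0 d1.K_nonneg by (simp add: c_def)
  have Ed: "E v - E u = dint a b u v" if "s \<le> u" "u \<le> v" "v \<le> T" for u v
    unfolding E_def using dint_add[OF s that mb_sub[OF a order_refl] mb_sub[OF b order_refl]] that by simp
  have Eb: "\<bar>dint a b u v\<bar> \<le> c * (v - u)" if "s \<le> u" "u \<le> v" "v \<le> T" for u v
    using dint_bound[of u v L a b] that s mb_sub[OF a] mb_sub[OF b] by (simp add: c_def)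
  have wd: "w v - w u = dint (\<lambda>r. a r * w r) (\<lambda>r. b r * w r) u v" if "s \<le> u" "u \<le> v" "v \<le> T" for u v
    using eq[of u] eq[of v] that dint_add[OF s that mb_sub[OF aw order_refl] mb_sub[OF bw order_refl]] by simp
  have wb: "\<bar>w v - w u\<bar> \<le> c * Q * (v - u)" if "s \<le> u" "u \<le> v" "v \<le> T" for u v
    unfolding wd[OF that] using dint_bound[of u v "L * Q" "\<lambda>r. a r * w r" "\<lambda>r. b r * w r"] that s mb_sub[OF aw] mb_sub[OF bw]
    by (simp add: c_def mult_ac)
  define \<psi> where "\<psi> t = w t * exp (- E t)" for t
  define C where "C = exp (c * T) * (Q * c\<^sup>2 + c * (c * Q) * exp 1)"
  have "\<psi> t = \<psi> s"
  proof (rule quadratic_increments_const[of "1 / (c + 1)" s T \<psi> C])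
    fix u v assume uv: "s \<le> u" "u \<le> v" "v \<le> T" "v - u \<le> 1 / (c + 1)"
    define e where "e = dint a b u v"
    have "c * (v - u) \<le> c * (1 / (c + 1))" using uv c0 by (intro mult_left_mono) auto
    also have "\<dots> \<le> 1" using c0 by (simp add: field_simps)
    finally have e1: "\<bar>e\<bar> \<le> 1" "\<bar>e\<bar> \<le> c * (v - u)" using Eb[OF uv(1-3)] by (auto simp: e_def)
    define \<rho> where "\<rho> = w v - w u - w u * e"
    have "\<rho> = dint (\<lambda>r. a r * (w r - w u)) (\<lambda>r. b r * (w r - w u)) u v"
    proof -
      have k: "mb u v (\<bar>w u\<bar>) (\<lambda>r. w u)" by (intro mb_cont continuous_intros) auto
      note a' = mb_sub[OF a uv(1,3)] and b' = mb_sub[OF b uv(1,3)]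
      have "w u * e = dint (\<lambda>r. a r * w u) (\<lambda>r. b r * w u) u v"
        unfolding e_def dint_def by (simp add: algebra_simps)
      moreover have "dint (\<lambda>r. a r * w r - a r * w u) (\<lambda>r. b r * w r - b r * w u) u v
          = dint (\<lambda>r. a r * w r) (\<lambda>r. b r * w r) u v - dint (\<lambda>r. a r * w u) (\<lambda>r. b r * w u) u v"
        using uv s by (intro dint_diff[OF _ _ _ mb_sub[OF aw uv(1,3)] mb_sub[OF bw uv(1,3)] mb_mult[OF a' k] mb_mult[OF b' k]]) auto
      ultimately show ?thesis unfolding \<rho>_def wd[OF uv(1-3)] by (simp add: right_diff_distrib)
    qed
    moreover have md: "mb u v (c * Q * (v - u)) (\<lambda>r. w r - w u)"
    proof (rule mb_cont)
      show "continuous_on {u..v} (\<lambda>r. w r - w u)"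
        by (intro continuous_intros continuous_on_subset[OF w]) (use uv in auto)
      show "\<bar>w r - w u\<bar> \<le> c * Q * (v - u)" if "r \<in> {u..v}" for r
      proof -
        have "\<bar>w r - w u\<bar> \<le> c * Q * (r - u)" using that uv by (intro wb) auto
        also have "\<dots> \<le> c * Q * (v - u)" using that c0 Q0 by (intro mult_left_mono) auto
        finally show ?thesis .
      qed
    qed
    ultimately have \<rho>: "\<bar>\<rho>\<bar> \<le> c * (c * Q) * (v - u)\<^sup>2"
      using dint_bound[of u v "L * (c * Q * (v - u))" "\<lambda>r. a r * (w r - w u)" "\<lambda>r. b r * (w r - w u)"] uv s
        mb_mult[OF mb_sub[OF a uv(1,3)] md] mb_mult[OF mb_sub[OF b uv(1,3)] md]
      by (simp add: c_def power2_eq_square mult_ac)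
    have "- E v = - E u + - e" using Ed[OF uv(1-3)] by (simp add: e_def)
    then have Ev: "exp (- E v) = exp (- E u) * exp (- e)" by (simp only: exp_add)
    have wv: "w v = w u * (1 + e) + \<rho>" by (simp add: \<rho>_def algebra_simps)
    have "\<psi> v - \<psi> u = exp (- E u) * (w u * ((1 + e) * exp (- e) - 1) + \<rho> * exp (- e))"
      unfolding \<psi>_def Ev wv by (simp add: algebra_simps)
    then have "\<bar>\<psi> v - \<psi> u\<bar> \<le> exp (- E u) * (\<bar>w u\<bar> * \<bar>(1 + e) * exp (- e) - 1\<bar> + \<bar>\<rho>\<bar> * exp (- e))"
      by (simp add: abs_mult) (metis abs_triangle_ineq abs_mult abs_exp_cancel)
    also have "\<dots> \<le> exp (c * T) * (Q * (c * (v - u))\<^sup>2 + (c * (c * Q) * (v - u)\<^sup>2) * exp 1)"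
    proof (intro mult_mono add_mono)
      have "- E u \<le> c * (u - s)" using Eb[of s u] uv by (auto simp: E_def)
      also have "\<dots> \<le> c * T" using uv s c0 by (intro mult_left_mono) auto
      finally show "exp (- E u) \<le> exp (c * T)" by simp
      show "\<bar>w u\<bar> \<le> Q" using Q uv by auto
      have "e\<^sup>2 \<le> (c * (v - u))\<^sup>2" using power_mono[OF e1(2) abs_ge_zero, of 2] by simp
      then show "\<bar>(1 + e) * exp (- e) - 1\<bar> \<le> (c * (v - u))\<^sup>2" using one_plus_exp_minus[OF e1(1)] by linarith
      show "exp (- e) \<le> exp 1" using e1(1) by simp
    qed (use \<rho> Q0 c0 in auto)
    also have "\<dots> = C * (v - u)\<^sup>2" by (simp add: C_def algebra_simps power2_eq_square)
    finally show "\<bar>\<psi> v - \<psi> u\<bar> \<le> C * (v - u)\<^sup>2" .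
  qed (use c0 t in auto)
  moreover have "E s = 0" unfolding E_def by (rule dint_refl[OF _ _ mb_sub[OF a] mb_sub[OF b]]) (use t s in auto)
  ultimately have "w t * exp (- E t) = w s" by (simp add: \<psi>_def)
  then have "w t * exp (- E t) * exp (E t) = w s * exp (E t)" by simp
  then show ?thesis by (simp add: mult.assoc exp_add[symmetric] E_def)
qed

end


section \<open>Existence, uniqueness and smoothness of the flow\<close>

definition dquot :: "(real => real) => (real => real) => real => real => real" where
  "dquot f f' a b = (if a = b then f' a else (f b - f a) / (b - a))"

locale ode = drivers +
  fixes \<beta> \<gamma> \<beta>' \<gamma>' :: "real => real" and B L :: real and x :: "real => real"
  assumes T_nonneg: "0 \<le> T"
    and \<beta>d: "\<And>z. (\<beta> has_real_derivative \<beta>' z) (at z)" and \<gamma>d: "\<And>z. (\<gamma> has_real_derivative \<gamma>' z) (at z)"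
    and \<beta>b: "\<And>z. \<bar>\<beta> z\<bar> \<le> B" and \<gamma>b: "\<And>z. \<bar>\<gamma> z\<bar> \<le> B"
    and \<beta>'b: "\<And>z. \<bar>\<beta>' z\<bar> \<le> L" and \<gamma>'b: "\<And>z. \<bar>\<gamma>' z\<bar> \<le> L"
    and \<beta>'c: "continuous_on UNIV \<beta>'" and \<gamma>'c: "continuous_on UNIV \<gamma>'"
    and x_cont: "continuous_on {0..T} x"

lemma dquot_eq: "f b - f a = dquot f f' a b * (b - a)"
  by (simp add: dquot_def)

lemma dquot_mvt:
  assumes "\<And>z. (f has_real_derivative f' z) (at z)"
  shows "\<exists>\<zeta>. \<bar>\<zeta> - a\<bar> \<le> \<bar>b - a\<bar> \<and> dquot f f' a b = f' \<zeta>"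
proof (cases a b rule: linorder_cases)
  case less
  obtain \<zeta> where "a < \<zeta>" "\<zeta> < b" "f b - f a = (b - a) * f' \<zeta>" using MVT2[OF less, of f f'] assms by auto
  then show ?thesis using less by (intro exI[of _ \<zeta>]) (auto simp: dquot_def)
next
  case greater
  obtain \<zeta> where "b < \<zeta>" "\<zeta> < a" "f a - f b = (a - b) * f' \<zeta>" using MVT2[OF greater, of f f'] assms by auto
  moreover from this have "f b - f a = (b - a) * f' \<zeta>" by (simp add: algebra_simps)
  ultimately show ?thesis using greater by (intro exI[of _ \<zeta>]) (auto simp: dquot_def)
qed (auto simp: dquot_def)

lemma mb_dquot:
  assumes d: "\<And>z. (f has_real_derivative f' z) (at z)" and c: "continuous_on UNIV f'" and b: "\<And>z. \<bar>f' z\<bar> \<le> L"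
    and Z: "continuous_on {u..v} Z" "continuous_on {u..v} Z'"
  shows "mb u v L (\<lambda>r. dquot f f' (Z r) (Z' r))"
  unfolding mb_def
proof (intro conjI ballI)
  have cf: "continuous_on UNIV f" using d by (meson DERIV_isCont continuous_at_imp_continuous_on)
  have comp: "(\<lambda>r. indicator {u..v} r *\<^sub>R h (V r)) \<in> borel_measurable borel" if "continuous_on UNIV h" "continuous_on {u..v} V" for h V :: "real => real"
    by (intro borel_measurable_continuous_on_indicator continuous_on_compose2[OF that]) auto
  have id: "(\<lambda>r. indicator {u..v} r *\<^sub>R V r) \<in> borel_measurable borel" if "continuous_on {u..v} V" for V :: "real => real"
    by (intro borel_measurable_continuous_on_indicator that) auto
  note m[measurable] = id[OF Z(1)] id[OF Z(2)] comp[OF cf Z(1)] comp[OF cf Z(2)] comp[OF c Z(1)]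
  have "(\<lambda>r. indicator {u..v} r *\<^sub>R dquot f f' (Z r) (Z' r)) =
    (\<lambda>r. if indicator {u..v} r *\<^sub>R Z r = indicator {u..v} r *\<^sub>R Z' r then indicator {u..v} r *\<^sub>R f' (Z r)
       else (indicator {u..v} r *\<^sub>R f (Z' r) - indicator {u..v} r *\<^sub>R f (Z r)) / (indicator {u..v} r *\<^sub>R Z' r - indicator {u..v} r *\<^sub>R Z r))"
    by (rule ext) (simp add: dquot_def indicator_def)
  also have "\<dots> \<in> borel_measurable borel" by measurable
  finally show "set_borel_measurable borel {u..v} (\<lambda>r. dquot f f' (Z r) (Z' r))" unfolding set_borel_measurable_def .
  fix r
  obtain \<zeta> where "dquot f f' (Z r) (Z' r) = f' \<zeta>" using dquot_mvt[of f f' "Z r" "Z' r"] d by blast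
  then show "\<bar>dquot f f' (Z r) (Z' r)\<bar> \<le> L" using b by simp
qed

context ode
begin

definition sol :: "real => real => (real => real) => bool" where
  "sol s z Z \<longleftrightarrow> continuous_on {s..T} Z \<and>
     (\<forall>t\<in>{s..T}. Z t = z + x t - x s + dint (\<lambda>r. \<beta> (Z r)) (\<lambda>r. \<gamma> (Z r)) s t)"

lemma \<beta>c: "continuous_on UNIV \<beta>" and \<gamma>c: "continuous_on UNIV \<gamma>"
  using \<beta>d \<gamma>d by (meson DERIV_isCont continuous_at_imp_continuous_on)+

lemma L_nonneg: "0 \<le> L" using \<beta>'b[of 0] by linarith

lemma mb_coeff:
  assumes "continuous_on {u..v} Z"
  shows "mb u v B (\<lambda>r. \<beta> (Z r))" "mb u v B (\<lambda>r. \<gamma> (Z r))" "mb u v L (\<lambda>r. \<beta>' (Z r))" "mb u v L (\<lambda>r. \<gamma>' (Z r))"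
  using \<beta>b \<gamma>b \<beta>'b \<gamma>'b
  by (auto intro!: mb_cont continuous_on_compose2[OF \<beta>c assms] continuous_on_compose2[OF \<gamma>c assms]
      continuous_on_compose2[OF \<beta>'c assms] continuous_on_compose2[OF \<gamma>'c assms])

lemma sol_init:
  assumes "sol s z Z" "0 \<le> s" "s \<le> T" shows "Z s = z"
proof -
  have "continuous_on {s..s} Z" by simp
  from mb_coeff(1,2)[OF this] have "dint (\<lambda>r. \<beta> (Z r)) (\<lambda>r. \<gamma> (Z r)) s s = 0" using assms by (intro dint_refl)
  then show ?thesis using assms by (simp add: sol_def)
qed

lemma sol_restart:
  assumes Z: "sol s z Z" and s: "0 \<le> s" "s \<le> r" "r \<le> T"
  shows "sol r (Z r) Z"
  unfolding sol_def
proof (intro conjI ballI)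
  show "continuous_on {r..T} Z" using Z s by (auto simp: sol_def intro: continuous_on_subset)
  fix t assume t: "t \<in> {r..T}"
  have c: "continuous_on {s..t} Z" using Z t by (auto simp: sol_def intro: continuous_on_subset)
  have "dint (\<lambda>r. \<beta> (Z r)) (\<lambda>r. \<gamma> (Z r)) s t = dint (\<lambda>r. \<beta> (Z r)) (\<lambda>r. \<gamma> (Z r)) s r + dint (\<lambda>r. \<beta> (Z r)) (\<lambda>r. \<gamma> (Z r)) r t"
    by (rule dint_add[OF _ _ _ _ mb_coeff(1,2)[OF c]]) (use s t in auto)
  moreover have "Z t = z + x t - x s + dint (\<lambda>r. \<beta> (Z r)) (\<lambda>r. \<gamma> (Z r)) s t"
    "Z r = z + x r - x s + dint (\<lambda>r. \<beta> (Z r)) (\<lambda>r. \<gamma> (Z r)) s r" using Z s t by (auto simp: sol_def)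
  ultimately show "Z t = Z r + x t - x r + dint (\<lambda>r. \<beta> (Z r)) (\<lambda>r. \<gamma> (Z r)) r t" by simp
qed

text \<open>The difference of two solutions solves a linear equation whose coefficients are difference
  quotients; this gives uniqueness, Lipschitz dependence on the initial value and, in the limit,
  the derivative of the flow.\<close>

lemma sol_difference:
  assumes Z: "sol s z Z" and Z': "sol s z' Z'" and s: "0 \<le> s" and t: "t \<in> {s..T}"
  shows "Z' t - Z t = (z' - z) * exp (dint (\<lambda>r. dquot \<beta> \<beta>' (Z r) (Z' r)) (\<lambda>r. dquot \<gamma> \<gamma>' (Z r) (Z' r)) s t)"
proof -
  have cZ: "continuous_on {s..T} Z" and cZ': "continuous_on {s..T} Z'" using Z Z' by (auto simp: sol_def)
  define w where "w r = Z' r - Z r" for r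
  have sT: "s \<le> T" using t by simp
  have ws: "w s = z' - z" using sol_init[OF Z s sT] sol_init[OF Z' s sT] by (simp add: w_def)
  have "w t = w s * exp (dint (\<lambda>r. dquot \<beta> \<beta>' (Z r) (Z' r)) (\<lambda>r. dquot \<gamma> \<gamma>' (Z r) (Z' r)) s t)"
  proof (rule linear_solution[OF s _ mb_dquot[OF \<beta>d \<beta>'c \<beta>'b cZ cZ'] mb_dquot[OF \<gamma>d \<gamma>'c \<gamma>'b cZ cZ'] _ t])
    show "continuous_on {s..T} w" unfolding w_def by (intro continuous_intros cZ cZ')
    fix u assume u: "u \<in> {s..T}"
    have c: "continuous_on {s..u} Z" "continuous_on {s..u} Z'" using u by (auto intro: continuous_on_subset[OF cZ] continuous_on_subset[OF cZ'])
    have "w u = (z' - z) + (dint (\<lambda>r. \<beta> (Z' r)) (\<lambda>r. \<gamma> (Z' r)) s u - dint (\<lambda>r. \<beta> (Z r)) (\<lambda>r. \<gamma> (Z r)) s u)"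
      using Z Z' u by (simp add: sol_def w_def)
    also have "\<dots> = w s + dint (\<lambda>r. \<beta> (Z' r) - \<beta> (Z r)) (\<lambda>r. \<gamma> (Z' r) - \<gamma> (Z r)) s u"
      using u s by (subst dint_diff[OF _ _ _ mb_coeff(1,2)[OF c(2)] mb_coeff(1,2)[OF c(1)]]) (auto simp: ws)
    also have "(\<lambda>r. \<beta> (Z' r) - \<beta> (Z r)) = (\<lambda>r. dquot \<beta> \<beta>' (Z r) (Z' r) * w r)"
      unfolding w_def by (intro ext dquot_eq)
    also have "(\<lambda>r. \<gamma> (Z' r) - \<gamma> (Z r)) = (\<lambda>r. dquot \<gamma> \<gamma>' (Z r) (Z' r) * w r)"
      unfolding w_def by (intro ext dquot_eq)
    finally show "w u = w s + dint (\<lambda>r. dquot \<beta> \<beta>' (Z r) (Z' r) * w r) (\<lambda>r. dquot \<gamma> \<gamma>' (Z r) (Z' r) * w r) s u" .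
  qed
  from this[unfolded ws] show ?thesis by (simp add: w_def)
qed

lemma sol_unique:
  assumes "sol s z Z" "sol s z Z'" "0 \<le> s" "t \<in> {s..T}"
  shows "Z' t = Z t"
  using sol_difference[OF assms] by simp

lemma dquot_dint_bound:
  assumes "continuous_on {s..T} Z" "continuous_on {s..T} Z'" "0 \<le> s" "s \<le> t" "t \<le> T"
  shows "\<bar>dint (\<lambda>r. dquot \<beta> \<beta>' (Z r) (Z' r)) (\<lambda>r. dquot \<gamma> \<gamma>' (Z r) (Z' r)) s t\<bar> \<le> 2 * L * K * T"
proof -
  have c: "continuous_on {s..t} Z" "continuous_on {s..t} Z'"
    using assms by (auto intro: continuous_on_subset[OF assms(1)] continuous_on_subset[OF assms(2)])
  have "\<bar>dint (\<lambda>r. dquot \<beta> \<beta>' (Z r) (Z' r)) (\<lambda>r. dquot \<gamma> \<gamma>' (Z r) (Z' r)) s t\<bar> \<le> 2 * L * K * (t - s)"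
    using assms by (intro dint_bound mb_dquot[OF \<beta>d \<beta>'c \<beta>'b c] mb_dquot[OF \<gamma>d \<gamma>'c \<gamma>'b c])
  also have "\<dots> \<le> 2 * L * K * T" using assms L_nonneg d1.K_nonneg by (intro mult_left_mono) auto
  finally show ?thesis .
qed

text \<open>The difference of two solutions is exactly the initial difference times an exponential of integrated
  difference quotients, which converge to derivatives as the initial values merge.\<close>

lemma sol_derivative:
  assumes ex: "\<And>z. sol s z (Z z)" and s: "0 \<le> s" and t: "t \<in> {s..T}"
  shows "((\<lambda>z. Z z t) has_real_derivative exp (dint (\<lambda>r. \<beta>' (Z z r)) (\<lambda>r. \<gamma>' (Z z r)) s t)) (at z)"
proof -
  have c: "continuous_on {s..T} (Z y)" for y using ex by (auto simp: sol_def)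
  define E where "E y r = dint (\<lambda>r. dquot \<beta> \<beta>' (Z z r) (Z y r)) (\<lambda>r. dquot \<gamma> \<gamma>' (Z z r) (Z y r)) s r" for y r
  define C where "C = exp (2 * L * K * T)"
  have diff: "Z y r - Z z r = (y - z) * exp (E y r)" if "r \<in> {s..T}" for y r
    unfolding E_def by (rule sol_difference[OF ex ex s that])
  have lip: "\<bar>Z y r - Z z r\<bar> \<le> C * \<bar>y - z\<bar>" if r: "r \<in> {s..T}" for y r
  proof -
    have "E y r \<le> 2 * L * K * T" using dquot_dint_bound[OF c c s, of r z y] r by (simp add: E_def)
    then have "exp (E y r) \<le> C" by (simp add: C_def)
    then show ?thesis unfolding diff[OF r] abs_mult by (subst mult.commute) (intro mult_right_mono, auto)
  qed
  show ?thesis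
    unfolding has_field_derivative_iff tendsto_at_iff_sequentially
  proof (intro allI impI)
    fix X assume X: "\<forall>i. X i \<in> UNIV - {z}" "X \<longlonglongrightarrow> z"
    have Zl: "(\<lambda>i. Z (X i) r) \<longlonglongrightarrow> Z z r" if r: "r \<in> {s..T}" for r
    proof -
      have "(\<lambda>i. C * \<bar>X i - z\<bar>) \<longlonglongrightarrow> C * \<bar>z - z\<bar>" by (intro tendsto_intros X)
      then have "(\<lambda>i. Z (X i) r - Z z r) \<longlonglongrightarrow> 0" by (intro tendsto_zero_bound[OF lip[OF r]]) simp
      then show ?thesis by (simp add: LIM_zero_iff)
    qed
    have dql: "(\<lambda>i. dquot f f' (Z z r) (Z (X i) r)) \<longlonglongrightarrow> f' (Z z r)"
      if f: "\<And>z. (f has_real_derivative f' z) (at z)" "continuous_on UNIV f'" and r: "r \<in> {s..T}" for f f' r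
    proof -
      have "\<exists>\<zeta>. \<forall>i. \<bar>\<zeta> i - Z z r\<bar> \<le> \<bar>Z (X i) r - Z z r\<bar> \<and> dquot f f' (Z z r) (Z (X i) r) = f' (\<zeta> i)"
        by (intro choice allI dquot_mvt f)
      then obtain \<zeta> where \<zeta>: "\<And>i. \<bar>\<zeta> i - Z z r\<bar> \<le> \<bar>Z (X i) r - Z z r\<bar>" "\<And>i. dquot f f' (Z z r) (Z (X i) r) = f' (\<zeta> i)" by blast
      have "(\<lambda>i. \<bar>Z (X i) r - Z z r\<bar>) \<longlonglongrightarrow> 0" using Zl[OF r] by (simp add: LIM_zero tendsto_rabs_zero)
      then have "(\<lambda>i. \<zeta> i - Z z r) \<longlonglongrightarrow> 0" by (rule tendsto_zero_bound[OF \<zeta>(1)])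
      then have "\<zeta> \<longlonglongrightarrow> Z z r" by (simp add: LIM_zero_iff)
      then have "(\<lambda>i. f' (\<zeta> i)) \<longlonglongrightarrow> f' (Z z r)"
        using f(2) by (intro isCont_tendsto_compose[of _ f']) (auto simp: continuous_on_eq_continuous_at)
      then show ?thesis by (simp add: \<zeta>(2))
    qed
    have Il: "(\<lambda>i. LINT r:{s..t}|\<mu>. dquot f f' (Z z r) (Z (X i) r)) \<longlonglongrightarrow> (LINT r:{s..t}|\<mu>. f' (Z z r))"
      if f: "\<And>z. (f has_real_derivative f' z) (at z)" "continuous_on UNIV f'" "\<And>z. \<bar>f' z\<bar> \<le> L" and dr: "driver T K \<mu> p"
      for f f' \<mu> p
    proof -
      interpret D: driver T K \<mu> p by (rule dr)
      have ct: "continuous_on {s..t} (Z y)" for y using c t by (auto intro: continuous_on_subset[OF c])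
      have m: "mb s t L (\<lambda>r. dquot f f' (Z z r) (Z y r))" for y by (rule mb_dquot[OF f ct ct])
      have m': "mb s t L (\<lambda>r. f' (Z z r))" using f(3) by (intro mb_cont continuous_on_compose2[OF f(2) ct]) auto
      show ?thesis
        unfolding set_lebesgue_integral_def
      proof (rule integral_dominated_convergence[where w = "\<lambda>r. L * indicator {s..t} r"])
        show "integrable \<mu> (\<lambda>r. L * indicator {s..t} r)"
          using D.sets_mu D.emeasure_mu[of s t] s t by (intro integrable_mult_right integrable_real_indicator) auto
        show "(\<lambda>r. indicator {s..t} r *\<^sub>R f' (Z z r)) \<in> borel_measurable \<mu>"
          "(\<lambda>r. indicator {s..t} r *\<^sub>R dquot f f' (Z z r) (Z (X i) r)) \<in> borel_measurable \<mu>" for i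
          using m m' unfolding mb_def set_borel_measurable_def measurable_cong_sets[OF D.sets_mu refl] by auto
        show "AE r in \<mu>. (\<lambda>i. indicator {s..t} r *\<^sub>R dquot f f' (Z z r) (Z (X i) r)) \<longlonglongrightarrow> indicator {s..t} r *\<^sub>R f' (Z z r)"
        proof (rule AE_I2, goal_cases)
          case (1 r) then show ?case
            using dql[OF f(1,2), of r] t by (cases "r \<in> {s..t}") (auto simp: indicator_def)
        qed
        show "AE r in \<mu>. norm (indicator {s..t} r *\<^sub>R dquot f f' (Z z r) (Z (X i) r)) \<le> L * indicator {s..t} r" for i
          using m unfolding mb_def by (intro AE_I2) (auto simp: indicator_def)
      qed
    qed
    have "(\<lambda>i. E (X i) t) \<longlonglongrightarrow> dint (\<lambda>r. \<beta>' (Z z r)) (\<lambda>r. \<gamma>' (Z z r)) s t"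
      unfolding E_def dint_def
      by (intro tendsto_add Il[OF \<beta>d \<beta>'c \<beta>'b d1.driver_axioms] Il[OF \<gamma>d \<gamma>'c \<gamma>'b d2.driver_axioms])
    then have "(\<lambda>i. exp (E (X i) t)) \<longlonglongrightarrow> exp (dint (\<lambda>r. \<beta>' (Z z r)) (\<lambda>r. \<gamma>' (Z z r)) s t)" by (rule tendsto_exp)
    moreover have "(Z (X i) t - Z z t) / (X i - z) = exp (E (X i) t)" for i
      using diff[OF t, of "X i"] X(1) by simp
    ultimately show "((\<lambda>y. (Z y t - Z z t) / (y - z)) \<circ> X) \<longlonglongrightarrow> exp (dint (\<lambda>r. \<beta>' (Z z r)) (\<lambda>r. \<gamma>' (Z z r)) s t)"
      by (simp add: o_def)
  qed
qed

lemma dint_continuous: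
  assumes s: "0 \<le> s" and m: "mb s T C a" "mb s T C b"
  shows "continuous_on {s..T} (\<lambda>t. dint a b s t)"
proof (cases "s \<le> T")
  case True
  have C0: "0 \<le> C" using m(1) True by (force simp: mb_def)
  have "(2 * C * K)-lipschitz_on {s..T} (\<lambda>t. dint a b s t)"
  proof (rule lipschitz_onI)
    have *: "\<bar>dint a b s v - dint a b s u\<bar> \<le> 2 * C * K * (v - u)" if "s \<le> u" "u \<le> v" "v \<le> T" for u v
    proof -
      have "dint a b s v = dint a b s u + dint a b u v"
        by (rule dint_add[OF s that mb_sub[OF m(1)] mb_sub[OF m(2)]]) (use that in auto)
      then show ?thesis using dint_bound[of u v C a b] mb_sub[OF m(1), of u v] mb_sub[OF m(2), of u v] that s by simp
    qed
    fix u v assume "u \<in> {s..T}" "v \<in> {s..T}"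
    then show "dist (dint a b s u) (dint a b s v) \<le> 2 * C * K * dist u v"
      using *[of u v] *[of v u] by (cases "u \<le> v") (auto simp: dist_real_def abs_minus_commute)
  qed (use C0 d1.K_nonneg in simp)
  then show ?thesis by (rule lipschitz_on_continuous_on)
qed simp

text \<open>Contraction principle in an exponentially weighted supremum norm. The weight is built into the unknown
  (\<open>V\<close> below), so that the complete space of bounded continuous functions can be used; time is clamped
  to \<open>[s, T]\<close>.\<close>

lemma sol_exists:
  assumes s: "0 \<le> s" "s \<le> T"
  shows "\<exists>Z. sol s z Z"
proof -
  \<comment> \<open>Two driving measures contribute \<open>3 K L / l\<close> each, so this weight makes the map a \<open>1/2\<close>-contraction.\<close>
  define l where "l = 12 * (L + 1) * (K + 1)"
  have l0: "0 < l" using L_nonneg d1.K_nonneg by (simp add: l_def)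
  have lk: "6 * K * L / l \<le> 1 / 2"
  proof -
    have "12 * (K * L) \<le> 12 * ((K + 1) * (L + 1))" using L_nonneg d1.K_nonneg by (intro mult_left_mono mult_mono) auto
    then have "12 * K * L \<le> l" by (simp add: l_def mult_ac)
    then show ?thesis using l0 by (simp add: divide_le_eq)
  qed
  define cl where "cl t = max s (min T t)" for t
  have cl: "cl t \<in> {s..T}" for t using s by (auto simp: cl_def)
  have cl_cont: "continuous_on UNIV cl" unfolding cl_def by (intro continuous_intros)
  have cl_id: "cl t = t" if "t \<in> {s..T}" for t using that by (simp add: cl_def)
  define V where "V f r = exp (l * r) * apply_bcontfun f r" for f :: "real \<Rightarrow>\<^sub>C real" and r
  have Vc: "continuous_on A (V f)" for A f
    unfolding V_def by (intro continuous_intros) auto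
  define G where "G f t = exp (- (l * cl t)) * (z + x (cl t) - x s + dint (\<lambda>r. \<beta> (V f r)) (\<lambda>r. \<gamma> (V f r)) s (cl t))" for f t
  have Gb: "G f \<in> bcontfun" for f
  proof -
    define g where "g t = exp (- (l * t)) * (z + x t - x s + dint (\<lambda>r. \<beta> (V f r)) (\<lambda>r. \<gamma> (V f r)) s t)" for t
    have gc: "continuous_on {s..T} g"
      unfolding g_def using s
      by (intro continuous_intros dint_continuous[OF s(1) mb_coeff(1,2)[OF Vc]] continuous_on_subset[OF x_cont]) auto
    have Gg: "G f = (\<lambda>t. g (cl t))" by (simp add: G_def g_def fun_eq_iff)
    have "continuous_on UNIV (\<lambda>t. g (cl t))" by (rule continuous_on_compose2[OF gc cl_cont]) (use cl in auto)
    moreover have "bounded (range (\<lambda>t. g (cl t)))"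
      by (rule bounded_subset[OF compact_imp_bounded[OF compact_continuous_image[OF gc compact_Icc]]]) (use cl in auto)
    ultimately show ?thesis unfolding Gg bcontfun_def by auto
  qed
  define \<Gamma> where "\<Gamma> f = Bcontfun (G f)" for f
  have \<Gamma>G: "apply_bcontfun (\<Gamma> f) = G f" for f unfolding \<Gamma>_def by (rule Bcontfun_inverse[OF Gb])
  have "\<exists>!f. \<Gamma> f = f"
  proof (rule banach_fix_type[of "1/2"])
    show "\<forall>f g. dist (\<Gamma> f) (\<Gamma> g) \<le> 1 / 2 * dist f g"
    proof (intro allI dist_bound)
      fix f g :: "real \<Rightarrow>\<^sub>C real" and t
      define c where "c = cl t"
      have c: "s \<le> c" "c \<le> T" using cl[of t] by (auto simp: c_def)
      define D where "D = dist f g"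
      have D0: "0 \<le> D" by (simp add: D_def)
      have Vd: "\<bar>V f r - V g r\<bar> \<le> exp (l * r) * D" for r
      proof -
        have "V f r - V g r = exp (l * r) * (apply_bcontfun f r - apply_bcontfun g r)" by (simp add: V_def right_diff_distrib)
        then show ?thesis using dist_bounded[of f r g] by (simp add: abs_mult D_def dist_real_def)
      qed
      have lipd: "\<bar>h (V f r) - h (V g r)\<bar> \<le> L * D * exp (l * r)"
        if hd: "\<And>z. (h has_real_derivative h' z) (at z)" and hb: "\<And>z. \<bar>h' z\<bar> \<le> L" for h h' r
      proof -
        obtain \<zeta> where "dquot h h' (V g r) (V f r) = h' \<zeta>" using dquot_mvt[OF hd, of "V g r" "V f r"] by blast
        then have "h (V f r) - h (V g r) = h' \<zeta> * (V f r - V g r)" using dquot_eq[of h "V f r" "V g r" h'] by simp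
        then have "\<bar>h (V f r) - h (V g r)\<bar> = \<bar>h' \<zeta>\<bar> * \<bar>V f r - V g r\<bar>" by (simp add: abs_mult)
        also have "\<dots> \<le> L * (exp (l * r) * D)" by (intro mult_mono hb Vd) (use L_nonneg in auto)
        finally show ?thesis by (simp add: mult_ac)
      qed
      have one: "\<bar>LINT r:{s..c}|\<mu>. h (V f r) - h (V g r)\<bar> \<le> L * D * (3 * K / l * exp (l * c))"
        if h: "\<And>z. (h has_real_derivative h' z) (at z)" "\<And>z. \<bar>h' z\<bar> \<le> L" "\<And>z. \<bar>h z\<bar> \<le> B" and dr: "driver T K \<mu> p"
        for h h' \<mu> p
      proof -
        interpret D: driver T K \<mu> p by (rule dr)
        have hc: "continuous_on UNIV h" using h(1) by (meson DERIV_isCont continuous_at_imp_continuous_on)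
        have m: "mb s c B (\<lambda>r. h (V f r))" for f :: "real \<Rightarrow>\<^sub>C real" using h(3) by (intro mb_cont continuous_on_compose2[OF hc Vc]) auto
        have me: "mb s c (exp (l * c)) (\<lambda>r. exp (l * r))" using l0 by (intro mb_cont continuous_intros) auto
        note i = D.driver_integrable[OF s(1) c mb_diff[OF m m]] and ie = D.driver_integrable[OF s(1) c me]
        have "\<bar>LINT r:{s..c}|\<mu>. h (V f r) - h (V g r)\<bar> \<le> (LINT r|\<mu>. \<bar>indicator {s..c} r *\<^sub>R (h (V f r) - h (V g r))\<bar>)"
          unfolding set_lebesgue_integral_def by (rule integral_abs_bound)
        also have "\<dots> \<le> (LINT r|\<mu>. (L * D) * (indicator {s..c} r *\<^sub>R exp (l * r)))"
          using i[of f g] ie lipd[OF h(1,2)] unfolding set_integrable_def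
          by (intro integral_mono) (auto simp: indicator_def)
        also have "\<dots> = L * D * (LINT r:{s..c}|\<mu>. exp (l * r))" unfolding set_lebesgue_integral_def by simp
        also have "\<dots> \<le> L * D * (3 * K / l * (exp (l * c) - exp (l * s)))"
          using L_nonneg D0 by (intro mult_left_mono D.driver_exp_bound l0 s c) auto
        also have "\<dots> \<le> L * D * (3 * K / l * exp (l * c))"
          using L_nonneg D0 l0 D.K_nonneg by (intro mult_left_mono) auto
        finally show ?thesis .
      qed
      have ct: "continuous_on {s..c} (V f)" "continuous_on {s..c} (V g)" by (rule Vc)+
      have "G f t - G g t = exp (- (l * c)) * (dint (\<lambda>r. \<beta> (V f r)) (\<lambda>r. \<gamma> (V f r)) s c - dint (\<lambda>r. \<beta> (V g r)) (\<lambda>r. \<gamma> (V g r)) s c)"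
        by (simp add: G_def c_def right_diff_distrib[symmetric])
      also have "\<dots> = exp (- (l * c)) * dint (\<lambda>r. \<beta> (V f r) - \<beta> (V g r)) (\<lambda>r. \<gamma> (V f r) - \<gamma> (V g r)) s c"
        by (subst dint_diff[OF s(1) c mb_coeff(1,2)[OF ct(1)] mb_coeff(1,2)[OF ct(2)]]) simp
      finally have "\<bar>G f t - G g t\<bar> = exp (- (l * c)) * \<bar>dint (\<lambda>r. \<beta> (V f r) - \<beta> (V g r)) (\<lambda>r. \<gamma> (V f r) - \<gamma> (V g r)) s c\<bar>"
        by (simp add: abs_mult)
      also have "\<dots> \<le> exp (- (l * c)) * (2 * (L * D * (3 * K / l * exp (l * c))))"
        unfolding dint_def
        using one[OF \<beta>d \<beta>'b \<beta>b d1.driver_axioms] one[OF \<gamma>d \<gamma>'b \<gamma>b d2.driver_axioms]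
        by (intro mult_left_mono) (auto intro!: order_trans[OF abs_triangle_ineq])
      also have "\<dots> = (exp (- (l * c)) * exp (l * c)) * (6 * K * L / l) * D" by simp
      also have "\<dots> = (6 * K * L / l) * D" by (simp add: exp_add[symmetric])
      also have "\<dots> \<le> 1 / 2 * D" using lk D0 by (rule mult_right_mono)
      finally show "dist (apply_bcontfun (\<Gamma> f) t) (apply_bcontfun (\<Gamma> g) t) \<le> 1 / 2 * dist f g"
        by (simp add: \<Gamma>G dist_real_def D_def)
    qed
  qed auto
  then obtain f where f: "\<Gamma> f = f" by blast
  have "sol s z (V f)"
    unfolding sol_def
  proof (intro conjI ballI)
    show "continuous_on {s..T} (V f)" by (rule Vc)
    fix t assume t: "t \<in> {s..T}"
    have "apply_bcontfun f t = G f t" using \<Gamma>G[of f] f by simp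
    then have "V f t = exp (l * t) * exp (- (l * t)) * (z + x t - x s + dint (\<lambda>r. \<beta> (V f r)) (\<lambda>r. \<gamma> (V f r)) s t)"
      by (simp add: V_def G_def cl_id[OF t] mult.assoc)
    then show "V f t = z + x t - x s + dint (\<lambda>r. \<beta> (V f r)) (\<lambda>r. \<gamma> (V f r)) s t"
      by (simp add: exp_add[symmetric])
  qed
  then show ?thesis by blast
qed

end


section \<open>The Euler scheme with approximate coefficients\<close>

text \<open>The increments of the two clocks and of the noise are arguments, so that the scheme can be read both
  along a path and as a function of finitely many coordinates.\<close>

primrec euler :: "(real => real) => (real => real) => (nat => real) => (nat => real) => (nat => real) => real => nat => real" where
  "euler b g \<delta>1 \<delta>2 \<delta>x z 0 = z"
| "euler b g \<delta>1 \<delta>2 \<delta>x z (Suc k) = euler b g \<delta>1 \<delta>2 \<delta>x z k + \<delta>x k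
     + b (euler b g \<delta>1 \<delta>2 \<delta>x z k) * \<delta>1 k + g (euler b g \<delta>1 \<delta>2 \<delta>x z k) * \<delta>2 k"

text \<open>Derivative of the scheme along a perturbation whose increments are \<open>\<eta>\<close>.\<close>

primrec tangent :: "(nat => real) => (nat => real) => nat => real" where
  "tangent a \<eta> 0 = 0"
| "tangent a \<eta> (Suc k) = tangent a \<eta> k * (1 + a k) + \<eta> k"

lemma tangent_scale: "tangent a (\<lambda>k. c * \<eta> k) k = c * tangent a \<eta> k"
  by (induction k) (simp_all add: algebra_simps)

lemma tangent_bound:
  assumes "\<And>i. i < k ==> \<bar>a i\<bar> \<le> c"
  shows "\<bar>tangent a \<eta> k\<bar> \<le> (1 + c) ^ k * (\<Sum>i<k. \<bar>\<eta> i\<bar>)"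
  using assms
proof (induction k)
  case (Suc k)
  have c: "0 \<le> c" using Suc.prems[of k] by linarith
  have IH: "\<bar>tangent a \<eta> k\<bar> \<le> (1 + c) ^ k * (\<Sum>i<k. \<bar>\<eta> i\<bar>)" by (rule Suc.IH) (use Suc.prems in simp)
  have 1: "\<bar>1 + a k\<bar> \<le> 1 + c" using Suc.prems[of k] by simp
  have "1 \<le> (1 + c) ^ Suc k" using c by (intro one_le_power) simp
  then have 2: "\<bar>\<eta> k\<bar> \<le> (1 + c) ^ Suc k * \<bar>\<eta> k\<bar>" using mult_right_mono[of 1 "(1 + c) ^ Suc k" "\<bar>\<eta> k\<bar>"] by simp
  have "\<bar>tangent a \<eta> (Suc k)\<bar> \<le> \<bar>tangent a \<eta> k\<bar> * \<bar>1 + a k\<bar> + \<bar>\<eta> k\<bar>"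
    by (simp add: abs_mult[symmetric])
  also have "\<dots> \<le> ((1 + c) ^ k * (\<Sum>i<k. \<bar>\<eta> i\<bar>)) * (1 + c) + (1 + c) ^ Suc k * \<bar>\<eta> k\<bar>"
    using 2 by (intro add_mono mult_mono IH 1) (use c in \<open>auto intro!: mult_nonneg_nonneg sum_nonneg\<close>)
  finally show ?case by (simp add: algebra_simps)
qed simp

lemma one_plus_power_le_exp: "0 \<le> c ==> (1 + c) ^ k \<le> exp (c * real k)"
proof -
  assume "0 \<le> (c::real)"
  then have "(1 + c) ^ k \<le> exp c ^ k" by (intro power_mono exp_ge_add_one_self) auto
  then show ?thesis by (simp add: exp_of_nat_mult[symmetric] mult.commute)
qed

lemma discrete_gronwall:
  fixes e :: "nat => real"
  assumes c: "0 \<le> c" and d: "0 \<le> d" and e0: "0 \<le> e 0"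
    and step: "\<And>i. i < k ==> e (Suc i) \<le> (1 + c) * e i + d"
  shows "e k \<le> exp (c * real k) * (e 0 + real k * d)"
proof -
  have "e k \<le> (1 + c) ^ k * (e 0 + real k * d)"
    using step
  proof (induction k)
    case (Suc k)
    have "1 \<le> (1 + c) ^ Suc k" using c by (intro one_le_power) simp
    then have 2: "d \<le> (1 + c) ^ Suc k * d" using mult_right_mono[of 1 "(1 + c) ^ Suc k" d] d by simp
    have "e (Suc k) \<le> (1 + c) * e k + d" by (rule Suc.prems) simp
    also have "\<dots> \<le> (1 + c) * ((1 + c) ^ k * (e 0 + real k * d)) + (1 + c) ^ Suc k * d"
      using Suc c 2 by (intro add_mono mult_left_mono) auto
    finally show ?case by (simp add: algebra_simps)
  qed simp
  also have "\<dots> \<le> exp (c * real k) * (e 0 + real k * d)"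
    using c d e0 by (intro mult_right_mono one_plus_power_le_exp) auto
  finally show ?thesis .
qed

definition locunif :: "(nat => real => real) => (real => real) => bool" where
  "locunif f F \<longleftrightarrow> (\<forall>R. \<forall>\<epsilon>>0. eventually (\<lambda>n. \<forall>z. \<bar>z\<bar> \<le> R \<longrightarrow> \<bar>f n z - F z\<bar> \<le> \<epsilon>) sequentially)"

lemma lipschitz_of_deriv_bound:
  fixes f f' :: "real => real"
  assumes "\<And>z. (f has_real_derivative f' z) (at z)" "\<And>z. \<bar>f' z\<bar> \<le> L"
  shows "\<bar>f b - f a\<bar> \<le> L * \<bar>b - a\<bar>"
proof -
  obtain \<zeta> where "dquot f f' a b = f' \<zeta>" using dquot_mvt[OF assms(1), of a b] by blast
  then have "f b - f a = f' \<zeta> * (b - a)" using dquot_eq[of f b a f'] by simp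
  then show ?thesis using assms(2)[of \<zeta>] by (simp add: abs_mult mult_right_mono)
qed

lemma exp_minus_one_bound: "\<bar>exp e - 1\<bar> \<le> 2 * \<bar>e\<bar>" and exp_second_order: "\<bar>exp e - (1 + e)\<bar> \<le> 2 * e\<^sup>2"
  if e: "\<bar>e\<bar> \<le> 1 / 2" for e :: real
proof -
  have lo: "1 + e \<le> exp e" by (rule exp_ge_add_one_self)
  have "1 - e \<le> exp (- e)" using exp_ge_add_one_self[of "- e"] by simp
  then have "exp e * (1 - e) \<le> exp e * exp (- e)" by (intro mult_left_mono) auto
  then have up: "exp e * (1 - e) \<le> 1" by (simp add: exp_add[symmetric])
  have "1 \<le> (1 + e + 2 * e\<^sup>2) * (1 - e)"
  proof -
    have "(1 + e + 2 * e\<^sup>2) * (1 - e) = 1 + e\<^sup>2 * (1 - 2 * e)" by (simp add: algebra_simps power2_eq_square)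
    moreover have "0 \<le> e\<^sup>2 * (1 - 2 * e)" using e by (intro mult_nonneg_nonneg) auto
    ultimately show ?thesis by simp
  qed
  then have "exp e * (1 - e) \<le> (1 + e + 2 * e\<^sup>2) * (1 - e)" using up by linarith
  then have "exp e \<le> 1 + e + 2 * e\<^sup>2" using e by (subst (asm) mult_le_cancel_right) auto
  with lo show 2: "\<bar>exp e - (1 + e)\<bar> \<le> 2 * e\<^sup>2" by simp
  have "2 * e\<^sup>2 = 2 * \<bar>e\<bar> * \<bar>e\<bar>" by (simp add: power2_eq_square)
  also have "\<dots> \<le> 1 * \<bar>e\<bar>" using e by (intro mult_right_mono) auto
  finally show "\<bar>exp e - 1\<bar> \<le> 2 * \<bar>e\<bar>" using 2 by linarith
qed

text \<open>The Euler scheme for an equation whose coefficients are replaced by approximations converging together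
  with their first derivatives, locally uniformly; globally only the derivatives are bounded.\<close>

locale ode_approx = ode +
  fixes b g b' g' :: "nat => real => real" and L' :: real and s t z :: real and Z :: "real => real"
  assumes b_deriv: "\<And>n z. (b n has_real_derivative b' n z) (at z)" and g_deriv: "\<And>n z. (g n has_real_derivative g' n z) (at z)"
    and b'_bound: "\<And>n z. \<bar>b' n z\<bar> \<le> L'" and g'_bound: "\<And>n z. \<bar>g' n z\<bar> \<le> L'"
    and b_conv: "locunif b \<beta>" and g_conv: "locunif g \<gamma>"
    and b'_conv: "locunif b' \<beta>'" and g'_conv: "locunif g' \<gamma>'"
    and st: "0 \<le> s" "s \<le> t" "t \<le> T" and Z_sol: "sol s z Z"
begin

definition u :: "nat => nat => real" where "u n k = s + real k * ((t - s) / real (Suc n))"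

definition mesh :: "nat => real" where "mesh n = (t - s) / real (Suc n)"

definition \<delta>1 :: "nat => nat => real" where "\<delta>1 n k = p1 (u n (Suc k)) - p1 (u n k)"
definition \<delta>2 :: "nat => nat => real" where "\<delta>2 n k = p2 (u n (Suc k)) - p2 (u n k)"

definition \<zeta> :: "nat => nat => real" where
  "\<zeta> n k = euler (b n) (g n) (\<delta>1 n) (\<delta>2 n) (\<lambda>k. x (u n (Suc k)) - x (u n k)) z k"

lemma u_0 [simp]: "u n 0 = s" by (simp add: u_def)
lemma u_end [simp]: "u n (Suc n) = t" by (simp add: u_def)
lemma u_Suc: "u n (Suc k) = u n k + mesh n" by (simp add: u_def mesh_def distrib_right add_divide_distrib)
lemma mesh_nonneg: "0 \<le> mesh n" using st by (simp add: mesh_def)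
lemma u_mono: "i \<le> j ==> u n i \<le> u n j" using st unfolding u_def by (intro add_left_mono mult_right_mono) auto
lemma u_bounds: "k \<le> Suc n ==> s \<le> u n k \<and> u n k \<le> t"
  using u_mono[of 0 k n] u_mono[of k "Suc n" n] by simp
lemma mesh_tendsto: "mesh \<longlonglongrightarrow> 0" unfolding mesh_def[abs_def] by (rule LIMSEQ_Suc[OF lim_const_over_n])
lemma mesh_mult: "k \<le> Suc n ==> mesh n * real k \<le> T"
proof -
  assume "k \<le> Suc n"
  then have "mesh n * real k \<le> mesh n * real (Suc n)" using mesh_nonneg by (intro mult_left_mono) auto
  also have "\<dots> = t - s" by (simp add: mesh_def)
  finally show ?thesis using st by simp
qed

lemma \<delta>_bounds:
  assumes "k < Suc n" shows "\<bar>\<delta>1 n k\<bar> \<le> K * mesh n" "\<bar>\<delta>2 n k\<bar> \<le> K * mesh n"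
proof -
  have "0 \<le> u n k" "u n k \<le> u n (Suc k)" "u n (Suc k) \<le> T"
    using u_bounds[of k n] u_bounds[of "Suc k" n] u_mono[of k "Suc k" n] assms st by auto
  from d1.clock_inc[OF this] d2.clock_inc[OF this] u_Suc[of n k]
  show "\<bar>\<delta>1 n k\<bar> \<le> K * mesh n" "\<bar>\<delta>2 n k\<bar> \<le> K * mesh n" by (auto simp: \<delta>1_def \<delta>2_def)
qed

lemma L'_nonneg: "0 \<le> L'" using b'_bound[of 0 0] by linarith

lemma Z_cont: "continuous_on {s..T} Z" using Z_sol by (simp add: sol_def)

lemma Z_osc: "0 < \<epsilon> ==> eventually (\<lambda>n. \<forall>r v. s \<le> r \<and> r \<le> v \<and> v \<le> t \<and> v - r \<le> mesh n \<longrightarrow> \<bar>Z v - Z r\<bar> \<le> \<epsilon>) sequentially"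
proof -
  assume e: "0 < \<epsilon>"
  have "uniformly_continuous_on {s..T} Z" by (rule compact_uniformly_continuous[OF Z_cont]) simp
  then obtain d where d: "0 < d" "\<And>r v. r \<in> {s..T} ==> v \<in> {s..T} ==> dist v r < d ==> dist (Z v) (Z r) < \<epsilon>"
    using e unfolding uniformly_continuous_on_def by metis
  have "eventually (\<lambda>n. mesh n < d) sequentially" using mesh_tendsto d(1) by (rule order_tendstoD(2))
  then show ?thesis
  proof eventually_elim
    fix n assume n: "mesh n < d"
    show "\<forall>r v. s \<le> r \<and> r \<le> v \<and> v \<le> t \<and> v - r \<le> mesh n \<longrightarrow> \<bar>Z v - Z r\<bar> \<le> \<epsilon>"
    proof (intro allI impI)
      fix r v assume a: "s \<le> r \<and> r \<le> v \<and> v \<le> t \<and> v - r \<le> mesh n"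
      then have "dist (Z v) (Z r) < \<epsilon>" using n st by (intro d(2)) (auto simp: dist_real_def)
      then show "\<bar>Z v - Z r\<bar> \<le> \<epsilon>" by (simp add: dist_real_def)
    qed
  qed
qed

lemma Z_bounded: obtains R where "0 \<le> R" "\<And>r. r \<in> {s..T} ==> \<bar>Z r\<bar> \<le> R"
proof -
  have "bounded (Z ` {s..T})" by (intro compact_imp_bounded compact_continuous_image Z_cont) simp
  then obtain R where R: "\<forall>y\<in>Z ` {s..T}. norm y \<le> R" unfolding bounded_iff by blast
  then have R': "\<bar>Z r\<bar> \<le> R" if "r \<in> {s..T}" for r using that by auto
  have "0 \<le> R" using R'[of s] st by auto
  then show ?thesis using R' by (rule that)
qed

lemma Z_step:
  assumes v: "s \<le> v" "v \<le> w" "w \<le> T"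
  shows "Z w = Z v + x w - x v + dint (\<lambda>r. \<beta> (Z r)) (\<lambda>r. \<gamma> (Z r)) v w"
proof -
  have "sol v (Z v) Z" by (rule sol_restart[OF Z_sol st(1)]) (use v in auto)
  then have "\<forall>t\<in>{v..T}. Z t = Z v + x t - x v + dint (\<lambda>r. \<beta> (Z r)) (\<lambda>r. \<gamma> (Z r)) v t"
    unfolding sol_def by (rule conjunct2)
  then show ?thesis by (rule bspec) (use v in auto)
qed

text \<open>Discrete Gronwall inequality. The local error of a step combines the oscillation of \<open>Z\<close> over a cell
  and the error of the coefficients on the compact range of \<open>Z\<close>; both are at most \<open>d\<close> for fine grids.\<close>

lemma euler_converges:
  assumes e: "0 < \<epsilon>"
  shows "eventually (\<lambda>n. \<forall>k\<le>Suc n. \<bar>\<zeta> n k - Z (u n k)\<bar> \<le> \<epsilon>) sequentially"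
proof -
  obtain R where R: "0 \<le> R" "\<And>r. r \<in> {s..T} ==> \<bar>Z r\<bar> \<le> R" by (rule Z_bounded, rule that)
  define C where "C = exp (2 * K * L' * T) * (T * (2 * K * (L + 1)))"
  have K0: "0 \<le> K" by (rule d1.K_nonneg)
  have C0: "0 \<le> C" using K0 L_nonneg T_nonneg by (simp add: C_def)
  \<comment> \<open>\<open>C\<close> is the Gronwall constant of the scheme; adding \<open>1\<close> avoids division by zero.\<close>
  define d where "d = \<epsilon> / (C + 1)"
  have d0: "0 < d" using e C0 by (simp add: d_def)
  have Cd: "C * d \<le> \<epsilon>" using e C0 by (simp add: d_def field_simps)
  have "eventually (\<lambda>n. \<forall>y. \<bar>y\<bar> \<le> R \<longrightarrow> \<bar>b n y - \<beta> y\<bar> \<le> d) sequentially"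
    "eventually (\<lambda>n. \<forall>y. \<bar>y\<bar> \<le> R \<longrightarrow> \<bar>g n y - \<gamma> y\<bar> \<le> d) sequentially"
    using b_conv g_conv d0 unfolding locunif_def by blast+
  with Z_osc[OF d0] show ?thesis
  proof eventually_elim
    fix n
    assume osc: "\<forall>r v. s \<le> r \<and> r \<le> v \<and> v \<le> t \<and> v - r \<le> mesh n \<longrightarrow> \<bar>Z v - Z r\<bar> \<le> d"
      and bn: "\<forall>y. \<bar>y\<bar> \<le> R \<longrightarrow> \<bar>b n y - \<beta> y\<bar> \<le> d" and gn: "\<forall>y. \<bar>y\<bar> \<le> R \<longrightarrow> \<bar>g n y - \<gamma> y\<bar> \<le> d"
    define er where "er k = \<bar>\<zeta> n k - Z (u n k)\<bar>" for k
    have step: "er (Suc k) \<le> (1 + 2 * K * L' * mesh n) * er k + 2 * K * (L + 1) * d * mesh n" if k: "k < Suc n" for k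
    proof -
      define v where "v = u n k"
      define w where "w = u n (Suc k)"
      have vw: "s \<le> v" "v \<le> w" "w \<le> t" "w \<le> T" "0 \<le> v" "w - v = mesh n"
        using u_bounds[of k n] u_bounds[of "Suc k" n] u_mono[of k "Suc k" n] k st u_Suc[of n k] by (auto simp: v_def w_def)
      define M where "M = L' * er k + (L + 1) * d"
      have close: "\<bar>F (Z r) - \<phi> (\<zeta> n k)\<bar> \<le> M"
        if r: "r \<in> {v..w}" and Fd: "\<And>z. (F has_real_derivative F' z) (at z)" "\<And>z. \<bar>F' z\<bar> \<le> L"
          and fd: "\<And>z. (\<phi> has_real_derivative \<phi>' z) (at z)" "\<And>z. \<bar>\<phi>' z\<bar> \<le> L'" and fn: "\<forall>y. \<bar>y\<bar> \<le> R \<longrightarrow> \<bar>\<phi> y - F y\<bar> \<le> d"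
        for F F' \<phi> \<phi>' r
      proof -
        have "\<bar>F (Z r) - F (Z v)\<bar> \<le> L * \<bar>Z r - Z v\<bar>" by (rule lipschitz_of_deriv_bound[OF Fd])
        also have "\<dots> \<le> L * d" using osc[rule_format, of v r] r vw L_nonneg by (intro mult_left_mono) auto
        finally have 1: "\<bar>F (Z r) - F (Z v)\<bar> \<le> L * d" .
        have 2: "\<bar>\<phi> (Z v) - F (Z v)\<bar> \<le> d" using fn R(2)[of v] vw by auto
        have 3: "\<bar>\<phi> (\<zeta> n k) - \<phi> (Z v)\<bar> \<le> L' * er k" unfolding er_def v_def by (rule lipschitz_of_deriv_bound[OF fd])
        show ?thesis using 1 2 3 unfolding M_def distrib_right by linarith
      qed
      have cZ: "continuous_on {v..w} Z" by (rule continuous_on_subset[OF Z_cont]) (use vw in auto)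
      have mB: "mb v w M (\<lambda>r. \<beta> (Z r) - b n (\<zeta> n k))" "mb v w M (\<lambda>r. \<gamma> (Z r) - g n (\<zeta> n k))"
        by (intro mb_cont continuous_on_diff continuous_on_const continuous_on_compose2[OF \<beta>c cZ] continuous_on_compose2[OF \<gamma>c cZ]
            close[where F = \<beta> and F' = \<beta>' and \<phi> = "b n" and \<phi>' = "b' n", OF _ \<beta>d \<beta>'b b_deriv b'_bound bn]
            close[where F = \<gamma> and F' = \<gamma>' and \<phi> = "g n" and \<phi>' = "g' n", OF _ \<gamma>d \<gamma>'b g_deriv g'_bound gn]; simp)+
      define c where "c = \<bar>b n (\<zeta> n k)\<bar> + \<bar>g n (\<zeta> n k)\<bar>"
      have mc: "mb v w c (\<lambda>r. b n (\<zeta> n k))" "mb v w c (\<lambda>r. g n (\<zeta> n k))"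
        by (intro mb_cont continuous_on_const; simp add: c_def)+
      have Zw: "Z w = Z v + x w - x v + dint (\<lambda>r. \<beta> (Z r)) (\<lambda>r. \<gamma> (Z r)) v w" by (rule Z_step) (use vw in auto)
      have "\<zeta> n (Suc k) = \<zeta> n k + (x w - x v) + dint (\<lambda>r. b n (\<zeta> n k)) (\<lambda>r. g n (\<zeta> n k)) v w"
        by (subst dint_const) (use vw in \<open>auto simp: \<zeta>_def v_def w_def \<delta>1_def \<delta>2_def\<close>)
      with Zw have "Z w - \<zeta> n (Suc k) = (Z v - \<zeta> n k) + (dint (\<lambda>r. \<beta> (Z r)) (\<lambda>r. \<gamma> (Z r)) v w - dint (\<lambda>r. b n (\<zeta> n k)) (\<lambda>r. g n (\<zeta> n k)) v w)"
        by simp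
      also have "\<dots> = (Z v - \<zeta> n k) + dint (\<lambda>r. \<beta> (Z r) - b n (\<zeta> n k)) (\<lambda>r. \<gamma> (Z r) - g n (\<zeta> n k)) v w"
        by (subst dint_diff[OF vw(5,2,4) mb_coeff(1,2)[OF cZ] mc]) simp
      finally have "er (Suc k) \<le> er k + 2 * M * K * mesh n"
        using dint_bound[OF vw(5,2,4) mB, unfolded vw(6)] unfolding er_def v_def[symmetric] w_def[symmetric] by linarith
      then show ?thesis by (simp add: M_def algebra_simps)
    qed
    show "\<forall>k\<le>Suc n. \<bar>\<zeta> n k - Z (u n k)\<bar> \<le> \<epsilon>"
    proof (intro allI impI)
      fix k assume k: "k \<le> Suc n"
      have e0: "er 0 = 0" using sol_init[OF Z_sol] st by (simp add: er_def \<zeta>_def)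
      have "er k \<le> exp (2 * K * L' * mesh n * real k) * (er 0 + real k * (2 * K * (L + 1) * d * mesh n))"
        by (rule discrete_gronwall) (use step k K0 L'_nonneg L_nonneg d0 mesh_nonneg e0 in auto)
      also have "\<dots> = exp (2 * K * L' * (mesh n * real k)) * ((mesh n * real k) * (2 * K * (L + 1) * d))"
        by (simp add: e0 mult_ac)
      also have "\<dots> \<le> exp (2 * K * L' * T) * (T * (2 * K * (L + 1) * d))"
        using mesh_mult[OF k] K0 L'_nonneg L_nonneg d0 T_nonneg mesh_nonneg[of n]
        by (intro mult_mono) (auto intro!: mult_left_mono)
      also have "\<dots> = C * d" by (simp add: C_def mult_ac)
      finally show "\<bar>\<zeta> n k - Z (u n k)\<bar> \<le> \<epsilon>" using Cd by (simp add: er_def)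
    qed
  qed
qed

lemma coefficient_converges:
  assumes f: "locunif f F" and F: "continuous_on UNIV F" and e: "0 < \<epsilon>"
  shows "eventually (\<lambda>n. \<forall>k<Suc n. \<forall>r\<in>{u n k..u n (Suc k)}. \<bar>F (Z r) - f n (\<zeta> n k)\<bar> \<le> \<epsilon>) sequentially"
proof -
  obtain R where R: "0 \<le> R" "\<And>r. r \<in> {s..T} ==> \<bar>Z r\<bar> \<le> R" by (rule Z_bounded, rule that)
  have "uniformly_continuous_on {-(R+1)..R+1} F"
    by (rule compact_uniformly_continuous) (auto intro: continuous_on_subset[OF F])
  then obtain d where d: "0 < d" "\<And>y y'. y \<in> {-(R+1)..R+1} ==> y' \<in> {-(R+1)..R+1} ==> dist y' y < d ==> dist (F y') (F y) < \<epsilon> / 2"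
    using e unfolding uniformly_continuous_on_def by (metis half_gt_zero)
  define d' where "d' = min 1 (d / 3)"
  have d': "0 < d'" "d' \<le> 1" "2 * d' < d" using d(1) by (auto simp: d'_def)
  have "0 < \<epsilon> / 2" using e by simp
  then have "eventually (\<lambda>n. \<forall>y. \<bar>y\<bar> \<le> R + 1 \<longrightarrow> \<bar>f n y - F y\<bar> \<le> \<epsilon> / 2) sequentially"
    using f unfolding locunif_def by blast
  with Z_osc[OF d'(1)] euler_converges[OF d'(1)] show ?thesis
  proof eventually_elim
    fix n
    assume osc: "\<forall>r v. s \<le> r \<and> r \<le> v \<and> v \<le> t \<and> v - r \<le> mesh n \<longrightarrow> \<bar>Z v - Z r\<bar> \<le> d'"
      and eu: "\<forall>k\<le>Suc n. \<bar>\<zeta> n k - Z (u n k)\<bar> \<le> d'" and fn: "\<forall>y. \<bar>y\<bar> \<le> R + 1 \<longrightarrow> \<bar>f n y - F y\<bar> \<le> \<epsilon> / 2"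
    show "\<forall>k<Suc n. \<forall>r\<in>{u n k..u n (Suc k)}. \<bar>F (Z r) - f n (\<zeta> n k)\<bar> \<le> \<epsilon>"
    proof (intro allI impI ballI)
      fix k r assume k: "k < Suc n" and r: "r \<in> {u n k..u n (Suc k)}"
      have b: "s \<le> u n k" "u n (Suc k) \<le> t" "u n (Suc k) = u n k + mesh n"
        using u_bounds[of k n] u_bounds[of "Suc k" n] k u_Suc[of n k] by auto
      have z1: "\<bar>Z r - Z (u n k)\<bar> \<le> d'" using osc[rule_format, of "u n k" r] r b by auto
      have z2: "\<bar>\<zeta> n k - Z (u n k)\<bar> \<le> d'" using eu k by simp
      have Zr: "\<bar>Z r\<bar> \<le> R" "\<bar>Z (u n k)\<bar> \<le> R" using R(2) r b st by auto
      have "\<bar>\<zeta> n k\<bar> \<le> R + 1" using z2 Zr(2) d'(2) by linarith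
      then have 1: "\<bar>f n (\<zeta> n k) - F (\<zeta> n k)\<bar> \<le> \<epsilon> / 2" using fn by blast
      have "dist (F (Z r)) (F (\<zeta> n k)) < \<epsilon> / 2"
      proof (rule d(2))
        show "\<zeta> n k \<in> {-(R+1)..R+1}" using \<open>\<bar>\<zeta> n k\<bar> \<le> R + 1\<close> by auto
        show "Z r \<in> {-(R+1)..R+1}" using Zr(1) by auto
        show "dist (Z r) (\<zeta> n k) < d" using z1 z2 d'(3) unfolding dist_real_def by linarith
      qed
      with 1 show "\<bar>F (Z r) - f n (\<zeta> n k)\<bar> \<le> \<epsilon>" unfolding dist_real_def by linarith
    qed
  qed
qed

definition rate :: "nat => nat => real" where
  "rate n k = b' n (\<zeta> n k) * \<delta>1 n k + g' n (\<zeta> n k) * \<delta>2 n k"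

text \<open>The direction \<open>1\<^bsub>[r,\<infinity>)\<^esub>\<close>: the perturbation of the noise belonging to the time \<open>r\<close> of a Malliavin derivative.
  It has a single jump, in the cell that contains \<open>r\<close>.\<close>

definition kick :: "nat => real => nat => real" where
  "kick n r k = of_bool (r \<le> u n (Suc k)) - of_bool (r \<le> u n k)"

lemma kick_sum: "(\<Sum>i<k. \<bar>kick n r i\<bar>) \<le> 1"
proof -
  have "\<bar>kick n r i\<bar> = kick n r i" for i using u_mono[of i "Suc i" n] by (auto simp: kick_def of_bool_def)
  then have "(\<Sum>i<k. \<bar>kick n r i\<bar>) = (\<Sum>i<k. of_bool (r \<le> u n (Suc i)) - of_bool (r \<le> u n i))"
    by (intro sum.cong refl) (simp only: kick_def)
  also have "\<dots> = of_bool (r \<le> u n k) - of_bool (r \<le> u n 0)"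
    by (rule sum_lessThan_telescope)
  finally have "(\<Sum>i<k. \<bar>kick n r i\<bar>) = of_bool (r \<le> u n k) - of_bool (r \<le> u n 0)" .
  then show ?thesis by (auto simp: of_bool_def)
qed

lemma rate_bound:
  assumes "k < Suc n" shows "\<bar>rate n k\<bar> \<le> 2 * K * L' * mesh n"
proof -
  have "\<bar>rate n k\<bar> \<le> \<bar>b' n (\<zeta> n k)\<bar> * \<bar>\<delta>1 n k\<bar> + \<bar>g' n (\<zeta> n k)\<bar> * \<bar>\<delta>2 n k\<bar>"
    unfolding rate_def by (simp add: abs_mult[symmetric])
  also have "\<dots> \<le> L' * (K * mesh n) + L' * (K * mesh n)"
    using L'_nonneg by (intro add_mono mult_mono b'_bound g'_bound \<delta>_bounds assms) auto
  finally show ?thesis by simp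
qed

lemma tangent_kick_bound: "\<bar>tangent (rate n) (kick n r) (Suc n)\<bar> \<le> exp (2 * K * L' * T)"
proof -
  have K0: "0 \<le> K" by (rule d1.K_nonneg)
  define c where "c = 2 * K * L' * mesh n"
  have c0: "0 \<le> c" using K0 L'_nonneg mesh_nonneg by (simp add: c_def)
  have "\<bar>tangent (rate n) (kick n r) (Suc n)\<bar> \<le> (1 + c) ^ Suc n * (\<Sum>i<Suc n. \<bar>kick n r i\<bar>)"
    unfolding c_def by (rule tangent_bound) (rule rate_bound)
  also have "\<dots> \<le> exp (c * real (Suc n)) * 1"
    using c0 by (intro mult_mono one_plus_power_le_exp kick_sum) (auto intro: sum_nonneg)
  also have "c * real (Suc n) = 2 * K * L' * (mesh n * real (Suc n))" by (simp add: c_def)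
  also have "exp \<dots> * 1 \<le> exp (2 * K * L' * T)"
    using mesh_mult[of "Suc n" n] K0 L'_nonneg by (simp add: mult_left_mono)
  finally show ?thesis .
qed

lemma tangent_kick_outside:
  assumes "r \<le> s \<or> t < r" shows "tangent (rate n) (kick n r) (Suc n) = 0"
proof -
  have k0: "kick n r k = 0" if "k < Suc n" for k
    using assms u_bounds[of k n] u_bounds[of "Suc k" n] that by (auto simp: kick_def)
  have "tangent (rate n) (kick n r) k = 0" if "k \<le> Suc n" for k
    using that by (induction k) (simp_all add: k0)
  from this[OF order_refl] show ?thesis .
qed

text \<open>After the jump the tangent process multiplies by \<open>1 + rate\<close> in each cell, while the exponential
  multiplies by \<open>exp\<close> of the integral over the cell; the factors differ by terms of second order and by the
  error of the coefficient derivatives, which Gronwall's inequality sums up.\<close>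

lemma tangent_converges:
  assumes r: "s < r" "r \<le> t"
  shows "(\<lambda>n. tangent (rate n) (kick n r) (Suc n)) \<longlonglongrightarrow> exp (dint (\<lambda>v. \<beta>' (Z v)) (\<lambda>v. \<gamma>' (Z v)) r t)"
proof (rule tendstoI)
  fix \<epsilon> :: real assume e: "0 < \<epsilon>"
  have K0: "0 \<le> K" by (rule d1.K_nonneg)
  define c where "c = 2 * L * K"
  have c0: "0 \<le> c" using K0 L_nonneg by (simp add: c_def)
  define C1 where "C1 = exp (c * T)"
  define A where "A = exp (2 * K * L' * T)"
  have A0: "0 < A" "0 < C1" by (simp_all add: A_def C1_def)
  let ?D = "\<lambda>v w. dint (\<lambda>v. \<beta>' (Z v)) (\<lambda>v. \<gamma>' (Z v)) v w"
  have mZ: "mb v w L (\<lambda>v. \<beta>' (Z v))" "mb v w L (\<lambda>v. \<gamma>' (Z v))" if "s \<le> v" "w \<le> T" for v w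
    by (intro mb_coeff(3,4) continuous_on_subset[OF Z_cont]; use that in auto)+
  have Db: "\<bar>?D v w\<bar> \<le> c * (w - v)" if "s \<le> v" "v \<le> w" "w \<le> T" for v w
    using dint_bound[OF _ that(2,3) mZ[OF that(1,3)]] that st by (simp add: c_def)
  \<comment> \<open>The part of the accumulated error that stems from the coefficients is \<open>A T C1 2 K d \<le> \<epsilon> / 4\<close>.\<close>
  define d where "d = \<epsilon> / (4 * A * (T * (C1 * (2 * K)) + 1))"
  have X0: "0 \<le> T * (C1 * (2 * K))" using T_nonneg A0 K0 by simp
  have X1: "0 < T * (C1 * (2 * K)) + 1" using X0 by linarith
  have d0: "0 < d" unfolding d_def by (intro divide_pos_pos mult_pos_pos e X1 A0) auto
  have Xd: "A * (T * (C1 * (2 * K * d))) \<le> \<epsilon> / 4"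
  proof -
    have "A * (T * (C1 * (2 * K * d))) = (T * (C1 * (2 * K))) * (A * d)" by (simp add: mult_ac)
    also have "\<dots> \<le> (T * (C1 * (2 * K)) + 1) * (A * d)" using A0 d0 by (intro mult_right_mono) auto
    also have "\<dots> = \<epsilon> / 4"
    proof -
      have ne: "T * (C1 * (2 * K)) + 1 \<noteq> 0" using X0 by linarith
      have "P * (A * (\<epsilon> / (4 * A * P))) = \<epsilon> / 4" if "P \<noteq> 0" for P using that A0 by (simp add: field_simps)
      from this[OF ne] show ?thesis unfolding d_def .
    qed
    finally show ?thesis .
  qed
  have "(\<lambda>n. c * mesh n) \<longlonglongrightarrow> c * 0" by (intro tendsto_intros mesh_tendsto)
  then have e1: "eventually (\<lambda>n. c * mesh n < 1 / 2) sequentially" by (intro order_tendstoD(2)) auto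
  have "(\<lambda>n. A * (2 * (c * mesh n) + T * (C1 * (2 * c\<^sup>2 * mesh n)))) \<longlonglongrightarrow> A * (2 * (c * 0) + T * (C1 * (2 * c\<^sup>2 * 0)))"
    by (intro tendsto_intros mesh_tendsto)
  then have e2: "eventually (\<lambda>n. A * (2 * (c * mesh n) + T * (C1 * (2 * c\<^sup>2 * mesh n))) < \<epsilon> / 4) sequentially"
    using e by (intro order_tendstoD(2)) auto
  from e1 e2 coefficient_converges[OF b'_conv \<beta>'c d0] coefficient_converges[OF g'_conv \<gamma>'c d0]
  show "eventually (\<lambda>n. dist (tangent (rate n) (kick n r) (Suc n)) (exp (?D r t)) < \<epsilon>) sequentially"
  proof eventually_elim
    fix n
    assume h1: "c * mesh n < 1 / 2" and h2: "A * (2 * (c * mesh n) + T * (C1 * (2 * c\<^sup>2 * mesh n))) < \<epsilon> / 4"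
      and cb: "\<forall>k<Suc n. \<forall>r\<in>{u n k..u n (Suc k)}. \<bar>\<beta>' (Z r) - b' n (\<zeta> n k)\<bar> \<le> d"
      and cg: "\<forall>k<Suc n. \<forall>r\<in>{u n k..u n (Suc k)}. \<bar>\<gamma>' (Z r) - g' n (\<zeta> n k)\<bar> \<le> d"
    note h0 = mesh_nonneg[of n]
    \<comment> \<open>\<open>J\<close> is the first grid index not before \<open>r\<close>, the position at which the kick has just occurred.\<close>
    define J where "J = (LEAST k. r \<le> u n k)"
    have J: "r \<le> u n J" unfolding J_def by (rule LeastI[of "\<lambda>k. r \<le> u n k" "Suc n"]) (use r in simp)
    have Jle: "J \<le> Suc n" unfolding J_def by (rule Least_le) (use r in simp)
    have Jlt: "u n k < r" if "k < J" for k using not_less_Least[of k "\<lambda>k. r \<le> u n k"] that by (simp add: J_def)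
    have "J \<noteq> 0" using J r by (intro notI) simp
    then obtain j where j: "J = Suc j" by (cases J) auto
    have kick: "kick n r k = of_bool (k = j)" for k
    proof -
      have "r \<le> u n k \<longleftrightarrow> J \<le> k" for k
        using Jlt[of k] J u_mono[of J k n] by (cases "J \<le> k") auto
      then show ?thesis by (auto simp: kick_def j of_bool_def)
    qed
    let ?t = "tangent (rate n) (kick n r)"
    have t0: "?t k = 0" if "k \<le> j" for k
      using that by (induction k) (simp_all add: kick)
    have tJ: "?t J = 1" by (simp add: j t0 kick)
    define f where "f i = \<bar>?t (J + i) - exp (?D r (u n (J + i)))\<bar>" for i
    have step: "f (Suc i) \<le> (1 + 2 * K * L' * mesh n) * f i + C1 * (2 * K * d + 2 * c\<^sup>2 * mesh n) * mesh n"
      if i: "i < Suc n - J" for i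
    proof -
      define k where "k = J + i"
      have k: "k < Suc n" "J \<le> k" using i by (auto simp: k_def)
      define v where "v = u n k"
      define w where "w = u n (Suc k)"
      have vw: "s \<le> v" "v \<le> w" "w \<le> t" "w \<le> T" "0 \<le> v" "w - v = mesh n" "r \<le> v"
        using u_bounds[of k n] u_bounds[of "Suc k" n] u_mono[of k "Suc k" n] k st u_Suc[of n k] J u_mono[OF k(2), of n] by (auto simp: v_def w_def)
      define \<epsilon>' where "\<epsilon>' = ?D v w"
      have Dw: "?D r w = ?D r v + \<epsilon>'"
        unfolding \<epsilon>'_def by (rule dint_add[OF _ _ _ _ mZ]) (use vw r st in auto)
      have eb: "\<bar>\<epsilon>'\<bar> \<le> c * mesh n" using Db[of v w] vw by (simp add: \<epsilon>'_def)
      have ra: "\<bar>rate n k - \<epsilon>'\<bar> \<le> 2 * K * d * mesh n"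
      proof -
        define m where "m = \<bar>b' n (\<zeta> n k)\<bar> + \<bar>g' n (\<zeta> n k)\<bar>"
        have mc: "mb v w m (\<lambda>r. b' n (\<zeta> n k))" "mb v w m (\<lambda>r. g' n (\<zeta> n k))"
          by (intro mb_cont continuous_on_const; simp add: m_def)+
        have cZ: "continuous_on {v..w} Z" by (rule continuous_on_subset[OF Z_cont]) (use vw in auto)
        have cb': "\<And>r. r \<in> {v..w} ==> \<bar>\<beta>' (Z r) - b' n (\<zeta> n k)\<bar> \<le> d"
          and cg': "\<And>r. r \<in> {v..w} ==> \<bar>\<gamma>' (Z r) - g' n (\<zeta> n k)\<bar> \<le> d"
          using cb cg k(1) by (auto simp: v_def w_def)
        have md: "mb v w d (\<lambda>r. \<beta>' (Z r) - b' n (\<zeta> n k))" "mb v w d (\<lambda>r. \<gamma>' (Z r) - g' n (\<zeta> n k))"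
          by (intro mb_cont continuous_on_diff continuous_on_const continuous_on_compose2[OF \<beta>'c cZ]
              continuous_on_compose2[OF \<gamma>'c cZ] cb' cg'; simp)+
        have "rate n k = dint (\<lambda>r. b' n (\<zeta> n k)) (\<lambda>r. g' n (\<zeta> n k)) v w"
          by (subst dint_const) (use vw in \<open>auto simp: rate_def v_def w_def \<delta>1_def \<delta>2_def\<close>)
        then have "\<epsilon>' - rate n k = dint (\<lambda>r. \<beta>' (Z r) - b' n (\<zeta> n k)) (\<lambda>r. \<gamma>' (Z r) - g' n (\<zeta> n k)) v w"
          unfolding \<epsilon>'_def by (subst dint_diff[OF vw(5,2,4) mZ[OF vw(1,4)] mc]) simp
        then show ?thesis using dint_bound[OF vw(5,2,4) md] vw(6) by (simp add: abs_minus_commute mult_ac)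
      qed
      have "\<bar>\<epsilon>'\<bar> \<le> 1 / 2" using eb h1 by linarith
      from exp_second_order[OF this] have "\<bar>exp \<epsilon>' - (1 + \<epsilon>')\<bar> \<le> 2 * \<epsilon>'\<^sup>2" .
      also have "\<epsilon>'\<^sup>2 \<le> (c * mesh n)\<^sup>2" using power_mono[OF eb abs_ge_zero, of 2] by simp
      finally have "\<bar>(1 + rate n k) - exp \<epsilon>'\<bar> \<le> 2 * K * d * mesh n + 2 * (c * mesh n)\<^sup>2" using ra by linarith
      then have loc: "\<bar>(1 + rate n k) - exp \<epsilon>'\<bar> \<le> (2 * K * d + 2 * c\<^sup>2 * mesh n) * mesh n"
        by (simp add: power2_eq_square algebra_simps)
      have E: "exp (?D r v) \<le> C1"
      proof -
        have "?D r v \<le> c * (v - r)" using Db[of r v] vw r by auto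
        also have "\<dots> \<le> c * T" using c0 vw r st by (intro mult_left_mono) auto
        finally show ?thesis by (simp add: C1_def)
      qed
      have "kick n r k = 0" using k(2) by (simp add: kick j)
      then have "?t (Suc k) - exp (?D r w) = (?t k - exp (?D r v)) * (1 + rate n k) + exp (?D r v) * ((1 + rate n k) - exp \<epsilon>')"
        unfolding Dw exp_add by (simp add: algebra_simps)
      then have "f (Suc i) \<le> \<bar>?t k - exp (?D r v)\<bar> * \<bar>1 + rate n k\<bar> + exp (?D r v) * \<bar>(1 + rate n k) - exp \<epsilon>'\<bar>"
        unfolding f_def k_def[symmetric] add_Suc_right w_def[symmetric]
        by (simp add: abs_mult[symmetric]) (metis abs_exp_cancel abs_mult abs_triangle_ineq)
      also have "\<dots> \<le> f i * (1 + 2 * K * L' * mesh n) + C1 * ((2 * K * d + 2 * c\<^sup>2 * mesh n) * mesh n)"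
      proof (intro add_mono mult_mono loc E)
        show "\<bar>?t k - exp (?D r v)\<bar> \<le> f i" by (simp add: f_def k_def v_def)
        show "\<bar>1 + rate n k\<bar> \<le> 1 + 2 * K * L' * mesh n" using rate_bound[OF k(1)] by linarith
      qed (auto simp: f_def C1_def)
      finally show ?thesis by (simp add: mult_ac)
    qed
    have f0: "f 0 \<le> 2 * (c * mesh n)"
    proof -
      have "u n J - r \<le> mesh n" using Jlt[of j] u_Suc[of n j] j by simp
      then have "\<bar>?D r (u n J)\<bar> \<le> c * mesh n"
        using Db[of r "u n J"] J r u_bounds[OF Jle] st c0 mult_left_mono[of "u n J - r" "mesh n" c] by simp
      then have "\<bar>exp (?D r (u n J)) - 1\<bar> \<le> 2 * (c * mesh n)"
        using exp_minus_one_bound[of "?D r (u n J)"] h1 by linarith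
      then show ?thesis by (simp add: f_def tJ abs_minus_commute)
    qed
    define m where "m = Suc n - J"
    define q where "q = C1 * (2 * K * d + 2 * c\<^sup>2 * mesh n)"
    have q0: "0 \<le> q" using A0 K0 d0 h0 by (auto simp: q_def intro!: mult_nonneg_nonneg add_nonneg_nonneg)
    have m: "m \<le> Suc n" by (simp add: m_def)
    have "f m \<le> exp (2 * K * L' * mesh n * real m) * (f 0 + real m * (q * mesh n))"
    proof (rule discrete_gronwall)
      show "0 \<le> 2 * K * L' * mesh n" using K0 L'_nonneg h0 by simp
      show "0 \<le> q * mesh n" using q0 h0 by simp
      show "0 \<le> f 0" by (simp add: f_def)
      show "f (Suc i) \<le> (1 + 2 * K * L' * mesh n) * f i + q * mesh n" if "i < m" for i
        using step[of i] that by (simp add: m_def q_def)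
    qed
    also have "\<dots> \<le> A * (2 * (c * mesh n) + T * q)"
    proof (rule mult_mono)
      have "2 * K * L' * (mesh n * real m) \<le> 2 * K * L' * T" using mesh_mult[OF m] K0 L'_nonneg by (intro mult_left_mono) auto
      then show "exp (2 * K * L' * mesh n * real m) \<le> A" by (simp add: A_def mult.assoc)
      have "(mesh n * real m) * q \<le> T * q" using mesh_mult[OF m] q0 by (rule mult_right_mono)
      then have "real m * (q * mesh n) \<le> T * q" by (simp add: mult_ac)
      with f0 show "f 0 + real m * (q * mesh n) \<le> 2 * (c * mesh n) + T * q" by (rule add_mono)
      show "0 \<le> f 0 + real m * (q * mesh n)" using q0 h0 by (simp add: f_def)
    qed (use A0 in auto)
    also have "\<dots> = A * (2 * (c * mesh n) + T * (C1 * (2 * c\<^sup>2 * mesh n))) + A * (T * (C1 * (2 * K * d)))"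
      by (simp add: q_def algebra_simps)
    also have "\<dots> < \<epsilon>" using h2 Xd e by linarith
    finally have "f m < \<epsilon>" .
    moreover have "J + m = Suc n" using Jle by (simp add: m_def)
    ultimately show "dist (?t (Suc n)) (exp (?D r t)) < \<epsilon>" by (simp add: f_def dist_real_def del: tangent.simps)
  qed
qed

end


section \<open>The Lamperti transform\<close>

lemma abs_divide_le:
  fixes x y :: real assumes "\<bar>x\<bar> \<le> B" "0 < m" "m \<le> y" shows "\<bar>x / y\<bar> \<le> B / m"
proof -
  have "\<bar>x / y\<bar> = \<bar>x\<bar> / y" using assms by simp
  also have "\<dots> \<le> B / m" using assms by (intro frac_le) auto
  finally show ?thesis .
qed

locale lamperti_coeffs =
  fixes b \<sigma> :: "real => real" and lo hi :: real
  assumes b_Cb: "b \<in> Cb 2" and \<sigma>_Cb: "\<sigma> \<in> Cb 3" and lo: "0 < lo"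
    and \<sigma>_lo: "\<And>y. lo \<le> \<sigma> y" and \<sigma>_hi: "\<And>y. \<sigma> y \<le> hi"
begin

lemma Cb_facts:
  assumes f: "f \<in> Cb k" and j: "j < k"
  shows "((deriv ^^ j) f has_real_derivative (deriv ^^ Suc j) f y) (at y)"
    "continuous_on UNIV ((deriv ^^ j) f)" "\<exists>B. \<forall>y. \<bar>(deriv ^^ j) f y\<bar> \<le> B"
    "continuous_on UNIV ((deriv ^^ Suc j) f)" "\<exists>B. \<forall>y. \<bar>(deriv ^^ Suc j) f y\<bar> \<le> B"
proof -
  have "(deriv ^^ j) f field_differentiable at y" using f j by (simp add: Cb_def)
  then show "((deriv ^^ j) f has_real_derivative (deriv ^^ Suc j) f y) (at y)"
    by (simp add: DERIV_deriv_iff_field_differentiable)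
  have *: "continuous_on UNIV ((deriv ^^ i) f)" "\<exists>B. \<forall>y. \<bar>(deriv ^^ i) f y\<bar> \<le> B" if "i \<le> k" for i
  proof -
    show "continuous_on UNIV ((deriv ^^ i) f)" using f that by (simp add: Cb_def)
    have "bounded (range ((deriv ^^ i) f))" using f that by (simp add: Cb_def)
    then show "\<exists>B. \<forall>y. \<bar>(deriv ^^ i) f y\<bar> \<le> B" unfolding bounded_iff by auto
  qed
  show "continuous_on UNIV ((deriv ^^ j) f)" "\<exists>B. \<forall>y. \<bar>(deriv ^^ j) f y\<bar> \<le> B"
    "continuous_on UNIV ((deriv ^^ Suc j) f)" "\<exists>B. \<forall>y. \<bar>(deriv ^^ Suc j) f y\<bar> \<le> B"
    using *[of j] *[of "Suc j"] j by auto
qed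

lemma b_facts: "(b has_real_derivative deriv b y) (at y)" "continuous_on UNIV b" "\<exists>B. \<forall>y. \<bar>b y\<bar> \<le> B"
   "continuous_on UNIV (deriv b)" "\<exists>B. \<forall>y. \<bar>deriv b y\<bar> \<le> B"
  using Cb_facts[OF b_Cb, of 0] by simp_all

lemma \<sigma>_facts: "(\<sigma> has_real_derivative deriv \<sigma> y) (at y)" "continuous_on UNIV \<sigma>" "\<exists>B. \<forall>y. \<bar>\<sigma> y\<bar> \<le> B"
   "continuous_on UNIV (deriv \<sigma>)" "\<exists>B. \<forall>y. \<bar>deriv \<sigma> y\<bar> \<le> B"
  using Cb_facts[OF \<sigma>_Cb, of 0] by simp_all

lemma \<sigma>'_facts: "(deriv \<sigma> has_real_derivative deriv (deriv \<sigma>) y) (at y)"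
   "continuous_on UNIV (deriv (deriv \<sigma>))" "\<exists>B. \<forall>y. \<bar>deriv (deriv \<sigma>) y\<bar> \<le> B"
  using Cb_facts[OF \<sigma>_Cb, of 1] by simp_all

lemma \<sigma>_pos: "0 < \<sigma> y" using lo \<sigma>_lo[of y] by linarith

abbreviation "F \<equiv> lamperti \<sigma>"
abbreviation "G \<equiv> lamperti_inv \<sigma>"

lemma F_deriv: "(F has_real_derivative 1 / \<sigma> y) (at y)"
proof -
  define a where "a = min 0 y - 1"
  define c where "c = max 0 y + 1"
  have "continuous_on {a..c} (\<lambda>r. 1 / \<sigma> r)"
    using \<sigma>_pos by (intro continuous_intros continuous_on_subset[OF \<sigma>_facts(2)]) (auto simp: less_imp_neq[symmetric])
  then have "((\<lambda>u. LBINT r=ereal 0..ereal u. 1 / \<sigma> r) has_vector_derivative 1 / \<sigma> y) (at y within {a..c})"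
    by (intro interval_integral_FTC2) (auto simp: a_def c_def)
  moreover have "at y within {a..c} = at y" by (rule at_within_interior) (auto simp: a_def c_def)
  ultimately show ?thesis
    unfolding lamperti_def[abs_def] has_real_derivative_iff_has_vector_derivative by (simp only:)
qed

lemma F_diff: "\<exists>\<xi>. F y' - F y = (y' - y) / \<sigma> \<xi>"
proof -
  obtain \<xi> where "dquot F (\<lambda>y. 1 / \<sigma> y) y y' = 1 / \<sigma> \<xi>" using dquot_mvt[OF F_deriv, of y y'] by blast
  then show ?thesis using dquot_eq[of F y' y "\<lambda>y. 1 / \<sigma> y"] by (intro exI[of _ \<xi>]) simp
qed

lemma F_inj: "inj F"
proof (rule injI)
  fix y y' assume "F y = F y'"
  then show "y = y'" using F_diff[of y y'] \<sigma>_pos by (auto simp: less_imp_neq[symmetric])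
qed

lemma F_cont: "continuous_on A F"
  using F_deriv by (meson DERIV_isCont continuous_at_imp_continuous_on)

text \<open>The slope of \<open>F\<close> is at least \<open>1 / hi\<close>, so \<open>F\<close> is unbounded in both directions.\<close>

lemma F_surj: "surj F"
proof -
  have hi0: "0 < hi" using \<sigma>_pos[of 0] \<sigma>_hi[of 0] by linarith
  have grow: "(y' - y) / hi \<le> F y' - F y" if "y \<le> y'" for y y'
  proof -
    obtain \<xi> where "F y' - F y = (y' - y) / \<sigma> \<xi>" using F_diff by blast
    moreover have "(y' - y) / hi \<le> (y' - y) / \<sigma> \<xi>" using that \<sigma>_pos[of \<xi>] \<sigma>_hi[of \<xi>] by (intro divide_left_mono) (auto intro: mult_pos_pos hi0)
    ultimately show ?thesis by simp
  qed
  have "\<exists>y. F y = z" for z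
  proof -
    define k where "k = hi * (\<bar>z - F 0\<bar>)"
    have k0: "0 \<le> k" using hi0 by (simp add: k_def)
    have "\<bar>z - F 0\<bar> \<le> F k - F 0" using grow[of 0 k] k0 hi0 by (simp add: k_def)
    moreover have "\<bar>z - F 0\<bar> \<le> F 0 - F (- k)" using grow[of "-k" 0] k0 hi0 by (simp add: k_def)
    ultimately have "F (- k) \<le> z" "z \<le> F k" by linarith+
    then show ?thesis using IVT'[of F "-k" z k] k0 F_cont by auto
  qed
  then show ?thesis by (metis surjI)
qed

lemma GF [simp]: "G (F y) = y" unfolding lamperti_inv_def by (rule inv_f_f[OF F_inj])
lemma FG [simp]: "F (G z) = z" unfolding lamperti_inv_def by (rule surj_f_inv_f[OF F_surj])

lemma G_lipschitz: "\<bar>G z' - G z\<bar> \<le> hi * \<bar>z' - z\<bar>"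
proof -
  obtain \<xi> where "F (G z') - F (G z) = (G z' - G z) / \<sigma> \<xi>" using F_diff by blast
  then have "G z' - G z = \<sigma> \<xi> * (z' - z)" using \<sigma>_pos[of \<xi>] by (simp add: field_simps)
  then show ?thesis using \<sigma>_hi[of \<xi>] \<sigma>_pos[of \<xi>] by (simp add: abs_mult mult_right_mono)
qed

lemma G_cont: "continuous_on A G"
proof -
  have "hi-lipschitz_on A G"
    using G_lipschitz \<sigma>_pos[of 0] \<sigma>_hi[of 0] by (intro lipschitz_onI) (auto simp: dist_real_def)
  then show ?thesis by (rule lipschitz_on_continuous_on)
qed

lemma G_deriv: "(G has_real_derivative \<sigma> (G z)) (at z)"
proof -
  have "(G has_real_derivative inverse (1 / \<sigma> (G z))) (at z)"
    by (rule DERIV_inverse_function[OF F_deriv, where a = "z - 1" and b = "z + 1"])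
       (use \<sigma>_pos[of "G z"] G_cont[of UNIV] in \<open>auto simp: continuous_on_eq_continuous_at\<close>)
  then show ?thesis by simp
qed

definition bh' :: "real => real" where "bh' z = (deriv b (G z) * \<sigma> (G z) - b (G z) * deriv \<sigma> (G z)) / \<sigma> (G z)"
definition ch' :: "real => real" where "ch' z = - (1 / 2) * (deriv (deriv \<sigma>) (G z) * \<sigma> (G z))"

lemma b_hat_deriv: "(b_hat b \<sigma> has_real_derivative bh' z) (at z)"
  unfolding b_hat_def[abs_def]
  by (rule DERIV_cong[OF DERIV_divide[OF DERIV_chain2[OF b_facts(1) G_deriv] DERIV_chain2[OF \<sigma>_facts(1) G_deriv]]])
     (use \<sigma>_pos[of "G z"] in \<open>auto simp: bh'_def field_simps\<close>)

lemma c_hat_deriv: "(c_hat \<sigma> has_real_derivative ch' z) (at z)"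
  unfolding c_hat_def[abs_def] ch'_def by (intro DERIV_cmult DERIV_chain2[OF \<sigma>'_facts(1) G_deriv])

lemma G_compose_cont: "continuous_on UNIV f ==> continuous_on UNIV (\<lambda>z. f (G z))"
  by (rule continuous_on_compose2[OF _ G_cont]) auto

lemma bh'_cont: "continuous_on UNIV bh'"
  unfolding bh'_def[abs_def] using \<sigma>_pos
  by (intro continuous_intros G_compose_cont b_facts \<sigma>_facts) (auto simp: less_imp_neq[symmetric])

lemma ch'_cont: "continuous_on UNIV ch'"
  unfolding ch'_def[abs_def] by (intro continuous_intros G_compose_cont \<sigma>'_facts \<sigma>_facts)

lemma hat_bounds:
  obtains B L where "\<And>z. \<bar>b_hat b \<sigma> z\<bar> \<le> B" "\<And>z. \<bar>c_hat \<sigma> z\<bar> \<le> B" "\<And>z. \<bar>bh' z\<bar> \<le> L" "\<And>z. \<bar>ch' z\<bar> \<le> L"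
proof -
  obtain B0 B1 S1 S2 where B: "\<And>y. \<bar>b y\<bar> \<le> B0" "\<And>y. \<bar>deriv b y\<bar> \<le> B1" "\<And>y. \<bar>deriv \<sigma> y\<bar> \<le> S1" "\<And>y. \<bar>deriv (deriv \<sigma>) y\<bar> \<le> S2"
    using b_facts(3,5) \<sigma>_facts(5) \<sigma>'_facts(3) by metis
  have nn: "0 \<le> B0" "0 \<le> B1" "0 \<le> S1" "0 \<le> S2" using B[of 0] by linarith+
  have hi0: "0 < hi" using \<sigma>_pos[of 0] \<sigma>_hi[of 0] by linarith
  have s: "\<bar>\<sigma> y\<bar> \<le> hi" for y using \<sigma>_hi[of y] \<sigma>_pos[of y] by simp
  have "\<bar>b_hat b \<sigma> z\<bar> \<le> B0 / lo" for z unfolding b_hat_def by (rule abs_divide_le[OF B(1) lo \<sigma>_lo])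
  moreover have "\<bar>c_hat \<sigma> z\<bar> \<le> S1" for z using B(3)[of "G z"] nn by (simp add: c_hat_def abs_mult)
  moreover have "\<bar>bh' z\<bar> \<le> (B1 * hi + B0 * S1) / lo" for z
    unfolding bh'_def
  proof (rule abs_divide_le[OF _ lo \<sigma>_lo])
    have "\<bar>deriv b (G z)\<bar> * \<bar>\<sigma> (G z)\<bar> \<le> B1 * hi" "\<bar>b (G z)\<bar> * \<bar>deriv \<sigma> (G z)\<bar> \<le> B0 * S1"
      using nn by (auto intro!: mult_mono B s)
    then show "\<bar>deriv b (G z) * \<sigma> (G z) - b (G z) * deriv \<sigma> (G z)\<bar> \<le> B1 * hi + B0 * S1"
      unfolding abs_mult[symmetric] by linarith
  qed
  moreover have "\<bar>ch' z\<bar> \<le> S2 * hi" for z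
  proof -
    have "\<bar>deriv (deriv \<sigma>) (G z)\<bar> * \<bar>\<sigma> (G z)\<bar> \<le> S2 * hi" using nn by (intro mult_mono B s) auto
    moreover have "0 \<le> S2 * hi" using nn hi0 by simp
    ultimately show ?thesis unfolding ch'_def abs_mult by simp
  qed
  moreover have "0 \<le> B0 / lo" "0 \<le> S1" "0 \<le> (B1 * hi + B0 * S1) / lo" "0 \<le> S2 * hi" using nn lo hi0 by auto
  ultimately show ?thesis
    by (intro that[of "B0 / lo + S1" "(B1 * hi + B0 * S1) / lo + S2 * hi"])
       (metis add_increasing2 add_increasing add_left_mono order_trans)+
qed

end


section \<open>Smooth approximation of the coefficients\<close>

text \<open>The substitution \<open>z \<mapsto> c sin (z / c)\<close> is the identity in the limit and has range \<open>[-c, c]\<close>, so a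
  polynomial close to \<open>\<phi>\<close> on \<open>[-c, c]\<close> yields a globally bounded smooth approximation that is built
  from polynomials and the sine only.\<close>

lemma poly_C1_approx:
  fixes \<phi> \<phi>' :: "real => real"
  assumes d: "\<And>z. (\<phi> has_real_derivative \<phi>' z) (at z)" and c: "continuous_on UNIV \<phi>'" and k: "0 < k" and e: "0 < e"
  shows "\<exists>a m. (\<forall>z. \<bar>z\<bar> \<le> k \<longrightarrow> \<bar>(\<Sum>i\<le>m. a i * z ^ i) - \<phi>' z\<bar> \<le> e \<and> \<bar>\<phi> 0 + (\<Sum>i\<le>m. a i / real (Suc i) * z ^ Suc i) - \<phi> z\<bar> \<le> e * k)"
proof -
  have "continuous_on {-k..k} \<phi>'" by (rule continuous_on_subset[OF c]) simp
  then obtain q where q: "real_polynomial_function q" "\<And>z. z \<in> {-k..k} ==> \<bar>\<phi>' z - q z\<bar> < e"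
    using Stone_Weierstrass_real_polynomial_function[of "{-k..k}" \<phi>' e] e by auto
  obtain a m where am: "q = (\<lambda>z. \<Sum>i\<le>(m::nat). a i * z ^ i)" using q(1) real_polynomial_function_iff_sum by auto
  define P where "P z = \<phi> 0 + (\<Sum>i\<le>m. a i / real (Suc i) * z ^ Suc i)" for z
  have P: "(P has_real_derivative q z) (at z)" for z
  proof -
    have "((\<lambda>z. a i / real (Suc i) * z ^ Suc i) has_real_derivative a i * z ^ i) (at z)" for i
      by (rule DERIV_cong[OF DERIV_cmult[OF DERIV_pow]]) simp
    then have "((\<lambda>z. \<Sum>i\<le>m. a i / real (Suc i) * z ^ Suc i) has_real_derivative (\<Sum>i\<le>m. a i * z ^ i)) (at z)" by (intro DERIV_sum)
    from DERIV_add[OF DERIV_const[of "\<phi> 0"] this] show ?thesis by (simp add: P_def[abs_def] am)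
  qed
  have "\<bar>P z - \<phi> z\<bar> \<le> e * k" if z: "\<bar>z\<bar> \<le> k" for z
  proof -
    have D: "((\<lambda>z. P z - \<phi> z) has_real_derivative q z - \<phi>' z) (at z)" for z by (intro DERIV_diff P d)
    obtain \<zeta> where \<zeta>: "\<bar>\<zeta> - 0\<bar> \<le> \<bar>z - 0\<bar>" "dquot (\<lambda>z. P z - \<phi> z) (\<lambda>z. q z - \<phi>' z) 0 z = q \<zeta> - \<phi>' \<zeta>"
      using dquot_mvt[of "\<lambda>z. P z - \<phi> z" "\<lambda>z. q z - \<phi>' z" 0 z] D by blast
    have "P z - \<phi> z = (q \<zeta> - \<phi>' \<zeta>) * z"
      using dquot_eq[of "\<lambda>z. P z - \<phi> z" z 0 "\<lambda>z. q z - \<phi>' z"] \<zeta>(2) by (simp add: P_def)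
    moreover have "\<bar>q \<zeta> - \<phi>' \<zeta>\<bar> \<le> e" using q(2)[of \<zeta>] \<zeta>(1) z by (force simp: abs_minus_commute)
    ultimately show ?thesis using z e by (simp add: abs_mult mult_mono)
  qed
  moreover have "\<bar>q z - \<phi>' z\<bar> \<le> e" if "\<bar>z\<bar> \<le> k" for z using q(2)[of z] that by (force simp: abs_minus_commute)
  ultimately show ?thesis by (intro exI[of _ a] exI[of _ m]) (simp add: P_def am)
qed

definition trig_poly :: "(real => real) => bool" where
  "trig_poly f \<longleftrightarrow> (\<exists>a m c k. \<forall>z. f z = c + (\<Sum>i\<le>(m::nat). a i * (k * sin (z / k)) ^ Suc i))"

lemma sin_minus_self: "\<bar>sin y - y\<bar> \<le> y\<^sup>2" and cos_minus_one: "\<bar>cos y - 1\<bar> \<le> \<bar>y\<bar>" for y :: real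
proof -
  have c: "\<bar>cos y - 1\<bar> \<le> \<bar>y\<bar>" for y :: real
    using lipschitz_of_deriv_bound[of cos "\<lambda>y. - sin y" 1 y 0] by (auto intro!: derivative_eq_intros)
  then show "\<bar>cos y - 1\<bar> \<le> \<bar>y\<bar>" .
  have D: "((\<lambda>y. sin y - y) has_real_derivative cos y - 1) (at y)" for y :: real by (auto intro!: derivative_eq_intros)
  obtain \<zeta> where \<zeta>: "\<bar>\<zeta> - 0\<bar> \<le> \<bar>y - 0\<bar>" "dquot (\<lambda>y. sin y - y) (\<lambda>y. cos y - 1) 0 y = cos \<zeta> - 1"
    using dquot_mvt[OF D, of 0 y] by blast
  have "sin y - y = (cos \<zeta> - 1) * y" using dquot_eq[of "\<lambda>y. sin y - y" y 0 "\<lambda>y. cos y - 1"] \<zeta>(2) by simp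
  then have "\<bar>sin y - y\<bar> = \<bar>cos \<zeta> - 1\<bar> * \<bar>y\<bar>" by (simp add: abs_mult)
  also have "\<dots> \<le> \<bar>y\<bar> * \<bar>y\<bar>" using c[of \<zeta>] \<zeta>(1) by (intro mult_right_mono) auto
  finally show "\<bar>sin y - y\<bar> \<le> y\<^sup>2" by (simp add: power2_eq_square abs_mult[symmetric])
qed

text \<open>The polynomial is chosen for the radius \<open>k = n + 1\<close> with an error of order \<open>1 / k\<^sup>2\<close> in the derivative: its
  integral over \<open>[-k, k]\<close> is then still of order \<open>1 / k\<close>.\<close>

lemma trig_approximation:
  fixes \<phi> \<phi>' :: "real => real"
  assumes d: "\<And>z. (\<phi> has_real_derivative \<phi>' z) (at z)" and c: "continuous_on UNIV \<phi>'" and L: "\<And>z. \<bar>\<phi>' z\<bar> \<le> L"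
  obtains f f' :: "nat => real => real" where
    "\<And>n z. (f n has_real_derivative f' n z) (at z)" "\<And>n z. \<bar>f' n z\<bar> \<le> L + 1"
    "locunif f \<phi>" "locunif f' \<phi>'" "\<And>n. trig_poly (f n)" "\<forall>B. (\<forall>z. \<bar>\<phi> z\<bar> \<le> B) \<longrightarrow> (\<forall>n z. \<bar>f n z\<bar> \<le> B + 1)"
    "\<And>n. f n 0 = \<phi> 0"
proof -
  define k where "k n = real (Suc n)" for n
  define e where "e n = 1 / (k n)\<^sup>2" for n
  have k1: "1 \<le> k n" "0 < k n" for n by (simp_all add: k_def)
  have e0: "0 < e n" "e n \<le> 1" "e n * k n = 1 / k n" "1 / k n \<le> 1" "e n \<le> 1 / k n" for n
  proof -
    have "1 \<le> (k n)\<^sup>2" using k1 by (simp add: one_le_power)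
    then show "e n \<le> 1" using k1(2)[of n] by (simp add: e_def divide_le_eq)
    show ek: "e n * k n = 1 / k n" using k1(2)[of n] by (simp add: e_def power2_eq_square)
    show "1 / k n \<le> 1" using k1(1)[of n] by simp
    show "0 < e n" using k1(2)[of n] by (simp add: e_def)
    then have "e n * 1 \<le> e n * k n" using k1(1)[of n] by (intro mult_left_mono) auto
    then show "e n \<le> 1 / k n" using ek by simp
  qed
  have "\<forall>n. \<exists>a m. (\<forall>z. \<bar>z\<bar> \<le> k n \<longrightarrow> \<bar>(\<Sum>i\<le>m. a i * z ^ i) - \<phi>' z\<bar> \<le> e n \<and> \<bar>\<phi> 0 + (\<Sum>i\<le>m. a i / real (Suc i) * z ^ Suc i) - \<phi> z\<bar> \<le> e n * k n)"
    by (intro allI poly_C1_approx d c k1 e0)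
  then obtain a where "\<forall>n. \<exists>m. (\<forall>z. \<bar>z\<bar> \<le> k n \<longrightarrow> \<bar>(\<Sum>i\<le>m. a n i * z ^ i) - \<phi>' z\<bar> \<le> e n \<and> \<bar>\<phi> 0 + (\<Sum>i\<le>m. a n i / real (Suc i) * z ^ Suc i) - \<phi> z\<bar> \<le> e n * k n)"
    unfolding choice_iff by (rule exE)
  then obtain m where "\<forall>n. (\<forall>z. \<bar>z\<bar> \<le> k n \<longrightarrow> \<bar>(\<Sum>i\<le>m n. a n i * z ^ i) - \<phi>' z\<bar> \<le> e n \<and> \<bar>\<phi> 0 + (\<Sum>i\<le>m n. a n i / real (Suc i) * z ^ Suc i) - \<phi> z\<bar> \<le> e n * k n)"
    unfolding choice_iff by (rule exE)
  note am = this[rule_format]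
  define q where "q n z = (\<Sum>i\<le>m n. a n i * z ^ i)" for n z
  define P where "P n z = \<phi> 0 + (\<Sum>i\<le>m n. a n i / real (Suc i) * z ^ Suc i)" for n z
  have qb: "\<bar>q n z - \<phi>' z\<bar> \<le> e n" and Pb: "\<bar>P n z - \<phi> z\<bar> \<le> 1 / k n" if "\<bar>z\<bar> \<le> k n" for n z
    using am[OF that] e0(3)[of n] by (auto simp: q_def P_def)
  have Pd: "(P n has_real_derivative q n z) (at z)" for n z
  proof -
    have "((\<lambda>z. a n i / real (Suc i) * z ^ Suc i) has_real_derivative a n i * z ^ i) (at z)" for i
      by (rule DERIV_cong[OF DERIV_cmult[OF DERIV_pow]]) simp
    then have "((\<lambda>z. \<Sum>i\<le>m n. a n i / real (Suc i) * z ^ Suc i) has_real_derivative (\<Sum>i\<le>m n. a n i * z ^ i)) (at z)" by (intro DERIV_sum)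
    from DERIV_add[OF DERIV_const[of "\<phi> 0"] this] show ?thesis by (simp add: P_def[abs_def] q_def)
  qed
  define w where "w n z = k n * sin (z / k n)" for n z
  have wk: "\<bar>w n z\<bar> \<le> k n" for n z
    using abs_sin_le_one[of "z / k n"] k1(2)[of n] mult_left_mono[of "\<bar>sin (z / k n)\<bar>" 1 "k n"] by (simp add: w_def abs_mult)
  have wz: "\<bar>w n z\<bar> \<le> \<bar>z\<bar>" for n z
  proof -
    have "k n * \<bar>sin (z / k n)\<bar> \<le> k n * \<bar>z / k n\<bar>" using k1(2)[of n] by (intro mult_left_mono abs_sin_x_le_abs_x) auto
    then show ?thesis using k1(2)[of n] by (simp add: w_def abs_mult)
  qed
  have wd: "(w n has_real_derivative cos (z / k n)) (at z)" for n z
    unfolding w_def[abs_def] by (rule DERIV_cong[OF DERIV_cmult[OF DERIV_chain2[OF DERIV_sin DERIV_cdivide[OF DERIV_ident]]]]) (use k1(2)[of n] in simp)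
  have wdiff: "\<bar>w n z - z\<bar> \<le> R\<^sup>2 / k n" if "\<bar>z\<bar> \<le> R" for n z R
  proof -
    have "w n z - z = k n * (sin (z / k n) - z / k n)" using k1(2)[of n] by (simp add: w_def right_diff_distrib)
    then have "\<bar>w n z - z\<bar> \<le> k n * (z / k n)\<^sup>2" using k1(2)[of n] by (simp add: abs_mult mult_left_mono sin_minus_self)
    also have "\<dots> = z\<^sup>2 / k n" using k1(2)[of n] by (simp add: power2_eq_square)
    also have "\<dots> \<le> R\<^sup>2 / k n" using that k1(2)[of n] by (intro divide_right_mono) (auto simp: abs_le_square_iff[symmetric])
    finally show ?thesis .
  qed
  define f where "f n z = P n (w n z)" for n z
  define f' where "f' n z = q n (w n z) * cos (z / k n)" for n z
  have L0: "0 \<le> L" using L[of 0] by linarith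
  have kl: "(\<lambda>n. 1 / k n) \<longlonglongrightarrow> 0" unfolding k_def by (rule LIMSEQ_Suc[OF lim_const_over_n])
  have ev: "eventually (\<lambda>n. X * (1 / k n) < \<epsilon>) sequentially" if "0 < \<epsilon>" for X \<epsilon> :: real
  proof -
    have "(\<lambda>n. X * (1 / k n)) \<longlonglongrightarrow> X * 0" by (intro tendsto_intros kl)
    then show ?thesis using that by (intro order_tendstoD(2)) auto
  qed
  have q1: "\<bar>q n (w n z)\<bar> \<le> L + 1" for n z
    using qb[OF wk, of n z] L[of "w n z"] e0(2)[of n] by linarith
  show thesis
  proof (rule that[of f f'])
    show "(f n has_real_derivative f' n z) (at z)" for n z
      unfolding f_def[abs_def] f'_def by (rule DERIV_chain2[OF Pd wd])
    show "\<bar>f' n z\<bar> \<le> L + 1" for n z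
      using mult_mono[OF q1[of n z] abs_cos_le_one[of "z / k n"]] L0 by (simp add: f'_def abs_mult)
    show "locunif f \<phi>"
      unfolding locunif_def
    proof (intro allI impI)
      fix R \<epsilon> :: real assume e: "0 < \<epsilon>"
      from ev[OF e, of "1 + L * R\<^sup>2"] show "\<forall>\<^sub>F n in sequentially. \<forall>z. \<bar>z\<bar> \<le> R \<longrightarrow> \<bar>f n z - \<phi> z\<bar> \<le> \<epsilon>"
      proof eventually_elim
        fix n assume n: "(1 + L * R\<^sup>2) * (1 / k n) < \<epsilon>"
        show "\<forall>z. \<bar>z\<bar> \<le> R \<longrightarrow> \<bar>f n z - \<phi> z\<bar> \<le> \<epsilon>"
        proof (intro allI impI)
          fix z assume z: "\<bar>z\<bar> \<le> R"
          have "\<bar>\<phi> (w n z) - \<phi> z\<bar> \<le> L * \<bar>w n z - z\<bar>" by (rule lipschitz_of_deriv_bound[OF d L])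
          also have "\<dots> \<le> L * (R\<^sup>2 / k n)" using wdiff[OF z] L0 by (rule mult_left_mono)
          finally have "\<bar>f n z - \<phi> z\<bar> \<le> 1 / k n + L * (R\<^sup>2 / k n)" using Pb[OF wk, of n z] unfolding f_def by linarith
          also have "\<dots> = (1 + L * R\<^sup>2) * (1 / k n)" by (simp add: distrib_right add_divide_distrib)
          finally show "\<bar>f n z - \<phi> z\<bar> \<le> \<epsilon>" using n by linarith
        qed
      qed
    qed
    show "locunif f' \<phi>'"
      unfolding locunif_def
    proof (intro allI impI)
      fix R \<epsilon> :: real assume e: "0 < \<epsilon>"
      have "uniformly_continuous_on {-R..R} \<phi>'"
        by (rule compact_uniformly_continuous) (auto intro: continuous_on_subset[OF c])
      then obtain \<delta> where \<delta>: "0 < \<delta>" "\<And>y y'. y \<in> {-R..R} ==> y' \<in> {-R..R} ==> dist y' y < \<delta> ==> dist (\<phi>' y') (\<phi>' y) < \<epsilon> / 2"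
        using e unfolding uniformly_continuous_on_def by (metis half_gt_zero)
      have e2: "0 < \<epsilon> / 2" using e by simp
      from ev[OF \<delta>(1), of "R\<^sup>2"] ev[OF e2, of "1 + L * R"]
      show "\<forall>\<^sub>F n in sequentially. \<forall>z. \<bar>z\<bar> \<le> R \<longrightarrow> \<bar>f' n z - \<phi>' z\<bar> \<le> \<epsilon>"
      proof eventually_elim
        fix n assume n1: "R\<^sup>2 * (1 / k n) < \<delta>" and n2: "(1 + L * R) * (1 / k n) < \<epsilon> / 2"
        show "\<forall>z. \<bar>z\<bar> \<le> R \<longrightarrow> \<bar>f' n z - \<phi>' z\<bar> \<le> \<epsilon>"
        proof (intro allI impI)
          fix z assume z: "\<bar>z\<bar> \<le> R"
          have "dist (\<phi>' (w n z)) (\<phi>' z) < \<epsilon> / 2"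
            using wz[of n z] z wdiff[OF z, of n] n1 by (intro \<delta>(2)) (auto simp: dist_real_def)
          then have 1: "\<bar>\<phi>' (w n z) - \<phi>' z\<bar> < \<epsilon> / 2" by (simp add: dist_real_def)
          have 2: "\<bar>(q n (w n z) - \<phi>' (w n z)) * cos (z / k n)\<bar> \<le> (1 / k n) * 1"
            unfolding abs_mult using qb[OF wk, of n z] e0(5)[of n] k1(2)[of n] by (intro mult_mono) (auto intro: order_trans)
          have "\<bar>z / k n\<bar> \<le> R * (1 / k n)" using z k1(2)[of n] by (simp add: divide_right_mono)
          then have 3: "\<bar>\<phi>' (w n z) * (cos (z / k n) - 1)\<bar> \<le> L * (R * (1 / k n))"
            unfolding abs_mult using L0 L[of "w n z"] cos_minus_one[of "z / k n"] by (intro mult_mono) (auto intro: order_trans)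
          have "f' n z - \<phi>' z = (q n (w n z) - \<phi>' (w n z)) * cos (z / k n) + \<phi>' (w n z) * (cos (z / k n) - 1) + (\<phi>' (w n z) - \<phi>' z)"
            by (simp add: f'_def algebra_simps)
          then have "\<bar>f' n z - \<phi>' z\<bar> \<le> (1 / k n) * 1 + L * (R * (1 / k n)) + \<epsilon> / 2" using 1 2 3 by linarith
          also have "(1 / k n) * 1 + L * (R * (1 / k n)) = (1 + L * R) * (1 / k n)" by (simp add: distrib_right add_divide_distrib)
          finally show "\<bar>f' n z - \<phi>' z\<bar> \<le> \<epsilon>" using n2 by linarith
        qed
      qed
    qed
    show "trig_poly (f n)" for n
      unfolding trig_poly_def f_def P_def w_def by (intro exI allI) (rule refl)
    show "\<forall>B. (\<forall>z. \<bar>\<phi> z\<bar> \<le> B) \<longrightarrow> (\<forall>n z. \<bar>f n z\<bar> \<le> B + 1)"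
    proof (intro allI impI)
      fix B n z assume "\<forall>z. \<bar>\<phi> z\<bar> \<le> B"
      then have "\<bar>\<phi> (w n z)\<bar> \<le> B" by (rule spec)
      then show "\<bar>f n z\<bar> \<le> B + 1" using Pb[OF wk, of n z] e0(4)[of n] unfolding f_def by linarith
    qed
    show "f n 0 = \<phi> 0" for n by (simp add: f_def w_def P_def)
  qed
qed


section \<open>Functions generated by coordinates, sine and cosine\<close>

text \<open>This class is closed under partial derivatives by inspection and all of its members have
  polynomial growth; it therefore supplies smooth cylindrical functionals without any bookkeeping
  of higher derivatives.\<close>

inductive tame :: "nat => ((nat => real) => real) => bool" for n where
  const: "tame n (\<lambda>z. c)"
| coord: "i < n ==> tame n (\<lambda>z. z i)"
| add: "tame n f ==> tame n g ==> tame n (\<lambda>z. f z + g z)"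
| mult: "tame n f ==> tame n g ==> tame n (\<lambda>z. f z * g z)"
| sin: "tame n f ==> tame n (\<lambda>z. sin (f z))"
| cos: "tame n f ==> tame n (\<lambda>z. cos (f z))"

lemma tame_cmult: "tame n f ==> tame n (\<lambda>z. c * f z)" using tame.mult[OF tame.const] .

lemma tame_diff: "tame n f ==> tame n g ==> tame n (\<lambda>z. f z - g z)"
  using tame.add[OF _ tame_cmult[of n g "-1"], of f] by simp

lemma tame_power: "tame n f ==> tame n (\<lambda>z. f z ^ k)"
  by (induction k) (auto intro: tame.intros)

lemma tame_sum: "(\<And>i. i \<in> A ==> tame n (f i)) ==> tame n (\<lambda>z. \<Sum>i\<in>A. f i z)"
  by (induction A rule: infinite_finite_induct) (auto intro: tame.intros)

lemma tame_trig_poly: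
  assumes "trig_poly \<phi>" "tame n f" shows "tame n (\<lambda>z. \<phi> (f z))"
proof -
  obtain a m c k where \<phi>: "\<And>z. \<phi> z = c + (\<Sum>i\<le>(m::nat). a i * (k * sin (z / k)) ^ Suc i)" using assms(1) unfolding trig_poly_def by blast
  have "tame n (\<lambda>z. f z / k)" using tame_cmult[OF assms(2), of "1 / k"] by simp
  then have "tame n (\<lambda>z. c + (\<Sum>i\<le>m. a i * (k * sin (f z / k)) ^ Suc i))"
    by (intro tame.add tame.const tame_sum tame_cmult tame_power tame.sin)
  then show ?thesis by (simp only: \<phi>)
qed

lemma tame_cont: "tame n f ==> continuous_on UNIV f"
  by (induction rule: tame.induct) (auto intro!: continuous_intros continuous_on_product_coordinates)

lemma tame_coords: "tame n f ==> (\<And>i. i < n ==> z i = z' i) ==> f z = f z'"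
  by (induction rule: tame.induct) auto

lemma tame_deriv: "tame n f ==> \<exists>f'. tame n f' \<and> (\<forall>z. ((\<lambda>v. f (z(i := v))) has_real_derivative f' z) (at (z i)))"
proof (induction rule: tame.induct)
  case (const c) show ?case by (intro exI[of _ "\<lambda>_. 0"]) (auto intro: tame.intros)
next
  case (coord j)
  have "((\<lambda>v. (z(i := v)) j) has_real_derivative of_bool (i = j)) (at (z i))" for z :: "nat => real"
    by (cases "i = j") simp_all
  then show ?case by (intro exI[of _ "\<lambda>_. of_bool (i = j)"]) (auto intro: tame.intros)
next
  case (add f g)
  then obtain f' g' where h: "tame n f'" "tame n g'" "\<And>z. ((\<lambda>v. f (z(i := v))) has_real_derivative f' z) (at (z i))"
    "\<And>z. ((\<lambda>v. g (z(i := v))) has_real_derivative g' z) (at (z i))" by blast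
  have "((\<lambda>v. f (z(i := v)) + g (z(i := v))) has_real_derivative f' z + g' z) (at (z i))" for z by (intro DERIV_add h)
  then show ?case using tame.add[OF h(1,2)] by blast
next
  case (mult f g)
  then obtain f' g' where h: "tame n f'" "tame n g'" "\<And>z. ((\<lambda>v. f (z(i := v))) has_real_derivative f' z) (at (z i))"
    "\<And>z. ((\<lambda>v. g (z(i := v))) has_real_derivative g' z) (at (z i))" by blast
  have "((\<lambda>v. f (z(i := v)) * g (z(i := v))) has_real_derivative f' z * g z + g' z * f z) (at (z i))" for z
    using DERIV_mult[OF h(3)[of z] h(4)[of z]] by simp
  moreover have "tame n (\<lambda>z. f' z * g z + g' z * f z)" by (intro tame.add tame.mult h mult.hyps)
  ultimately show ?case by blast
next
  case (sin f)
  then obtain f' where h: "tame n f'" "\<And>z. ((\<lambda>v. f (z(i := v))) has_real_derivative f' z) (at (z i))" by blast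
  have "((\<lambda>v. sin (f (z(i := v)))) has_real_derivative cos (f z) * f' z) (at (z i))" for z
    using DERIV_chain2[OF DERIV_sin h(2)[of z]] by simp
  moreover have "tame n (\<lambda>z. cos (f z) * f' z)" by (intro tame.mult tame.cos h sin.hyps)
  ultimately show ?case by blast
next
  case (cos f)
  then obtain f' where h: "tame n f'" "\<And>z. ((\<lambda>v. f (z(i := v))) has_real_derivative f' z) (at (z i))" by blast
  have "((\<lambda>v. cos (f (z(i := v)))) has_real_derivative - sin (f z) * f' z) (at (z i))" for z
    using DERIV_chain2[OF DERIV_cos h(2)[of z]] by simp
  moreover have "tame n (\<lambda>z. - sin (f z) * f' z)" using tame_cmult[OF tame.mult[OF tame.sin[OF cos.hyps] h(1)], of "-1"] by simp
  ultimately show ?case by blast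
qed

lemma tame_partial_deriv:
  assumes "tame n f"
  shows "tame n (partial_deriv i f)" "(\<lambda>v. f (z(i := v))) field_differentiable at (z i)"
proof -
  obtain f' where f': "tame n f'" "\<And>z. ((\<lambda>v. f (z(i := v))) has_real_derivative f' z) (at (z i))" using tame_deriv[OF assms] by blast
  have "partial_deriv i f = f'" unfolding partial_deriv_def by (intro ext DERIV_imp_deriv f')
  then show "tame n (partial_deriv i f)" using f' by simp
  show "(\<lambda>v. f (z(i := v))) field_differentiable at (z i)" using f'(2) field_differentiable_def by blast
qed

lemma tame_growth: "tame n f ==> \<exists>C (m::nat). 0 \<le> C \<and> (\<forall>z. \<bar>f z\<bar> \<le> C * (1 + (\<Sum>i<n. \<bar>z i\<bar>)) ^ m)"
proof (induction rule: tame.induct)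
  case (const c) show ?case by (intro exI[of _ "\<bar>c\<bar>"] exI[of _ 0]) simp
next
  case (coord i)
  have "\<bar>z i\<bar> \<le> 1 + (\<Sum>i<n. \<bar>z i\<bar>)" for z :: "nat => real"
    using member_le_sum[of i "{..<n}" "\<lambda>i. \<bar>z i\<bar>"] coord by simp
  then show ?case by (intro exI[of _ 1]) simp
next
  case (add f g)
  then obtain C m D k where h: "0 \<le> C" "\<And>z. \<bar>f z\<bar> \<le> C * (1 + (\<Sum>i<n. \<bar>z i\<bar>)) ^ m" "0 \<le> D" "\<And>z. \<bar>g z\<bar> \<le> D * (1 + (\<Sum>i<n. \<bar>z i\<bar>)) ^ k" by blast
  have "\<bar>f z + g z\<bar> \<le> (C + D) * (1 + (\<Sum>i<n. \<bar>z i\<bar>)) ^ (m + k)" for z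
  proof -
    define S where "S = 1 + (\<Sum>i<n. \<bar>z i\<bar>)"
    have S: "1 \<le> S" by (simp add: S_def sum_nonneg)
    have "S ^ m \<le> S ^ (m + k)" "S ^ k \<le> S ^ (m + k)" using S by (auto intro: power_increasing)
    then have "C * S ^ m \<le> C * S ^ (m + k)" "D * S ^ k \<le> D * S ^ (m + k)" using h by (auto intro: mult_left_mono)
    then show ?thesis using h(2)[of z] h(4)[of z] unfolding S_def[symmetric] distrib_right by linarith
  qed
  then show ?case using h by (intro exI[of _ "C + D"] exI[of _ "m + k"]) auto
next
  case (mult f g)
  then obtain C m D k where h: "0 \<le> C" "\<And>z. \<bar>f z\<bar> \<le> C * (1 + (\<Sum>i<n. \<bar>z i\<bar>)) ^ m" "0 \<le> D" "\<And>z. \<bar>g z\<bar> \<le> D * (1 + (\<Sum>i<n. \<bar>z i\<bar>)) ^ k" by blast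
  have "\<bar>f z * g z\<bar> \<le> (C * D) * (1 + (\<Sum>i<n. \<bar>z i\<bar>)) ^ (m + k)" for z
  proof -
    have "\<bar>f z\<bar> * \<bar>g z\<bar> \<le> (C * (1 + (\<Sum>i<n. \<bar>z i\<bar>)) ^ m) * (D * (1 + (\<Sum>i<n. \<bar>z i\<bar>)) ^ k)"
      using h by (intro mult_mono) (auto intro!: mult_nonneg_nonneg zero_le_power add_nonneg_nonneg sum_nonneg)
    then show ?thesis by (simp add: abs_mult power_add mult_ac)
  qed
  then show ?case using h by (intro exI[of _ "C * D"] exI[of _ "m + k"]) auto
next
  case (sin f) then show ?case by (intro exI[of _ 1] exI[of _ 0]) simp
next
  case (cos f) then show ?case by (intro exI[of _ 1] exI[of _ 0]) simp
qed

lemma tame_smooth: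
  assumes "tame n f"
  shows "smooth_poly_growth n f"
  unfolding smooth_poly_growth_def Let_def
proof (intro conjI allI impI)
  show "\<And>z z'. \<forall>i<n. z i = z' i ==> f z = f z'" using tame_coords[OF assms] by blast
  fix js :: "nat list"
  have t: "tame n (foldr partial_deriv js f)" by (induction js) (auto intro: assms tame_partial_deriv)
  show "continuous_on UNIV (foldr partial_deriv js f)" by (rule tame_cont[OF t])
  show "\<And>i z. (\<lambda>v. foldr partial_deriv js f (z(i := v))) field_differentiable at (z i)" by (rule tame_partial_deriv(2)[OF t])
  show "\<exists>C (m::nat). \<forall>z. \<bar>foldr partial_deriv js f z\<bar> \<le> C * (1 + (\<Sum>i<n. \<bar>z i\<bar>)) ^ m" using tame_growth[OF t] by blast
qed

lemma tame_euler:
  assumes b: "trig_poly b" and g: "trig_poly g"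
  shows "k < n ==> tame n (\<lambda>z. euler b g \<delta>1 \<delta>2 (\<lambda>k. z (Suc k) - z k) y k)"
proof (induction k)
  case (Suc k)
  then have IH: "tame n (\<lambda>z. euler b g \<delta>1 \<delta>2 (\<lambda>k. z (Suc k) - z k) y k)" by simp
  have c: "tame n (\<lambda>z. f (euler b g \<delta>1 \<delta>2 (\<lambda>k. z (Suc k) - z k) y k) * d)" if "trig_poly f" for f d
    using tame_cmult[OF tame_trig_poly[OF that IH], of d] by (simp add: mult.commute)
  show ?case unfolding euler.simps using Suc.prems
    by (intro tame.add IH tame_diff tame.coord c b g) auto
qed (simp add: tame.const)

text \<open>Differentiating the scheme along a direction \<open>e\<close> gives the tangent recursion; by the chain rule
  this is also the sum of the partial derivatives weighted by \<open>e\<close>.\<close>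

lemma euler_partial_derivs:
  fixes b g G b' g' G' :: "real => real" and \<delta>1 \<delta>2 :: "nat => real" and y :: real
  assumes b: "trig_poly b" and g: "trig_poly g" and G: "trig_poly G"
    and bd: "\<And>z. (b has_real_derivative b' z) (at z)" and gd: "\<And>z. (g has_real_derivative g' z) (at z)"
    and Gd: "\<And>z. (G has_real_derivative G' z) (at z)" and k: "k < n"
  defines "\<zeta> \<equiv> \<lambda>z k. euler b g \<delta>1 \<delta>2 (\<lambda>k. z (Suc k) - z k) y k"
  shows "(\<Sum>i<n. partial_deriv i (\<lambda>z. G (\<zeta> z k)) z * e i)
     = G' (\<zeta> z k) * tangent (\<lambda>k. b' (\<zeta> z k) * \<delta>1 k + g' (\<zeta> z k) * \<delta>2 k) (\<lambda>k. e (Suc k) - e k) k"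
proof -
  define l where "l v = (\<lambda>i. z i + v * e i)" for v
  have l0: "l 0 = z" by (simp add: l_def)
  have D: "((\<lambda>v. \<zeta> (l v) k) has_real_derivative
      tangent (\<lambda>k. b' (\<zeta> z k) * \<delta>1 k + g' (\<zeta> z k) * \<delta>2 k) (\<lambda>k. e (Suc k) - e k) k) (at 0)" for k
  proof (induction k)
    case 0 then show ?case by (simp add: \<zeta>_def)
  next
    case (Suc k)
    have 1: "((\<lambda>v. l v (Suc k) - l v k) has_real_derivative e (Suc k) - e k) (at 0)"
      unfolding l_def by (auto intro!: derivative_eq_intros)
    have bd': "(b has_real_derivative b' (\<zeta> z k)) (at (\<zeta> (l 0) k))" and gd': "(g has_real_derivative g' (\<zeta> z k)) (at (\<zeta> (l 0) k))"
      unfolding l0 by (rule bd, rule gd)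
    have "((\<lambda>v. \<zeta> (l v) k + (l v (Suc k) - l v k) + b (\<zeta> (l v) k) * \<delta>1 k + g (\<zeta> (l v) k) * \<delta>2 k) has_real_derivative
       tangent (\<lambda>k. b' (\<zeta> z k) * \<delta>1 k + g' (\<zeta> z k) * \<delta>2 k) (\<lambda>k. e (Suc k) - e k) (Suc k)) (at 0)"
      by (rule DERIV_cong[OF DERIV_add[OF DERIV_add[OF DERIV_add[OF Suc.IH 1]
            DERIV_cmult_right[OF DERIV_chain2[OF bd' Suc.IH]]] DERIV_cmult_right[OF DERIV_chain2[OF gd' Suc.IH]]]])
         (simp add: algebra_simps)
    moreover have "\<zeta> (l v) (Suc k) = \<zeta> (l v) k + (l v (Suc k) - l v k) + b (\<zeta> (l v) k) * \<delta>1 k + g (\<zeta> (l v) k) * \<delta>2 k" for v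
      by (simp add: \<zeta>_def)
    ultimately show ?case by (simp only:)
  qed
  have Gd': "(G has_real_derivative G' (\<zeta> z k)) (at (\<zeta> (l 0) k))" unfolding l0 by (rule Gd)
  from DERIV_chain2[OF Gd' D] have 1: "((\<lambda>v. G (\<zeta> (l v) k)) has_real_derivative
      G' (\<zeta> z k) * tangent (\<lambda>k. b' (\<zeta> z k) * \<delta>1 k + g' (\<zeta> z k) * \<delta>2 k) (\<lambda>k. e (Suc k) - e k) k) (at 0)" .
  have "tame n (\<lambda>z. G (\<zeta> z k))" unfolding \<zeta>_def by (intro tame_trig_poly[OF G] tame_euler[OF b g] k)
  then have "C1_fun n (\<lambda>z. G (\<zeta> z k)) (\<lambda>i. partial_deriv i (\<lambda>z. G (\<zeta> z k)))"
    using smooth_poly_growth_C2[OF tame_smooth] by (simp add: C2_loc_def C1_loc_def)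
  from C1_fun_line[OF this, of z e 0]
  have 2: "((\<lambda>v. G (\<zeta> (l v) k)) has_real_derivative (\<Sum>i<n. e i * partial_deriv i (\<lambda>z. G (\<zeta> z k)) z)) (at 0)"
    by (simp add: l_def)
  from DERIV_unique[OF 2 1] show ?thesis by (simp add: mult.commute)
qed


section \<open>The flow along a fixed path\<close>

lemma lborel_driver: "1 \<le> K ==> driver T K lborel (\<lambda>r. r)"
proof
  show "\<And>u v. 1 \<le> K ==> u \<le> v ==> 0 \<le> v - u \<and> v - u \<le> K * (v - u)"
    using mult_right_mono[of 1 K] by fastforce
qed auto

lemma stieltjes_driver:
  assumes q: "q \<in> bracket_paths T \<Lambda>" and T: "0 \<le> T" and K: "\<Lambda> \<le> K" "0 \<le> K"
  shows "driver T K (stieltjes T q) q"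
proof
  let ?c = "\<lambda>r. max 0 (min T r)"
  have c: "?c r \<in> {0..T}" for r using T by auto
  have inc: "0 \<le> q v - q u \<and> q v - q u \<le> \<Lambda> * (v - u)" if "0 \<le> u" "u \<le> v" "v \<le> T" for u v
    using q that unfolding bracket_paths_def by blast
  show "sets (stieltjes T q) = sets borel" unfolding stieltjes_def by (rule sets_interval_measure)
  show "0 \<le> K" by (rule K)
  fix u v assume uv: "0 \<le> u" "u \<le> v" "v \<le> T"
  have "q (?c x) \<le> q (?c y)" if "x \<le> y" for x y
    using inc[of "?c x" "?c y"] that c[of x] c[of y] by auto
  moreover have "continuous_on {0..T} q" using q by (simp add: bracket_paths_def)
  then have "continuous_on UNIV (\<lambda>r. q (?c r))"
    by (rule continuous_on_compose2) (use c in \<open>auto intro!: continuous_intros\<close>)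
  ultimately have "emeasure (stieltjes T q) {u..v} = ennreal (q (?c v) - q (?c u))"
    unfolding stieltjes_def by (intro emeasure_interval_measure_Icc uv) auto
  then show "emeasure (stieltjes T q) {u..v} = ennreal (q v - q u)" using uv by simp
  have "\<Lambda> * (v - u) \<le> K * (v - u)" using K uv by (intro mult_right_mono) auto
  then show "0 \<le> q v - q u \<and> q v - q u \<le> K * (v - u)" using inc[OF uv] by linarith
qed

text \<open>Replacing the bracket by an almost surely equal clock changes the flow on a null set only, since the
  Stieltjes measure sees the values on \<open>[0, T]\<close> and nothing else.\<close>

lemma stieltjes_cong:
  assumes "\<And>r. r \<in> {0..T} ==> q r = q' r" "0 \<le> T"
  shows "stieltjes T q = stieltjes T q'"
proof -
  have "(\<lambda>r. q (max 0 (min T r))) = (\<lambda>r. q' (max 0 (min T r)))" using assms by (intro ext assms(1)) auto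
  then show ?thesis by (simp add: stieltjes_def)
qed

lemma flow_cong:
  assumes "\<And>r. r \<in> {0..T} ==> q r = q' r" "0 \<le> T"
  shows "flow T b \<sigma> s t x q y = flow T b \<sigma> s t x q' y"
proof -
  have "stieltjes T q = stieltjes T q'" by (rule stieltjes_cong) (use assms in auto)
  then show ?thesis by (simp only: flow_def Z_sol_def solves_Z_def)
qed

locale lamperti_flow = lamperti_coeffs b \<sigma> lo hi for b \<sigma> lo hi +
  fixes T \<Lambda> :: real and q x :: "real => real" and B L :: real
  assumes T_pos: "0 < T" and q_path: "q \<in> bracket_paths T \<Lambda>" and x_path: "x \<in> path_space T"
    and b_hat_bound: "\<And>z. \<bar>b_hat b \<sigma> z\<bar> \<le> B" and c_hat_bound: "\<And>z. \<bar>c_hat \<sigma> z\<bar> \<le> B"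
    and bh'_bound: "\<And>z. \<bar>bh' z\<bar> \<le> L" and ch'_bound: "\<And>z. \<bar>ch' z\<bar> \<le> L"

sublocale lamperti_flow \<subseteq> ode T "max 1 \<Lambda>" lborel "\<lambda>r. r" "stieltjes T q" q "b_hat b \<sigma>" "c_hat \<sigma>" bh' ch' B L x
proof -
  have T: "0 \<le> T" and x: "continuous_on {0..T} x" using T_pos x_path by (simp_all add: path_space_def)
  have K: "1 \<le> max 1 \<Lambda>" "\<Lambda> \<le> max 1 \<Lambda>" "0 \<le> max 1 \<Lambda>" by simp_all
  show "ode T (max 1 \<Lambda>) lborel (\<lambda>r. r) (stieltjes T q) q (b_hat b \<sigma>) (c_hat \<sigma>) bh' ch' B L x"
  proof (rule ode.intro)
    show "drivers T (max 1 \<Lambda>) lborel (\<lambda>r. r) (stieltjes T q) q"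
      by (rule drivers.intro[OF lborel_driver[OF K(1)] stieltjes_driver[OF q_path T K(2,3)]])
    show "ode_axioms T (b_hat b \<sigma>) (c_hat \<sigma>) bh' ch' B L x"
      by (rule ode_axioms.intro[OF T b_hat_deriv c_hat_deriv b_hat_bound c_hat_bound bh'_bound ch'_bound bh'_cont ch'_cont x])
  qed
qed

context lamperti_flow
begin

lemma solves_Z_iff: "solves_Z T b \<sigma> s x q y Z \<longleftrightarrow> sol s (F y) Z"
  unfolding solves_Z_def sol_def dint_def by (simp only: add.assoc)

lemma sol_cong:
  assumes "\<And>r. r \<in> {s..T} ==> Z r = Z' r" "sol s z Z"
  shows "sol s z Z'"
proof -
  have Z: "continuous_on {s..T} Z" "\<forall>t\<in>{s..T}. Z t = z + x t - x s + dint (\<lambda>r. b_hat b \<sigma> (Z r)) (\<lambda>r. c_hat \<sigma> (Z r)) s t"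
    using assms(2) unfolding sol_def by (rule conjunct1, rule conjunct2)
  have "continuous_on {s..T} Z'" by (rule continuous_on_eq[OF Z(1) assms(1)])
  moreover have "Z' t = z + x t - x s + dint (\<lambda>r. b_hat b \<sigma> (Z' r)) (\<lambda>r. c_hat \<sigma> (Z' r)) s t" if t: "t \<in> {s..T}" for t
  proof -
    have "dint (\<lambda>r. b_hat b \<sigma> (Z r)) (\<lambda>r. c_hat \<sigma> (Z r)) s t = dint (\<lambda>r. b_hat b \<sigma> (Z' r)) (\<lambda>r. c_hat \<sigma> (Z' r)) s t"
      by (rule dint_cong) (use assms(1) t in auto)
    moreover have "Z t = z + x t - x s + dint (\<lambda>r. b_hat b \<sigma> (Z r)) (\<lambda>r. c_hat \<sigma> (Z r)) s t"
      by (rule bspec[OF Z(2) t])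
    ultimately show ?thesis unfolding assms(1)[OF t, symmetric] by (simp only:)
  qed
  ultimately show ?thesis unfolding sol_def by (intro conjI ballI)
qed

text \<open>Solutions are unique on \<open>[s, T]\<close>; extensionality makes the description in the definition unique as a
  function.\<close>

lemma Z_sol_solves:
  assumes s: "0 \<le> s" "s \<le> T"
  shows "sol s (F y) (Z_sol T b \<sigma> s x q y)"
proof -
  obtain Z where Z: "sol s (F y) Z" using sol_exists[OF s, of "F y"] by (rule exE)
  have Zr: "sol s (F y) (restrict Z {s..T})" by (rule sol_cong[OF _ Z]) simp
  have "\<exists>!Z. solves_Z T b \<sigma> s x q y Z \<and> Z \<in> extensional {s..T}"
  proof (rule ex1I)
    show "solves_Z T b \<sigma> s x q y (restrict Z {s..T}) \<and> restrict Z {s..T} \<in> extensional {s..T}"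
      unfolding solves_Z_iff using Zr by simp
    fix Z' assume Z': "solves_Z T b \<sigma> s x q y Z' \<and> Z' \<in> extensional {s..T}"
    then have "sol s (F y) Z'" unfolding solves_Z_iff by (rule conjunct1)
    from sol_unique[OF Zr this s(1)] show "Z' = restrict Z {s..T}"
      using Z' by (intro extensionalityI[of Z' "{s..T}"]) auto
  qed
  from theI'[OF this] show ?thesis unfolding Z_sol_def solves_Z_iff by (rule conjunct1)
qed

lemma flow_eq:
  assumes "0 \<le> s" "s \<le> t" "t \<le> T" "sol s (F y) Z"
  shows "flow T b \<sigma> s t x q y = G (Z t)"
  unfolding flow_def using sol_unique[OF assms(4) Z_sol_solves[of s y], of t] assms by auto

text \<open>The derivative of the flow in its starting point is the exponential of the linearised equation,
  conjugated by the Lamperti transform; the factor \<open>\<sigma> (Y r)\<close> of the kernel cancels the derivative of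
  \<open>F\<close> at \<open>Y r\<close>.\<close>

lemma kernel_formula:
  assumes s: "0 \<le> s" "s \<le> r" "r \<le> t" "t \<le> T" and Z: "sol s (F y) Z"
  defines "Y \<equiv> flow T b \<sigma> s r x q y"
  shows "\<sigma> Y * deriv (\<lambda>\<xi>. flow T b \<sigma> r t x q \<xi>) Y = \<sigma> (G (Z t)) * exp (dint (\<lambda>v. bh' (Z v)) (\<lambda>v. ch' (Z v)) r t)"
proof -
  have r: "0 \<le> r" "r \<le> T" "t \<in> {r..T}" using s by auto
  have Y: "Y = G (Z r)" unfolding Y_def by (rule flow_eq) (use s Z in auto)
  define V where "V z = Z_sol T b \<sigma> r x q (G z)" for z
  have V: "sol r z (V z)" for z using Z_sol_solves[OF r(1,2), of "G z"] by (simp add: V_def)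
  have VZ: "V (Z r) v = Z v" if "v \<in> {r..T}" for v
    by (rule sol_unique[OF sol_restart[OF Z s(1,2) r(2)] V r(1) that])
  have fl: "flow T b \<sigma> r t x q \<xi> = G (V (F \<xi>) t)" for \<xi>
    by (rule flow_eq[OF r(1) s(3,4) V])
  let ?E = "exp (dint (\<lambda>v. bh' (Z v)) (\<lambda>v. ch' (Z v)) r t)"
  have "dint (\<lambda>v. bh' (V (Z r) v)) (\<lambda>v. ch' (V (Z r) v)) r t = dint (\<lambda>v. bh' (Z v)) (\<lambda>v. ch' (Z v)) r t"
    by (rule dint_cong) (use VZ r in auto)
  then have D: "((\<lambda>z. V z t) has_real_derivative ?E) (at (F Y))"
    using sol_derivative[OF V r(1,3), of "Z r"] by (simp add: Y)
  have D2: "((\<lambda>\<xi>. V (F \<xi>) t) has_real_derivative ?E * (1 / \<sigma> Y)) (at Y)" by (rule DERIV_chain2[OF D F_deriv])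
  have "((\<lambda>\<xi>. G (V (F \<xi>) t)) has_real_derivative \<sigma> (G (V (F Y) t)) * (?E * (1 / \<sigma> Y))) (at Y)"
    by (rule DERIV_chain2[OF G_deriv D2])
  then have "deriv (\<lambda>\<xi>. flow T b \<sigma> r t x q \<xi>) Y = \<sigma> (G (V (F Y) t)) * (?E * (1 / \<sigma> Y))"
    unfolding fl by (rule DERIV_imp_deriv)
  moreover have "V (F Y) t = Z t" using VZ[OF r(3)] by (simp add: Y)
  ultimately show ?thesis using \<sigma>_pos[of Y] by simp
qed

lemma exact_euler_limit:
  assumes s: "0 \<le> s" "s \<le> t" "t \<le> T"
  defines "u \<equiv> \<lambda>n k. s + real k * ((t - s) / real (Suc n))"
  shows "(\<lambda>n. G (euler (b_hat b \<sigma>) (c_hat \<sigma>) (\<lambda>k. u n (Suc k) - u n k) (\<lambda>k. q (u n (Suc k)) - q (u n k))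
       (\<lambda>k. x (u n (Suc k)) - x (u n k)) (F y) (Suc n))) \<longlonglongrightarrow> flow T b \<sigma> s t x q y"
proof -
  let ?Z = "Z_sol T b \<sigma> s x q y"
  have Z: "sol s (F y) ?Z" by (rule Z_sol_solves) (use s in auto)
  have triv: "locunif (\<lambda>_. f) f" for f by (simp add: locunif_def)
  interpret ap: ode_approx T "max 1 \<Lambda>" lborel "\<lambda>r. r" "stieltjes T q" q "b_hat b \<sigma>" "c_hat \<sigma>" bh' ch' B L x
      "\<lambda>_. b_hat b \<sigma>" "\<lambda>_. c_hat \<sigma>" "\<lambda>_. bh'" "\<lambda>_. ch'" L s t "F y" ?Z
    by (intro ode_approx.intro ode_approx_axioms.intro b_hat_deriv c_hat_deriv bh'_bound ch'_bound triv Z s ode_axioms)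
  have "(\<lambda>n. ap.\<zeta> n (Suc n)) \<longlonglongrightarrow> ?Z t"
  proof (rule tendstoI)
    fix \<epsilon> :: real assume "0 < \<epsilon>"
    then have "0 < \<epsilon> / 2" by simp
    from ap.euler_converges[OF this] show "eventually (\<lambda>n. dist (ap.\<zeta> n (Suc n)) (?Z t) < \<epsilon>) sequentially"
    proof eventually_elim
      fix n assume h: "\<forall>k\<le>Suc n. \<bar>ap.\<zeta> n k - ?Z (ap.u n k)\<bar> \<le> \<epsilon> / 2"
      from h[rule_format, OF order_refl] show "dist (ap.\<zeta> n (Suc n)) (?Z t) < \<epsilon>"
        unfolding ap.u_end dist_real_def using \<open>0 < \<epsilon>\<close> by linarith
    qed
  qed
  moreover have "isCont G (?Z t)" using G_cont[of UNIV] by (simp add: continuous_on_eq_continuous_at)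
  ultimately have "(\<lambda>n. G (ap.\<zeta> n (Suc n))) \<longlonglongrightarrow> G (?Z t)" by (rule isCont_tendsto_compose[rotated])
  then show ?thesis unfolding ap.\<zeta>_def ap.\<delta>1_def[abs_def] ap.\<delta>2_def[abs_def] ap.u_def u_def flow_def .
qed

end

text \<open>Measurability holds for every choice of clock, not only for the almost sure bracket: it is read
  off the Euler scheme.\<close>

lemma (in lamperti_coeffs) flow_measurable:
  assumes T: "0 < T" and s: "0 \<le> s" "s \<le> t" "t \<le> T"
    and x: "\<And>w. w \<in> space M ==> x w \<in> path_space T" and q: "\<And>w. w \<in> space M ==> q w \<in> bracket_paths T \<Lambda>"
    and xm: "\<And>u. u \<in> {0..T} ==> (\<lambda>w. x w u) \<in> borel_measurable M" and qm: "\<And>u. u \<in> {0..T} ==> (\<lambda>w. q w u) \<in> borel_measurable M"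
  shows "(\<lambda>w. flow T b \<sigma> s t (x w) (q w) y) \<in> borel_measurable M"
proof -
  obtain B L where BL: "\<And>z. \<bar>b_hat b \<sigma> z\<bar> \<le> B" "\<And>z. \<bar>c_hat \<sigma> z\<bar> \<le> B" "\<And>z. \<bar>bh' z\<bar> \<le> L" "\<And>z. \<bar>ch' z\<bar> \<le> L"
    by (rule hat_bounds, rule that)
  have lf: "lamperti_flow b \<sigma> lo hi T \<Lambda> (q w) (x w) B L" if "w \<in> space M" for w
    by unfold_locales (use T x[OF that] q[OF that] BL in auto)
  define u where "u n k = s + real k * ((t - s) / real (Suc n))" for n k
  have ub: "u n k \<in> {0..T}" if "k \<le> Suc n" for n k
  proof -
    have "real k / real (Suc n) * (t - s) \<le> 1 * (t - s)" using that s by (intro mult_right_mono) auto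
    moreover have "0 \<le> real k / real (Suc n) * (t - s)" using s by simp
    ultimately show ?thesis using s by (simp add: u_def)
  qed
  define e where "e n w k = euler (b_hat b \<sigma>) (c_hat \<sigma>) (\<lambda>k. u n (Suc k) - u n k) (\<lambda>k. q w (u n (Suc k)) - q w (u n k))
       (\<lambda>k. x w (u n (Suc k)) - x w (u n k)) (F y) k" for n w k
  have bm: "b_hat b \<sigma> \<in> borel_measurable borel" "c_hat \<sigma> \<in> borel_measurable borel" "G \<in> borel_measurable borel"
    using b_hat_deriv c_hat_deriv G_cont[of UNIV]
    by (auto intro!: borel_measurable_continuous_onI) (meson DERIV_isCont continuous_at_imp_continuous_on)+
  have em: "(\<lambda>w. e n w k) \<in> borel_measurable M" if "k \<le> Suc n" for n k
    using that
  proof (induction k)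
    case 0 then show ?case by (simp add: e_def)
  next
    case (Suc k)
    then have IH: "(\<lambda>w. e n w k) \<in> borel_measurable M" by simp
    have "(\<lambda>w. e n w k + (x w (u n (Suc k)) - x w (u n k)) + b_hat b \<sigma> (e n w k) * (u n (Suc k) - u n k)
        + c_hat \<sigma> (e n w k) * (q w (u n (Suc k)) - q w (u n k))) \<in> borel_measurable M"
      using Suc.prems
      by (intro borel_measurable_add borel_measurable_diff borel_measurable_times IH xm qm ub borel_measurable_const
          measurable_compose[OF IH bm(1)] measurable_compose[OF IH bm(2)]) auto
    then show ?case by (simp add: e_def)
  qed
  show ?thesis
  proof (rule borel_measurable_LIMSEQ_real)
    fix w assume w: "w \<in> space M"
    interpret lamperti_flow b \<sigma> lo hi T \<Lambda> "q w" "x w" B L by (rule lf[OF w])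
    show "(\<lambda>n. G (e n w (Suc n))) \<longlonglongrightarrow> flow T b \<sigma> s t (x w) (q w) y"
      using exact_euler_limit[OF s, of y] unfolding e_def u_def .
  next
    show "(\<lambda>w. G (e n w (Suc n))) \<in> borel_measurable M" for n
      by (rule measurable_compose[OF em bm(3)]) simp
  qed
qed


section \<open>The flow as a limit of smooth cylindrical functionals\<close>

lemma locunif_tendsto:
  fixes F :: "real => real"
  assumes f: "locunif f F" and F: "continuous_on UNIV F" and z: "z \<longlonglongrightarrow> l"
  shows "(\<lambda>n. f n (z n)) \<longlonglongrightarrow> F l"
proof -
  have "isCont F l" using F by (simp add: continuous_on_eq_continuous_at)
  then have 1: "(\<lambda>n. F (z n)) \<longlonglongrightarrow> F l" by (rule isCont_tendsto_compose[OF _ z])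
  have "Bseq z" using z by (intro convergent_imp_Bseq) (auto simp: convergent_def)
  then obtain R where R: "\<And>n. \<bar>z n\<bar> \<le> R" by (metis BseqE real_norm_def)
  have "(\<lambda>n. f n (z n) - F (z n)) \<longlonglongrightarrow> 0"
  proof (rule tendstoI)
    fix \<epsilon> :: real assume e: "0 < \<epsilon>"
    then have "0 < \<epsilon> / 2" by simp
    with f have "eventually (\<lambda>n. \<forall>v. \<bar>v\<bar> \<le> R \<longrightarrow> \<bar>f n v - F v\<bar> \<le> \<epsilon> / 2) sequentially"
      unfolding locunif_def by blast
    then show "eventually (\<lambda>n. dist (f n (z n) - F (z n)) 0 < \<epsilon>) sequentially"
    proof eventually_elim
      fix n assume "\<forall>v. \<bar>v\<bar> \<le> R \<longrightarrow> \<bar>f n v - F v\<bar> \<le> \<epsilon> / 2"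
      then have "\<bar>f n (z n) - F (z n)\<bar> \<le> \<epsilon> / 2" using R by blast
      then show "dist (f n (z n) - F (z n)) 0 < \<epsilon>" using e unfolding dist_real_def by linarith
    qed
  qed
  from tendsto_add[OF this 1] show ?thesis by simp
qed

lemma euler_bound:
  assumes b: "\<And>v. \<bar>b v\<bar> \<le> C" "\<And>v. \<bar>g v\<bar> \<le> C" and d: "\<And>i. i < k ==> \<bar>\<delta>1 i\<bar> \<le> m" "\<And>i. i < k ==> \<bar>\<delta>2 i\<bar> \<le> m"
  shows "\<bar>euler b g \<delta>1 \<delta>2 (\<lambda>k. c (Suc k) - c k) z k - (z + (c k - c 0))\<bar> \<le> real k * (2 * C * m)"
  using d
proof (induction k)
  case (Suc k)
  let ?e = "euler b g \<delta>1 \<delta>2 (\<lambda>k. c (Suc k) - c k) z k"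
  have C: "0 \<le> C" using b(1)[of 0] by linarith
  have "\<bar>?e - (z + (c k - c 0))\<bar> \<le> real k * (2 * C * m)" using Suc by simp
  moreover have "\<bar>b ?e * \<delta>1 k\<bar> \<le> C * m" "\<bar>g ?e * \<delta>2 k\<bar> \<le> C * m"
    unfolding abs_mult using C by (auto intro!: mult_mono b Suc.prems)
  moreover have "real (Suc k) * (2 * C * m) = real k * (2 * C * m) + 2 * (C * m)" by (simp add: algebra_simps)
  ultimately show ?case unfolding euler.simps by linarith
qed simp

lemma powr_add_le:
  fixes x y :: real assumes "0 \<le> x" "0 \<le> y" "0 \<le> p"
  shows "(x + y) powr p \<le> 2 powr p * (x powr p + y powr p)"
proof -
  have "(x + y) powr p \<le> (2 * max x y) powr p" using assms by (intro powr_mono2) auto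
  also have "\<dots> = 2 powr p * (max x y) powr p" using assms by (intro powr_mult)
  also have "\<dots> \<le> 2 powr p * (x powr p + y powr p)"
    by (intro mult_left_mono) (auto simp: max_def)
  finally show ?thesis .
qed

text \<open>The approximating coefficients are parameters, chosen once in the final proof, so that the
  approximations of flow and derivative are plain definitions.\<close>

locale wiener_flow = wiener_process M T W \<Lambda> a X + lamperti_coeffs b \<sigma> lo hi
  for M :: "'w measure" and T :: real and W and \<Lambda> a X b \<sigma> lo hi +
  fixes s t y B L :: real and bn gn Gn bn' gn' Gn' :: "nat => real => real"
  assumes st: "0 \<le> s" "s \<le> t" "t \<le> T"
    and b_hat_bound: "\<And>z. \<bar>b_hat b \<sigma> z\<bar> \<le> B" and c_hat_bound: "\<And>z. \<bar>c_hat \<sigma> z\<bar> \<le> B"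
    and bh'_bound: "\<And>z. \<bar>bh' z\<bar> \<le> L" and ch'_bound: "\<And>z. \<bar>ch' z\<bar> \<le> L"
    and bn_deriv: "\<And>n z. (bn n has_real_derivative bn' n z) (at z)"
    and gn_deriv: "\<And>n z. (gn n has_real_derivative gn' n z) (at z)"
    and Gn_deriv: "\<And>n z. (Gn n has_real_derivative Gn' n z) (at z)"
    and bn'_bound: "\<And>n z. \<bar>bn' n z\<bar> \<le> L + 1" and gn'_bound: "\<And>n z. \<bar>gn' n z\<bar> \<le> L + 1" and Gn'_bound: "\<And>n z. \<bar>Gn' n z\<bar> \<le> hi + 1"
    and bn_bound: "\<And>n z. \<bar>bn n z\<bar> \<le> B + 1" and gn_bound: "\<And>n z. \<bar>gn n z\<bar> \<le> B + 1" and Gn_zero: "\<And>n. Gn n 0 = G 0"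
    and bn_conv: "locunif bn (b_hat b \<sigma>)" and gn_conv: "locunif gn (c_hat \<sigma>)" and Gn_conv: "locunif Gn G"
    and bn'_conv: "locunif bn' bh'" and gn'_conv: "locunif gn' ch'" and Gn'_conv: "locunif Gn' (\<lambda>z. \<sigma> (G z))"
    and trig: "\<And>n. trig_poly (bn n)" "\<And>n. trig_poly (gn n)" "\<And>n. trig_poly (Gn n)"
begin

definition Zp :: "'w => real => real" where "Zp w = Z_sol T b \<sigma> s (X w) clock y"

definition gr :: "nat => nat => real" where "gr n k = s + real k * ((t - s) / real (Suc n))"

text \<open>The Euler scheme as a function of the noise values \<open>c\<close> at the grid points.\<close>

definition \<zeta>p :: "nat => (nat => real) => nat => real" where
  "\<zeta>p n c k = euler (bn n) (gn n) (\<lambda>k. gr n (Suc k) - gr n k) (\<lambda>k. clock (gr n (Suc k)) - clock (gr n k))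
     (\<lambda>k. c (Suc k) - c k) (F y) k"

definition crd :: "nat => 'w => nat => real" where "crd n w i = X w (gr n i)"

definition tn :: "nat => 'w => real => real" where
  "tn n w r = tangent (\<lambda>k. bn' n (\<zeta>p n (crd n w) k) * (gr n (Suc k) - gr n k)
        + gn' n (\<zeta>p n (crd n w) k) * (clock (gr n (Suc k)) - clock (gr n k)))
     (\<lambda>k. of_bool (r \<le> gr n (Suc k)) - of_bool (r \<le> gr n k)) (Suc n)"

definition Ez :: "'w => real => real" where
  "Ez w r = exp (drivers.dint lborel (stieltjes T clock) (\<lambda>v. bh' (Zp w v)) (\<lambda>v. ch' (Zp w v)) r t)"

definition Fn :: "nat => 'w => real" where "Fn n w = Gn n (\<zeta>p n (crd n w) (Suc n))"

definition Dn :: "nat => 'w => real => real" where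
  "Dn n w r = (\<Sum>i<Suc (Suc n). partial_deriv i (\<lambda>c. Gn n (\<zeta>p n c (Suc n))) (crd n w) * (indicator {0..gr n i} r * sqrt (a r)))"

definition D0 :: "'w => real => real" where
  "D0 w r = indicator {s<..t} r * (sqrt (a r) * (\<sigma> (G (Zp w t)) * Ez w r))"

definition F0 :: "'w => real" where "F0 w = flow T b \<sigma> s t (X w) clock y"

lemma gr_bounds: "k \<le> Suc n ==> gr n k \<in> {0..T}"
proof -
  assume "k \<le> Suc n"
  then have "real k / real (Suc n) * (t - s) \<le> 1 * (t - s)" using st by (intro mult_right_mono) auto
  moreover have "0 \<le> real k / real (Suc n) * (t - s)" using st by simp
  ultimately show ?thesis using st by (simp add: gr_def)
qed

lemma gr_ends: "gr n 0 = s" "gr n (Suc n) = t"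
  by (simp_all add: gr_def)

lemma path_flow: "w \<in> space M ==> lamperti_flow b \<sigma> lo hi T \<Lambda> clock (X w) B L"
  by (intro lamperti_flow.intro lamperti_coeffs_axioms lamperti_flow_axioms.intro T_pos clock_in_bracket_paths X_path
      b_hat_bound c_hat_bound bh'_bound ch'_bound)

lemma path_approx:
  assumes "w \<in> space M"
  shows "ode_approx T (max 1 \<Lambda>) lborel (\<lambda>r. r) (stieltjes T clock) clock (b_hat b \<sigma>) (c_hat \<sigma>) bh' ch' B L (X w)
     bn gn bn' gn' (L + 1) s t (F y) (Zp w)"
proof -
  interpret lf: lamperti_flow b \<sigma> lo hi T \<Lambda> clock "X w" B L by (rule path_flow[OF assms])
  have "lf.sol s (F y) (Zp w)" unfolding Zp_def by (rule lf.Z_sol_solves) (use st in auto)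
  then show ?thesis
    by (intro ode_approx.intro ode_approx_axioms.intro lf.ode_axioms bn_deriv gn_deriv bn'_bound gn'_bound bn_conv gn_conv bn'_conv gn'_conv st)
qed

lemma F0_eq: "w \<in> space M ==> F0 w = G (Zp w t)"
  by (simp add: F0_def flow_def Zp_def)

text \<open>Collected along a fixed path: the scheme converges, its tangent process is bounded and converges, and
  the scheme differs from its noise by a bounded amount, the coefficients being bounded.\<close>

lemma path_limits:
  assumes w: "w \<in> space M"
  shows "(\<lambda>n. \<zeta>p n (crd n w) (Suc n)) \<longlonglongrightarrow> Zp w t"
    "\<bar>tn n w r\<bar> \<le> exp (2 * max 1 \<Lambda> * (L + 1) * T)"
    "(\<lambda>n. tn n w r) \<longlonglongrightarrow> indicator {s<..t} r * Ez w r"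
    "\<bar>\<zeta>p n (crd n w) (Suc n) - (F y + (X w t - X w s))\<bar> \<le> 2 * (B + 1) * max 1 \<Lambda> * T"
proof -
  interpret ap: ode_approx T "max 1 \<Lambda>" lborel "\<lambda>r. r" "stieltjes T clock" clock "b_hat b \<sigma>" "c_hat \<sigma>" bh' ch' B L "X w"
     bn gn bn' gn' "L + 1" s t "F y" "Zp w" by (rule path_approx[OF w])
  have u: "ap.u n k = gr n k" for n k by (simp add: ap.u_def gr_def)
  have z: "ap.\<zeta> n k = \<zeta>p n (crd n w) k" for n k
    unfolding ap.\<zeta>_def \<zeta>p_def crd_def ap.\<delta>1_def[abs_def] ap.\<delta>2_def[abs_def] u by (rule refl)
  have tn: "tn n w r = tangent (ap.rate n) (ap.kick n r) (Suc n)" for n r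
    unfolding tn_def ap.rate_def[abs_def] ap.kick_def[abs_def] ap.\<delta>1_def ap.\<delta>2_def z u by (rule refl)
  show "(\<lambda>n. \<zeta>p n (crd n w) (Suc n)) \<longlonglongrightarrow> Zp w t"
  proof (rule tendstoI)
    fix \<epsilon> :: real assume e: "0 < \<epsilon>"
    then have "0 < \<epsilon> / 2" by simp
    from ap.euler_converges[OF this] show "eventually (\<lambda>n. dist (\<zeta>p n (crd n w) (Suc n)) (Zp w t) < \<epsilon>) sequentially"
    proof eventually_elim
      fix n assume h: "\<forall>k\<le>Suc n. \<bar>ap.\<zeta> n k - Zp w (ap.u n k)\<bar> \<le> \<epsilon> / 2"
      from h[rule_format, OF order_refl] show "dist (\<zeta>p n (crd n w) (Suc n)) (Zp w t) < \<epsilon>"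
        unfolding ap.u_end z dist_real_def using e by linarith
    qed
  qed
  show "\<bar>tn n w r\<bar> \<le> exp (2 * max 1 \<Lambda> * (L + 1) * T)" unfolding tn by (rule ap.tangent_kick_bound)
  show "(\<lambda>n. tn n w r) \<longlonglongrightarrow> indicator {s<..t} r * Ez w r"
  proof (cases "s < r \<and> r \<le> t")
    case True
    then show ?thesis using ap.tangent_converges[of r] by (simp add: tn Ez_def)
  next
    case False
    then have "tn n w r = 0" for n unfolding tn by (intro ap.tangent_kick_outside) auto
    moreover have "indicator {s<..t} r = (0::real)" using False by (simp add: indicator_def)
    ultimately show ?thesis by simp
  qed
  have B0: "0 \<le> B + 1" using b_hat_bound[of 0] by linarith
  have "\<bar>\<zeta>p n (crd n w) (Suc n) - (F y + (crd n w (Suc n) - crd n w 0))\<bar> \<le> real (Suc n) * (2 * (B + 1) * (max 1 \<Lambda> * ap.mesh n))"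
    unfolding \<zeta>p_def
    by (rule euler_bound[OF bn_bound gn_bound]) (use ap.\<delta>_bounds[of _ n] in \<open>simp_all add: ap.\<delta>1_def ap.\<delta>2_def u\<close>)
  also have "\<dots> = 2 * (B + 1) * max 1 \<Lambda> * (ap.mesh n * real (Suc n))" by (simp add: mult_ac)
  also have "\<dots> \<le> 2 * (B + 1) * max 1 \<Lambda> * T" using B0 by (intro mult_left_mono ap.mesh_mult) auto
  finally show "\<bar>\<zeta>p n (crd n w) (Suc n) - (F y + (X w t - X w s))\<bar> \<le> 2 * (B + 1) * max 1 \<Lambda> * T"
    by (simp only: crd_def gr_ends)
qed

lemma smooth_approximation: "smooth_cylindrical M T W (Fn n) (Dn n)"
  unfolding smooth_cylindrical_def
proof (intro exI conjI)
  show "smooth_poly_growth (Suc (Suc n)) (\<lambda>c. Gn n (\<zeta>p n c (Suc n)))"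
    unfolding \<zeta>p_def by (intro tame_smooth tame_trig_poly[OF trig(3)] tame_euler trig lessI)
  show "\<forall>i<Suc (Suc n). is_wiener_integral M T W (\<lambda>r. indicator {0..gr n i} r * sqrt (a r)) (\<lambda>w. crd n w i)"
    unfolding crd_def by (intro allI impI X_wiener gr_bounds) simp
  show "Fn n = (\<lambda>w. Gn n (\<zeta>p n (crd n w) (Suc n)))" by (rule ext) (simp add: Fn_def)
  show "Dn n = (\<lambda>w r. \<Sum>i<Suc (Suc n). partial_deriv i (\<lambda>c. Gn n (\<zeta>p n c (Suc n))) (crd n w) * (indicator {0..gr n i} r * sqrt (a r)))"
    by (intro ext) (simp only: Dn_def)
qed

text \<open>The direction belonging to time \<open>r\<close> has increments \<open>sqrt (a r)\<close> times the kick at \<open>r\<close>, because the integrand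
  of \<open>X u\<close> is \<open>1\<^bsub>[0,u]\<^esub> sqrt a\<close>.\<close>

lemma Dn_eq:
  assumes "r \<in> {0..T}"
  shows "Dn n w r = sqrt (a r) * (Gn' n (\<zeta>p n (crd n w) (Suc n)) * tn n w r)"
proof -
  have i: "indicator {0..gr n i} r = (of_bool (r \<le> gr n i) :: real)" for i using assms by (auto simp: indicator_def)
  have "(\<lambda>k. indicator {0..gr n (Suc k)} r * sqrt (a r) - indicator {0..gr n k} r * sqrt (a r))
      = (\<lambda>k. sqrt (a r) * (of_bool (r \<le> gr n (Suc k)) - of_bool (r \<le> gr n k)))"
    unfolding i by (simp add: algebra_simps)
  then show ?thesis
    unfolding Dn_def \<zeta>p_def euler_partial_derivs[OF trig bn_deriv gn_deriv Gn_deriv lessI] tn_def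
    by (simp only: tangent_scale mult_ac)
qed

definition CD :: real where "CD = sqrt \<Lambda> * ((hi + 1) * exp (2 * max 1 \<Lambda> * (L + 1) * T))"

lemma derivative_limits:
  assumes w: "w \<in> space M" and r: "r \<in> {0..T}"
  shows "\<bar>Dn n w r\<bar> \<le> CD" "(\<lambda>n. Dn n w r) \<longlonglongrightarrow> D0 w r" "\<bar>D0 w r\<bar> \<le> CD"
proof -
  have hi: "0 \<le> hi + 1" using Gn'_bound[of 0 0] by linarith
  have a: "0 \<le> sqrt (a r)" "sqrt (a r) \<le> sqrt \<Lambda>" using a_bounds[OF r] by auto
  show 1: "\<bar>Dn n w r\<bar> \<le> CD" for n
    unfolding Dn_eq[OF r] CD_def abs_mult using a hi
    by (intro mult_mono Gn'_bound path_limits[OF w]) auto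
  have "continuous_on UNIV (\<lambda>z. \<sigma> (G z))" by (rule G_compose_cont[OF \<sigma>_facts(2)])
  then have "(\<lambda>n. Gn' n (\<zeta>p n (crd n w) (Suc n))) \<longlonglongrightarrow> \<sigma> (G (Zp w t))"
    by (rule locunif_tendsto[OF Gn'_conv _ path_limits(1)[OF w]])
  from tendsto_mult_left[OF tendsto_mult[OF this path_limits(3)[OF w, of r]], of "sqrt (a r)"]
  show 2: "(\<lambda>n. Dn n w r) \<longlonglongrightarrow> D0 w r" unfolding Dn_eq[OF r] D0_def by (simp only: mult_ac)
  show "\<bar>D0 w r\<bar> \<le> CD"
    by (rule LIMSEQ_le_const2[OF tendsto_rabs[OF 2]]) (use 1 in auto)
qed

lemma value_limits:
  assumes w: "w \<in> space M"
  defines "C0 \<equiv> \<bar>G 0\<bar> + (hi + 1) * (\<bar>F y\<bar> + 2 * (B + 1) * max 1 \<Lambda> * T)"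
  shows "(\<lambda>n. Fn n w) \<longlonglongrightarrow> F0 w" "\<bar>Fn n w\<bar> \<le> C0 + (hi + 1) * \<bar>X w t - X w s\<bar>"
    "\<bar>F0 w\<bar> \<le> C0 + (hi + 1) * \<bar>X w t - X w s\<bar>"
proof -
  have hi: "0 \<le> hi + 1" using Gn'_bound[of 0 0] by linarith
  show 1: "(\<lambda>n. Fn n w) \<longlonglongrightarrow> F0 w"
    unfolding Fn_def F0_eq[OF w] by (rule locunif_tendsto[OF Gn_conv G_cont path_limits(1)[OF w]])
  show 2: "\<bar>Fn n w\<bar> \<le> C0 + (hi + 1) * \<bar>X w t - X w s\<bar>" for n
  proof -
    let ?z = "\<zeta>p n (crd n w) (Suc n)"
    have "\<bar>Gn n ?z - Gn n 0\<bar> \<le> (hi + 1) * \<bar>?z - 0\<bar>" by (rule lipschitz_of_deriv_bound[OF Gn_deriv Gn'_bound])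
    also have "\<dots> \<le> (hi + 1) * (\<bar>F y\<bar> + 2 * (B + 1) * max 1 \<Lambda> * T + \<bar>X w t - X w s\<bar>)"
      using path_limits(4)[OF w, of n] hi by (intro mult_left_mono) linarith+
    also have "\<dots> = (hi + 1) * (\<bar>F y\<bar> + 2 * (B + 1) * max 1 \<Lambda> * T) + (hi + 1) * \<bar>X w t - X w s\<bar>"
      by (rule distrib_left)
    finally show ?thesis unfolding Fn_def C0_def Gn_zero by linarith
  qed
  show "\<bar>F0 w\<bar> \<le> C0 + (hi + 1) * \<bar>X w t - X w s\<bar>"
    by (rule LIMSEQ_le_const2[OF tendsto_rabs[OF 1]]) (use 2 in auto)
qed

lemma F0_measurable: "F0 \<in> borel_measurable M"
  unfolding F0_def[abs_def]
  by (rule flow_measurable[OF T_pos st X_path clock_in_bracket_paths X_measurable borel_measurable_const])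

lemma increment_powr:
  assumes "0 \<le> p" shows "integrable M (\<lambda>w. \<bar>X w t - X w s\<bar> powr p)"
  using wiener_powr[OF X_increment[OF st] assms] by simp

lemma dominated_powr:
  assumes p: "0 \<le> p" and C: "0 \<le> C" "0 \<le> D" and f: "f \<in> borel_measurable M"
    and b: "\<And>w. w \<in> space M ==> \<bar>f w\<bar> \<le> C + D * \<bar>X w t - X w s\<bar>"
  shows "w \<in> space M ==> \<bar>f w\<bar> powr p \<le> 2 powr p * (C powr p + D powr p * \<bar>X w t - X w s\<bar> powr p)"
    and "integrable M (\<lambda>w. 2 powr p * (C powr p + D powr p * \<bar>X w t - X w s\<bar> powr p))"
    and "integrable M (\<lambda>w. \<bar>f w\<bar> powr p)"
proof -
  show 1: "\<bar>f w\<bar> powr p \<le> 2 powr p * (C powr p + D powr p * \<bar>X w t - X w s\<bar> powr p)" if "w \<in> space M" for w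
  proof -
    have "\<bar>f w\<bar> powr p \<le> (C + D * \<bar>X w t - X w s\<bar>) powr p" using b[OF that] p by (intro powr_mono2) auto
    also have "\<dots> \<le> 2 powr p * (C powr p + (D * \<bar>X w t - X w s\<bar>) powr p)" using C p by (intro powr_add_le) auto
    also have "(D * \<bar>X w t - X w s\<bar>) powr p = D powr p * \<bar>X w t - X w s\<bar> powr p" by (rule powr_mult)
    finally show ?thesis .
  qed
  show 2: "integrable M (\<lambda>w. 2 powr p * (C powr p + D powr p * \<bar>X w t - X w s\<bar> powr p))"
    using increment_powr[OF p] by simp
  show "integrable M (\<lambda>w. \<bar>f w\<bar> powr p)"
  proof (rule Bochner_Integration.integrable_bound[OF 2])
    show "(\<lambda>w. \<bar>f w\<bar> powr p) \<in> borel_measurable M" using f by measurable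
    show "AE w in M. norm (\<bar>f w\<bar> powr p) \<le> norm (2 powr p * (C powr p + D powr p * \<bar>X w t - X w s\<bar> powr p))"
    proof (rule AE_I2)
      fix w assume "w \<in> space M"
      from 1[OF this] show "norm (\<bar>f w\<bar> powr p) \<le> norm (2 powr p * (C powr p + D powr p * \<bar>X w t - X w s\<bar> powr p))"
        unfolding real_norm_def by (metis abs_ge_self abs_of_nonneg order_trans powr_ge_zero)
    qed
  qed
qed

lemma D0_measurable: "case_prod D0 \<in> borel_measurable (M \<Otimes>\<^sub>M leb T)"
proof (rule borel_measurable_LIMSEQ_real)
  show "case_prod (Dn n) \<in> borel_measurable (M \<Otimes>\<^sub>M leb T)" for n
    by (rule smooth_cylindrical_measurable(3)[OF smooth_approximation])
  fix z assume "z \<in> space (M \<Otimes>\<^sub>M leb T)"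
  then obtain w r where z: "z = (w, r)" "w \<in> space M" "r \<in> {0..T}"
    by (cases z) (auto simp: space_pair_measure space_restrict_space)
  show "(\<lambda>n. case_prod (Dn n) z) \<longlonglongrightarrow> case_prod D0 z" using derivative_limits(2)[OF z(2,3)] by (simp add: z(1))
qed

lemma D0_L2: assumes w: "w \<in> space M" shows "D0 w \<in> L2_time T"
proof -
  have m: "D0 w \<in> borel_measurable (leb T)"
  proof (rule borel_measurable_LIMSEQ_real)
    show "Dn n w \<in> borel_measurable (leb T)" for n
      using smooth_cylindrical_measurable(2)[OF smooth_approximation, of n w] by (simp add: L2_time_def)
    show "(\<lambda>n. Dn n w r) \<longlonglongrightarrow> D0 w r" if "r \<in> space (leb T)" for r
      using derivative_limits(2)[OF w, of r] that by (simp add: space_restrict_space)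
  qed
  have "integrable (leb T) (\<lambda>r. (D0 w r)\<^sup>2)"
  proof (rule bounded_integrable_leb_on)
    show "(\<lambda>r. (D0 w r)\<^sup>2) \<in> borel_measurable (leb T)" using m by measurable
    show "\<bar>(D0 w r)\<^sup>2\<bar> \<le> CD\<^sup>2" if "r \<in> {0..T}" for r
      using power_mono[OF derivative_limits(3)[OF w that] abs_ge_zero, of 2] by simp
  qed
  with m show ?thesis by (simp add: L2_time_def)
qed

lemma L2_norm_bounded:
  assumes f: "f \<in> L2_time T" and b: "\<And>r. r \<in> {0..T} ==> \<bar>f r\<bar> \<le> C"
  shows "L2_norm_time T f \<le> sqrt (C\<^sup>2 * T)"
proof -
  have c: "integrable (leb T) (\<lambda>r. C\<^sup>2)" by (rule bounded_integrable_leb_on[where B = "C\<^sup>2"]) auto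
  have "(LINT r|leb T. (f r)\<^sup>2) \<le> (LINT r|leb T. C\<^sup>2)"
  proof (rule integral_mono[OF _ c])
    show "integrable (leb T) (\<lambda>r. (f r)\<^sup>2)" using f by (simp add: L2_time_def)
    show "(f r)\<^sup>2 \<le> C\<^sup>2" if "r \<in> space (leb T)" for r
      using power_mono[OF b abs_ge_zero, of r 2] that by (simp add: space_restrict_space)
  qed
  also have "\<dots> = C\<^sup>2 * T" using T_pos by (simp add: measure_restrict_space space_restrict_space)
  finally show ?thesis unfolding L2_norm_time_def by (rule real_sqrt_le_mono)
qed

text \<open>Domination by an affine function of the Gaussian variable \<open>\<bar>X t - X s\<bar>\<close>, which has moments of all orders.\<close>

lemma tendsto_Lp_dominated:
  assumes p: "1 \<le> p" and m: "\<And>n. f n \<in> borel_measurable M" "g \<in> borel_measurable M"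
    and lim: "\<And>w. w \<in> space M ==> (\<lambda>n. f n w) \<longlonglongrightarrow> g w"
    and C: "0 \<le> C" "0 \<le> D" and b: "\<And>n w. w \<in> space M ==> \<bar>f n w - g w\<bar> \<le> C + D * \<bar>X w t - X w s\<bar>"
  shows "tendsto_Lp M p f g"
proof -
  have p0: "0 \<le> p" using p by simp
  have mm: "(\<lambda>w. f n w - g w) \<in> borel_measurable M" for n using m by measurable
  note dom = dominated_powr[OF p0 C mm b]
  have "(\<lambda>n. LINT w|M. \<bar>f n w - g w\<bar> powr p) \<longlonglongrightarrow> (LINT w|M. 0)"
  proof (rule integral_dominated_convergence[OF _ _ dom(2)])
    show "AE w in M. (\<lambda>n. \<bar>f n w - g w\<bar> powr p) \<longlonglongrightarrow> 0"
    proof (rule AE_I2)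
      fix w assume w: "w \<in> space M"
      have "(\<lambda>n. \<bar>f n w - g w\<bar>) \<longlonglongrightarrow> 0" using lim[OF w] by (metis LIM_zero tendsto_rabs_zero)
      then show "(\<lambda>n. \<bar>f n w - g w\<bar> powr p) \<longlonglongrightarrow> 0" using p by (intro tendsto_zero_powrI[OF _ tendsto_const]) auto
    qed
    show "(\<lambda>w. \<bar>f n w - g w\<bar> powr p) \<in> borel_measurable M" for n using mm by measurable
    show "AE w in M. norm (\<bar>f n w - g w\<bar> powr p) \<le> 2 powr p * (C powr p + D powr p * \<bar>X w t - X w s\<bar> powr p)" for n
      using dom(1) by (intro AE_I2) simp
  qed simp
  then show ?thesis using dom(3) by (simp add: tendsto_Lp_def)
qed

theorem F0_malliavin:
  assumes p: "1 \<le> p"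
  shows "has_malliavin_derivative M T W p F0 D0"
  unfolding has_malliavin_derivative_def
proof (intro conjI)
  have p0: "0 \<le> p" using p by simp
  have hi: "0 \<le> hi + 1" using Gn'_bound[of 0 0] by linarith
  have B0: "0 \<le> B + 1" using b_hat_bound[of 0] by linarith
  define C0 where "C0 = \<bar>G 0\<bar> + (hi + 1) * (\<bar>F y\<bar> + 2 * (B + 1) * max 1 \<Lambda> * T)"
  have "0 \<le> 2 * (B + 1) * max 1 \<Lambda> * T" using B0 T_pos by (intro mult_nonneg_nonneg) auto
  then have "0 \<le> (hi + 1) * (\<bar>F y\<bar> + 2 * (B + 1) * max 1 \<Lambda> * T)" by (intro mult_nonneg_nonneg[OF hi]) simp
  then have C0: "0 \<le> C0" by (simp add: C0_def)
  note vl = value_limits[folded C0_def]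
  show "F0 \<in> borel_measurable M" by (rule F0_measurable)
  show "integrable M (\<lambda>w. \<bar>F0 w\<bar> powr p)" by (rule dominated_powr(3)[OF p0 C0 hi F0_measurable vl(3)])
  show "case_prod D0 \<in> borel_measurable (M \<Otimes>\<^sub>M leb T)" by (rule D0_measurable)
  show "AE w in M. D0 w \<in> L2_time T" by (rule AE_I2) (rule D0_L2)
  have L2m: "(\<lambda>w. L2_norm_time T (D0 w)) \<in> borel_measurable M" by (rule L2_norm_measurable[OF D0_measurable])
  have "\<bar>L2_norm_time T (D0 w)\<bar> \<le> sqrt (CD\<^sup>2 * T) + 0 * \<bar>X w t - X w s\<bar>" if "w \<in> space M" for w
    using L2_norm_bounded[OF D0_L2[OF that] derivative_limits(3)[OF that]] L2_norm_nonneg by simp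
  from dominated_powr(3)[OF p0 _ order_refl L2m this]
  show "integrable M (\<lambda>w. L2_norm_time T (D0 w) powr p)" using T_pos L2_norm_nonneg by simp
  show "\<exists>Fn Dn. (\<forall>n. smooth_cylindrical M T W (Fn n) (Dn n)) \<and> tendsto_Lp M p Fn F0 \<and>
        tendsto_Lp M p (\<lambda>n w. L2_norm_time T (\<lambda>r. Dn n w r - D0 w r)) (\<lambda>_. 0)"
  proof (intro exI conjI allI)
    show "smooth_cylindrical M T W (Fn n) (Dn n)" for n by (rule smooth_approximation)
    show "tendsto_Lp M p Fn F0"
    proof (rule tendsto_Lp_dominated[OF p _ F0_measurable vl(1)])
      show "Fn n \<in> borel_measurable M" for n by (rule smooth_cylindrical_measurable(1)[OF smooth_approximation])
      show "0 \<le> 2 * C0" "0 \<le> 2 * (hi + 1)" using C0 hi by simp_all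
      show "\<bar>Fn n w - F0 w\<bar> \<le> 2 * C0 + 2 * (hi + 1) * \<bar>X w t - X w s\<bar>" if "w \<in> space M" for n w
        using vl(2)[OF that, of n] vl(3)[OF that] by linarith
    qed
    have dL2: "(\<lambda>r. Dn n w r - D0 w r) \<in> L2_time T" if "w \<in> space M" for n w
      by (rule L2_time_diff[OF smooth_cylindrical_measurable(2)[OF smooth_approximation] D0_L2[OF that]])
    have db: "\<bar>Dn n w r - D0 w r\<bar> \<le> 2 * CD" if "w \<in> space M" "r \<in> {0..T}" for n w r
      using derivative_limits(1)[OF that, of n] derivative_limits(3)[OF that] by linarith
    show "tendsto_Lp M p (\<lambda>n w. L2_norm_time T (\<lambda>r. Dn n w r - D0 w r)) (\<lambda>_. 0)"
    proof (rule tendsto_Lp_dominated[OF p _ _ _ _ order_refl])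
      show "(\<lambda>w. L2_norm_time T (\<lambda>r. Dn n w r - D0 w r)) \<in> borel_measurable M" for n
      proof (rule L2_norm_measurable)
        have "case_prod (Dn n) \<in> borel_measurable (M \<Otimes>\<^sub>M leb T)"
          by (rule smooth_cylindrical_measurable(3)[OF smooth_approximation])
        from borel_measurable_diff[OF this D0_measurable]
        show "(\<lambda>(w, r). Dn n w r - D0 w r) \<in> borel_measurable (M \<Otimes>\<^sub>M leb T)" by (simp add: split_beta')
      qed
      show "(\<lambda>_. 0) \<in> borel_measurable M" by simp
      show "0 \<le> sqrt ((2 * CD)\<^sup>2 * T)" using T_pos by simp
      show "\<bar>L2_norm_time T (\<lambda>r. Dn n w r - D0 w r) - 0\<bar> \<le> sqrt ((2 * CD)\<^sup>2 * T) + 0 * \<bar>X w t - X w s\<bar>"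
        if "w \<in> space M" for n w
        using L2_norm_bounded[OF dL2[OF that] db[OF that]] L2_norm_nonneg by simp
      show "(\<lambda>n. L2_norm_time T (\<lambda>r. Dn n w r - D0 w r)) \<longlonglongrightarrow> 0" if w: "w \<in> space M" for w
      proof -
        have "(\<lambda>n. LINT r|leb T. (Dn n w r - D0 w r)\<^sup>2) \<longlonglongrightarrow> (LINT r|leb T. 0)"
        proof (rule integral_dominated_convergence[where w = "\<lambda>_. (2 * CD)\<^sup>2"])
          show "integrable (leb T) (\<lambda>_. (2 * CD)\<^sup>2)"
            by (rule bounded_integrable_leb_on[where B = "(2 * CD)\<^sup>2"]) auto
          show "(\<lambda>r. (Dn n w r - D0 w r)\<^sup>2) \<in> borel_measurable (leb T)" for n
            using dL2[OF w, of n] unfolding L2_time_def by (intro borel_measurable_power) simp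
          show "AE r in leb T. (\<lambda>n. (Dn n w r - D0 w r)\<^sup>2) \<longlonglongrightarrow> 0"
          proof (rule AE_I2)
            fix r assume "r \<in> space (leb T)"
            then have "(\<lambda>n. Dn n w r) \<longlonglongrightarrow> D0 w r" using derivative_limits(2)[OF w, of r] by (simp add: space_restrict_space)
            then have "(\<lambda>n. (Dn n w r - D0 w r)\<^sup>2) \<longlonglongrightarrow> (D0 w r - D0 w r)\<^sup>2" by (intro tendsto_intros)
            then show "(\<lambda>n. (Dn n w r - D0 w r)\<^sup>2) \<longlonglongrightarrow> 0" by simp
          qed
          show "AE r in leb T. norm ((Dn n w r - D0 w r)\<^sup>2) \<le> (2 * CD)\<^sup>2" for n
          proof (rule AE_I2)
            fix r assume "r \<in> space (leb T)"
            then have "r \<in> {0..T}" by (simp add: space_restrict_space)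
            from power_mono[OF db[OF w this, of n] abs_ge_zero, of 2]
            show "norm ((Dn n w r - D0 w r)\<^sup>2) \<le> (2 * CD)\<^sup>2" by simp
          qed
        qed simp
        from tendsto_real_sqrt[OF this] show ?thesis unfolding L2_norm_time_def by simp
      qed
    qed
  qed
qed

end


section \<open>The response kernel as Malliavin derivative\<close>

context brownian
begin

text \<open>Modification on a null set preserves the derivative, provided measurability is known separately: the
  probability space may be incomplete.\<close>

lemma has_malliavin_derivative_cong:
  assumes h: "has_malliavin_derivative M T W p F D" and F': "F' \<in> borel_measurable M" and e: "AE w in M. F' w = F w"
  shows "has_malliavin_derivative M T W p F' D"
proof -
  note h' = h[unfolded has_malliavin_derivative_def]
  have Fm: "F \<in> borel_measurable M" using h' by (rule conjunct1)
  have i: "integrable M (\<lambda>w. \<bar>F' w\<bar> powr p)"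
  proof (rule integrable_cong_AE_imp)
    show "integrable M (\<lambda>w. \<bar>F w\<bar> powr p)" using h' by (elim conjE)
    show "(\<lambda>w. \<bar>F' w\<bar> powr p) \<in> borel_measurable M" using F' by measurable
    show "AE w in M. \<bar>F w\<bar> powr p = \<bar>F' w\<bar> powr p" using e by eventually_elim simp
  qed
  obtain Fn Dn where a: "\<forall>n. smooth_cylindrical M T W (Fn n) (Dn n)" "tendsto_Lp M p Fn F"
      "tendsto_Lp M p (\<lambda>n w. L2_norm_time T (\<lambda>r. Dn n w r - D w r)) (\<lambda>_. 0)"
    using h' by (elim conjE exE)
  have Fnm: "Fn n \<in> borel_measurable M" for n using a(1) smooth_cylindrical_measurable(1) by blast
  have "tendsto_Lp M p Fn F'"
    unfolding tendsto_Lp_def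
  proof (intro conjI allI)
    have m: "(\<lambda>w. \<bar>Fn n w - F w\<bar> powr p) \<in> borel_measurable M" "(\<lambda>w. \<bar>Fn n w - F' w\<bar> powr p) \<in> borel_measurable M" for n
      using Fnm[of n] Fm F' by measurable
    have ae: "AE w in M. \<bar>Fn n w - F w\<bar> powr p = \<bar>Fn n w - F' w\<bar> powr p" for n using e by eventually_elim simp
    show "integrable M (\<lambda>w. \<bar>Fn n w - F' w\<bar> powr p)" for n
      by (rule integrable_cong_AE_imp[OF _ m(2) ae]) (use a(2) in \<open>simp add: tendsto_Lp_def\<close>)
    show "(\<lambda>n. LINT w|M. \<bar>Fn n w - F' w\<bar> powr p) \<longlonglongrightarrow> 0"
      using a(2) integral_cong_AE[OF m ae] by (simp add: tendsto_Lp_def)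
  qed
  with a have "\<exists>Fn Dn. (\<forall>n. smooth_cylindrical M T W (Fn n) (Dn n)) \<and> tendsto_Lp M p Fn F' \<and>
        tendsto_Lp M p (\<lambda>n w. L2_norm_time T (\<lambda>r. Dn n w r - D w r)) (\<lambda>_. 0)"
    by (intro exI[of _ Fn] exI[of _ Dn] conjI)
  with h' F' i show ?thesis unfolding has_malliavin_derivative_def by (elim conjE, intro conjI)
qed

end

lemma AE_leb_on_neq: "AE r in leb T. r \<noteq> (s::real)"
proof -
  have "AE r in lebesgue. r \<noteq> s" by (rule AE_completion[OF AE_lborel_singleton])
  then show ?thesis by (subst AE_restrict_space_iff) auto
qed

lemma LINT_leb_on_subinterval:
  fixes a :: "real => real"
  assumes "0 \<le> s" "t \<le> T"
  shows "(LINT r|leb T. indicator {s..t} r * a r) = (LINT r:{s..t}|lebesgue. a r)"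
proof -
  have "(LINT r|leb T. indicator {s..t} r * a r) = (LINT r|lebesgue. indicator {0..T} r *\<^sub>R (indicator {s..t} r * a r))"
    by (rule integral_restrict_space) simp
  also have "\<dots> = (LINT r:{s..t}|lebesgue. a r)"
    unfolding set_lebesgue_integral_def
    by (rule Bochner_Integration.integral_cong) (use assms in \<open>auto simp: indicator_def\<close>)
  finally show ?thesis .
qed

context wiener_flow
begin

abbreviation "S \<equiv> \<lambda>w. raw_flow T \<Lambda> b \<sigma> s t (X w) y"

lemma S_measurable: "S \<in> borel_measurable M"
  unfolding raw_flow_def
  by (rule flow_measurable[OF T_pos st X_path bracket_in_bracket_paths[OF T_pos Lam_pos] X_measurable
        bracket_measurable[OF T_pos Lam_pos _ X_measurable]])

lemma raw_flow_clock:
  assumes "\<forall>r\<in>{0..T}. bracket T \<Lambda> (X w) r = clock r"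
  shows "raw_flow T \<Lambda> b \<sigma> u v (X w) \<xi> = flow T b \<sigma> u v (X w) clock \<xi>"
  unfolding raw_flow_def by (rule flow_cong) (use assms T_pos in auto)

lemma kernel_clock:
  assumes w: "w \<in> space M" and c: "\<forall>r\<in>{0..T}. bracket T \<Lambda> (X w) r = clock r" and r: "s \<le> r" "r \<le> t"
  shows "response_kernel T \<Lambda> b \<sigma> s t r (X w) y = \<sigma> (G (Zp w t)) * Ez w r"
proof -
  interpret lf: lamperti_flow b \<sigma> lo hi T \<Lambda> clock "X w" B L by (rule path_flow[OF w])
  have Z: "lf.sol s (F y) (Zp w)" unfolding Zp_def by (rule lf.Z_sol_solves) (use st in auto)
  show ?thesis
    unfolding response_kernel_def raw_flow_clock[OF c] Let_def Ez_def
    by (rule lf.kernel_formula[OF st(1) r st(3) Z])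
qed

text \<open>The clock is the bracket on a set of full measure; on it flow and clock-driven flow coincide.\<close>

theorem S_malliavin:
  assumes "1 \<le> p" shows "has_malliavin_derivative M T W p S D0"
proof (rule has_malliavin_derivative_cong[OF F0_malliavin[OF assms] S_measurable])
  show "AE w in M. S w = F0 w"
    using AE_bracket_eq_clock by eventually_elim (simp add: raw_flow_clock F0_def)
qed

theorem derivative_is_kernel:
  assumes p: "1 \<le> p" and D: "has_malliavin_derivative M T W p S D"
  shows "AE w in M. AE r in leb T. D w r = indicator {s..t} r * sqrt (a r) * response_kernel T \<Lambda> b \<sigma> s t r (X w) y"
  using malliavin_derivative_unique[OF D S_malliavin[OF p] p] AE_bracket_eq_clock AE_space
proof eventually_elim
  case (elim w)
  from elim(1) AE_leb_on_neq[of s T] show ?case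
  proof eventually_elim
    case (elim r)
    show ?case
    proof (cases "s < r \<and> r \<le> t")
      case True
      then show ?thesis using elim(1) kernel_clock[of w r] \<open>w \<in> space M\<close> \<open>\<forall>t\<in>{0..T}. bracket T \<Lambda> (X w) t = clock t\<close>
        by (simp add: D0_def)
    next
      case False
      then show ?thesis using elim by (auto simp: D0_def indicator_def)
    qed
  qed
qed

theorem derivative_norm:
  assumes p: "1 \<le> p" and D: "has_malliavin_derivative M T W p S D"
    and C: "\<And>w r \<xi>. w \<in> space M ==> s \<le> r ==> r \<le> t ==>
      0 < deriv (\<lambda>\<xi>. raw_flow T \<Lambda> b \<sigma> r t (X w) \<xi>) \<xi> \<and> deriv (\<lambda>\<xi>. raw_flow T \<Lambda> b \<sigma> r t (X w) \<xi>) \<xi> \<le> C"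
  shows "AE w in M. L2_norm_time T (D w) \<le> hi * C * sqrt (LINT r:{s..t}|lebesgue. a r)"
proof -
  have "AE w in M. D w \<in> L2_time T" using D unfolding has_malliavin_derivative_def by (elim conjE)
  with derivative_is_kernel[OF p D] AE_space show ?thesis
  proof eventually_elim
    case (elim w)
    let ?k = "\<lambda>r. response_kernel T \<Lambda> b \<sigma> s t r (X w) y"
    have C0: "0 \<le> C" using C[OF elim(2) order_refl st(2), of 0] by linarith
    have hi: "0 \<le> hi" using \<sigma>_pos[of 0] \<sigma>_hi[of 0] by linarith
    have k: "\<bar>?k r\<bar> \<le> hi * C" if "s \<le> r" "r \<le> t" for r
      unfolding response_kernel_def Let_def abs_mult
    proof (rule mult_mono)
      let ?Y = "raw_flow T \<Lambda> b \<sigma> s r (X w) y"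
      show "\<bar>\<sigma> ?Y\<bar> \<le> hi" using \<sigma>_pos[of ?Y] \<sigma>_hi[of ?Y] by simp
      show "\<bar>deriv (\<lambda>\<xi>. raw_flow T \<Lambda> b \<sigma> r t (X w) \<xi>) ?Y\<bar> \<le> C" using C[OF elim(2) that, of ?Y] by simp
    qed (use hi in auto)
    have "(LINT r|leb T. (D w r)\<^sup>2) \<le> (LINT r|leb T. (hi * C)\<^sup>2 * (indicator {s..t} r * a r))"
    proof (rule integral_mono_AE)
      show "integrable (leb T) (\<lambda>r. (D w r)\<^sup>2)" using elim(3) by (simp add: L2_time_def)
      show "integrable (leb T) (\<lambda>r. (hi * C)\<^sup>2 * (indicator {s..t} r * a r))"
        by (intro integrable_mult_right indicator_a_integrable)
      show "AE r in leb T. (D w r)\<^sup>2 \<le> (hi * C)\<^sup>2 * (indicator {s..t} r * a r)"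
        using elim(1) AE_space
      proof eventually_elim
        case (elim r)
        then have ar: "0 \<le> a r" using a_bounds[of r] by (simp add: space_restrict_space)
        show ?case
        proof (cases "r \<in> {s..t}")
          case True
          have "(D w r)\<^sup>2 = a r * (?k r)\<^sup>2" using elim(1) True ar by (simp add: power_mult_distrib)
          also have "\<dots> \<le> a r * (hi * C)\<^sup>2"
            using power_mono[OF k[of r] abs_ge_zero, of 2] True ar by (intro mult_left_mono) auto
          finally show ?thesis using True by (simp add: mult.commute)
        next
          case False
          then show ?thesis using elim(1) by simp
        qed
      qed
    qed
    also have "\<dots> = (hi * C)\<^sup>2 * (LINT r:{s..t}|lebesgue. a r)"
      using st by (simp add: LINT_leb_on_subinterval)
    finally have "L2_norm_time T (D w) \<le> sqrt ((hi * C)\<^sup>2 * (LINT r:{s..t}|lebesgue. a r))"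
      unfolding L2_norm_time_def by (rule real_sqrt_le_mono)
    also have "\<dots> = hi * C * sqrt (LINT r:{s..t}|lebesgue. a r)"
      using hi C0 by (simp add: real_sqrt_mult)
    finally show ?case .
  qed
qed

end

theorem theorem6p3:
  fixes T \<Lambda> L \<sigma>lo \<sigma>hi s t y :: real
    and \<Theta> :: "(real ^ 'd) set"
    and b \<sigma> :: "real ^ 'd \<Rightarrow> real \<Rightarrow> real"
    and \<theta> :: "real ^ 'd"
    and a :: "real \<Rightarrow> real"
    and M :: "'w measure"
    and W :: "real \<Rightarrow> 'w \<Rightarrow> real"
    and X :: "'w \<Rightarrow> real \<Rightarrow> real"
  assumes "0 < T" and "0 < \<Lambda>"
    and "coefficient_hyps \<Theta> b \<sigma> L \<sigma>lo \<sigma>hi"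
    and "a \<in> borel_measurable (lebesgue_on {0..T})"
    and "\<And>r. r \<in> {0..T} \<Longrightarrow> a r \<in> {0..\<Lambda>}"
    and "brownian_motion M T W"
    and "\<And>\<omega>. \<omega> \<in> space M \<Longrightarrow> X \<omega> \<in> path_space T"
    and "\<And>u. u \<in> {0..T} \<Longrightarrow>
           is_wiener_integral M T W (\<lambda>r. indicator {0..u} r * sqrt (a r)) (\<lambda>\<omega>. X \<omega> u)"
    and "\<theta> \<in> \<Theta>" and "0 \<le> s" and "s \<le> t" and "t \<le> T"
  shows "\<forall>p\<ge>1.
           (\<lambda>\<omega>. raw_flow T \<Lambda> (b \<theta>) (\<sigma> \<theta>) s t (X \<omega>) y) \<in> malliavin_sobolev M T W p \<and>
           (\<forall>D. has_malliavin_derivative M T W p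
                  (\<lambda>\<omega>. raw_flow T \<Lambda> (b \<theta>) (\<sigma> \<theta>) s t (X \<omega>) y) D \<longrightarrow>
              (AE \<omega> in M. AE r in lebesgue_on {0..T}.
                 D \<omega> r = indicator {s..t} r * sqrt (a r)
                           * response_kernel T \<Lambda> (b \<theta>) (\<sigma> \<theta>) s t r (X \<omega>) y) \<and>
              (\<forall>C. flow_deriv_bound T \<Lambda> \<Theta> b \<sigma> C \<longrightarrow>
                 (AE \<omega> in M. L2_norm_time T (D \<omega>)
                    \<le> \<sigma>hi * C * sqrt (LINT r:{s..t}|lebesgue. a r))))"
proof -
  note T = assms(1) and \<Lambda> = assms(2) and st = assms(10-12)
  have ch: "b \<theta> \<in> Cb 2" "\<sigma> \<theta> \<in> Cb 3" "0 < \<sigma>lo" "\<And>y. \<sigma>lo \<le> \<sigma> \<theta> y" "\<And>y. \<sigma> \<theta> y \<le> \<sigma>hi"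
    using assms(3,9) unfolding coefficient_hyps_def by auto
  interpret lc: lamperti_coeffs "b \<theta>" "\<sigma> \<theta>" \<sigma>lo \<sigma>hi by (rule lamperti_coeffs.intro[OF ch])
  have pr: "prob_space M" using assms(6) by (simp add: brownian_motion_def)
  have wp: "wiener_process M T W \<Lambda> a X"
    by (intro wiener_process.intro brownian.intro brownian_axioms.intro wiener_process_axioms.intro pr assms)
  obtain B L' where BL: "\<And>z. \<bar>b_hat (b \<theta>) (\<sigma> \<theta>) z\<bar> \<le> B" "\<And>z. \<bar>c_hat (\<sigma> \<theta>) z\<bar> \<le> B" "\<And>z. \<bar>lc.bh' z\<bar> \<le> L'" "\<And>z. \<bar>lc.ch' z\<bar> \<le> L'"
    by (rule lc.hat_bounds, rule that)
  obtain bn bn' :: "nat \<Rightarrow> real \<Rightarrow> real" where bn: "\<And>n z. (bn n has_real_derivative bn' n z) (at z)" "\<And>n z. \<bar>bn' n z\<bar> \<le> L' + 1"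
    "locunif bn (b_hat (b \<theta>) (\<sigma> \<theta>))" "locunif bn' lc.bh'" "\<And>n. trig_poly (bn n)" "\<forall>B. (\<forall>z. \<bar>b_hat (b \<theta>) (\<sigma> \<theta>) z\<bar> \<le> B) \<longrightarrow> (\<forall>n z. \<bar>bn n z\<bar> \<le> B + 1)"
    by (rule trig_approximation[OF lc.b_hat_deriv lc.bh'_cont BL(3)]) (rule that)
  obtain gn gn' :: "nat \<Rightarrow> real \<Rightarrow> real" where gn: "\<And>n z. (gn n has_real_derivative gn' n z) (at z)" "\<And>n z. \<bar>gn' n z\<bar> \<le> L' + 1"
    "locunif gn (c_hat (\<sigma> \<theta>))" "locunif gn' lc.ch'" "\<And>n. trig_poly (gn n)" "\<forall>B. (\<forall>z. \<bar>c_hat (\<sigma> \<theta>) z\<bar> \<le> B) \<longrightarrow> (\<forall>n z. \<bar>gn n z\<bar> \<le> B + 1)"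
    by (rule trig_approximation[OF lc.c_hat_deriv lc.ch'_cont BL(4)]) (rule that)
  have G: "continuous_on UNIV (\<lambda>z. \<sigma> \<theta> (lamperti_inv (\<sigma> \<theta>) z))" by (rule lc.G_compose_cont[OF lc.\<sigma>_facts(2)])
  have Gb: "\<bar>\<sigma> \<theta> (lamperti_inv (\<sigma> \<theta>) z)\<bar> \<le> \<sigma>hi" for z
    using lc.\<sigma>_pos[of "lamperti_inv (\<sigma> \<theta>) z"] ch(5)[of "lamperti_inv (\<sigma> \<theta>) z"] by simp
  obtain Gn Gn' :: "nat \<Rightarrow> real \<Rightarrow> real" where Gn: "\<And>n z. (Gn n has_real_derivative Gn' n z) (at z)" "\<And>n z. \<bar>Gn' n z\<bar> \<le> \<sigma>hi + 1"
    "locunif Gn (lamperti_inv (\<sigma> \<theta>))" "locunif Gn' (\<lambda>z. \<sigma> \<theta> (lamperti_inv (\<sigma> \<theta>) z))" "\<And>n. trig_poly (Gn n)"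
    "\<And>n. Gn n 0 = lamperti_inv (\<sigma> \<theta>) 0"
    by (rule trig_approximation[OF lc.G_deriv G Gb]) (rule that)
  interpret wiener_flow M T W \<Lambda> a X "b \<theta>" "\<sigma> \<theta>" \<sigma>lo \<sigma>hi s t y B L' bn gn Gn bn' gn' Gn'
    by (rule wiener_flow.intro[OF wp lc.lamperti_coeffs_axioms wiener_flow_axioms.intro[OF st BL bn(1) gn(1) Gn(1)
        bn(2) gn(2) Gn(2) bn(6)[rule_format, OF BL(1)] gn(6)[rule_format, OF BL(2)] Gn(6) bn(3) gn(3) Gn(3) bn(4) gn(4) Gn(4) bn(5) gn(5) Gn(5)]])
  show ?thesis
  proof (intro allI impI conjI)
    fix p :: real assume p: "1 \<le> p"
    show "S \<in> malliavin_sobolev M T W p" using S_malliavin[OF p] unfolding malliavin_sobolev_def by blast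
    fix D assume D: "has_malliavin_derivative M T W p S D"
    show "AE w in M. AE r in leb T. D w r = indicator {s..t} r * sqrt (a r) * response_kernel T \<Lambda> (b \<theta>) (\<sigma> \<theta>) s t r (X w) y"
      by (rule derivative_is_kernel[OF p D])
    fix C assume C: "flow_deriv_bound T \<Lambda> \<Theta> b \<sigma> C"
    show "AE w in M. L2_norm_time T (D w) \<le> \<sigma>hi * C * sqrt (LINT r:{s..t}|lebesgue. a r)"
    proof (rule derivative_norm[OF p D])
      fix w r \<xi> assume w: "w \<in> space M" and r: "s \<le> r" "r \<le> t"
      have "0 \<le> r \<and> r \<le> t \<and> t \<le> T" using r st by simp
      with C show "0 < deriv (\<lambda>\<xi>. raw_flow T \<Lambda> (b \<theta>) (\<sigma> \<theta>) r t (X w) \<xi>) \<xi> \<and> deriv (\<lambda>\<xi>. raw_flow T \<Lambda> (b \<theta>) (\<sigma> \<theta>) r t (X w) \<xi>) \<xi> \<le> C"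
        unfolding flow_deriv_bound_def raw_flow_def
        using assms(9) X_path[OF w] bracket_in_bracket_paths[OF T \<Lambda>, of "X w"] by blast
    qed
  qed
qed

end
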